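(* Let $n\ge 1$, $\boldsymbol a\in\mathbb R^n$, $\boldsymbol x\in W$, and let $\tau$ be the collision time of the Brownian motion $\boldsymbol X$ with drift vector $\boldsymbol a$ started from $\boldsymbol x$. Let $q,(m_i),(\nu_i),\boldsymbol f,q',(m'_i),(\nu'_i),(i_k)$ be the characteristics of the stable partition of $\boldsymbol a$. Put $$\gamma=\frac12\sum_{\ell=1}^{q}\frac1{\nu_\ell}\sum_{m_{\ell-1}<u<v\le m_\ell}(a_u-a_v)^2,$$ $$\alpha=\frac12\left(\sum_{j=1}^{q'}\binom{\nu'_j}{2}+(n-q)+\sum_{j=1}^{q}\binom{\nu_j}{2}\right),$$ $$h(\boldsymbol x)=e^{-\langle \boldsymbol x,\boldsymbol a\rangle}\det\left[e^{x_if_j}\,x_i^{\sum_{l=1}^{q'}(j-m'_{l-1}-1)\mathbf 1\{m'_{l-1}<j\le m'_l\}}\right]_{i,j=1}^n .$$ Then, as $t\to\infty$, $$\mathbb P_{\boldsymbol x}(\tau>t)=C\,h(\boldsymbol x)\,t^{-\alpha}e^{-\gamma t}(1+o(1)),$$ where $C=A_1A_2A_3$ with $$A_1=(2\pi)^{-n/2}\sqrt{2\pi n}\ \prod_{j=1}^{q'}c_{\nu'_j},$$ $$A_2=\int\cdots\int_{\{\xi_i>0\,:\ 1\le i\le n,\ i\notin\{m_1,\dots,m_q\}\}}\exp\left(-\frac12\sum_{l=1}^q\frac{2}{\nu_l}\sum_{m_{l-1}<u<v\le m_l}(\xi_u+\dots+\xi_{v-1})(a_u-a_v)\right)\prod_{i=1}^qH(\xi_{m_{i-1}+1},\dots,\xi_{m_i-1})\prod_{i\notin\{m_1,\dots,m_q\}}d\xi_i,$$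 $$A_3=\int\cdots\int_{D}\exp\left(-\frac12\sum_{k,l\in\{m_1,\dots,m_{q-1}\}}S_{kl}\,\xi_k\xi_l\right)\prod_{k=0}^{q-1}\ \prod_{i:\ \{i,i+1,\dots,i+k\}\subset\{1,\dots,q\}\setminus\{i_1,\dots,i_{q'}\}}\left(\sum_{j=0}^k\xi_{m_{i+j}}\right)^{\nu_i\nu_{i+k+1}}\prod_{i\in\{m_1,\dots,m_{q-1}\}}d\xi_i,$$ where $D$ is the set of $(\xi_{m_1},\dots,\xi_{m_{q-1}})\in\mathbb R^{q-1}$ such that $\xi_{m_i}>0$ whenever $1\le i\le q-1$ and $m_i\notin\{m'_1,\dots,m'_{q'}\}$ (the other coordinates range over all of $\mathbb R$), and $S_{kl}=k(n-l)/n$ for $k\le l$, $S_{kl}=S_{lk}$. An integral over no variables ($A_2$ if $q=n$, $A_3$ if $q=1$) equals $1$.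
   Context: $W=\{\boldsymbol y\in\mathbb R^n: y_1<\dots<y_n\}$. Under $\mathbb P_{\boldsymbol x}$, $\boldsymbol X_t=(X^1_t,\dots,X^n_t)$ has independent coordinates which are Brownian motions with unit variance parameter and drifts $a_1,\dots,a_n$, with $\boldsymbol X_0=\boldsymbol x$; $\tau=\inf\{t>0:\boldsymbol X_t\notin W\}$. $\langle\cdot,\cdot\rangle$ is the Euclidean inner product. $c_m=1/\prod_{j=1}^{m-1}j!$ (so $c_1=1$). $H(s_1,\dots,s_\ell)=\prod_{1\le i<j\le\ell+1}(s_i+\dots+s_{j-1})$, and $H=1$ for an empty list of arguments. Stable partition. Write $\bar a_{[i;j]}=(a_i+\dots+a_j)/(j-i+1)$. A vector $(b_1,\dots,b_r)$ is irreducible if $\bar b_{[1;k]}>\bar b_{[k+1;r]}$ for all $1\le k\le r-1$ (for $r=1$ there is no condition). A partition of $\boldsymbol a$ into consecutive nonempty blocks is given by integers $0=m_0<m_1<\dots<m_q=n$, the $i$-th block being $(a_{m_{i-1}+1},\dots,a_{m_i})$, of length $\nu_i=m_i-m_{i-1}$ and mean $f^i=\bar a_{[m_{i-1}+1;m_i]}$. It is stable if $f^1\le f^2\le\dots\le f^q$ and every block is irreducible. Each $\boldsymbol a$ has a unique stable partition. Given it, $\boldsymbol f=(f_1,\dots,f_n)$ is defined by $f_i=f^k$ for $m_{k-1}<i\le m_k$. Let $i_1<\dots<i_{q'}$ be the indices $j\in\{1,\dots,q\}$ such that $j=q$ or $f^j<f^{j+1}$ (so $q'$ is the number of strict inequalities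 in $f^1\le\dots\le f^q$ plus one and $i_{q'}=q$); put $i_0=0$, $m'_0=0$, $m'_k=m_{i_k}$, $\nu'_k=m'_k-m'_{k-1}$.
   Formalization: In A_1 the factor √(2πn) is corrected to √(2π/n); as printed the constant C is too large by the factor n for every n≥2 (e.g. n=2, a_1<a_2 gives C=2 where the limit forces C=1), while for n=1 the two agree. *)

theory Defs
  imports
    "HOL-Probability.Probability"
    "HOL-Library.Landau_Symbols"
    "Jordan_Normal_Form.Determinant"
begin

(* Vectors (y_1, ..., y_n) are functions nat => real of which only the values on {1..n}
   matter. *)

section \<open>Brownian motion and the collision time\<close>

definition weyl_chamber :: "nat \<Rightarrow> (nat \<Rightarrow> real) set" where
  "weyl_chamber n = {y. \<forall>i j. 1 \<le> i \<and> i < j \<and> j \<le> n \<longrightarrow> y i < y j}"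

(* All paths are continuous, so that events defined through the whole path, such as
   {tau > t}, are measurable without completing M. *)
definition brownian_motion ::
  "'w measure \<Rightarrow> real \<Rightarrow> real \<Rightarrow> (real \<Rightarrow> 'w \<Rightarrow> real) \<Rightarrow> bool" where
  "brownian_motion M drift start B \<longleftrightarrow>
     prob_space M \<and>
     (\<forall>t\<ge>0. B t \<in> borel_measurable M) \<and>
     (\<forall>\<omega>\<in>space M. continuous_on {0..} (\<lambda>t. B t \<omega>)) \<and>
     (AE \<omega> in M. B 0 \<omega> = start) \<and>
     (\<forall>s t. 0 \<le> s \<and> s < t \<longrightarrow>
        distributed M lborel (\<lambda>\<omega>. B t \<omega> - B s \<omega>)
          (\<lambda>y. ennreal (normal_density (drift * (t - s)) (sqrt (t - s)) y))) \<and>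
     (\<forall>(r :: nat \<Rightarrow> real) k. 0 \<le> r 0 \<and> (\<forall>i<k. r i < r (Suc i)) \<longrightarrow>
        prob_space.indep_vars M (\<lambda>_. borel)
          (\<lambda>i \<omega>. B (r (Suc i)) \<omega> - B (r i) \<omega>) {..<k})"

(* Independence of the coordinate processes: each one is a random variable with values in
   the path space with its product sigma-algebra. *)
definition indep_brownian_motions ::
  "'w measure \<Rightarrow> nat \<Rightarrow> (nat \<Rightarrow> real) \<Rightarrow> (nat \<Rightarrow> real) \<Rightarrow> (nat \<Rightarrow> real \<Rightarrow> 'w \<Rightarrow> real) \<Rightarrow> bool" where
  "indep_brownian_motions M n a x X \<longleftrightarrow>
     prob_space M \<and>
     (\<forall>i\<in>{1..n}. brownian_motion M (a i) (x i) (X i)) \<and>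
     prob_space.indep_vars M (\<lambda>_. Pi\<^sub>M {0..} (\<lambda>_. borel))
       (\<lambda>i \<omega>. \<lambda>t\<in>{0..}. X i t \<omega>) {1..n}"

definition collision_time :: "nat \<Rightarrow> (nat \<Rightarrow> real \<Rightarrow> 'w \<Rightarrow> real) \<Rightarrow> 'w \<Rightarrow> ereal" where
  "collision_time n X \<omega> = Inf {ereal t |t. t > 0 \<and> (\<lambda>i. X i t \<omega>) \<notin> weyl_chamber n}"

section \<open>Stable partitions\<close>

definition avg :: "(nat \<Rightarrow> real) \<Rightarrow> nat \<Rightarrow> nat \<Rightarrow> real" where
  "avg b i j = (\<Sum>k=i..j. b k) / real (j - i + 1)"

definition irreducible_vector :: "nat \<Rightarrow> (nat \<Rightarrow> real) \<Rightarrow> bool" where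
  "irreducible_vector r b \<longleftrightarrow> (\<forall>k. 1 \<le> k \<and> k \<le> r - 1 \<longrightarrow> avg b 1 k > avg b (k + 1) r)"

definition block_len :: "(nat \<Rightarrow> nat) \<Rightarrow> nat \<Rightarrow> nat" where
  "block_len m i = m i - m (i - 1)"

definition block_mean :: "(nat \<Rightarrow> real) \<Rightarrow> (nat \<Rightarrow> nat) \<Rightarrow> nat \<Rightarrow> real" where
  "block_mean a m i = avg a (m (i - 1) + 1) (m i)"

definition stable_partition :: "nat \<Rightarrow> (nat \<Rightarrow> real) \<Rightarrow> nat \<Rightarrow> (nat \<Rightarrow> nat) \<Rightarrow> bool" where
  "stable_partition n a q m \<longleftrightarrow>
     m 0 = 0 \<and> m q = n \<and> (\<forall>i\<in>{1..q}. m (i - 1) < m i) \<and>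
     (\<forall>i. 1 \<le> i \<and> i < q \<longrightarrow> block_mean a m i \<le> block_mean a m (i + 1)) \<and>
     (\<forall>i\<in>{1..q}. irreducible_vector (block_len m i) (\<lambda>j. a (m (i - 1) + j)))"

(* The vector f = (f_1, ..., f_n), as opposed to the block means f^1, ..., f^q. *)
definition f_vec :: "(nat \<Rightarrow> real) \<Rightarrow> nat \<Rightarrow> (nat \<Rightarrow> nat) \<Rightarrow> nat \<Rightarrow> real" where
  "f_vec a q m i = block_mean a m (THE k. k \<in> {1..q} \<and> m (k - 1) < i \<and> i \<le> m k)"

(* The set {i_1, ..., i_q'}. *)
definition strict_idx :: "(nat \<Rightarrow> real) \<Rightarrow> nat \<Rightarrow> (nat \<Rightarrow> nat) \<Rightarrow> nat set" where
  "strict_idx a q m =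
     {j \<in> {1..q}. j = q \<or> block_mean a m j < block_mean a m (j + 1)}"

definition q' :: "(nat \<Rightarrow> real) \<Rightarrow> nat \<Rightarrow> (nat \<Rightarrow> nat) \<Rightarrow> nat" where
  "q' a q m = card (strict_idx a q m)"

(* i_k, with i_0 = 0 *)
definition idx :: "(nat \<Rightarrow> real) \<Rightarrow> nat \<Rightarrow> (nat \<Rightarrow> nat) \<Rightarrow> nat \<Rightarrow> nat" where
  "idx a q m k = (if k = 0 then 0 else sorted_list_of_set (strict_idx a q m) ! (k - 1))"

definition m' :: "(nat \<Rightarrow> real) \<Rightarrow> nat \<Rightarrow> (nat \<Rightarrow> nat) \<Rightarrow> nat \<Rightarrow> nat" where
  "m' a q m k = (if k = 0 then 0 else m (idx a q m k))"

section \<open>The constants\<close>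

definition gamma_rate :: "(nat \<Rightarrow> real) \<Rightarrow> nat \<Rightarrow> (nat \<Rightarrow> nat) \<Rightarrow> real" where
  "gamma_rate a q m =
     1/2 * (\<Sum>l=1..q. 1 / real (block_len m l) *
       (\<Sum>(u, v) \<in> {(u, v). m (l - 1) < u \<and> u < v \<and> v \<le> m l}. (a u - a v)\<^sup>2))"

definition alpha_exp :: "nat \<Rightarrow> (nat \<Rightarrow> real) \<Rightarrow> nat \<Rightarrow> (nat \<Rightarrow> nat) \<Rightarrow> real" where
  "alpha_exp n a q m =
     1/2 * ((\<Sum>j=1..q' a q m. real (block_len (m' a q m) j choose 2))
            + (real n - real q)
            + (\<Sum>j=1..q. real (block_len m j choose 2)))"

(* Matrices of the AFP entry are indexed from 0, hence the shifts by Suc. In the exponent,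
   the guard makes the natural-number subtraction exact. *)
definition h_fun ::
  "nat \<Rightarrow> (nat \<Rightarrow> real) \<Rightarrow> nat \<Rightarrow> (nat \<Rightarrow> nat) \<Rightarrow> (nat \<Rightarrow> real) \<Rightarrow> real" where
  "h_fun n a q m x =
     exp (- (\<Sum>i=1..n. x i * a i)) *
     Determinant.det (Matrix.mat n n (\<lambda>(r, s).
       let i = Suc r; j = Suc s in
         exp (x i * f_vec a q m j) *
         x i ^ (\<Sum>l=1..q' a q m.
                  if m' a q m (l - 1) < j \<and> j \<le> m' a q m l
                  then j - m' a q m (l - 1) - 1 else 0)))"

definition c_const :: "nat \<Rightarrow> real" where
  "c_const k = 1 / (\<Prod>j=1..k - 1. fact j)"

(* H(s_1, ..., s_l) *)
definition H_fun :: "nat \<Rightarrow> (nat \<Rightarrow> real) \<Rightarrow> real" where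
  "H_fun l s = (\<Prod>(i, j) \<in> {(i, j). 1 \<le> i \<and> i < j \<and> j \<le> l + 1}. \<Sum>r=i..j - 1. s r)"

(* The factor sqrt (2 pi / n) is the Gaussian integral of exp (- n z^2 / 2) over the centre
   of mass z of the particles. The source prints sqrt (2 pi n), which cannot be meant: already
   for n = 2 and a_1 < a_2 it would give a limit of P(tau > t) that is twice the correct
   value 1 - exp (- (x_2 - x_1) (a_2 - a_1)). *)
definition A1 :: "nat \<Rightarrow> (nat \<Rightarrow> real) \<Rightarrow> nat \<Rightarrow> (nat \<Rightarrow> nat) \<Rightarrow> real" where
  "A1 n a q m =
     (2 * pi) powr (- real n / 2) * sqrt (2 * pi / real n) *
     (\<Prod>j=1..q' a q m. c_const (block_len (m' a q m) j))"

(* For an empty index set I, Pi\<^sub>M I is the one-point probability space, so that integrals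
   over no variables have the value of the integrand, here 1. *)
definition A2 :: "nat \<Rightarrow> (nat \<Rightarrow> real) \<Rightarrow> nat \<Rightarrow> (nat \<Rightarrow> nat) \<Rightarrow> real" where
  "A2 n a q m =
     (let I = {1..n} - m ` {1..q}; \<mu> = Pi\<^sub>M I (\<lambda>_. lborel) in
      LINT \<xi>:{\<xi> \<in> space \<mu>. \<forall>i\<in>I. \<xi> i > 0}|\<mu>.
        exp (- (1/2) * (\<Sum>l=1..q. 2 / real (block_len m l) *
          (\<Sum>(u, v) \<in> {(u, v). m (l - 1) < u \<and> u < v \<and> v \<le> m l}.
             (\<Sum>r=u..v - 1. \<xi> r) * (a u - a v)))) *
        (\<Prod>i=1..q. H_fun (block_len m i - 1) (\<lambda>r. \<xi> (m (i - 1) + r))))"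

definition S_mat :: "nat \<Rightarrow> nat \<Rightarrow> nat \<Rightarrow> real" where
  "S_mat n k l = (if k \<le> l then real k * (real n - real l) / real n
                  else real l * (real n - real k) / real n)"

definition A3 :: "nat \<Rightarrow> (nat \<Rightarrow> real) \<Rightarrow> nat \<Rightarrow> (nat \<Rightarrow> nat) \<Rightarrow> real" where
  "A3 n a q m =
     (let K = m ` {1..q - 1}; \<mu> = Pi\<^sub>M K (\<lambda>_. lborel);
          D = {\<xi> \<in> space \<mu>. \<forall>i\<in>{1..q - 1}.
                 m i \<notin> m' a q m ` {1..q' a q m} \<longrightarrow> \<xi> (m i) > 0} in
      LINT \<xi>:D|\<mu>.
        exp (- (1/2) * (\<Sum>k\<in>K. \<Sum>l\<in>K. S_mat n k l * \<xi> k * \<xi> l)) *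
        (\<Prod>k=0..q - 1. \<Prod>i \<in> {i. {i..i + k} \<subseteq> {1..q} - strict_idx a q m}.
           (\<Sum>j=0..k. \<xi> (m (i + j))) ^ (block_len m i * block_len m (i + k + 1))))"

end

theory Submission
  imports Defs "HOL-Real_Asymp.Real_Asymp"
begin

text \<open>
The survival probability has a determinantal formula, and the theorem is Laplace's method applied to it.

Reflection gives the formula. Up to the drift factor of Girsanov's theorem, the vector X_t has on the event
\<tau> > t the density det [g_t (z_i - x_j)], where g_t is the centred Gaussian density of variance t. Indeed,
the signed sum of the images of a terminal weight under permutations has, for a process started on a wall of
the chamber, expectation 0, because the determinant then has two equal columns; so paths that leave the chamber
contribute nothing. The strong Markov property at the exit time is avoided: the path is watched on dyadic
grids only, the ordinary Markov property is used at the first exit on the grid (\<open>ibm_markov\<close>), and the exit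
points converge to a wall as the grids are refined (\<open>exit_value_tendsto_0\<close>). The outcome is
\<open>survival_probability\<close>.

In this integral over z, completing the square around t f turns the exponent into -\<gamma> t, a quadratic form
in the fluctuations of z around t f, and a linear form in the gaps of z inside the blocks of the stable
partition (\<open>exponent_identity\<close>). The coefficients of the linear form are the partial sums of a - f, and
irreducibility of the blocks says that they are positive (\<open>excess_pos\<close>). Hence gaps inside a block stay of
order 1, whereas gaps between blocks, and the mean, are of order sqrt t; the coordinates \<open>position\<close> are scaled
accordingly. Where f has equal entries, the nodes z_j / t of the matrix exp (x_i z_j / t) merge. Passing
to divided differences extracts the product of the differences of the merging nodes, whose powers of t together with
those of the Jacobian and of the Gaussian normalisation make up t powr -\<alpha> (\<open>km_density_position\<close>,
\<open>prefactor_eq\<close>).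

The remaining integrand converges pointwise (\<open>tendsto_chamber_integrand\<close>) under an integrable bound
(\<open>integrand_bound\<close>). Its limit is a function of the gaps inside blocks, times one of the gaps between
blocks, times a Gaussian in the mean, times a constant determinant: the integrals are A2, A3 and
sqrt (2 pi / n), and the determinant is the one in h up to factorials (\<open>integral_profile\<close>). As the
assertion is about a quotient, the limit must not vanish; for the determinant this is the bound on the number
of real zeros of an exponential polynomial (\<open>exp_poly_zero_count\<close>).
\<close>

section \<open>Lebesgue measure on finite products\<close>

text \<open>Coordinates, blocks and cuts are numbered from 1. The simplifier would rewrite the lower bounds 1
of sums and intervals to Suc 0.\<close>

declare One_nat_def [simp del]

abbreviation lebesgue_pi :: "nat set \<Rightarrow> (nat \<Rightarrow> real) measure" where
  "lebesgue_pi I \<equiv> Pi\<^sub>M I (\<lambda>_. lborel)"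

lemma product_sigma_finite_lborel: "product_sigma_finite (\<lambda>_::nat. lborel :: real measure)"
  unfolding product_sigma_finite_def by (simp add: lborel.sigma_finite_measure_axioms)

lemma distr_permute_lebesgue_pi:
  assumes "finite I" and p: "p permutes I"
  shows "distr (lebesgue_pi I) (lebesgue_pi I) (\<lambda>z. \<lambda>i\<in>I. z (p i)) = lebesgue_pi I"
proof (rule product_sigma_finite.PiM_eqI[OF product_sigma_finite_lborel \<open>finite I\<close>])
  fix A :: "nat \<Rightarrow> real set" assume A: "\<And>i. i \<in> I \<Longrightarrow> A i \<in> sets lborel"
  let ?q = "inv_into UNIV p"
  have pI: "p i \<in> I \<longleftrightarrow> i \<in> I" for i using permutes_in_image[OF p] .
  have m: "(\<lambda>z. \<lambda>i\<in>I. z (p i)) \<in> measurable (lebesgue_pi I) (lebesgue_pi I)"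
    by (rule measurable_restrict) (simp add: pI)
  have *: "(\<lambda>z. \<lambda>i\<in>I. z (p i)) -` (Pi\<^sub>E I A) \<inter> space (lebesgue_pi I) = Pi\<^sub>E I (\<lambda>i. A (?q i))"
  proof (intro Set.set_eqI iffI)
    fix z assume z: "z \<in> (\<lambda>z. \<lambda>i\<in>I. z (p i)) -` (Pi\<^sub>E I A) \<inter> space (lebesgue_pi I)"
    then have ext: "z \<in> extensional I" by (auto simp: space_PiM PiE_iff)
    have "z i \<in> A (?q i)" if "i \<in> I" for i
    proof -
      have "?q i \<in> I" using permutes_in_image[OF permutes_inv[OF p]] that by simp
      moreover have "p (?q i) = i" by (rule permutes_inverses[OF p])
      ultimately show ?thesis using z by (auto simp: PiE_iff)
    qed
    then show "z \<in> Pi\<^sub>E I (\<lambda>i. A (?q i))" using ext by (auto simp: PiE_iff)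
  next
    fix z assume "z \<in> Pi\<^sub>E I (\<lambda>i. A (?q i))"
    then show "z \<in> (\<lambda>z. \<lambda>i\<in>I. z (p i)) -` (Pi\<^sub>E I A) \<inter> space (lebesgue_pi I)"
      using pI permutes_inverses[OF p] by (fastforce simp: space_PiM PiE_iff)
  qed
  have Ainv: "A (?q i) \<in> sets lborel" if "i \<in> I" for i
    using A permutes_in_image[OF permutes_inv[OF p]] that by simp
  have "emeasure (distr (lebesgue_pi I) (lebesgue_pi I) (\<lambda>z. \<lambda>i\<in>I. z (p i))) (Pi\<^sub>E I A)
      = emeasure (lebesgue_pi I) (Pi\<^sub>E I (\<lambda>i. A (?q i)))"
    using A by (subst emeasure_distr[OF m]) (auto intro!: sets_PiM_I_finite \<open>finite I\<close> simp: *)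
  also have "\<dots> = (\<Prod>i\<in>I. emeasure lborel (A (?q i)))"
    using Ainv by (intro product_sigma_finite.emeasure_PiM[OF product_sigma_finite_lborel \<open>finite I\<close>]) auto
  also have "\<dots> = (\<Prod>i\<in>I. emeasure lborel (A i))"
    using prod.permute[OF permutes_inv[OF p], of "\<lambda>i. emeasure lborel (A i)"] by (simp add: o_def)
  finally show "emeasure (distr (lebesgue_pi I) (lebesgue_pi I) (\<lambda>z. \<lambda>i\<in>I. z (p i))) (Pi\<^sub>E I A)
    = (\<Prod>i\<in>I. emeasure lborel (A i))" .
qed simp

text \<open>Fubini with the j-th coordinate innermost, in which the substitution is affine with a constant
shift. The linear change of variables below is a composition of such steps.\<close>

lemma nn_integral_lebesgue_pi_affine:
  fixes f :: "(nat \<Rightarrow> real) \<Rightarrow> ennreal"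
  assumes I: "finite I" "j \<in> I" and c: "c \<noteq> 0"
    and d[measurable]: "d \<in> borel_measurable (lebesgue_pi I)"
    and indep: "\<And>z y. d (z(j := y)) = d z"
    and f[measurable]: "f \<in> borel_measurable (lebesgue_pi I)"
  shows "(\<integral>\<^sup>+z. f z \<partial>lebesgue_pi I) = ennreal \<bar>c\<bar> * (\<integral>\<^sup>+z. f (z(j := d z + c * z j)) \<partial>lebesgue_pi I)"
proof -
  let ?J = "I - {j}"
  have IJ: "I = insert j ?J" using I by auto
  have J: "finite ?J" "j \<notin> ?J" using I by auto
  note ins = product_sigma_finite.product_nn_integral_insert[OF product_sigma_finite_lborel J, folded IJ]
  have upd[measurable]: "(\<lambda>z. z(j := d z + c * z j)) \<in> measurable (lebesgue_pi I) (lebesgue_pi I)"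
    by (rule measurable_fun_upd[where J="I"]) (use I in auto)
  have f1: "(\<lambda>y. f (z(j := y))) \<in> borel_measurable lborel" if "z \<in> space (lebesgue_pi ?J)" for z
  proof -
    have "(\<lambda>y. z(j := y)) \<in> measurable lborel (lebesgue_pi (insert j ?J))"
      by (rule measurable_fun_upd[where J="?J"]) (use that in auto)
    then show ?thesis unfolding IJ[symmetric] by (rule measurable_compose[OF _ f])
  qed
  have "(\<integral>\<^sup>+z. f z \<partial>lebesgue_pi I) = (\<integral>\<^sup>+z. \<integral>\<^sup>+y. f (z(j := y)) \<partial>lborel \<partial>lebesgue_pi ?J)"
    by (rule ins) simp
  also have "\<dots> = (\<integral>\<^sup>+z. ennreal \<bar>c\<bar> * \<integral>\<^sup>+y. f (z(j := d z + c * y)) \<partial>lborel \<partial>lebesgue_pi ?J)"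
    by (rule nn_integral_cong) (intro nn_integral_real_affine f1[unfolded measurable_lborel2] c)
  also have "\<dots> = (\<integral>\<^sup>+z. \<integral>\<^sup>+y. ennreal \<bar>c\<bar> * f ((z(j := y))(j := d (z(j := y)) + c * (z(j := y)) j)) \<partial>lborel \<partial>lebesgue_pi ?J)"
  proof (rule nn_integral_cong)
    fix z assume z: "z \<in> space (lebesgue_pi ?J)"
    have "(\<lambda>y. f (z(j := d z + c * y))) \<in> borel_measurable lborel"
      using measurable_compose[OF _ f1[OF z], of "\<lambda>y. d z + c * y"] by simp
    then show "ennreal \<bar>c\<bar> * (\<integral>\<^sup>+y. f (z(j := d z + c * y)) \<partial>lborel)
      = (\<integral>\<^sup>+y. ennreal \<bar>c\<bar> * f ((z(j := y))(j := d (z(j := y)) + c * (z(j := y)) j)) \<partial>lborel)"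
      by (simp add: indep nn_integral_cmult)
  qed
  also have "\<dots> = (\<integral>\<^sup>+z. ennreal \<bar>c\<bar> * f (z(j := d z + c * z j)) \<partial>lebesgue_pi I)"
    by (rule ins[symmetric]) measurable
  also have "\<dots> = ennreal \<bar>c\<bar> * (\<integral>\<^sup>+z. f (z(j := d z + c * z j)) \<partial>lebesgue_pi I)"
    by (rule nn_integral_cmult) measurable
  finally show ?thesis .
qed

section \<open>Coordinates given by the gaps and the mean\<close>

text \<open>The vector with the gaps s k * \<zeta> k + d k and the mean c + s n * \<zeta> n. A gap at k is
part of y n - y j for the k indices j \<le> k, hence the weight k / n in the difference of the last coordinate
and the mean.\<close>

definition gap_coords :: "nat \<Rightarrow> (nat \<Rightarrow> real) \<Rightarrow> (nat \<Rightarrow> real) \<Rightarrow> real \<Rightarrow> (nat \<Rightarrow> real) \<Rightarrow> nat \<Rightarrow> real" where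
  "gap_coords n s d c \<zeta> = (\<lambda>j\<in>{1..n}. c + s n * \<zeta> n
      + (\<Sum>k=1..<n. real k / real n * (s k * \<zeta> k + d k)) - (\<Sum>k=j..<n. s k * \<zeta> k + d k))"

lemma measurable_gap_coords [measurable]:
  assumes "n \<ge> 1"
  shows "gap_coords n s d c \<in> measurable (lebesgue_pi {1..n}) (lebesgue_pi {1..n})"
proof -
  have "(\<lambda>\<zeta>. c + s n * \<zeta> n + (\<Sum>k=1..<n. real k / real n * (s k * \<zeta> k + d k)) - (\<Sum>k=j..<n. s k * \<zeta> k + d k))
     \<in> measurable (lebesgue_pi {1..n}) lborel" if j: "j \<in> {1..n}" for j
  proof -
    have [measurable]: "(\<lambda>\<zeta>. \<zeta> k) \<in> borel_measurable (lebesgue_pi {1..n})" if "k \<in> {1..n}" for k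
      using that by simp
    have "(\<lambda>\<zeta>. \<Sum>k=1..<n. real k / real n * (s k * \<zeta> k + d k)) \<in> borel_measurable (lebesgue_pi {1..n})"
      by (intro borel_measurable_sum borel_measurable_add borel_measurable_times borel_measurable_const) auto
    moreover have "(\<lambda>\<zeta>. \<Sum>k=j..<n. s k * \<zeta> k + d k) \<in> borel_measurable (lebesgue_pi {1..n})"
      using j by (intro borel_measurable_sum borel_measurable_add borel_measurable_times borel_measurable_const) auto
    ultimately show ?thesis using assms by simp
  qed
  then show ?thesis unfolding gap_coords_def by (intro measurable_restrict)
qed

lemma nn_integral_gap_coords:
  fixes f :: "(nat \<Rightarrow> real) \<Rightarrow> ennreal"
  assumes n: "n \<ge> 1" and s: "\<And>k. k \<in> {1..n} \<Longrightarrow> s k > 0"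
    and f[measurable]: "f \<in> borel_measurable (lebesgue_pi {1..n})"
  shows "(\<integral>\<^sup>+z. f z \<partial>lebesgue_pi {1..n})
       = ennreal (\<Prod>k=1..n. s k) * (\<integral>\<^sup>+\<zeta>. f (gap_coords n s d c \<zeta>) \<partial>lebesgue_pi {1..n})"
proof -
  let ?P = "lebesgue_pi {1..n}"
  \<comment> \<open>\<Psi> r has turned the first r gaps into positions relative to the coordinate r + 1.\<close>
  define \<Psi> where "\<Psi> r = (\<lambda>\<zeta>. \<lambda>j\<in>{1..n}. if j \<le> r then \<zeta> (Suc r) - (\<Sum>k=j..r. s k * \<zeta> k + d k) else \<zeta> j)"
    for r and \<zeta> :: "nat \<Rightarrow> real"
  have comp: "(\<lambda>\<zeta>. \<zeta> k) \<in> borel_measurable ?P" if "k \<in> {1..n}" for k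
    using that by simp
  have meas: "\<Psi> r \<in> measurable ?P ?P" if "r < n" for r
    unfolding \<Psi>_def
  proof (rule measurable_restrict)
    fix j assume j: "j \<in> {1..n}"
    have "(\<lambda>\<zeta>. \<zeta> (Suc r) - (\<Sum>k=j..r. s k * \<zeta> k + d k)) \<in> borel_measurable ?P"
      using j that by (intro borel_measurable_diff comp borel_measurable_sum borel_measurable_add borel_measurable_times borel_measurable_const) auto
    then show "(\<lambda>\<zeta>. if j \<le> r then \<zeta> (Suc r) - (\<Sum>k=j..r. s k * \<zeta> k + d k) else \<zeta> j) \<in> measurable ?P lborel"
      using j by (cases "j \<le> r") auto
  qed
  have step: "(\<integral>\<^sup>+z. f z \<partial>?P) = ennreal (\<Prod>k=1..r. s k) * (\<integral>\<^sup>+\<zeta>. f (\<Psi> r \<zeta>) \<partial>?P)" if "r < n" for r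
    using that
  proof (induction r)
    case 0
    have "\<Psi> 0 \<zeta> = \<zeta>" if "\<zeta> \<in> space ?P" for \<zeta>
      using that by (auto simp: \<Psi>_def space_PiM PiE_iff extensional_def fun_eq_iff)
    then have "(\<integral>\<^sup>+\<zeta>. f (\<Psi> 0 \<zeta>) \<partial>?P) = (\<integral>\<^sup>+\<zeta>. f \<zeta> \<partial>?P)"
      by (intro nn_integral_cong) simp
    then show ?case by simp
  next
    case (Suc r)
    let ?j = "Suc r"
    let ?upd = "\<lambda>\<zeta>. \<zeta>(?j := (\<zeta> (Suc (Suc r)) - d ?j) + (- s ?j) * \<zeta> ?j)"
    have sj: "s ?j > 0" using Suc.prems s by auto
    have "(\<integral>\<^sup>+\<zeta>. f (\<Psi> r \<zeta>) \<partial>?P) = ennreal \<bar>- s ?j\<bar> *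
       (\<integral>\<^sup>+\<zeta>. f (\<Psi> r (?upd \<zeta>)) \<partial>?P)"
      using Suc.prems sj measurable_compose[OF meas f, of r]
      by (intro nn_integral_lebesgue_pi_affine) auto
    also have "(\<integral>\<^sup>+\<zeta>. f (\<Psi> r (?upd \<zeta>)) \<partial>?P) = (\<integral>\<^sup>+\<zeta>. f (\<Psi> (Suc r) \<zeta>) \<partial>?P)"
    proof (rule nn_integral_cong, rule arg_cong[where f=f])
      fix \<zeta>
      show "\<Psi> r (?upd \<zeta>) = \<Psi> (Suc r) \<zeta>"
        unfolding \<Psi>_def
      proof (rule restrict_ext)
        fix j assume "j \<in> {1..n}"
        have "(\<Sum>k=j..r. s k * (?upd \<zeta>) k + d k)
          = (\<Sum>k=j..r. s k * \<zeta> k + d k)" by (rule sum.cong) auto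
        then show "(if j \<le> r then (?upd \<zeta>) (Suc r)
              - (\<Sum>k=j..r. s k * (?upd \<zeta>) k + d k)
             else (?upd \<zeta>) j)
          = (if j \<le> Suc r then \<zeta> (Suc (Suc r)) - (\<Sum>k=j..Suc r. s k * \<zeta> k + d k) else \<zeta> j)"
          by (cases "j \<le> r"; cases "j = Suc r") (auto simp: algebra_simps)
      qed
    qed
    finally have *: "(\<integral>\<^sup>+\<zeta>. f (\<Psi> r \<zeta>) \<partial>?P) = ennreal (s ?j) * (\<integral>\<^sup>+\<zeta>. f (\<Psi> (Suc r) \<zeta>) \<partial>?P)"
      using sj by simp
    have "(\<Prod>k=1..r. s k) \<ge> 0" using Suc.prems s by (intro prod_nonneg) (force intro: less_imp_le)
    then show ?case using Suc sj unfolding * by (simp add: ennreal_mult mult.assoc)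
  qed
  let ?y = "\<lambda>\<zeta>. (c + (\<Sum>k=1..<n. real k / real n * (s k * \<zeta> k + d k))) + s n * \<zeta> n"
  have last: "(\<integral>\<^sup>+\<zeta>. f (\<Psi> (n-1) \<zeta>) \<partial>?P) = ennreal \<bar>s n\<bar> *
      (\<integral>\<^sup>+\<zeta>. f (\<Psi> (n-1) (\<zeta>(n := ?y \<zeta>))) \<partial>?P)"
  proof (rule nn_integral_lebesgue_pi_affine)
    show "s n \<noteq> 0" using s[of n] n by auto
    show "(\<lambda>\<zeta>. c + (\<Sum>k=1..<n. real k / real n * (s k * \<zeta> k + d k))) \<in> borel_measurable ?P"
      by (intro borel_measurable_sum borel_measurable_add borel_measurable_times borel_measurable_const comp) auto
    show "(\<lambda>\<zeta>. f (\<Psi> (n-1) \<zeta>)) \<in> borel_measurable ?P"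
      using measurable_compose[OF meas f, of "n-1"] n by auto
    show "c + (\<Sum>k=1..<n. real k / real n * (s k * (z(n := y)) k + d k)) =
      c + (\<Sum>k=1..<n. real k / real n * (s k * z k + d k))" for z y
      by (auto intro!: sum.cong)
  qed (use n in auto)
  also have "(\<integral>\<^sup>+\<zeta>. f (\<Psi> (n-1) (\<zeta>(n := ?y \<zeta>))) \<partial>?P)
    = (\<integral>\<^sup>+\<zeta>. f (gap_coords n s d c \<zeta>) \<partial>?P)"
  proof (rule nn_integral_cong, rule arg_cong[where f=f])
    fix \<zeta>
    show "\<Psi> (n-1) (\<zeta>(n := ?y \<zeta>)) = gap_coords n s d c \<zeta>"
      unfolding \<Psi>_def gap_coords_def
    proof (rule restrict_ext)
      fix j assume "j \<in> {1..n}"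
      have *: "{j..n-1} = {j..<n}" using n by auto
      have "(\<Sum>k=j..<n. s k * (\<zeta>(n := ?y \<zeta>)) k + d k) = (\<Sum>k=j..<n. s k * \<zeta> k + d k)"
        by (rule sum.cong) auto
      then show "(if j \<le> n-1 then (\<zeta>(n := ?y \<zeta>)) (Suc (n-1)) - (\<Sum>k=j..n-1. s k * (\<zeta>(n := ?y \<zeta>)) k + d k)
              else (\<zeta>(n := ?y \<zeta>)) j) = c + s n * \<zeta> n
        + (\<Sum>k=1..<n. real k / real n * (s k * \<zeta> k + d k)) - (\<Sum>k=j..<n. s k * \<zeta> k + d k)"
        using n \<open>j \<in> {1..n}\<close> unfolding * by (cases "j = n") auto
    qed
  qed
  finally have last': "(\<integral>\<^sup>+\<zeta>. f (\<Psi> (n-1) \<zeta>) \<partial>?P) = ennreal (s n) * (\<integral>\<^sup>+\<zeta>. f (gap_coords n s d c \<zeta>) \<partial>?P)"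
    using s[of n] n by simp
  have "(\<Prod>k=1..n. s k) = (\<Prod>k=1..n-1. s k) * s n"
    using n by (cases n) auto
  moreover have "(\<Prod>k=1..n-1. s k) \<ge> 0" by (intro prod_nonneg) (use s in \<open>force intro: less_imp_le\<close>)
  ultimately show ?thesis
    using step[of "n-1"] n s[of n] unfolding last' by (simp add: ennreal_mult mult.assoc)
qed

text \<open>The nonnegative case identifies Lebesgue measure with a multiple of an image measure, which
carries it over to signed integrands.\<close>

lemma integral_gap_coords:
  fixes f :: "(nat \<Rightarrow> real) \<Rightarrow> real"
  assumes n: "n \<ge> 1" and s: "\<And>k. k \<in> {1..n} \<Longrightarrow> s k > 0"
    and f[measurable]: "f \<in> borel_measurable (lebesgue_pi {1..n})"
  shows "(\<integral>z. f z \<partial>lebesgue_pi {1..n})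
       = (\<Prod>k=1..n. s k) * (\<integral>\<zeta>. f (gap_coords n s d c \<zeta>) \<partial>lebesgue_pi {1..n})"
proof -
  let ?P = "lebesgue_pi {1..n}" and ?g = "gap_coords n s d c"
  have pos: "(\<Prod>k=1..n. s k) > 0" by (intro prod_pos) (use s in auto)
  have [measurable]: "?g \<in> measurable ?P ?P" by (rule measurable_gap_coords[OF n])
  have "?P = density (distr ?P ?P ?g) (\<lambda>_. ennreal (\<Prod>k=1..n. s k))"
  proof (rule measure_eqI)
    fix A assume A[measurable]: "A \<in> sets ?P"
    have "emeasure ?P A = (\<integral>\<^sup>+z. indicator A z \<partial>?P)" using A by simp
    also have "\<dots> = ennreal (\<Prod>k=1..n. s k) * (\<integral>\<^sup>+\<zeta>. indicator A (?g \<zeta>) \<partial>?P)"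
      by (rule nn_integral_gap_coords[OF n s]) auto
    also have "\<dots> = ennreal (\<Prod>k=1..n. s k) * emeasure (distr ?P ?P ?g) A"
      by (subst nn_integral_indicator[symmetric], use A in simp, subst nn_integral_distr) auto
    finally show "emeasure ?P A = emeasure (density (distr ?P ?P ?g) (\<lambda>_. ennreal (\<Prod>k=1..n. s k))) A"
      by (subst emeasure_density) (auto simp: nn_integral_cmult)
  qed simp
  then have "(\<integral>z. f z \<partial>?P) = (\<integral>z. f z \<partial>density (distr ?P ?P ?g) (\<lambda>_. ennreal (\<Prod>k=1..n. s k)))"
    by metis
  also have "\<dots> = (\<integral>z. (\<Prod>k=1..n. s k) *\<^sub>R f z \<partial>distr ?P ?P ?g)"
    using pos by (intro integral_density) auto
  also have "\<dots> = (\<integral>\<zeta>. (\<Prod>k=1..n. s k) *\<^sub>R f (?g \<zeta>) \<partial>?P)"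
    by (intro integral_distr) auto
  finally show ?thesis by simp
qed

section \<open>The Markov property on a time grid\<close>

lemma distr_translate_lebesgue_pi:
  assumes "finite I"
  shows "distr (lebesgue_pi I) (lebesgue_pi I) (\<lambda>z. \<lambda>i\<in>I. y i + z i) = lebesgue_pi I"
proof (rule product_sigma_finite.PiM_eqI[OF product_sigma_finite_lborel \<open>finite I\<close>])
  fix A :: "nat \<Rightarrow> real set" assume A: "\<And>i. i \<in> I \<Longrightarrow> A i \<in> sets lborel"
  have m: "(\<lambda>z. \<lambda>i\<in>I. y i + z i) \<in> measurable (lebesgue_pi I) (lebesgue_pi I)"
    by (rule measurable_restrict) simp
  have *: "(\<lambda>z. \<lambda>i\<in>I. y i + z i) -` (Pi\<^sub>E I A) \<inter> space (lebesgue_pi I) = Pi\<^sub>E I (\<lambda>i. (\<lambda>z. y i + z) -` A i)"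
    by (auto simp: space_PiM PiE_iff)
  have A': "(\<lambda>z. y i + z) -` A i \<in> sets lborel" if "i \<in> I" for i
    using measurable_sets[of "\<lambda>z. y i + z" lborel lborel "A i"] A that by simp
  have e: "emeasure lborel ((\<lambda>z. y i + z) -` A i) = emeasure lborel (A i)" if "i \<in> I" for i
  proof -
    have "emeasure lborel (A i) = emeasure (distr lborel borel ((+) (y i))) (A i)"
      by (simp add: lborel_distr_plus)
    also have "\<dots> = emeasure lborel ((\<lambda>z. y i + z) -` A i)"
      using A that by (subst emeasure_distr) auto
    finally show ?thesis by simp
  qed
  have "emeasure (distr (lebesgue_pi I) (lebesgue_pi I) (\<lambda>z. \<lambda>i\<in>I. y i + z i)) (Pi\<^sub>E I A)
      = emeasure (lebesgue_pi I) (Pi\<^sub>E I (\<lambda>i. (\<lambda>z. y i + z) -` A i))"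
    using A by (subst emeasure_distr[OF m]) (auto intro!: sets_PiM_I_finite \<open>finite I\<close> simp: *)
  also have "\<dots> = (\<Prod>i\<in>I. emeasure lborel ((\<lambda>z. y i + z) -` A i))"
    using A' by (intro product_sigma_finite.emeasure_PiM[OF product_sigma_finite_lborel \<open>finite I\<close>]) auto
  also have "\<dots> = (\<Prod>i\<in>I. emeasure lborel (A i))"
    by (intro prod.cong e refl)
  finally show "emeasure (distr (lebesgue_pi I) (lebesgue_pi I) (\<lambda>z. \<lambda>i\<in>I. y i + z i)) (Pi\<^sub>E I A)
    = (\<Prod>i\<in>I. emeasure lborel (A i))" .
qed simp

lemma PiM_density_lborel:
  fixes f :: "nat \<Rightarrow> real \<Rightarrow> ennreal"
  assumes I: "finite I" and f: "\<And>i. f i \<in> borel_measurable borel"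
    and prob: "\<And>i. prob_space (density lborel (f i))"
  shows "Pi\<^sub>M I (\<lambda>i. density lborel (f i)) = density (lebesgue_pi I) (\<lambda>z. \<Prod>i\<in>I. f i (z i))"
proof (rule sym, rule product_sigma_finite.PiM_eqI[OF _ I])
  have [measurable]: "f i \<in> borel_measurable borel" for i by fact
  show "product_sigma_finite (\<lambda>i. density lborel (f i))"
    unfolding product_sigma_finite_def using prob prob_space_imp_sigma_finite by blast
  show "sets (density (lebesgue_pi I) (\<lambda>z. \<Prod>i\<in>I. f i (z i))) = sets (Pi\<^sub>M I (\<lambda>i. density lborel (f i)))"
    by (simp, rule sets_PiM_cong) simp_all
  fix A :: "nat \<Rightarrow> real set" assume "\<And>i. i \<in> I \<Longrightarrow> A i \<in> sets (density lborel (f i))"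
  then have A[measurable]: "A i \<in> sets borel" if "i \<in> I" for i using that by auto
  have "emeasure (density (lebesgue_pi I) (\<lambda>z. \<Prod>i\<in>I. f i (z i))) (Pi\<^sub>E I A)
    = (\<integral>\<^sup>+z. (\<Prod>i\<in>I. f i (z i)) * indicator (Pi\<^sub>E I A) z \<partial>lebesgue_pi I)"
    using A by (intro emeasure_density sets_PiM_I_finite I borel_measurable_prod) auto
  also have "\<dots> = (\<integral>\<^sup>+z. (\<Prod>i\<in>I. f i (z i) * indicator (A i) (z i)) \<partial>lebesgue_pi I)"
  proof (rule nn_integral_cong)
    fix z assume "z \<in> space (lebesgue_pi I)"
    then have "z \<in> Pi\<^sub>E I A \<longleftrightarrow> (\<forall>i\<in>I. z i \<in> A i)" by (auto simp: space_PiM PiE_iff)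
    then have "indicator (Pi\<^sub>E I A) z = (\<Prod>i\<in>I. indicator (A i) (z i) :: ennreal)"
      using I by (cases "z \<in> Pi\<^sub>E I A") (auto simp: indicator_def)
    then show "(\<Prod>i\<in>I. f i (z i)) * indicator (Pi\<^sub>E I A) z = (\<Prod>i\<in>I. f i (z i) * indicator (A i) (z i))"
      by (simp add: prod.distrib)
  qed
  also have "\<dots> = (\<Prod>i\<in>I. \<integral>\<^sup>+z. f i z * indicator (A i) z \<partial>lborel)"
    using A by (intro product_sigma_finite.product_nn_integral_prod[OF product_sigma_finite_lborel I]) auto
  also have "\<dots> = (\<Prod>i\<in>I. emeasure (density lborel (f i)) (A i))"
    using A by (intro prod.cong refl emeasure_density[symmetric]) auto
  finally show "emeasure (density (lebesgue_pi I) (\<lambda>z. \<Prod>i\<in>I. f i (z i))) (Pi\<^sub>E I A)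
    = (\<Prod>i\<in>I. emeasure (density lborel (f i)) (A i))" .
qed

text \<open>Independence in two layers: between the Y i, and for each of them between the functionals G l. It
yields the joint independence of all increments of independent processes with independent increments.\<close>

lemma (in prob_space) indep_vars_nested:
  assumes Y: "indep_vars N Y I" and fin: "finite I" "I \<noteq> {}" "finite L" "L \<noteq> {}"
    and G: "\<And>i l. i \<in> I \<Longrightarrow> l \<in> L \<Longrightarrow> G l \<in> measurable (N i) K"
    and each: "\<And>i. i \<in> I \<Longrightarrow> indep_vars (\<lambda>_. K) (\<lambda>l \<omega>. G l (Y i \<omega>)) L"
  shows "indep_vars (\<lambda>_. K) (\<lambda>p \<omega>. G (snd p) (Y (fst p) \<omega>)) (I \<times> L)"
proof (subst indep_vars_finite[where E="\<lambda>_. sets K"])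
  have Ym: "Y i \<in> measurable M (N i)" if "i \<in> I" for i using Y that by (auto simp: indep_vars_def)
  then have Gm: "(\<lambda>\<omega>. G l (Y i \<omega>)) \<in> measurable M K" if "i \<in> I" "l \<in> L" for i l
    using G that by (auto intro: measurable_compose)
  then show "\<And>p. p \<in> I \<times> L \<Longrightarrow> random_variable K (\<lambda>\<omega>. G (snd p) (Y (fst p) \<omega>))" by auto
  show "\<forall>A\<in>I \<times> L \<rightarrow> sets K. prob (\<Inter>p\<in>I \<times> L. (\<lambda>\<omega>. G (snd p) (Y (fst p) \<omega>)) -` A p \<inter> space M)
      = (\<Prod>p\<in>I \<times> L. prob ((\<lambda>\<omega>. G (snd p) (Y (fst p) \<omega>)) -` A p \<inter> space M))"
  proof
    fix A assume "A \<in> I \<times> L \<rightarrow> sets K"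
    then have A: "A (i, l) \<in> sets K" if "i \<in> I" "l \<in> L" for i l using that by auto
    define C where "C i = (\<Inter>l\<in>L. G l -` A (i, l) \<inter> space (N i))" for i
    have C: "C i \<in> sets (N i)" if "i \<in> I" for i
      unfolding C_def using that G A fin by (intro sets.finite_INT measurable_sets) auto
    have YC: "Y i -` C i \<inter> space M = (\<Inter>l\<in>L. (\<lambda>\<omega>. G l (Y i \<omega>)) -` A (i, l) \<inter> space M)" if "i \<in> I" for i
      using measurable_space[OF Ym[OF that]] fin by (auto simp: C_def)
    have "(\<Inter>p\<in>I \<times> L. (\<lambda>\<omega>. G (snd p) (Y (fst p) \<omega>)) -` A p \<inter> space M) = (\<Inter>i\<in>I. Y i -` C i \<inter> space M)"
      using fin(4) by (subst INF_cong[OF refl YC]) auto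
    then have "prob (\<Inter>p\<in>I \<times> L. (\<lambda>\<omega>. G (snd p) (Y (fst p) \<omega>)) -` A p \<inter> space M) = (\<Prod>i\<in>I. prob (Y i -` C i \<inter> space M))"
      using indep_varsD_finite[OF Y fin(2,1) C] by simp
    also have "\<dots> = (\<Prod>i\<in>I. \<Prod>l\<in>L. prob ((\<lambda>\<omega>. G l (Y i \<omega>)) -` A (i, l) \<inter> space M))"
      using indep_varsD_finite[OF each fin(4,3)] A by (intro prod.cong refl) (simp add: YC)
    also have "\<dots> = (\<Prod>p\<in>I \<times> L. prob ((\<lambda>\<omega>. G (snd p) (Y (fst p) \<omega>)) -` A p \<inter> space M))"
      by (simp add: prod.cartesian_product split_beta)
    finally show "prob (\<Inter>p\<in>I \<times> L. (\<lambda>\<omega>. G (snd p) (Y (fst p) \<omega>)) -` A p \<inter> space M)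
      = (\<Prod>p\<in>I \<times> L. prob ((\<lambda>\<omega>. G (snd p) (Y (fst p) \<omega>)) -` A p \<inter> space M))" .
  qed
  show "I \<times> L \<noteq> {}" "finite (I \<times> L)" using fin by auto
  show "\<And>p. p \<in> I \<times> L \<Longrightarrow> sets K = sigma_sets (space K) (sets K)" by (simp add: sets.sigma_sets_eq)
  show "\<And>p. p \<in> I \<times> L \<Longrightarrow> Int_stable (sets K)" by (simp add: sets.Int_stable)
  show "\<And>p. p \<in> I \<times> L \<Longrightarrow> sets K \<subseteq> Pow (space K)" by (rule sets.space_closed)
qed simp

text \<open>The transition density from y to z in time s of Brownian motion with drift a.\<close>

definition drift_kernel :: "nat \<Rightarrow> (nat \<Rightarrow> real) \<Rightarrow> real \<Rightarrow> (nat \<Rightarrow> real) \<Rightarrow> (nat \<Rightarrow> real) \<Rightarrow> real" where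
  "drift_kernel n a s y z = (\<Prod>i=1..n. normal_density (y i + a i * s) (sqrt s) (z i))"

lemma drift_kernel_nonneg: "drift_kernel n a s y z \<ge> 0"
  by (auto simp: drift_kernel_def intro!: prod_nonneg)

lemma borel_measurable_drift_kernel [measurable]:
  "drift_kernel n a s y \<in> borel_measurable (lebesgue_pi {1..n})"
  unfolding drift_kernel_def by (intro borel_measurable_prod) simp

lemma borel_measurable_drift_integral:
  fixes f :: "(nat \<Rightarrow> real) \<Rightarrow> real"
  assumes f[measurable]: "f \<in> borel_measurable (lebesgue_pi {1..n})"
  shows "(\<lambda>y. \<integral>z. f z * drift_kernel n a s y z \<partial>lebesgue_pi {1..n}) \<in> borel_measurable (lebesgue_pi {1..n})"
proof -
  let ?P = "lebesgue_pi {1..n}"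
  interpret sigma_finite_measure ?P
    by (intro product_sigma_finite.sigma_finite product_sigma_finite_lborel) simp
  have "(\<lambda>p. drift_kernel n a s (fst p) (snd p)) \<in> borel_measurable (?P \<Otimes>\<^sub>M ?P)"
    unfolding drift_kernel_def
  proof (rule borel_measurable_prod)
    fix i assume i: "i \<in> {1..n}"
    have [measurable]: "(\<lambda>p. fst p i) \<in> borel_measurable (?P \<Otimes>\<^sub>M ?P)" "(\<lambda>p. snd p i) \<in> borel_measurable (?P \<Otimes>\<^sub>M ?P)"
      using measurable_compose[OF measurable_fst, of "\<lambda>d. d i" ?P borel ?P]
        measurable_compose[OF measurable_snd, of "\<lambda>d. d i" ?P borel ?P] i by simp_all
    show "(\<lambda>p. normal_density (fst p i + a i * s) (sqrt s) (snd p i)) \<in> borel_measurable (?P \<Otimes>\<^sub>M ?P)"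
      unfolding normal_density_def by measurable
  qed
  then show ?thesis
    by (intro borel_measurable_lebesgue_integral) (simp add: split_beta)
qed

context
  fixes M :: "'w measure" and n :: nat and a x :: "nat \<Rightarrow> real" and X :: "nat \<Rightarrow> real \<Rightarrow> 'w \<Rightarrow> real"
  assumes n: "n \<ge> 1" and ibm: "indep_brownian_motions M n a x X"
begin

interpretation prob_space M using ibm by (simp add: indep_brownian_motions_def)

lemma ibm_component: "i \<in> {1..n} \<Longrightarrow> brownian_motion M (a i) (x i) (X i)"
  using ibm by (simp add: indep_brownian_motions_def)

lemma ibm_measurable: "i \<in> {1..n} \<Longrightarrow> 0 \<le> t \<Longrightarrow> X i t \<in> borel_measurable M"
  using ibm_component by (simp add: brownian_motion_def)

lemma ibm_start: "AE \<omega> in M. \<forall>i\<in>{1..n}. X i 0 \<omega> = x i"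
  by (rule AE_finite_allI) (use ibm_component in \<open>auto simp: brownian_motion_def\<close>)

lemma ibm_increment_distr:
  assumes "0 \<le> s" "s < t"
  shows "distr M (lebesgue_pi {1..n}) (\<lambda>\<omega>. \<lambda>i\<in>{1..n}. X i t \<omega> - X i s \<omega>)
    = density (lebesgue_pi {1..n}) (\<lambda>z. ennreal (drift_kernel n a (t - s) (\<lambda>_. 0) z))"
proof -
  let ?D = "\<lambda>i \<omega>. if i \<in> {1..n} then X i t \<omega> - X i s \<omega> else 0"
  let ?f = "\<lambda>i y. ennreal (normal_density (a i * (t - s)) (sqrt (t - s)) y)"
  have Dm: "?D i \<in> measurable M lborel" for i
    using ibm_measurable[of i t] ibm_measurable[of i s] assms by (cases "i \<in> {1..n}") auto
  have ind0: "indep_vars (\<lambda>_. Pi\<^sub>M {0..} (\<lambda>_. borel)) (\<lambda>i \<omega>. \<lambda>t\<in>{0..}. X i t \<omega>) {1..n}"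
    using ibm by (simp add: indep_brownian_motions_def)
  have "indep_vars (\<lambda>_. lborel) (\<lambda>i. (\<lambda>y. y t - y s) \<circ> (\<lambda>\<omega>. \<lambda>t\<in>{0..}. X i t \<omega>)) {1..n}"
    using assms by (intro indep_vars_compose[OF ind0] borel_measurable_diff) auto
  then have ind: "indep_vars (\<lambda>_. lborel) ?D {1..n}"
    by (subst indep_vars_cong[OF refl _ refl]) (use assms in \<open>auto simp: fun_eq_iff\<close>)
  have dist: "distr M lborel (?D i) = density lborel (?f i)" if "i \<in> {1..n}" for i
    using ibm_component[OF that] assms that unfolding brownian_motion_def distributed_def by auto
  have pos: "sqrt (t - s) > 0" using assms by simp
  have "distr M (lebesgue_pi {1..n}) (\<lambda>\<omega>. \<lambda>i\<in>{1..n}. ?D i \<omega>) = Pi\<^sub>M {1..n} (\<lambda>i. distr M lborel (?D i))"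
    using ind Dm n by (subst (asm) indep_vars_iff_distr_eq_PiM) auto
  also have "\<dots> = Pi\<^sub>M {1..n} (\<lambda>i. density lborel (?f i))"
    by (intro PiM_cong dist refl)
  also have "\<dots> = density (lebesgue_pi {1..n}) (\<lambda>z. \<Prod>i\<in>{1..n}. ?f i (z i))"
    using pos by (intro PiM_density_lborel prob_space_normal_density) auto
  also have "(\<lambda>z. \<Prod>i\<in>{1..n}. ?f i (z i)) = (\<lambda>z. ennreal (drift_kernel n a (t - s) (\<lambda>_. 0) z))"
    by (simp add: drift_kernel_def prod_ennreal)
  also have "(\<lambda>\<omega>. \<lambda>i\<in>{1..n}. ?D i \<omega>) = (\<lambda>\<omega>. \<lambda>i\<in>{1..n}. X i t \<omega> - X i s \<omega>)"
    by (auto simp: fun_eq_iff)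
  finally show ?thesis .
qed

lemma drift_kernel_translate:
  fixes f :: "(nat \<Rightarrow> real) \<Rightarrow> real"
  assumes [measurable]: "f \<in> borel_measurable (lebesgue_pi {1..n})"
  shows "(\<integral>d. f (\<lambda>i\<in>{1..n}. y i + d i) * drift_kernel n a s (\<lambda>_. 0) d \<partial>lebesgue_pi {1..n})
      = (\<integral>z. f z * drift_kernel n a s y z \<partial>lebesgue_pi {1..n})"
proof -
  let ?P = "lebesgue_pi {1..n}"
  have m[measurable]: "(\<lambda>d. \<lambda>i\<in>{1..n}. y i + d i) \<in> measurable ?P ?P"
    by (rule measurable_restrict) simp
  have "(\<integral>z. f z * drift_kernel n a s y z \<partial>?P) =
     (\<integral>z. f z * drift_kernel n a s y z \<partial>distr ?P ?P (\<lambda>d. \<lambda>i\<in>{1..n}. y i + d i))"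
    by (simp add: distr_translate_lebesgue_pi)
  also have "\<dots> = (\<integral>d. f (\<lambda>i\<in>{1..n}. y i + d i) * drift_kernel n a s y (\<lambda>i\<in>{1..n}. y i + d i) \<partial>?P)"
    by (rule integral_distr) measurable
  also have "\<dots> = (\<integral>d. f (\<lambda>i\<in>{1..n}. y i + d i) * drift_kernel n a s (\<lambda>_. 0) d \<partial>?P)"
    by (simp add: drift_kernel_def normal_density_def algebra_simps)
  finally show ?thesis by simp
qed

text \<open>The path on the grid r 0, ..., r k is a function of the starting point and of the increments up to
r k. These are independent of the increment from r k to T, whose law is the drift kernel.\<close>

lemma ibm_markov:
  fixes \<Phi> :: "(nat \<times> nat \<Rightarrow> real) \<Rightarrow> real" and f :: "(nat \<Rightarrow> real) \<Rightarrow> real"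
  assumes r: "r 0 = 0" "\<And>l. l < k \<Longrightarrow> r l < r (Suc l)" "r k < T"
    and \<Phi>[measurable]: "\<Phi> \<in> borel_measurable (Pi\<^sub>M ({1..n} \<times> {..k}) (\<lambda>_. borel))"
    and f[measurable]: "f \<in> borel_measurable (lebesgue_pi {1..n})"
    and bd: "\<And>u. \<bar>\<Phi> u\<bar> \<le> B" "\<And>z. \<bar>f z\<bar> \<le> B"
  shows "expectation (\<lambda>\<omega>. \<Phi> (\<lambda>p\<in>{1..n} \<times> {..k}. X (fst p) (r (snd p)) \<omega>) * f (\<lambda>i\<in>{1..n}. X i T \<omega>))
       = expectation (\<lambda>\<omega>. \<Phi> (\<lambda>p\<in>{1..n} \<times> {..k}. X (fst p) (r (snd p)) \<omega>) *
           (\<integral>z. f z * drift_kernel n a (T - r k) (\<lambda>i. X i (r k) \<omega>) z \<partial>lebesgue_pi {1..n}))"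
proof -
  let ?P = "lebesgue_pi {1..n}"
  let ?grid = "\<lambda>\<omega>. \<lambda>p\<in>{1..n} \<times> {..k}. X (fst p) (r (snd p)) \<omega>"
  \<comment> \<open>The grid r 0, ..., r k, T, continued beyond T so as to be strictly increasing.\<close>
  define r' where "r' l = (if l \<le> k then r l else T + real (l - Suc k))" for l
  have r': "r' 0 = 0" "r' l < r' (Suc l)" for l
    using r by (auto simp: r'_def not_less_eq_eq)
  have r'_mono: "r' i \<le> r' j" if "i \<le> j" for i j
    using lift_Suc_mono_le[of r'] r'(2) that by (simp add: less_imp_le)
  have r'_nonneg: "0 \<le> r' l" for l using r'_mono[of 0 l] r' by simp
  let ?G = "\<lambda>l y. y (r' (Suc l)) - y (r' l) :: real"
  let ?Y = "\<lambda>i \<omega>. \<lambda>t\<in>{0..}. X i t \<omega>"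
  let ?D = "\<lambda>p \<omega>. ?G (snd p) (?Y (fst p) \<omega>)"
  have D: "?D p \<omega> = X (fst p) (r' (Suc (snd p))) \<omega> - X (fst p) (r' (snd p)) \<omega>" for p \<omega>
    by (simp add: r'_nonneg)
  have ind: "indep_vars (\<lambda>_. borel) ?D ({1..n} \<times> {..<Suc k})"
  proof (rule indep_vars_nested[where N="\<lambda>_. Pi\<^sub>M {0..} (\<lambda>_. borel)" and Y="?Y" and G="?G"])
    show "indep_vars (\<lambda>_. Pi\<^sub>M {0..} (\<lambda>_. borel)) ?Y {1..n}"
      using ibm by (simp add: indep_brownian_motions_def)
    fix i assume i: "i \<in> {1..n}"
    have "indep_vars (\<lambda>_. borel) (\<lambda>l \<omega>. X i (r' (Suc l)) \<omega> - X i (r' l) \<omega>) {..<Suc k}"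
      using ibm_component[OF i] r' unfolding brownian_motion_def by auto
    then show "indep_vars (\<lambda>_. borel) (\<lambda>l \<omega>. ?G l (?Y i \<omega>)) {..<Suc k}"
      by (simp add: r'_nonneg)
  qed (use n in \<open>auto intro!: borel_measurable_diff measurable_component_singleton simp: r'_nonneg\<close>)
  let ?A = "{1..n} \<times> {..<k}" and ?B = "{1..n} \<times> {k}"
  define U where "U = (\<lambda>\<omega>. \<lambda>p\<in>?A. ?D p \<omega>)"
  define V where "V = (\<lambda>\<omega>. \<lambda>p\<in>?B. ?D p \<omega>)"
  let ?PA = "Pi\<^sub>M ?A (\<lambda>_. borel :: real measure)" and ?PB = "Pi\<^sub>M ?B (\<lambda>_. borel :: real measure)"
  have "indep_var ?PA U ?PB V"
    unfolding U_def V_def by (rule indep_var_restrict[OF ind]) auto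
  then have Um[measurable]: "U \<in> measurable M ?PA" and Vm[measurable]: "V \<in> measurable M ?PB"
    and joint: "distr M ?PA U \<Otimes>\<^sub>M distr M ?PB V = distr M (?PA \<Otimes>\<^sub>M ?PB) (\<lambda>\<omega>. (U \<omega>, V \<omega>))"
    by (simp_all add: indep_var_distribution_eq)
  have V_comp: "V \<omega> (i, k) = X i T \<omega> - X i (r k) \<omega>" if "i \<in> {1..n}" for i \<omega>
    using that r'_nonneg[of k] r'_nonneg[of "Suc k"] by (simp add: V_def r'_def)
  define pos where "pos l u i = x i + (\<Sum>j<l. u (i, j))" for l i and u :: "nat \<times> nat \<Rightarrow> real"
  have posm: "(\<lambda>u. pos l u i) \<in> borel_measurable ?PA" if "i \<in> {1..n}" "l \<le> k" for i l
    unfolding pos_def using that by (intro borel_measurable_add borel_measurable_const borel_measurable_sum) auto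
  let ?path = "\<lambda>u. \<lambda>p\<in>{1..n} \<times> {..k}. pos (snd p) u (fst p)"
  have path[measurable]: "?path \<in> measurable ?PA (Pi\<^sub>M ({1..n} \<times> {..k}) (\<lambda>_. borel))"
    by (rule measurable_restrict) (auto intro: posm)
  have pos_eq: "pos l (U \<omega>) i = X i (r l) \<omega>" if "\<forall>i\<in>{1..n}. X i 0 \<omega> = x i" "i \<in> {1..n}" "l \<le> k" for \<omega> i l
  proof -
    have "(\<Sum>j<l. U \<omega> (i, j)) = (\<Sum>j<l. X i (r' (Suc j)) \<omega> - X i (r' j) \<omega>)"
      using that by (intro sum.cong) (auto simp: U_def r'_nonneg)
    also have "\<dots> = X i (r' l) \<omega> - X i (r' 0) \<omega>" by (rule sum_lessThan_telescope)
    finally show ?thesis using that r by (simp add: pos_def r'_def)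
  qed
  define g where "g = (\<lambda>(u, d). \<Phi> (?path u) * f (\<lambda>i\<in>{1..n}. pos k u i + d (i, k)))"
  have shift[measurable]: "(\<lambda>(u, d). \<lambda>i\<in>{1..n}. pos k u i + d (i, k)) \<in> measurable (?PA \<Otimes>\<^sub>M ?PB) ?P"
    unfolding split_beta
  proof (rule measurable_restrict)
    fix i assume i: "i \<in> {1..n}"
    have "(\<lambda>p. pos k (fst p) i) \<in> borel_measurable (?PA \<Otimes>\<^sub>M ?PB)"
      by (rule measurable_compose[OF measurable_fst posm]) (use i in auto)
    moreover have "(\<lambda>p. snd p (i, k)) \<in> borel_measurable (?PA \<Otimes>\<^sub>M ?PB)"
      using measurable_compose[OF measurable_snd, of "\<lambda>d. d (i, k)" ?PB borel ?PA] i by simp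
    ultimately show "(\<lambda>p. pos k (fst p) i + snd p (i, k)) \<in> measurable (?PA \<Otimes>\<^sub>M ?PB) lborel" by simp
  qed
  have gm[measurable]: "g \<in> borel_measurable (?PA \<Otimes>\<^sub>M ?PB)"
  proof -
    have "(\<lambda>p. \<Phi> (?path (fst p))) \<in> borel_measurable (?PA \<Otimes>\<^sub>M ?PB)"
      by (rule measurable_compose[OF measurable_fst]) (rule measurable_compose[OF path \<Phi>])
    moreover have "(\<lambda>p. f (case p of (u, d) \<Rightarrow> \<lambda>i\<in>{1..n}. pos k u i + d (i, k))) \<in> borel_measurable (?PA \<Otimes>\<^sub>M ?PB)"
      by (rule measurable_compose[OF shift f])
    ultimately show ?thesis unfolding g_def split_beta by simp
  qed
  have B: "B \<ge> 0" using bd(2)[of undefined] by (meson abs_ge_zero order_trans)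
  have gbd: "\<bar>g p\<bar> \<le> B * B" for p
    unfolding g_def split_beta abs_mult by (intro mult_mono bd) (auto simp: B)
  interpret PA: prob_space "distr M ?PA U" by (rule prob_space_distr) simp
  interpret PB: prob_space "distr M ?PB V" by (rule prob_space_distr) simp
  interpret PAB: pair_prob_space "distr M ?PA U" "distr M ?PB V" ..
  have inner: "(\<integral>d. f (\<lambda>i\<in>{1..n}. y i + d (i, k)) \<partial>distr M ?PB V) = (\<integral>z. f z * drift_kernel n a (T - r k) y z \<partial>?P)" for y
  proof -
    have [measurable]: "(\<lambda>d. f (\<lambda>i\<in>{1..n}. y i + d i)) \<in> borel_measurable ?P"
      by (rule measurable_compose[OF _ f]) (rule measurable_restrict, simp)
    have [measurable]: "(\<lambda>d. f (\<lambda>i\<in>{1..n}. y i + d (i, k))) \<in> borel_measurable ?PB"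
      by (rule measurable_compose[OF _ f]) (rule measurable_restrict, simp)
    let ?W = "\<lambda>\<omega>. \<lambda>i\<in>{1..n}. X i T \<omega> - X i (r k) \<omega>"
    have k0: "r k \<ge> 0" using r'_nonneg[of k] by (simp add: r'_def)
    have [measurable]: "?W \<in> measurable M ?P"
      using ibm_measurable[of _ T] ibm_measurable[of _ "r k"] k0 r by (intro measurable_restrict) auto
    have "(\<integral>d. f (\<lambda>i\<in>{1..n}. y i + d (i, k)) \<partial>distr M ?PB V) = expectation (\<lambda>\<omega>. f (\<lambda>i\<in>{1..n}. y i + V \<omega> (i, k)))"
      by (rule integral_distr) measurable
    also have "\<dots> = expectation (\<lambda>\<omega>. f (\<lambda>i\<in>{1..n}. y i + ?W \<omega> i))"
      by (intro Bochner_Integration.integral_cong arg_cong[where f=f] restrict_ext refl) (simp add: V_comp)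
    also have "\<dots> = (\<integral>d. f (\<lambda>i\<in>{1..n}. y i + d i) \<partial>distr M ?P ?W)"
      by (rule integral_distr[symmetric]) measurable
    also have "distr M ?P ?W = density ?P (\<lambda>z. ennreal (drift_kernel n a (T - r k) (\<lambda>_. 0) z))"
      using r k0 by (intro ibm_increment_distr) auto
    also have "(\<integral>d. f (\<lambda>i\<in>{1..n}. y i + d i) \<partial>\<dots>)
       = (\<integral>d. drift_kernel n a (T - r k) (\<lambda>_. 0) d * f (\<lambda>i\<in>{1..n}. y i + d i) \<partial>?P)"
      by (simp add: integral_density drift_kernel_nonneg)
    also have "\<dots> = (\<integral>z. f z * drift_kernel n a (T - r k) y z \<partial>?P)"
      by (subst mult.commute) (rule drift_kernel_translate[OF f])
    finally show ?thesis .
  qed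
  have gridm: "?grid \<in> measurable M (Pi\<^sub>M ({1..n} \<times> {..k}) (\<lambda>_. borel))"
  proof (rule measurable_restrict)
    fix p assume "p \<in> {1..n} \<times> {..k}"
    then show "X (fst p) (r (snd p)) \<in> borel_measurable M"
      using r'_nonneg[of "snd p"] by (intro ibm_measurable) (auto simp: r'_def)
  qed
  have "expectation (\<lambda>\<omega>. \<Phi> (?grid \<omega>) * f (\<lambda>i\<in>{1..n}. X i T \<omega>))
      = expectation (\<lambda>\<omega>. g (U \<omega>, V \<omega>))"
  proof (rule integral_cong_AE)
    show "AE \<omega> in M. \<Phi> (?grid \<omega>) * f (\<lambda>i\<in>{1..n}. X i T \<omega>) = g (U \<omega>, V \<omega>)"
      using ibm_start
    proof eventually_elim
      case (elim \<omega>)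
      have "(?grid \<omega>) = ?path (U \<omega>)"
        by (rule restrict_ext) (use pos_eq[OF elim] in auto)
      moreover have "(\<lambda>i\<in>{1..n}. X i T \<omega>) = (\<lambda>i\<in>{1..n}. pos k (U \<omega>) i + V \<omega> (i, k))"
        by (rule restrict_ext) (subst pos_eq[OF elim], auto simp: V_comp)
      ultimately show ?case by (simp add: g_def)
    qed
    have "T \<ge> 0" using r'_nonneg[of "Suc k"] by (simp add: r'_def)
    then have 2: "(\<lambda>\<omega>. \<lambda>i\<in>{1..n}. X i T \<omega>) \<in> measurable M ?P"
      by (intro measurable_restrict) (simp add: ibm_measurable)
    show "(\<lambda>\<omega>. \<Phi> (?grid \<omega>) * f (\<lambda>i\<in>{1..n}. X i T \<omega>)) \<in> borel_measurable M"
      using measurable_compose[OF gridm \<Phi>] measurable_compose[OF 2 f] by simp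
  qed measurable
  also have "\<dots> = (\<integral>p. g p \<partial>distr M (?PA \<Otimes>\<^sub>M ?PB) (\<lambda>\<omega>. (U \<omega>, V \<omega>)))"
    by (rule integral_distr[symmetric]) measurable
  also have "\<dots> = (\<integral>p. g p \<partial>(distr M ?PA U \<Otimes>\<^sub>M distr M ?PB V))" by (simp add: joint)
  also have "\<dots> = (\<integral>u. \<integral>d. g (u, d) \<partial>distr M ?PB V \<partial>distr M ?PA U)"
    by (rule PAB.integral_fst'[symmetric], rule PAB.integrable_const_bound[where B="B*B"])
       (use gbd in \<open>auto simp: joint\<close>)
  also have "\<dots> = expectation (\<lambda>\<omega>. \<integral>d. g (U \<omega>, d) \<partial>distr M ?PB V)"
    by (intro integral_distr Um PB.borel_measurable_lebesgue_integral) simp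
  also have "\<dots> = expectation (\<lambda>\<omega>. \<Phi> (?path (U \<omega>)) * (\<integral>z. f z * drift_kernel n a (T - r k) (pos k (U \<omega>)) z \<partial>?P))"
    by (simp add: g_def inner)
  also have "\<dots> = expectation (\<lambda>\<omega>. \<Phi> (?grid \<omega>) *
           (\<integral>z. f z * drift_kernel n a (T - r k) (\<lambda>i. X i (r k) \<omega>) z \<partial>lebesgue_pi {1..n}))"
  proof (rule integral_cong_AE)
    note um = measurable_compose[OF _ borel_measurable_drift_integral[OF f]]
    have k0: "r k \<ge> 0" using r'_nonneg[of k] by (simp add: r'_def)
    have "(\<lambda>\<omega>. \<lambda>i\<in>{1..n}. pos k (U \<omega>) i) \<in> measurable M ?P"
      by (rule measurable_restrict, rule measurable_compose[OF Um]) (use posm in auto)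
    from um[OF this] have 1: "(\<lambda>\<omega>. \<integral>z. f z * drift_kernel n a (T - r k) (pos k (U \<omega>)) z \<partial>?P) \<in> borel_measurable M"
      by (simp add: drift_kernel_def)
    show "(\<lambda>\<omega>. \<Phi> (?path (U \<omega>)) * (\<integral>z. f z * drift_kernel n a (T - r k) (pos k (U \<omega>)) z \<partial>?P)) \<in> borel_measurable M"
      by (intro borel_measurable_times 1 measurable_compose[OF Um] measurable_compose[OF path] \<Phi>)
    have "(\<lambda>\<omega>. \<lambda>i\<in>{1..n}. X i (r k) \<omega>) \<in> measurable M ?P"
      using k0 by (intro measurable_restrict) (simp add: ibm_measurable)
    from um[OF this] have 2: "(\<lambda>\<omega>. \<integral>z. f z * drift_kernel n a (T - r k) (\<lambda>i. X i (r k) \<omega>) z \<partial>?P) \<in> borel_measurable M"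
      by (simp add: drift_kernel_def)
    show "(\<lambda>\<omega>. \<Phi> (?grid \<omega>) *
           (\<integral>z. f z * drift_kernel n a (T - r k) (\<lambda>i. X i (r k) \<omega>) z \<partial>lebesgue_pi {1..n})) \<in> borel_measurable M"
      by (intro borel_measurable_times 2 measurable_compose[OF gridm] \<Phi>)
    show "AE \<omega> in M. \<Phi> (?path (U \<omega>)) * (\<integral>z. f z * drift_kernel n a (T - r k) (pos k (U \<omega>)) z \<partial>?P)
      = \<Phi> (?grid \<omega>) *
           (\<integral>z. f z * drift_kernel n a (T - r k) (\<lambda>i. X i (r k) \<omega>) z \<partial>?P)"
      using ibm_start
    proof eventually_elim
      case (elim \<omega>)
      have "(?grid \<omega>) = ?path (U \<omega>)"
        by (rule restrict_ext) (use pos_eq[OF elim] in auto)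
      moreover have "drift_kernel n a (T - r k) (\<lambda>i. X i (r k) \<omega>) z = drift_kernel n a (T - r k) (pos k (U \<omega>)) z" for z
        unfolding drift_kernel_def by (rule prod.cong) (use pos_eq[OF elim] in auto)
      ultimately show ?case by simp
    qed
  qed
  finally show ?thesis .
qed

end

section \<open>Determinants as sums over permutations\<close>

text \<open>The determinant, for matrices indexed from 1 that are mere functions. The sum over permutations
can be integrated term by term.\<close>

definition leibniz :: "nat \<Rightarrow> (nat \<Rightarrow> nat \<Rightarrow> real) \<Rightarrow> real" where
  "leibniz n F = (\<Sum>p | p permutes {1..n}. of_int (sign p) * (\<Prod>i=1..n. F i (p i)))"

lemma leibniz_eq_det: "leibniz n F = Determinant.det (Matrix.mat n n (\<lambda>(r, s). F (Suc r) (Suc s)))"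
proof -
  have bij: "bij_betw Suc {0..<n} {1..n}"
    unfolding bij_betw_def One_nat_def image_Suc_atLeastLessThan atLeastLessThanSuc_atLeastAtMost by simp
  define h where "h = map_permutation {0..<n} Suc"
  have "bij_betw h {p. p permutes {0..<n}} {p. p permutes {1..n}}"
  proof (rule bij_betw_byWitness[where f'="map_permutation {1..n} (\<lambda>i. i - 1)"])
    have bij': "bij_betw (\<lambda>i. i - 1) {1..n} {0..<n}"
      by (rule bij_betw_byWitness[where f'=Suc]) (auto simp: One_nat_def)
    show "\<forall>p\<in>{p. p permutes {0..<n}}. map_permutation {1..n} (\<lambda>i. i - 1) (h p) = p"
      unfolding h_def by (auto intro!: map_permutation_compose_inv[OF bij])
    show "\<forall>p\<in>{p. p permutes {1..n}}. h (map_permutation {1..n} (\<lambda>i. i - 1) p) = p"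
      unfolding h_def by (auto intro!: map_permutation_compose_inv[OF bij'])
    show "h ` {p. p permutes {0..<n}} \<subseteq> {p. p permutes {1..n}}"
      unfolding h_def using map_permutation_permutes[OF bij] by blast
    show "map_permutation {1..n} (\<lambda>i. i - 1) ` {p. p permutes {1..n}} \<subseteq> {p. p permutes {0..<n}}"
      using map_permutation_permutes[OF bij'] by blast
  qed
  then have "leibniz n F = (\<Sum>p | p permutes {0..<n}. of_int (sign (h p)) * (\<Prod>i=1..n. F i (h p i)))"
    unfolding leibniz_def by (rule sum.reindex_bij_betw[symmetric])
  also have "\<dots> = (\<Sum>p | p permutes {0..<n}. signof p * (\<Prod>i=0..<n. Matrix.mat n n (\<lambda>(r, s). F (Suc r) (Suc s)) $$ (i, p i)))"
  proof (rule sum.cong[OF refl], rule arg_cong2[where f="(*)"])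
    fix p assume "p \<in> {p. p permutes {0..<n}}"
    then have p: "p permutes {0..<n}" by simp
    show "of_int (sign (h p)) = signof p"
      unfolding h_def by (subst sign_map_permutation) (use p in auto)
    have "(\<Prod>i=1..n. F i (h p i)) = (\<Prod>i=0..<n. F (Suc i) (h p (Suc i)))"
      by (rule prod.reindex_bij_betw[OF bij, symmetric])
    also have "\<dots> = (\<Prod>i=0..<n. Matrix.mat n n (\<lambda>(r, s). F (Suc r) (Suc s)) $$ (i, p i))"
    proof (rule prod.cong[OF refl])
      fix i assume i: "i \<in> {0..<n}"
      then have "p i \<in> {0..<n}" using permutes_in_image[OF p] by simp
      then show "F (Suc i) (h p (Suc i)) = Matrix.mat n n (\<lambda>(r, s). F (Suc r) (Suc s)) $$ (i, p i)"
        using i by (simp add: h_def map_permutation_apply)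
    qed
    finally show "(\<Prod>i=1..n. F i (h p i)) = (\<Prod>i=0..<n. Matrix.mat n n (\<lambda>(r, s). F (Suc r) (Suc s)) $$ (i, p i))" .
  qed
  also have "\<dots> = Determinant.det (Matrix.mat n n (\<lambda>(r, s). F (Suc r) (Suc s)))"
    by (subst det_def') auto
  finally show ?thesis .
qed

lemma leibniz_equal_columns:
  assumes "1 \<le> i" "i < j" "j \<le> n" "\<And>k. F k i = F k j"
  shows "leibniz n F = 0"
  unfolding leibniz_eq_det
  by (rule det_identical_columns[where i="i-1" and j="j-1" and n=n])
     (use assms in \<open>auto intro!: eq_vecI\<close>)

lemma leibniz_abs_le:
  assumes "\<And>i j. i \<in> {1..n} \<Longrightarrow> j \<in> {1..n} \<Longrightarrow> \<bar>F i j\<bar> \<le> B"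
  shows "\<bar>leibniz n F\<bar> \<le> fact n * B ^ n"
proof -
  have "\<bar>leibniz n F\<bar> \<le> (\<Sum>p | p permutes {1..n}. \<bar>of_int (sign p) * (\<Prod>i=1..n. F i (p i))\<bar>)"
    unfolding leibniz_def by (rule sum_abs)
  also have "\<dots> \<le> (\<Sum>p | p permutes {1..n}. B ^ n)"
  proof (rule sum_mono)
    fix p assume "p \<in> {p. p permutes {1..n}}"
    then have p: "p permutes {1..n}" by simp
    have "\<bar>of_int (sign p) * (\<Prod>i=1..n. F i (p i))\<bar> = (\<Prod>i=1..n. \<bar>F i (p i)\<bar>)"
      by (simp add: abs_mult abs_prod sign_def)
    also have "\<dots> \<le> (\<Prod>i=1..n. B)"
      using permutes_in_image[OF p] by (intro prod_mono) (auto intro!: assms)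
    finally show "\<bar>of_int (sign p) * (\<Prod>i=1..n. F i (p i))\<bar> \<le> B ^ n" by simp
  qed
  also have "\<dots> = fact n * B ^ n" by (simp add: card_permutations[of "{1..n}" n])
  finally show ?thesis .
qed

section \<open>Reflection in the walls of the Weyl chamber\<close>

lemma strictly_increasing_permutation_id:
  fixes p :: "nat \<Rightarrow> nat"
  assumes p: "p permutes {1..n}" and inc: "\<And>i j. 1 \<le> i \<Longrightarrow> i < j \<Longrightarrow> j \<le> n \<Longrightarrow> p i < p j"
  shows "p = id"
proof -
  have pI: "p i \<in> {1..n}" if "i \<in> {1..n}" for i using permutes_in_image[OF p] that by simp
  have up: "i \<in> {1..n} \<longrightarrow> i \<le> p i" for i
  proof (induction i)
    case (Suc i)
    show ?case
    proof (cases "i = 0")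
      case True then show ?thesis using pI[of 1] by (auto simp: One_nat_def)
    next
      case False
      then show ?thesis using Suc inc[of i "Suc i"] by auto
    qed
  qed simp
  have "p i = i" if i: "i \<in> {1..n}" for i
  proof (rule ccontr)
    assume "p i \<noteq> i"
    then have "(\<Sum>j=1..n. j) < (\<Sum>j=1..n. p j)"
      using up i by (intro sum_strict_mono_ex1) (auto intro!: bexI[of _ i] simp: le_neq_implies_less)
    also have "(\<Sum>j=1..n. p j) = (\<Sum>j=1..n. j)"
      using sum.permute[OF p, of "\<lambda>x. x"] by (simp add: o_def)
    finally show False by simp
  qed
  moreover have "p i = i" if "i \<notin> {1..n}" for i using p that by (simp add: permutes_def)
  ultimately show ?thesis by (auto simp: fun_eq_iff)
qed

lemma weyl_chamber_permute_iff:
  assumes z: "z \<in> weyl_chamber n" and p: "p permutes {1..n}"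
  shows "(\<lambda>i. z (p i)) \<in> weyl_chamber n \<longleftrightarrow> p = id"
proof
  assume zp: "(\<lambda>i. z (p i)) \<in> weyl_chamber n"
  have pI: "p i \<in> {1..n}" if "i \<in> {1..n}" for i using permutes_in_image[OF p] that by simp
  show "p = id"
  proof (rule strictly_increasing_permutation_id[OF p])
    fix i j assume ij: "1 \<le> i" "i < j" "j \<le> n"
    then have lt: "z (p i) < z (p j)" using zp by (simp add: weyl_chamber_def)
    show "p i < p j"
    proof (rule ccontr)
      assume "\<not> p i < p j"
      then consider "p j = p i" | "p j < p i" by linarith
      then show False
      proof cases
        case 2
        then have "z (p j) < z (p i)" using z pI[of i] pI[of j] ij unfolding weyl_chamber_def by auto
        then show False using lt by simp
      qed (use lt in simp)
    qed
  qed
qed (use z in \<open>simp add: id_def\<close>)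

lemma weyl_chamber_cong:
  assumes "\<And>i. i \<in> {1..n} \<Longrightarrow> y i = z i"
  shows "y \<in> weyl_chamber n \<longleftrightarrow> z \<in> weyl_chamber n"
proof -
  have "y i < y j \<longleftrightarrow> z i < z j" if "1 \<le> i" "i < j" "j \<le> n" for i j
    using assms[of i] assms[of j] that by simp
  then show ?thesis unfolding weyl_chamber_def by blast
qed

lemma pred_weyl_chamber:
  assumes "\<And>i. i \<in> {1..n} \<Longrightarrow> f i \<in> borel_measurable N"
  shows "Measurable.pred N (\<lambda>z. (\<lambda>i. f i z) \<in> weyl_chamber n)"
proof -
  have "(\<lambda>i. f i z) \<in> weyl_chamber n \<longleftrightarrow> (\<forall>i\<in>{1..n}. \<forall>j\<in>{i<..n}. f i z < f j z)" for z
    by (auto simp: weyl_chamber_def)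
  moreover have "Measurable.pred N (\<lambda>z. \<forall>i\<in>{1..n}. \<forall>j\<in>{i<..n}. f i z < f j z)"
    by (intro pred_intros_finite borel_measurable_pred_less) (use assms in auto)
  ultimately show ?thesis by simp
qed

definition centred_cube :: "nat \<Rightarrow> real \<Rightarrow> (nat \<Rightarrow> real) set" where
  "centred_cube n R = {z. \<forall>i\<in>{1..n}. \<bar>z i\<bar> \<le> R}"

lemma centred_cube_permute: "p permutes {1..n} \<Longrightarrow> (\<lambda>i. z (p i)) \<in> centred_cube n R \<longleftrightarrow> z \<in> centred_cube n R"
proof -
  assume p: "p permutes {1..n}"
  have "(\<forall>i\<in>p ` {1..n}. \<bar>z i\<bar> \<le> R) \<longleftrightarrow> (\<forall>i\<in>{1..n}. \<bar>z (p i)\<bar> \<le> R)" by blast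
  then show ?thesis unfolding centred_cube_def permutes_image[OF p] by simp
qed

text \<open>The terminal weight of the reflection argument. Without drift it would be the sum of sign p over
the p that map z to the chamber, which is antisymmetric in z. With drift, the exponentials compensate for the
different drift factors of a point and of its images. They are unbounded, hence the truncation to a
cube.\<close>

definition reflected_weight :: "nat \<Rightarrow> (nat \<Rightarrow> real) \<Rightarrow> real \<Rightarrow> (nat \<Rightarrow> real) \<Rightarrow> real" where
  "reflected_weight n a R z = (\<Sum>p | p permutes {1..n}. of_int (sign p) *
     (if (\<lambda>i. z (p i)) \<in> weyl_chamber n \<and> z \<in> centred_cube n R
      then exp (\<Sum>i=1..n. a i * z (p i)) * exp (- (\<Sum>i=1..n. a i * z i)) else 0))"

lemma reflected_weight_cong:
  assumes "\<And>i. i \<in> {1..n} \<Longrightarrow> y i = z i"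
  shows "reflected_weight n a R y = reflected_weight n a R z"
proof -
  have [simp]: "y \<in> centred_cube n R \<longleftrightarrow> z \<in> centred_cube n R" using assms by (auto simp: centred_cube_def)
  have pI: "p i \<in> {1..n}" if "p permutes {1..n}" "i \<in> {1..n}" for p i
    using permutes_in_image[OF that(1)] that(2) by simp
  show ?thesis unfolding reflected_weight_def
  proof (rule sum.cong[OF refl])
    fix p assume "p \<in> {p. p permutes {1..n}}"
    then have p: "p permutes {1..n}" by simp
    have 1: "(\<lambda>i. y (p i)) \<in> weyl_chamber n \<longleftrightarrow> (\<lambda>i. z (p i)) \<in> weyl_chamber n"
      by (rule weyl_chamber_cong) (use pI[OF p] assms in auto)
    have 2: "(\<Sum>i=1..n. a i * y (p i)) = (\<Sum>i=1..n. a i * z (p i))"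
      "(\<Sum>i=1..n. a i * y i) = (\<Sum>i=1..n. a i * z i)"
      by (rule sum.cong; use pI[OF p] assms in force)+
    show "of_int (sign p) *
       (if (\<lambda>i. y (p i)) \<in> weyl_chamber n \<and> y \<in> centred_cube n R
        then exp (\<Sum>i=1..n. a i * y (p i)) * exp (- (\<Sum>i=1..n. a i * y i)) else 0)
      = of_int (sign p) *
       (if (\<lambda>i. z (p i)) \<in> weyl_chamber n \<and> z \<in> centred_cube n R
        then exp (\<Sum>i=1..n. a i * z (p i)) * exp (- (\<Sum>i=1..n. a i * z i)) else 0)"
      by (simp only: 1 2 \<open>y \<in> centred_cube n R \<longleftrightarrow> z \<in> centred_cube n R\<close>)
  qed
qed

lemma pred_centred_cube: "Measurable.pred (lebesgue_pi {1..n}) (\<lambda>z. z \<in> centred_cube n R)"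
proof -
  have "Measurable.pred (lebesgue_pi {1..n}) (\<lambda>z. \<forall>i\<in>{1..n}. \<bar>z i\<bar> \<le> R)"
    by (intro pred_intros_finite) auto
  then show ?thesis by (simp add: centred_cube_def)
qed

lemma borel_measurable_reflected_weight [measurable]:
  "reflected_weight n a R \<in> borel_measurable (lebesgue_pi {1..n})"
  unfolding reflected_weight_def
proof (intro borel_measurable_sum borel_measurable_times borel_measurable_const)
  fix p assume "p \<in> {p. p permutes {1..n}}"
  then have p: "p permutes {1..n}" by simp
  have c: "(\<lambda>z. z (p i)) \<in> borel_measurable (lebesgue_pi {1..n})" if "i \<in> {1..n}" for i
    using permutes_in_image[OF p] that by simp
  have [measurable]: "Measurable.pred (lebesgue_pi {1..n}) (\<lambda>z. (\<lambda>i. z (p i)) \<in> weyl_chamber n)"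
    by (rule pred_weyl_chamber[OF c])
  note pred_centred_cube[measurable]
  have [measurable]: "(\<lambda>z. exp (\<Sum>i=1..n. a i * z (p i))) \<in> borel_measurable (lebesgue_pi {1..n})"
    by (rule measurable_compose[OF _ borel_measurable_exp]) (intro borel_measurable_sum borel_measurable_times borel_measurable_const c)
  have [measurable]: "(\<lambda>z. exp (- (\<Sum>i=1..n. a i * z i))) \<in> borel_measurable (lebesgue_pi {1..n})"
    by (rule measurable_compose[OF _ borel_measurable_exp]) (intro borel_measurable_uminus borel_measurable_sum borel_measurable_times borel_measurable_const, simp)
  show "(\<lambda>z. if (\<lambda>i. z (p i)) \<in> weyl_chamber n \<and> z \<in> centred_cube n R
      then exp (\<Sum>i=1..n. a i * z (p i)) * exp (- (\<Sum>i=1..n. a i * z i)) else 0) \<in> borel_measurable (lebesgue_pi {1..n})"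
    by measurable
qed

text \<open>In the chamber only the identity contributes.\<close>

lemma reflected_weight_chamber:
  assumes "z \<in> weyl_chamber n"
  shows "reflected_weight n a R z = (if z \<in> centred_cube n R then 1 else 0)"
proof -
  have "reflected_weight n a R z = (\<Sum>p | p permutes {1..n}. if p = id then (if z \<in> centred_cube n R then 1 else 0) else 0)"
    unfolding reflected_weight_def
    by (rule sum.cong) (use weyl_chamber_permute_iff[OF assms] in \<open>auto simp: exp_minus\<close>)
  also have "\<dots> = (if z \<in> centred_cube n R then 1 else 0)"
    by (simp add: finite_permutations)
  finally show ?thesis .
qed

lemma reflected_weight_outside_cube: "z \<notin> centred_cube n R \<Longrightarrow> reflected_weight n a R z = 0"
  by (simp add: reflected_weight_def)

lemma reflected_weight_bounded:
  "\<exists>B\<ge>0. \<forall>z. \<bar>reflected_weight n a R z\<bar> \<le> B"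
proof (intro exI conjI allI)
  let ?B = "exp (2 * (\<Sum>i=1..n. \<bar>a i\<bar> * R))"
  show "0 \<le> fact n * ?B" by simp
  fix z
  have "\<bar>reflected_weight n a R z\<bar> \<le> (\<Sum>p | p permutes {1..n}. ?B)"
    unfolding reflected_weight_def
  proof (rule order_trans[OF sum_abs], rule sum_mono)
    fix p assume "p \<in> {p. p permutes {1..n}}"
    then have p: "p permutes {1..n}" by simp
    show "\<bar>of_int (sign p) *
       (if (\<lambda>i. z (p i)) \<in> weyl_chamber n \<and> z \<in> centred_cube n R
        then exp (\<Sum>i=1..n. a i * z (p i)) * exp (- (\<Sum>i=1..n. a i * z i)) else 0)\<bar> \<le> ?B"
    proof (cases "z \<in> centred_cube n R")
      case True
      have l: "(\<Sum>i=1..n. a i * y i) \<le> (\<Sum>i=1..n. \<bar>a i\<bar> * R)" "- (\<Sum>i=1..n. a i * y i) \<le> (\<Sum>i=1..n. \<bar>a i\<bar> * R)"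
        if "y \<in> centred_cube n R" for y
      proof -
        have "\<bar>\<Sum>i=1..n. a i * y i\<bar> \<le> (\<Sum>i=1..n. \<bar>a i\<bar> * R)"
          using that by (intro order_trans[OF sum_abs] sum_mono) (auto simp: abs_mult centred_cube_def intro!: mult_left_mono)
        then show "(\<Sum>i=1..n. a i * y i) \<le> (\<Sum>i=1..n. \<bar>a i\<bar> * R)" "- (\<Sum>i=1..n. a i * y i) \<le> (\<Sum>i=1..n. \<bar>a i\<bar> * R)"
          by linarith+
      qed
      have "exp (\<Sum>i=1..n. a i * z (p i)) * exp (- (\<Sum>i=1..n. a i * z i)) \<le> ?B"
        unfolding exp_add[symmetric] using l(2)[OF True] l(1)[of "\<lambda>i. z (p i)"] True
        by (simp add: centred_cube_permute[OF p])
      then show ?thesis by (auto simp: abs_mult sign_def)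
    qed simp
  qed
  also have "\<dots> = fact n * ?B" by (simp add: card_permutations[of "{1..n}" n])
  finally show "\<bar>reflected_weight n a R z\<bar> \<le> fact n * ?B" .
qed

definition gauss :: "real \<Rightarrow> real \<Rightarrow> real" where
  "gauss s y = normal_density 0 (sqrt s) y"

lemma gauss_eq: "s > 0 \<Longrightarrow> gauss s y = exp (- y\<^sup>2 / (2 * s)) / sqrt (2 * pi * s)"
  by (simp add: gauss_def normal_density_def)

lemma gauss_nonneg: "gauss s y \<ge> 0" by (simp add: gauss_def)

text \<open>The drift enters through Girsanov's factor, which depends on the endpoints only.\<close>

lemma drift_kernel_gauss:
  assumes "s > 0"
  shows "drift_kernel n a s y z = exp ((\<Sum>i=1..n. a i * z i) - (\<Sum>i=1..n. a i * y i) - s / 2 * (\<Sum>i=1..n. (a i)\<^sup>2))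
    * (\<Prod>i=1..n. gauss s (z i - y i))"
proof -
  have "normal_density (y i + a i * s) (sqrt s) (z i) = exp (a i * z i - a i * y i - s / 2 * (a i)\<^sup>2) * gauss s (z i - y i)" for i
  proof -
    have "- (z i - (y i + a i * s))\<^sup>2 / (2 * s) = (a i * z i - a i * y i - s / 2 * (a i)\<^sup>2) + (- (z i - y i)\<^sup>2 / (2 * s))"
      using assms by (simp add: field_simps power2_eq_square)
    then show ?thesis using assms by (simp add: gauss_eq normal_density_def exp_add[symmetric])
  qed
  then show ?thesis
    by (simp add: drift_kernel_def prod.distrib exp_sum[symmetric] sum_subtractf sum_distrib_left)
qed

lemma integrable_drift_kernel:
  assumes "s > 0"
  shows "integrable (lebesgue_pi {1..n}) (drift_kernel n a s y)"
  unfolding drift_kernel_def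
  using assms by (intro product_sigma_finite.product_integrable_prod[OF product_sigma_finite_lborel]) auto

lemma integrable_gauss_prod:
  assumes "s > 0"
  shows "integrable (lebesgue_pi {1..n}) (\<lambda>z. \<Prod>i=1..n. gauss s (z i - y i))"
  using integrable_drift_kernel[OF assms, of n "\<lambda>_. 0" y] by (simp add: drift_kernel_gauss[OF assms, abs_def])

text \<open>The density formula of Karlin and McGregor for the process before its first collision, with
Girsanov's factor for the drift.\<close>

definition km_density :: "nat \<Rightarrow> (nat \<Rightarrow> real) \<Rightarrow> real \<Rightarrow> (nat \<Rightarrow> real) \<Rightarrow> (nat \<Rightarrow> real) \<Rightarrow> real" where
  "km_density n a s y z = exp ((\<Sum>i=1..n. a i * z i) - (\<Sum>i=1..n. a i * y i) - s / 2 * (\<Sum>i=1..n. (a i)\<^sup>2)) *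
      leibniz n (\<lambda>i j. gauss s (z i - y j))"

text \<open>Permuting the coordinates of z in the p-th summand moves it to the chamber. The exponential weight
turns the drift factor of the permuted point into that of the original one, and the permutation reappears in
the starting point: this is the Leibniz sum of the determinant.\<close>

lemma integral_reflected_weight:
  assumes s: "s > 0"
  shows "(\<integral>z. reflected_weight n a R z * drift_kernel n a s y z \<partial>lebesgue_pi {1..n})
    = (\<integral>z. indicator (weyl_chamber n \<inter> centred_cube n R) z * km_density n a s y z \<partial>lebesgue_pi {1..n})"
proof -
  let ?P = "lebesgue_pi {1..n}"
  define c where "c = exp (- (\<Sum>i=1..n. a i * y i) - s / 2 * (\<Sum>i=1..n. (a i)\<^sup>2))"
  define G where "G p w = indicator (weyl_chamber n \<inter> centred_cube n R) w * exp (\<Sum>i=1..n. a i * w i) * (\<Prod>i=1..n. gauss s (w i - y (p i)))"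
    for p w
  have W[measurable]: "Measurable.pred ?P (\<lambda>z. z \<in> weyl_chamber n)"
    by (rule pred_weyl_chamber) simp
  note pred_centred_cube[measurable]
  have gm[measurable]: "gauss s \<in> borel_measurable borel" by (simp add: gauss_def[abs_def])
  have cm: "(\<lambda>z. z i) \<in> borel_measurable ?P" if "i \<in> {1..n}" for i using that by simp
  have [measurable]: "(\<lambda>w. indicator (weyl_chamber n \<inter> centred_cube n R) w :: real) \<in> borel_measurable ?P"
    by (simp add: indicator_def)
  have Gm[measurable]: "G p \<in> borel_measurable ?P" for p
    unfolding G_def
    by (intro borel_measurable_times borel_measurable_exp borel_measurable_sum borel_measurable_prod borel_measurable_const
         measurable_compose[OF _ gm] borel_measurable_diff cm) auto
  have Gint: "integrable ?P (G p)" for p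
  proof (rule Bochner_Integration.integrable_bound)
    show "integrable ?P (\<lambda>z. exp (\<Sum>i=1..n. \<bar>a i\<bar> * R) * (\<Prod>i=1..n. gauss s (z i - y (p i))))"
      by (intro integrable_mult_right integrable_gauss_prod[OF s])
    show "AE z in ?P. norm (G p z) \<le> norm (exp (\<Sum>i=1..n. \<bar>a i\<bar> * R) * (\<Prod>i=1..n. gauss s (z i - y (p i))))"
    proof (rule AE_I2)
      fix z
      have "(\<Sum>i=1..n. a i * z i) \<le> (\<Sum>i=1..n. \<bar>a i\<bar> * R)" if "z \<in> centred_cube n R"
      proof (rule sum_mono)
        fix i assume i: "i \<in> {1..n}"
        have "a i * z i \<le> \<bar>a i\<bar> * \<bar>z i\<bar>" by (metis abs_ge_self abs_mult)
        also have "\<dots> \<le> \<bar>a i\<bar> * R" using that i by (intro mult_left_mono) (auto simp: centred_cube_def)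
        finally show "a i * z i \<le> \<bar>a i\<bar> * R" .
      qed
      moreover have "(\<Prod>i=1..n. gauss s (z i - y (p i))) \<ge> 0" by (intro prod_nonneg ballI gauss_nonneg)
      ultimately show "norm (G p z) \<le> norm (exp (\<Sum>i=1..n. \<bar>a i\<bar> * R) * (\<Prod>i=1..n. gauss s (z i - y (p i))))"
        by (auto simp: G_def abs_mult indicator_def intro!: mult_right_mono)
    qed
  qed measurable
  have perm: "(\<integral>z. G p (\<lambda>i\<in>{1..n}. z (p i)) \<partial>?P) = (\<integral>z. G p z \<partial>?P)"
    and permint: "integrable ?P (\<lambda>z. G p (\<lambda>i\<in>{1..n}. z (p i)))" if p: "p permutes {1..n}" for p
  proof -
    have m: "(\<lambda>z. \<lambda>i\<in>{1..n}. z (p i)) \<in> measurable ?P ?P"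
      by (rule measurable_restrict) (use permutes_in_image[OF p] in simp)
    have "(\<integral>z. G p z \<partial>?P) = (\<integral>z. G p z \<partial>distr ?P ?P (\<lambda>z. \<lambda>i\<in>{1..n}. z (p i)))"
      by (simp add: distr_permute_lebesgue_pi[OF _ p])
    also have "\<dots> = (\<integral>z. G p (\<lambda>i\<in>{1..n}. z (p i)) \<partial>?P)"
      by (rule integral_distr[OF m]) measurable
    finally show "(\<integral>z. G p (\<lambda>i\<in>{1..n}. z (p i)) \<partial>?P) = (\<integral>z. G p z \<partial>?P)" by simp
    have "integrable (distr ?P ?P (\<lambda>z. \<lambda>i\<in>{1..n}. z (p i))) (G p)"
      using Gint by (simp add: distr_permute_lebesgue_pi[OF _ p])
    then show "integrable ?P (\<lambda>z. G p (\<lambda>i\<in>{1..n}. z (p i)))"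
      by (subst (asm) integrable_distr_eq[OF m]) auto
  qed
  have eq: "reflected_weight n a R z * drift_kernel n a s y z
     = (\<Sum>p | p permutes {1..n}. of_int (sign p) * (c * G p (\<lambda>i\<in>{1..n}. z (p i))))" for z
    unfolding reflected_weight_def sum_distrib_right
  proof (rule sum.cong[OF refl])
    fix p assume "p \<in> {p. p permutes {1..n}}"
    then have p: "p permutes {1..n}" by simp
    let ?z = "\<lambda>i\<in>{1..n}. z (p i)"
    have 1: "?z \<in> weyl_chamber n \<longleftrightarrow> (\<lambda>i. z (p i)) \<in> weyl_chamber n" by (rule weyl_chamber_cong) simp
    have "?z \<in> centred_cube n R \<longleftrightarrow> (\<lambda>i. z (p i)) \<in> centred_cube n R" by (auto simp: centred_cube_def)
    then have 2: "?z \<in> centred_cube n R \<longleftrightarrow> z \<in> centred_cube n R" by (simp add: centred_cube_permute[OF p])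
    have 3: "(\<Prod>i=1..n. gauss s (z i - y i)) = (\<Prod>i=1..n. gauss s (?z i - y (p i)))"
      using prod.permute[OF p, of "\<lambda>i. gauss s (z i - y i)"] by (simp add: o_def)
    have 4: "(\<Sum>i=1..n. a i * ?z i) = (\<Sum>i=1..n. a i * z (p i))" by simp
    have "exp (- (\<Sum>i=1..n. a i * z i)) * drift_kernel n a s y z = c * (\<Prod>i=1..n. gauss s (?z i - y (p i)))"
      unfolding drift_kernel_gauss[OF s] c_def 3 mult.assoc[symmetric] exp_add[symmetric] by simp
    then show "of_int (sign p) *
         (if (\<lambda>i. z (p i)) \<in> weyl_chamber n \<and> z \<in> centred_cube n R
          then exp (\<Sum>i=1..n. a i * z (p i)) * exp (- (\<Sum>i=1..n. a i * z i)) else 0) * drift_kernel n a s y z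
       = of_int (sign p) * (c * G p ?z)"
      unfolding G_def 4 using 1 2 by (auto simp: indicator_def mult_ac)
  qed
  have "(\<integral>z. reflected_weight n a R z * drift_kernel n a s y z \<partial>?P)
     = (\<Sum>p | p permutes {1..n}. (\<integral>z. of_int (sign p) * (c * G p (\<lambda>i\<in>{1..n}. z (p i))) \<partial>?P))"
    unfolding eq by (rule Bochner_Integration.integral_sum) (auto intro!: permint)
  also have "\<dots> = (\<Sum>p | p permutes {1..n}. (\<integral>z. of_int (sign p) * (c * G p z) \<partial>?P))"
    by (intro sum.cong refl) (simp add: perm)
  also have "\<dots> = (\<integral>z. (\<Sum>p | p permutes {1..n}. of_int (sign p) * (c * G p z)) \<partial>?P)"
    by (rule Bochner_Integration.integral_sum[symmetric]) (auto intro!: Gint)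
  also have "(\<lambda>z. (\<Sum>p | p permutes {1..n}. of_int (sign p) * (c * G p z)))
     = (\<lambda>z. indicator (weyl_chamber n \<inter> centred_cube n R) z * km_density n a s y z)"
  proof
    fix z
    have e: "exp ((\<Sum>i=1..n. a i * z i) - (\<Sum>i=1..n. a i * y i) - s / 2 * (\<Sum>i=1..n. (a i)\<^sup>2)) = c * exp (\<Sum>i=1..n. a i * z i)"
      by (simp add: c_def exp_add[symmetric])
    show "(\<Sum>p | p permutes {1..n}. of_int (sign p) * (c * G p z)) = indicator (weyl_chamber n \<inter> centred_cube n R) z * km_density n a s y z"
      unfolding km_density_def e leibniz_def G_def by (simp add: sum_distrib_left mult_ac)
  qed
  finally show ?thesis .
qed

definition reflected_mean :: "nat \<Rightarrow> (nat \<Rightarrow> real) \<Rightarrow> real \<Rightarrow> real \<Rightarrow> (nat \<Rightarrow> real) \<Rightarrow> real" where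
  "reflected_mean n a R s y = (\<integral>z. reflected_weight n a R z * drift_kernel n a s y z \<partial>lebesgue_pi {1..n})"

text \<open>On a wall of the chamber the determinant has two equal columns.\<close>

lemma reflected_mean_boundary:
  assumes "s > 0" "1 \<le> i" "i < j" "j \<le> n" "y i = y j"
  shows "reflected_mean n a R s y = 0"
proof -
  have "km_density n a s y z = 0" for z
    unfolding km_density_def using leibniz_equal_columns[OF assms(2-4), of "\<lambda>i j. gauss s (z i - y j)"] assms(5) by simp
  then show ?thesis by (simp add: reflected_mean_def integral_reflected_weight[OF assms(1)])
qed

lemma integral_drift_kernel:
  assumes "s > 0"
  shows "(\<integral>z. drift_kernel n a s y z \<partial>lebesgue_pi {1..n}) = 1"
  unfolding drift_kernel_def using assms
  by (subst product_sigma_finite.product_integral_prod[OF product_sigma_finite_lborel]) auto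

lemma reflected_mean_bounded:
  assumes s: "s > 0" and B: "\<And>z. \<bar>reflected_weight n a R z\<bar> \<le> B"
  shows "\<bar>reflected_mean n a R s y\<bar> \<le> B"
proof -
  let ?P = "lebesgue_pi {1..n}"
  note int = integrable_drift_kernel[OF s, of n a y]
  have b: "norm (reflected_weight n a R z * drift_kernel n a s y z) \<le> B * drift_kernel n a s y z" for z
    using B[of z] by (auto simp: abs_mult drift_kernel_nonneg intro!: mult_right_mono)
  have "integrable ?P (\<lambda>z. reflected_weight n a R z * drift_kernel n a s y z)"
  proof (rule Bochner_Integration.integrable_bound[OF integrable_mult_right[OF int, of B]])
    show "AE z in ?P. norm (reflected_weight n a R z * drift_kernel n a s y z) \<le> norm (B * drift_kernel n a s y z)"
      unfolding real_norm_def by (rule AE_I2) (rule order_trans[OF b[unfolded real_norm_def] abs_ge_self])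
  qed measurable
  then have "norm (\<integral>z. reflected_weight n a R z * drift_kernel n a s y z \<partial>?P) \<le> (\<integral>z. B * drift_kernel n a s y z \<partial>?P)"
    by (intro order_trans[OF integral_norm_bound] integral_mono integrable_norm integrable_mult_right int b)
  then show ?thesis using integral_drift_kernel[OF s] by (simp add: reflected_mean_def)
qed

text \<open>Dominated convergence: on the cube, and for times above s0 / 2, the kernels are bounded by a
constant.\<close>

lemma reflected_mean_continuous:
  assumes s: "s \<longlonglongrightarrow> s0" "s0 > 0" and y: "\<And>i. i \<in> {1..n} \<Longrightarrow> (\<lambda>N. y N i) \<longlonglongrightarrow> y0 i"
  shows "(\<lambda>N::nat. reflected_mean n a R (s N) (y N)) \<longlonglongrightarrow> reflected_mean n a R s0 y0"
proof -
  let ?P = "lebesgue_pi {1..n}"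
  obtain B where B: "B \<ge> 0" "\<And>z. \<bar>reflected_weight n a R z\<bar> \<le> B"
    using reflected_weight_bounded[of n a R] by blast
  have "eventually (\<lambda>N. s N > s0 / 2) sequentially"
    using order_tendstoD(1)[OF s(1), of "s0/2"] s(2) by simp
  then obtain N0 where N0: "\<And>N. N \<ge> N0 \<Longrightarrow> s N > s0 / 2"
    by (auto simp: eventually_sequentially)
  have sp: "s N > 0" if "N \<ge> N0" for N using N0[OF that] s(2) by simp
  define C where "C = 1 / sqrt (2 * pi * (s0 / 2))"
  note pred_centred_cube[measurable]
  have "(\<lambda>N. reflected_mean n a R (s (N + N0)) (y (N + N0))) \<longlonglongrightarrow> reflected_mean n a R s0 y0"
    unfolding reflected_mean_def
  proof (rule integral_dominated_convergence[where w="\<lambda>z. B * C ^ n * indicator (centred_cube n R \<inter> space ?P) z"])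
    show "(\<lambda>z. reflected_weight n a R z * drift_kernel n a s0 y0 z) \<in> borel_measurable ?P"
      "\<And>N. (\<lambda>z. reflected_weight n a R z * drift_kernel n a (s (N + N0)) (y (N + N0)) z) \<in> borel_measurable ?P"
      by measurable
    have bx: "centred_cube n R \<inter> space ?P = Pi\<^sub>E {1..n} (\<lambda>_. {-R..R})"
      by (auto simp: centred_cube_def space_PiM PiE_iff abs_le_iff minus_le_iff)
    have "emeasure ?P (Pi\<^sub>E {1..n} (\<lambda>_. {-R..R})) = (\<Prod>i=1..n. emeasure lborel {-R..R})"
      by (intro product_sigma_finite.emeasure_PiM[OF product_sigma_finite_lborel]) auto
    also have "\<dots> < \<infinity>" by (cases "-R \<le> R") (auto simp: ennreal_power less_top[symmetric] power_0_left)
    finally have "emeasure ?P (centred_cube n R \<inter> space ?P) < \<infinity>" unfolding bx .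
    moreover have "centred_cube n R \<inter> space ?P \<in> sets ?P" unfolding bx by (intro sets_PiM_I_finite) auto
    ultimately show "integrable ?P (\<lambda>z. B * C ^ n * indicator (centred_cube n R \<inter> space ?P) z)"
      by (intro integrable_mult_right integrable_real_indicator)
    show "AE z in ?P. (\<lambda>N. reflected_weight n a R z * drift_kernel n a (s (N + N0)) (y (N + N0)) z)
        \<longlonglongrightarrow> reflected_weight n a R z * drift_kernel n a s0 y0 z"
    proof (rule AE_I2, rule tendsto_mult[OF tendsto_const])
      fix z
      show "(\<lambda>N. drift_kernel n a (s (N + N0)) (y (N + N0)) z) \<longlonglongrightarrow> drift_kernel n a s0 y0 z"
        unfolding drift_kernel_def
      proof (rule tendsto_prod)
        fix i assume i: "i \<in> {1..n}"
        note s' = LIMSEQ_ignore_initial_segment[OF s(1), of N0] and y' = LIMSEQ_ignore_initial_segment[OF y[OF i], of N0]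
        show "(\<lambda>N. normal_density (y (N + N0) i + a i * s (N + N0)) (sqrt (s (N + N0))) (z i))
            \<longlonglongrightarrow> normal_density (y0 i + a i * s0) (sqrt s0) (z i)"
          unfolding normal_density_def using s(2) by (intro tendsto_intros s' y') auto
      qed
    qed
    fix N
    show "AE z in ?P. norm (reflected_weight n a R z * drift_kernel n a (s (N + N0)) (y (N + N0)) z)
       \<le> B * C ^ n * indicator (centred_cube n R \<inter> space ?P) z"
    proof (rule AE_I2)
      fix z assume z: "z \<in> space ?P"
      show "norm (reflected_weight n a R z * drift_kernel n a (s (N + N0)) (y (N + N0)) z)
       \<le> B * C ^ n * indicator (centred_cube n R \<inter> space ?P) z"
      proof (cases "z \<in> centred_cube n R")
        case True
        have "drift_kernel n a (s (N + N0)) (y (N + N0)) z \<le> (\<Prod>i=1..n. C)"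
          unfolding drift_kernel_def
        proof (intro prod_mono conjI)
          fix i
          have "normal_density (y (N + N0) i + a i * s (N + N0)) (sqrt (s (N + N0))) (z i) \<le> 1 / sqrt (2 * pi * s (N + N0)) * 1"
            unfolding normal_density_def using sp[of "N + N0"] by (intro mult_mono) auto
          also have "\<dots> \<le> C" unfolding C_def using N0[of "N + N0"] s(2) by (auto intro!: divide_left_mono mult_pos_pos)
          finally show "normal_density (y (N + N0) i + a i * s (N + N0)) (sqrt (s (N + N0))) (z i) \<le> C" .
        qed simp
        then show ?thesis using B True z drift_kernel_nonneg[of n a "s (N+N0)" "y (N+N0)" z]
          by (auto simp: abs_mult intro!: mult_mono)
      qed (simp add: reflected_weight_outside_cube)
    qed
  qed
  then show ?thesis by (rule LIMSEQ_offset)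
qed

section \<open>First exits on dyadic grids\<close>

text \<open>The expected weight when the time s remains. For s = 0 the kernel degenerates to a point
mass.\<close>

definition reflected_value :: "nat \<Rightarrow> (nat \<Rightarrow> real) \<Rightarrow> real \<Rightarrow> real \<Rightarrow> (nat \<Rightarrow> real) \<Rightarrow> real" where
  "reflected_value n a R s y = (if s > 0 then reflected_mean n a R s y else reflected_weight n a R y)"

definition dyadic :: "real \<Rightarrow> nat \<Rightarrow> nat \<Rightarrow> real" where
  "dyadic T N k = T * real k / 2 ^ N"

lemma dyadic_simps [simp]: "dyadic T N 0 = 0" "dyadic T N (2 ^ N) = T"
  by (simp_all add: dyadic_def)

definition first_exit :: "nat \<Rightarrow> real \<Rightarrow> (real \<Rightarrow> nat \<Rightarrow> real) \<Rightarrow> nat \<Rightarrow> nat \<Rightarrow> bool" where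
  "first_exit n T w N k \<longleftrightarrow> (\<forall>l<k. w (dyadic T N l) \<in> weyl_chamber n) \<and> w (dyadic T N k) \<notin> weyl_chamber n"

lemma first_exit_unique: "first_exit n T w N k \<Longrightarrow> first_exit n T w N l \<Longrightarrow> k = l"
  unfolding first_exit_def by (metis linorder_neqE_nat)

text \<open>The conditional expectation of the terminal weight given the path up to its first exit on the grid
of level N, and 0 if there is no such exit.\<close>

definition exit_value :: "nat \<Rightarrow> (nat \<Rightarrow> real) \<Rightarrow> real \<Rightarrow> real \<Rightarrow> (real \<Rightarrow> nat \<Rightarrow> real) \<Rightarrow> nat \<Rightarrow> real" where
  "exit_value n a R T w N = (\<Sum>k\<le>2 ^ N. of_bool (first_exit n T w N k) *
      reflected_value n a R (T - dyadic T N k) (w (dyadic T N k)))"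

lemma exit_value_first_exit:
  assumes "k \<le> 2 ^ N" "first_exit n T w N k"
  shows "exit_value n a R T w N = reflected_value n a R (T - dyadic T N k) (w (dyadic T N k))"
proof -
  have "exit_value n a R T w N = (\<Sum>l\<le>2 ^ N. if l = k then reflected_value n a R (T - dyadic T N k) (w (dyadic T N k)) else 0)"
    unfolding exit_value_def
  proof (rule sum.cong[OF refl])
    fix l
    show "of_bool (first_exit n T w N l) * reflected_value n a R (T - dyadic T N l) (w (dyadic T N l))
        = (if l = k then reflected_value n a R (T - dyadic T N k) (w (dyadic T N k)) else 0)"
    proof (cases "l = k")
      case False
      then have "\<not> first_exit n T w N l" using first_exit_unique[OF _ assms(2)] by blast
      then show ?thesis using False by simp
    qed (simp add: assms(2))
  qed
  then show ?thesis using assms(1) by simp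
qed

lemma exit_value_no_exit:
  assumes "\<And>k. k \<le> 2 ^ N \<Longrightarrow> w (dyadic T N k) \<in> weyl_chamber n"
  shows "exit_value n a R T w N = 0"
  unfolding exit_value_def by (rule sum.neutral) (use assms in \<open>auto simp: first_exit_def\<close>)

text \<open>The first exit times on finer and finer grids decrease to a time t. Just before them, one grid
step earlier, the path is still in the chamber; by continuity its value at t lies in the closure of the
chamber, but not in the open chamber. So it lies on a wall, where the expected weight vanishes. The case t =
T, with no time left, is the one excluded by the distinct coordinates at T.\<close>

lemma exit_value_tendsto_0:
  fixes w :: "real \<Rightarrow> nat \<Rightarrow> real"
  assumes cont: "\<And>i. i \<in> {1..n} \<Longrightarrow> continuous_on {0..} (\<lambda>t. w t i)"
    and start: "w 0 \<in> weyl_chamber n"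
    and dist: "\<And>i j. 1 \<le> i \<Longrightarrow> i < j \<Longrightarrow> j \<le> n \<Longrightarrow> w T i \<noteq> w T j" and T: "T > 0"
  shows "(\<lambda>N. exit_value n a R T w N) \<longlonglongrightarrow> 0"
proof (cases "\<forall>N. \<forall>k\<le>2 ^ N. w (dyadic T N k) \<in> weyl_chamber n")
  case True
  have "exit_value n a R T w N = 0" for N
    by (rule exit_value_no_exit) (use True in blast)
  then show ?thesis by simp
next
  case False
  then obtain N0 k0 where k0: "k0 \<le> 2 ^ N0" "w (dyadic T N0 k0) \<notin> weyl_chamber n"
    by blast
  \<comment> \<open>\<kappa> N is the first exit on the grid of level N and \<tau> N its time; \<sigma> N is the grid time before it.\<close>
  define \<kappa> where "\<kappa> N = (LEAST k. w (dyadic T N k) \<notin> weyl_chamber n)" for N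
  define \<tau> where "\<tau> N = dyadic T N (\<kappa> N)" for N
  have ex: "\<exists>k\<le>2 ^ (N0 + N). w (dyadic T (N0 + N) k) \<notin> weyl_chamber n" for N
  proof (intro exI conjI)
    have "dyadic T (N0 + N) (k0 * 2 ^ N) = dyadic T N0 k0" by (simp add: dyadic_def power_add)
    then show "w (dyadic T (N0 + N) (k0 * 2 ^ N)) \<notin> weyl_chamber n" using k0 by simp
    show "k0 * 2 ^ N \<le> 2 ^ (N0 + N)" unfolding power_add by (rule mult_right_mono[OF k0(1)]) simp
  qed
  have \<kappa>1: "w (dyadic T N (\<kappa> N)) \<notin> weyl_chamber n" "\<kappa> N \<le> 2 ^ N" if "N \<ge> N0" for N
  proof -
    obtain k where k: "k \<le> 2 ^ N" "w (dyadic T N k) \<notin> weyl_chamber n"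
      using ex[of "N - N0"] \<open>N \<ge> N0\<close> by auto
    show "w (dyadic T N (\<kappa> N)) \<notin> weyl_chamber n"
      unfolding \<kappa>_def by (rule LeastI[where P="\<lambda>k. w (dyadic T N k) \<notin> weyl_chamber n", OF k(2)])
    have "\<kappa> N \<le> k" unfolding \<kappa>_def by (rule Least_le) (rule k(2))
    then show "\<kappa> N \<le> 2 ^ N" using k(1) by simp
  qed
  have \<kappa>2: "w (dyadic T N l) \<in> weyl_chamber n" if "l < \<kappa> N" for N l
    using not_less_Least[OF that[unfolded \<kappa>_def]] by simp
  have \<kappa>pos: "\<kappa> N > 0" if "N \<ge> N0" for N
    using \<kappa>1(1)[OF that] start by (intro gr0I notI) simp
  have val: "exit_value n a R T w N = reflected_value n a R (T - \<tau> N) (w (\<tau> N))" if "N \<ge> N0" for N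
    unfolding \<tau>_def by (rule exit_value_first_exit) (use \<kappa>1[OF that] \<kappa>2 in \<open>auto simp: first_exit_def\<close>)
  have dec: "\<tau> (Suc N) \<le> \<tau> N" if "N \<ge> N0" for N
  proof -
    have e: "dyadic T (Suc N) (2 * \<kappa> N) = dyadic T N (\<kappa> N)" by (simp add: dyadic_def)
    then have "\<kappa> (Suc N) \<le> 2 * \<kappa> N"
      using \<kappa>1(1)[OF that] unfolding \<kappa>_def[of "Suc N"] by (intro Least_le) simp
    then have "dyadic T (Suc N) (\<kappa> (Suc N)) \<le> dyadic T (Suc N) (2 * \<kappa> N)"
      unfolding dyadic_def using T by (intro divide_right_mono mult_left_mono) (auto simp del: of_nat_mult)
    then show ?thesis by (simp add: \<tau>_def e)
  qed
  have \<tau>0: "\<tau> N \<ge> 0" for N using T by (simp add: \<tau>_def dyadic_def)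
  have \<tau>T: "\<tau> N \<le> T" if "N \<ge> N0" for N
  proof -
    have "real (\<kappa> N) \<le> 2 ^ N" using \<kappa>1(2)[OF that] by (metis of_nat_le_iff of_nat_numeral of_nat_power)
    then show ?thesis using T by (simp add: \<tau>_def dyadic_def field_simps)
  qed
  have "decseq (\<lambda>N. \<tau> (N + N0))" using dec by (auto simp: decseq_Suc_iff)
  then obtain t where "(\<lambda>N. \<tau> (N + N0)) \<longlonglongrightarrow> t"
    using decseq_convergent[of "\<lambda>N. \<tau> (N + N0)" 0] \<tau>0 by blast
  then have \<tau>lim: "\<tau> \<longlonglongrightarrow> t" by (rule LIMSEQ_offset)
  have t0: "t \<ge> 0" by (rule LIMSEQ_le_const[OF \<tau>lim]) (use \<tau>0 in auto)
  have tT: "t \<le> T" by (rule LIMSEQ_le_const2[OF \<tau>lim]) (use \<tau>T in auto)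
  define \<sigma> where "\<sigma> N = dyadic T N (\<kappa> N - 1)" for N
  have \<sigma>lim: "\<sigma> \<longlonglongrightarrow> t"
  proof -
    have "(\<lambda>N. T * (1/2) ^ N) \<longlonglongrightarrow> T * 0" by (intro tendsto_intros) auto
    then have "(\<lambda>N. \<tau> N - T * (1/2) ^ N) \<longlonglongrightarrow> t - T * 0" by (intro tendsto_diff \<tau>lim)
    moreover have "eventually (\<lambda>N. \<tau> N - T * (1/2) ^ N = \<sigma> N) sequentially"
      using eventually_ge_at_top[of N0]
    proof eventually_elim
      case (elim N)
      then show ?case using \<kappa>pos[of N]
        by (simp add: \<tau>_def \<sigma>_def dyadic_def of_nat_diff field_simps)
    qed
    ultimately have "\<sigma> \<longlonglongrightarrow> t - T * 0" by (rule Lim_transform_eventually)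
    then show ?thesis by simp
  qed
  have \<sigma>0: "\<sigma> N \<ge> 0" for N using T by (simp add: \<sigma>_def dyadic_def)
  have wt: "(\<lambda>N. w (\<tau> N) i) \<longlonglongrightarrow> w t i" "(\<lambda>N. w (\<sigma> N) i) \<longlonglongrightarrow> w t i" if "i \<in> {1..n}" for i
    using continuous_on_tendsto_compose[OF cont[OF that] \<tau>lim] continuous_on_tendsto_compose[OF cont[OF that] \<sigma>lim] t0 \<tau>0 \<sigma>0
    by auto
  have le: "w t i \<le> w t j" if "1 \<le> i" "i < j" "j \<le> n" for i j
  proof (rule LIMSEQ_le)
    show "(\<lambda>N. w (\<sigma> N) i) \<longlonglongrightarrow> w t i" "(\<lambda>N. w (\<sigma> N) j) \<longlonglongrightarrow> w t j" using wt(2) that by auto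
    have "w (\<sigma> N) i \<le> w (\<sigma> N) j" if "N \<ge> N0" for N
      using \<kappa>2[of "\<kappa> N - 1" N] \<kappa>pos[OF that] \<open>1 \<le> i\<close> \<open>i < j\<close> \<open>j \<le> n\<close> unfolding \<sigma>_def weyl_chamber_def by force
    then show "\<exists>N. \<forall>m\<ge>N. w (\<sigma> m) i \<le> w (\<sigma> m) j" by blast
  qed
  have "\<exists>i j. 1 \<le> i \<and> i < j \<and> j \<le> n \<and> w t i = w t j"
  proof (rule ccontr)
    assume no: "\<not> ?thesis"
    have "eventually (\<lambda>N. \<forall>i\<in>{1..n}. \<forall>j\<in>{i<..n}. w (\<tau> N) i < w (\<tau> N) j) sequentially"
    proof (intro eventually_ball_finite ballI)
      fix i j assume ij: "i \<in> {1..n}" "j \<in> {i<..n}"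
      then have "w t i < w t j" using no le[of i j] by force
      moreover have "(\<lambda>N. w (\<tau> N) j - w (\<tau> N) i) \<longlonglongrightarrow> w t j - w t i"
        by (intro tendsto_diff wt(1)) (use ij in auto)
      ultimately have "eventually (\<lambda>N. w (\<tau> N) j - w (\<tau> N) i > 0) sequentially"
        by (intro order_tendstoD(1)) auto
      then show "eventually (\<lambda>N. w (\<tau> N) i < w (\<tau> N) j) sequentially" by eventually_elim simp
    qed auto
    then have "eventually (\<lambda>N. w (\<tau> N) \<in> weyl_chamber n) sequentially"
      by eventually_elim (auto simp: weyl_chamber_def)
    then obtain N1 where "\<And>N. N \<ge> N1 \<Longrightarrow> w (\<tau> N) \<in> weyl_chamber n" by (auto simp: eventually_sequentially)
    then show False using \<kappa>1(1)[of "max N0 N1"] by (auto simp: \<tau>_def)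
  qed
  then obtain i j where ij: "1 \<le> i" "i < j" "j \<le> n" "w t i = w t j" by blast
  then have "t \<noteq> T" using dist by blast
  then have tltT: "T - t > 0" using tT by simp
  have sl: "(\<lambda>N. T - \<tau> N) \<longlonglongrightarrow> T - t" by (intro tendsto_diff tendsto_const \<tau>lim)
  have "(\<lambda>N. reflected_mean n a R (T - \<tau> N) (w (\<tau> N))) \<longlonglongrightarrow> reflected_mean n a R (T - t) (w t)"
    by (rule reflected_mean_continuous[OF sl tltT wt(1)])
  also have "reflected_mean n a R (T - t) (w t) = 0"
    by (rule reflected_mean_boundary[OF tltT ij])
  finally have "(\<lambda>N. reflected_mean n a R (T - \<tau> N) (w (\<tau> N))) \<longlonglongrightarrow> 0" .
  moreover have "eventually (\<lambda>N. reflected_mean n a R (T - \<tau> N) (w (\<tau> N)) = exit_value n a R T w N) sequentially"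
    using order_tendstoD(1)[OF sl tltT] eventually_ge_at_top[of N0]
    by eventually_elim (simp add: val reflected_value_def)
  ultimately show ?thesis by (rule Lim_transform_eventually)
qed

lemma exit_value_bounded:
  assumes B: "B \<ge> 0" "\<And>z. \<bar>reflected_weight n a R z\<bar> \<le> B"
  shows "\<bar>exit_value n a R T w N\<bar> \<le> B"
proof (cases "\<exists>k\<le>2 ^ N. first_exit n T w N k")
  case True
  then obtain k where k: "k \<le> 2 ^ N" "first_exit n T w N k" by blast
  show ?thesis
    unfolding exit_value_first_exit[OF k] reflected_value_def
    using B reflected_mean_bounded[of "T - dyadic T N k" n a R B] by auto
next
  case False
  then have "exit_value n a R T w N = 0" unfolding exit_value_def by (intro sum.neutral) auto
  then show ?thesis using B by simp
qed

lemma AE_lebesgue_pi_distinct: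
  assumes "1 \<le> i" "i < j" "j \<le> n"
  shows "AE z in lebesgue_pi {1..n}. z i \<noteq> z j"
proof -
  let ?P = "lebesgue_pi {1..n}" and ?J = "{1..n} - {j}"
  have IJ: "{1..n} = insert j ?J" using assms by auto
  have A: "{z \<in> space ?P. z i = z j} \<in> sets ?P" using assms by (intro borel_measurable_eq) auto
  note ins = product_sigma_finite.product_nn_integral_insert[OF product_sigma_finite_lborel, of ?J j, folded IJ]
  have "emeasure ?P {z \<in> space ?P. z i = z j} = (\<integral>\<^sup>+z. indicator {z \<in> space ?P. z i = z j} z \<partial>?P)"
    using A by simp
  also have "\<dots> = (\<integral>\<^sup>+z. \<integral>\<^sup>+y. indicator {z \<in> space ?P. z i = z j} (z(j := y)) \<partial>lborel \<partial>lebesgue_pi ?J)"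
    using A by (intro ins) auto
  also have "\<dots> \<le> (\<integral>\<^sup>+z. \<integral>\<^sup>+y. indicator {z i} y \<partial>lborel \<partial>lebesgue_pi ?J)"
    by (intro nn_integral_mono) (use assms in \<open>auto simp: indicator_def\<close>)
  also have "\<dots> = 0" by simp
  finally show ?thesis using A by (intro AE_I[where N="{z \<in> space ?P. z i = z j}"]) auto
qed

context
  fixes M :: "'w measure" and n :: nat and a x :: "nat \<Rightarrow> real" and X :: "nat \<Rightarrow> real \<Rightarrow> 'w \<Rightarrow> real"
  assumes n: "n \<ge> 1" and ibm: "indep_brownian_motions M n a x X"
begin

interpretation prob_space M using ibm by (simp add: indep_brownian_motions_def)

lemma ibm_vec_measurable: "t \<ge> 0 \<Longrightarrow> (\<lambda>\<omega>. \<lambda>i\<in>{1..n}. X i t \<omega>) \<in> measurable M (lebesgue_pi {1..n})"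
  by (intro measurable_restrict) (simp add: ibm_measurable[OF n ibm])

lemma ibm_expectation_at:
  assumes T: "T > 0" and f[measurable]: "f \<in> borel_measurable (lebesgue_pi {1..n})" and bd: "\<And>z. \<bar>f z\<bar> \<le> B"
  shows "expectation (\<lambda>\<omega>. f (\<lambda>i\<in>{1..n}. X i T \<omega>)) = (\<integral>z. f z * drift_kernel n a T x z \<partial>lebesgue_pi {1..n})"
proof -
  have "expectation (\<lambda>\<omega>. 1 * f (\<lambda>i\<in>{1..n}. X i T \<omega>))
     = expectation (\<lambda>\<omega>. 1 * (\<integral>z. f z * drift_kernel n a (T - 0) (\<lambda>i. X i 0 \<omega>) z \<partial>lebesgue_pi {1..n}))"
    by (rule ibm_markov[OF n ibm, where \<Phi>="\<lambda>_. 1" and k=0 and r="\<lambda>_. 0" and B="max 1 B"])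
       (use T bd in \<open>auto simp: le_max_iff_disj\<close>)
  also have "\<dots> = expectation (\<lambda>\<omega>. \<integral>z. f z * drift_kernel n a T x z \<partial>lebesgue_pi {1..n})"
  proof (rule integral_cong_AE)
    have "(\<lambda>\<omega>. \<integral>z. f z * drift_kernel n a T (\<lambda>i\<in>{1..n}. X i 0 \<omega>) z \<partial>lebesgue_pi {1..n}) \<in> borel_measurable M"
      by (rule measurable_compose[OF ibm_vec_measurable borel_measurable_drift_integral]) auto
    then show "(\<lambda>\<omega>. 1 * (\<integral>z. f z * drift_kernel n a (T - 0) (\<lambda>i. X i 0 \<omega>) z \<partial>lebesgue_pi {1..n})) \<in> borel_measurable M"
      by (simp add: drift_kernel_def)
    show "AE \<omega> in M. 1 * (\<integral>z. f z * drift_kernel n a (T - 0) (\<lambda>i. X i 0 \<omega>) z \<partial>lebesgue_pi {1..n})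
      = (\<integral>z. f z * drift_kernel n a T x z \<partial>lebesgue_pi {1..n})"
      using ibm_start[OF n ibm] by eventually_elim (simp add: drift_kernel_def)
  qed simp
  finally show ?thesis by (simp add: prob_space)
qed

text \<open>The law of X at time T has a density, and the hyperplanes are null sets.\<close>

lemma ibm_distinct:
  assumes T: "T > 0"
  shows "AE \<omega> in M. \<forall>i\<in>{1..n}. \<forall>j\<in>{i<..n}. X i T \<omega> \<noteq> X j T \<omega>"
proof (intro AE_finite_allI)
  fix i j assume ij: "i \<in> {1..n}" "j \<in> {i<..n}"
  let ?P = "lebesgue_pi {1..n}"
  let ?f = "\<lambda>z. of_bool (z i = z j) :: real"
  have [measurable]: "?f \<in> borel_measurable ?P"
    using ij by (simp add: of_bool_def) measurable
  have [measurable]: "X i T \<in> borel_measurable M" "X j T \<in> borel_measurable M"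
    using ij T by (auto intro!: ibm_measurable[OF n ibm])
  have "expectation (\<lambda>\<omega>. ?f (\<lambda>i\<in>{1..n}. X i T \<omega>)) = (\<integral>z. ?f z * drift_kernel n a T x z \<partial>?P)"
    by (rule ibm_expectation_at[OF T, where B=1]) auto
  also have "\<dots> = (\<integral>z. 0 \<partial>?P)"
  proof (rule integral_cong_AE)
    show "AE z in ?P. ?f z * drift_kernel n a T x z = 0"
    proof -
      have "AE z in ?P. z i \<noteq> z j" using ij by (intro AE_lebesgue_pi_distinct) auto
      then show ?thesis by eventually_elim simp
    qed
  qed measurable
  finally have "expectation (\<lambda>\<omega>. of_bool (X i T \<omega> = X j T \<omega>) :: real) = 0" using ij by simp
  moreover have "integrable M (\<lambda>\<omega>. of_bool (X i T \<omega> = X j T \<omega>) :: real)"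
    by (rule integrable_const_bound[where B=1]) auto
  ultimately have "AE \<omega> in M. of_bool (X i T \<omega> = X j T \<omega>) = (0::real)"
    by (subst (asm) integral_nonneg_eq_0_iff_AE) auto
  then show "AE \<omega> in M. X i T \<omega> \<noteq> X j T \<omega>" by eventually_elim auto
qed auto

lemma ibm_chamber_measurable:
  assumes "t \<ge> 0"
  shows "Measurable.pred M (\<lambda>\<omega>. (\<lambda>i. X i t \<omega>) \<in> weyl_chamber n)"
  by (rule pred_weyl_chamber) (use assms in \<open>auto intro: ibm_measurable[OF n ibm]\<close>)

lemma ibm_cube_measurable:
  assumes "t \<ge> 0"
  shows "Measurable.pred M (\<lambda>\<omega>. (\<lambda>i. X i t \<omega>) \<in> centred_cube n R)"
proof -
  have "Measurable.pred M (\<lambda>\<omega>. (\<lambda>i\<in>{1..n}. X i t \<omega>) \<in> centred_cube n R)"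
    by (rule measurable_compose[OF ibm_vec_measurable[OF assms] pred_centred_cube])
  then show ?thesis by (simp add: centred_cube_def)
qed

lemma ibm_first_exit_measurable:
  assumes "T \<ge> 0"
  shows "Measurable.pred M (\<lambda>\<omega>. first_exit n T (\<lambda>t i. X i t \<omega>) N k)"
proof -
  have [measurable]: "Measurable.pred M (\<lambda>\<omega>. (\<lambda>i. X i (dyadic T N l) \<omega>) \<in> weyl_chamber n)" for l
    using assms by (intro ibm_chamber_measurable) (simp add: dyadic_def)
  show ?thesis unfolding first_exit_def by measurable
qed

lemma ibm_expectation_exit:
  assumes T: "T > 0" and k: "k \<le> 2 ^ N"
  shows "expectation (\<lambda>\<omega>. of_bool (first_exit n T (\<lambda>t i. X i t \<omega>) N k) * reflected_weight n a R (\<lambda>i\<in>{1..n}. X i T \<omega>))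
     = expectation (\<lambda>\<omega>. of_bool (first_exit n T (\<lambda>t i. X i t \<omega>) N k) *
         reflected_value n a R (T - dyadic T N k) (\<lambda>i. X i (dyadic T N k) \<omega>))"
proof (cases "k = 2 ^ N")
  case True
  have "reflected_weight n a R (\<lambda>i\<in>{1..n}. X i T \<omega>) = reflected_weight n a R (\<lambda>i. X i T \<omega>)" for \<omega>
    by (rule reflected_weight_cong) simp
  then show ?thesis using True by (simp add: reflected_value_def)
next
  case False
  then have "k < 2 ^ N" using k by simp
  then have "real k < 2 ^ N" by (metis of_nat_less_iff of_nat_numeral of_nat_power)
  then have lt: "dyadic T N k < T" using T by (simp add: dyadic_def field_simps)
  obtain B where B: "B \<ge> 0" "\<And>z. \<bar>reflected_weight n a R z\<bar> \<le> B"
    using reflected_weight_bounded[of n a R] by blast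
  define \<Phi> :: "(nat \<times> nat \<Rightarrow> real) \<Rightarrow> real" where
    "\<Phi> u = of_bool ((\<forall>l<k. (\<lambda>i. u (i, l)) \<in> weyl_chamber n) \<and> (\<lambda>i. u (i, k)) \<notin> weyl_chamber n)" for u
  let ?path = "\<lambda>\<omega>. \<lambda>p\<in>{1..n} \<times> {..k}. X (fst p) (dyadic T N (snd p)) \<omega>"
  have c: "(\<lambda>i. ?path \<omega> (i, l)) \<in> weyl_chamber n \<longleftrightarrow> (\<lambda>i. X i (dyadic T N l) \<omega>) \<in> weyl_chamber n" if "l \<le> k" for l \<omega>
    by (rule weyl_chamber_cong) (use that in auto)
  have \<Phi>eq: "\<Phi> (?path \<omega>) = of_bool (first_exit n T (\<lambda>t i. X i t \<omega>) N k)" for \<omega>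
  proof -
    have "(\<forall>l<k. (\<lambda>i. ?path \<omega> (i, l)) \<in> weyl_chamber n) \<longleftrightarrow> (\<forall>l<k. (\<lambda>i. X i (dyadic T N l) \<omega>) \<in> weyl_chamber n)"
      using c less_imp_le by blast
    then show ?thesis unfolding \<Phi>_def first_exit_def using c[of k] by simp
  qed
  have \<Phi>m: "\<Phi> \<in> borel_measurable (Pi\<^sub>M ({1..n} \<times> {..k}) (\<lambda>_. borel))"
  proof -
    have [measurable]: "Measurable.pred (Pi\<^sub>M ({1..n} \<times> {..k}) (\<lambda>_. borel)) (\<lambda>u. (\<lambda>i. u (i, l)) \<in> weyl_chamber n)" if "l \<le> k" for l
      by (rule pred_weyl_chamber) (use that in auto)
    have "Measurable.pred (Pi\<^sub>M ({1..n} \<times> {..k}) (\<lambda>_. borel)) (\<lambda>u. (\<forall>l\<in>{..<k}. (\<lambda>i. u (i, l)) \<in> weyl_chamber n) \<and> (\<lambda>i. u (i, k)) \<notin> weyl_chamber n)"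
      by (intro pred_intros_logic pred_intros_finite) auto
    then have [measurable]: "Measurable.pred (Pi\<^sub>M ({1..n} \<times> {..k}) (\<lambda>_. borel)) (\<lambda>u. (\<forall>l<k. (\<lambda>i. u (i, l)) \<in> weyl_chamber n) \<and> (\<lambda>i. u (i, k)) \<notin> weyl_chamber n)"
      by (simp add: Ball_def)
    show ?thesis unfolding \<Phi>_def[abs_def] of_bool_def by measurable
  qed
  have "expectation (\<lambda>\<omega>. \<Phi> (?path \<omega>) * reflected_weight n a R (\<lambda>i\<in>{1..n}. X i T \<omega>))
     = expectation (\<lambda>\<omega>. \<Phi> (?path \<omega>) * (\<integral>z. reflected_weight n a R z *
         drift_kernel n a (T - dyadic T N k) (\<lambda>i. X i (dyadic T N k) \<omega>) z \<partial>lebesgue_pi {1..n}))"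
  proof (rule ibm_markov[OF n ibm, where r="dyadic T N" and B="max 1 B"])
    show "dyadic T N l < dyadic T N (Suc l)" for l using T by (simp add: dyadic_def divide_strict_right_mono)
    show "\<bar>\<Phi> u\<bar> \<le> max 1 B" for u using B(1) by (simp add: \<Phi>_def le_max_iff_disj)
    show "\<bar>reflected_weight n a R z\<bar> \<le> max 1 B" for z using B(2)[of z] by simp
  qed (use \<Phi>m lt in auto)
  then show ?thesis using lt by (simp only: \<Phi>eq reflected_value_def reflected_mean_def) simp
qed

lemma ibm_exit_value_measurable:
  assumes T: "T > 0"
  shows "(\<lambda>\<omega>. of_bool (first_exit n T (\<lambda>t i. X i t \<omega>) N k) *
         reflected_value n a R (T - dyadic T N k) (\<lambda>i. X i (dyadic T N k) \<omega>)) \<in> borel_measurable M"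
proof -
  have d: "dyadic T N k \<ge> 0" using T by (simp add: dyadic_def)
  have "(\<lambda>\<omega>. reflected_mean n a R (T - dyadic T N k) (\<lambda>i\<in>{1..n}. X i (dyadic T N k) \<omega>)) \<in> borel_measurable M"
    unfolding reflected_mean_def
    by (rule measurable_compose[OF ibm_vec_measurable[OF d] borel_measurable_drift_integral]) measurable
  then have 1: "(\<lambda>\<omega>. reflected_mean n a R (T - dyadic T N k) (\<lambda>i. X i (dyadic T N k) \<omega>)) \<in> borel_measurable M"
    by (simp add: reflected_mean_def drift_kernel_def)
  have "reflected_weight n a R (\<lambda>i\<in>{1..n}. X i (dyadic T N k) \<omega>) = reflected_weight n a R (\<lambda>i. X i (dyadic T N k) \<omega>)" for \<omega>
    by (rule reflected_weight_cong) simp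
  then have 2: "(\<lambda>\<omega>. reflected_weight n a R (\<lambda>i. X i (dyadic T N k) \<omega>)) \<in> borel_measurable M"
    using measurable_compose[OF ibm_vec_measurable[OF d] borel_measurable_reflected_weight[of n a R]] by simp
  have [measurable]: "Measurable.pred M (\<lambda>\<omega>. first_exit n T (\<lambda>t i. X i t \<omega>) N k)"
    using T by (intro ibm_first_exit_measurable) simp
  have [measurable]: "(\<lambda>\<omega>. reflected_value n a R (T - dyadic T N k) (\<lambda>i. X i (dyadic T N k) \<omega>)) \<in> borel_measurable M"
    unfolding reflected_value_def using 1 2 by (cases "T - dyadic T N k > 0") auto
  show ?thesis unfolding of_bool_def by measurable
qed

text \<open>Split the expected terminal weight according to the first exit on a grid. Paths that stay in the
chamber and end in the cube have weight 1; the others contribute the expected exit value, which tends to 0 as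
the grid is refined.\<close>

lemma ibm_dyadic_survival:
  assumes T: "T > 0" and x: "x \<in> weyl_chamber n"
  shows "prob {\<omega> \<in> space M. (\<forall>N. \<forall>k\<le>2 ^ N. (\<lambda>i. X i (dyadic T N k) \<omega>) \<in> weyl_chamber n) \<and> (\<lambda>i. X i T \<omega>) \<in> centred_cube n R}
    = reflected_mean n a R T x"
proof -
  let ?w = "\<lambda>\<omega> t i. X i t \<omega>"
  obtain B where B: "B \<ge> 0" "\<And>z. \<bar>reflected_weight n a R z\<bar> \<le> B"
    using reflected_weight_bounded[of n a R] by blast
  define S where "S N = {\<omega> \<in> space M. (\<forall>k\<le>2 ^ N. (\<lambda>i. X i (dyadic T N k) \<omega>) \<in> weyl_chamber n) \<and> (\<lambda>i. X i T \<omega>) \<in> centred_cube n R}" for N :: nat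
  have chm[measurable]: "Measurable.pred M (\<lambda>\<omega>. (\<lambda>i. X i (dyadic T N k) \<omega>) \<in> weyl_chamber n)" for N k
    using T by (intro ibm_chamber_measurable) (simp add: dyadic_def)
  have [measurable]: "Measurable.pred M (\<lambda>\<omega>. (\<lambda>i. X i T \<omega>) \<in> centred_cube n R)"
    using T by (intro ibm_cube_measurable) simp
  have Sm[measurable]: "S N \<in> sets M" for N
    unfolding S_def by measurable
  let ?g = "\<lambda>\<omega>. reflected_weight n a R (\<lambda>i\<in>{1..n}. X i T \<omega>)"
  have gm[measurable]: "?g \<in> borel_measurable M"
    by (rule measurable_compose[OF ibm_vec_measurable borel_measurable_reflected_weight]) (use T in simp)
  have fem[measurable]: "Measurable.pred M (\<lambda>\<omega>. first_exit n T (?w \<omega>) N k)" for N k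
    using T by (intro ibm_first_exit_measurable) simp
  have part: "(1::real) = of_bool (\<forall>k<m. (\<lambda>i. X i (dyadic T N k) \<omega>) \<in> weyl_chamber n) + (\<Sum>k<m. of_bool (first_exit n T (?w \<omega>) N k))"
    for N m and \<omega> :: 'w
  proof (induction m)
    case (Suc m)
    have "of_bool (\<forall>k<m. (\<lambda>i. X i (dyadic T N k) \<omega>) \<in> weyl_chamber n)
      = of_bool (\<forall>k<Suc m. (\<lambda>i. X i (dyadic T N k) \<omega>) \<in> weyl_chamber n) + (of_bool (first_exit n T (?w \<omega>) N m) :: real)"
      by (auto simp: first_exit_def less_Suc_eq)
    then show ?case using Suc unfolding sum.lessThan_Suc by linarith
  qed simp
  have val: "prob (S N) = reflected_mean n a R T x - expectation (\<lambda>\<omega>. exit_value n a R T (?w \<omega>) N)" for N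
  proof -
    have dec: "?g \<omega> = indicator (S N) \<omega> + (\<Sum>k\<le>2^N. of_bool (first_exit n T (?w \<omega>) N k) * ?g \<omega>)" if \<omega>: "\<omega> \<in> space M" for \<omega>
    proof -
      have "?g \<omega> = of_bool (\<forall>k<Suc (2^N). (\<lambda>i. X i (dyadic T N k) \<omega>) \<in> weyl_chamber n) * ?g \<omega> + (\<Sum>k<Suc (2^N). of_bool (first_exit n T (?w \<omega>) N k)) * ?g \<omega>"
        unfolding distrib_right[symmetric] part[symmetric] by simp
      also have "of_bool (\<forall>k<Suc (2^N). (\<lambda>i. X i (dyadic T N k) \<omega>) \<in> weyl_chamber n) * ?g \<omega> = indicator (S N) \<omega>"
      proof (cases "\<forall>k<Suc (2^N). (\<lambda>i. X i (dyadic T N k) \<omega>) \<in> weyl_chamber n")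
        case True
        then have "(\<lambda>i. X i (dyadic T N (2^N)) \<omega>) \<in> weyl_chamber n" by blast
        then have "(\<lambda>i\<in>{1..n}. X i T \<omega>) \<in> weyl_chamber n"
          by (subst weyl_chamber_cong[where z="\<lambda>i. X i T \<omega>"]) auto
        then have "?g \<omega> = (if (\<lambda>i. X i T \<omega>) \<in> centred_cube n R then 1 else 0)"
          by (simp add: reflected_weight_chamber centred_cube_def)
        moreover have "\<omega> \<in> S N \<longleftrightarrow> (\<lambda>i. X i T \<omega>) \<in> centred_cube n R"
          using True \<omega> by (auto simp: S_def less_Suc_eq_le)
        ultimately show ?thesis using True by (simp add: indicator_def)
      next
        case False
        then have "\<omega> \<notin> S N" by (auto simp: S_def less_Suc_eq_le)
        then show ?thesis using False by simp
      qed
      finally show ?thesis unfolding sum_distrib_right lessThan_Suc_atMost .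
    qed
    have i1: "integrable M (\<lambda>\<omega>. of_bool (first_exit n T (?w \<omega>) N k) * ?g \<omega>)" for k
      by (rule integrable_const_bound[where B=B]) (use B in \<open>auto simp: of_bool_def\<close>)
    have i2: "integrable M (\<lambda>\<omega>. of_bool (first_exit n T (?w \<omega>) N k) * reflected_value n a R (T - dyadic T N k) (\<lambda>i. X i (dyadic T N k) \<omega>))" for k
    proof (rule integrable_const_bound[where B=B])
      show "AE \<omega> in M. norm (of_bool (first_exit n T (?w \<omega>) N k) * reflected_value n a R (T - dyadic T N k) (\<lambda>i. X i (dyadic T N k) \<omega>)) \<le> B"
        using B reflected_mean_bounded[of "T - dyadic T N k" n a R B] by (auto simp: reflected_value_def)
    qed (rule ibm_exit_value_measurable[OF T])
    have iS: "integrable M (indicator (S N) :: 'w \<Rightarrow> real)"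
      by (rule integrable_const_bound[where B=1]) auto
    have "reflected_mean n a R T x = expectation ?g"
      unfolding reflected_mean_def by (rule ibm_expectation_at[OF T _ B(2), symmetric]) measurable
    also have "\<dots> = expectation (\<lambda>\<omega>. indicator (S N) \<omega> + (\<Sum>k\<le>2^N. of_bool (first_exit n T (?w \<omega>) N k) * ?g \<omega>))"
      by (rule Bochner_Integration.integral_cong[OF refl]) (use dec in blast)
    also have "\<dots> = expectation (indicator (S N)) + (\<Sum>k\<le>2^N. expectation (\<lambda>\<omega>. of_bool (first_exit n T (?w \<omega>) N k) * ?g \<omega>))"
      by (subst Bochner_Integration.integral_add[OF iS Bochner_Integration.integrable_sum[OF i1]])
         (simp only: Bochner_Integration.integral_sum[OF i1])
    also have "(\<Sum>k\<le>2^N. expectation (\<lambda>\<omega>. of_bool (first_exit n T (?w \<omega>) N k) * ?g \<omega>))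
      = (\<Sum>k\<le>2^N. expectation (\<lambda>\<omega>. of_bool (first_exit n T (?w \<omega>) N k) * reflected_value n a R (T - dyadic T N k) (\<lambda>i. X i (dyadic T N k) \<omega>)))"
      by (rule sum.cong[OF refl]) (simp add: ibm_expectation_exit[OF T])
    also have "\<dots> = expectation (\<lambda>\<omega>. exit_value n a R T (?w \<omega>) N)"
      unfolding exit_value_def by (rule Bochner_Integration.integral_sum[symmetric]) (rule i2)
    finally show ?thesis by simp
  qed
  have "(\<lambda>N. expectation (\<lambda>\<omega>. exit_value n a R T (?w \<omega>) N)) \<longlonglongrightarrow> expectation (\<lambda>\<omega>. 0)"
  proof (rule integral_dominated_convergence[where w="\<lambda>_. B"])
    show "(\<lambda>\<omega>. exit_value n a R T (?w \<omega>) N) \<in> borel_measurable M" for N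
      unfolding exit_value_def by (intro borel_measurable_sum ibm_exit_value_measurable[OF T])
    have "AE \<omega> in M. \<forall>i\<in>{1..n}. \<forall>j\<in>{i<..n}. X i T \<omega> \<noteq> X j T \<omega>" by (rule ibm_distinct[OF T])
    then show "AE \<omega> in M. (\<lambda>N. exit_value n a R T (?w \<omega>) N) \<longlonglongrightarrow> 0"
      using ibm_start[OF n ibm] AE_space
    proof eventually_elim
      case (elim \<omega>)
      show ?case
      proof (rule exit_value_tendsto_0[OF _ _ _ T])
        show "continuous_on {0..} (\<lambda>t. X i t \<omega>)" if "i \<in> {1..n}" for i
          using ibm_component[OF n ibm that] elim(3) by (simp add: brownian_motion_def)
        show "(\<lambda>i. X i 0 \<omega>) \<in> weyl_chamber n"
          using x elim(2) by (subst weyl_chamber_cong[where z=x]) auto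
        show "X i T \<omega> \<noteq> X j T \<omega>" if "1 \<le> i" "i < j" "j \<le> n" for i j
          using elim(1) that by auto
      qed
    qed
    show "AE \<omega> in M. norm (exit_value n a R T (?w \<omega>) N) \<le> B" for N
      using exit_value_bounded[OF B] by simp
  qed auto
  then have "(\<lambda>N. prob (S N)) \<longlonglongrightarrow> reflected_mean n a R T x - 0"
    unfolding val by (intro tendsto_diff tendsto_const) simp
  moreover have "(\<lambda>N. prob (S N)) \<longlonglongrightarrow> prob (\<Inter>N. S N)"
  proof (rule finite_Lim_measure_decseq)
    show "decseq S"
    proof (rule decseq_SucI, rule subsetI)
      fix N \<omega> assume \<omega>: "\<omega> \<in> S (Suc N)"
      have "(\<lambda>i. X i (dyadic T N k) \<omega>) \<in> weyl_chamber n" if "k \<le> 2 ^ N" for k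
      proof -
        have e: "dyadic T (Suc N) (2 * k) = dyadic T N k" by (simp add: dyadic_def)
        have "2 * k \<le> 2 ^ Suc N" using that by simp
        then have "(\<lambda>i. X i (dyadic T (Suc N) (2 * k)) \<omega>) \<in> weyl_chamber n" using \<omega> unfolding S_def by blast
        then show ?thesis by (simp add: e)
      qed
      then show "\<omega> \<in> S N" using \<omega> by (simp add: S_def)
    qed
  qed auto
  moreover have "(\<Inter>N. S N) = {\<omega> \<in> space M. (\<forall>N. \<forall>k\<le>2 ^ N. (\<lambda>i. X i (dyadic T N k) \<omega>) \<in> weyl_chamber n) \<and> (\<lambda>i. X i T \<omega>) \<in> centred_cube n R}"
    by (auto simp: S_def)
  ultimately show ?thesis using LIMSEQ_unique by force
qed

end

section \<open>The density of the process before its first collision\<close>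

lemma dyadic_bounds:
  assumes "T \<ge> 0" "k \<le> 2 ^ N"
  shows "0 \<le> dyadic T N k" "dyadic T N k \<le> T"
proof -
  have "real k \<le> real (2 ^ N)" using assms(2) by (simp only: of_nat_le_iff)
  then have "T * real k \<le> T * 2 ^ N" using assms(1) by (intro mult_left_mono) auto
  then show "dyadic T N k \<le> T" by (simp add: dyadic_def pos_divide_le_eq)
qed (use assms in \<open>simp add: dyadic_def\<close>)

lemma dyadic_dense:
  assumes "T > 0" "0 \<le> t" "t \<le> T"
  shows "\<exists>k. (\<forall>N. k N \<le> 2 ^ N) \<and> (\<lambda>N. dyadic T N (k N)) \<longlonglongrightarrow> t"
proof -
  define k where "k N = nat \<lfloor>t / T * 2 ^ N\<rfloor>" for N :: nat
  have nn: "t / T * 2 ^ N \<ge> 0" for N :: nat using assms by simp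
  have k1: "real (k N) \<le> t / T * 2 ^ N" "t / T * 2 ^ N - 1 \<le> real (k N)" for N
    unfolding k_def using nn[of N] by linarith+
  have le: "k N \<le> 2 ^ N" for N
  proof -
    have "t / T * 2 ^ N \<le> 2 ^ N" using assms by (simp add: field_simps)
    from order_trans[OF k1(1)[of N] this] show ?thesis by simp
  qed
  have "(\<lambda>N. dyadic T N (k N)) \<longlonglongrightarrow> t"
  proof (rule tendsto_sandwich)
    show "eventually (\<lambda>N. t - T * (1/2) ^ N \<le> dyadic T N (k N)) sequentially"
    proof (rule always_eventually, rule allI)
      fix N
      have "T * (t / T * 2 ^ N - 1) / 2 ^ N \<le> T * real (k N) / 2 ^ N"
        using k1(2)[of N] assms by (intro divide_right_mono mult_left_mono) auto
      also have "T * (t / T * 2 ^ N - 1) / 2 ^ N = t - T * (1/2) ^ N"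
        using assms by (simp add: field_simps)
      finally show "t - T * (1/2) ^ N \<le> dyadic T N (k N)"
        by (simp only: dyadic_def)
    qed
    show "eventually (\<lambda>N. dyadic T N (k N) \<le> t) sequentially"
    proof (rule always_eventually, rule allI)
      fix N
      have "T * real (k N) / 2 ^ N \<le> T * (t / T * 2 ^ N) / 2 ^ N"
        using k1(1)[of N] assms by (intro divide_right_mono mult_left_mono) auto
      also have "T * (t / T * 2 ^ N) / 2 ^ N = t"
        using assms by simp
      finally show "dyadic T N (k N) \<le> t"
        by (simp only: dyadic_def)
    qed
    have "(\<lambda>N. t - T * (1/2) ^ N) \<longlonglongrightarrow> t - T * 0" by (intro tendsto_intros) auto
    then show "(\<lambda>N. t - T * (1/2) ^ N) \<longlonglongrightarrow> t" by simp
  qed simp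
  with le show ?thesis by blast
qed

lemma dyadic_bound_continuous:
  fixes f :: "real \<Rightarrow> real"
  assumes "T > 0" "continuous_on {0..} f" "\<And>N k. k \<le> 2 ^ N \<Longrightarrow> c \<le> f (dyadic T N k)" "0 \<le> t" "t \<le> T"
  shows "c \<le> f t"
proof -
  obtain k where k: "\<And>N. k N \<le> 2 ^ N" "(\<lambda>N. dyadic T N (k N)) \<longlonglongrightarrow> t"
    using dyadic_dense[OF assms(1,4,5)] by blast
  have "(\<lambda>N. f (dyadic T N (k N))) \<longlonglongrightarrow> f t"
    by (rule continuous_on_tendsto_compose[OF assms(2) k(2)]) (use assms in \<open>auto simp: dyadic_def\<close>)
  then show ?thesis by (rule LIMSEQ_le_const) (use k(1) assms(3) in auto)
qed

text \<open>The chamber is open: a path that is inside at time T stays inside for a while after T, so that the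
infimum exceeds T.\<close>

lemma collision_time_greater_iff:
  assumes cont: "\<And>i. i \<in> {1..n} \<Longrightarrow> continuous_on {0..} (\<lambda>t. X i t \<omega>)" and T: "T > 0"
  shows "ereal T < collision_time n X \<omega> \<longleftrightarrow> (\<forall>s. 0 < s \<and> s \<le> T \<longrightarrow> (\<lambda>i. X i s \<omega>) \<in> weyl_chamber n)"
proof
  assume a: "ereal T < collision_time n X \<omega>"
  show "\<forall>s. 0 < s \<and> s \<le> T \<longrightarrow> (\<lambda>i. X i s \<omega>) \<in> weyl_chamber n"
  proof (intro allI impI, rule ccontr)
    fix s assume s: "0 < s \<and> s \<le> T" "(\<lambda>i. X i s \<omega>) \<notin> weyl_chamber n"
    then have "collision_time n X \<omega> \<le> ereal s" unfolding collision_time_def by (intro Inf_lower) blast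
    also have "ereal s \<le> ereal T" using s by simp
    finally show False using a by simp
  qed
next
  assume a: "\<forall>s. 0 < s \<and> s \<le> T \<longrightarrow> (\<lambda>i. X i s \<omega>) \<in> weyl_chamber n"
  have "eventually (\<lambda>s. \<forall>i\<in>{1..n}. \<forall>j\<in>{i<..n}. X i s \<omega> < X j s \<omega>) (at_right T)"
  proof (intro eventually_ball_finite ballI)
    fix i j assume ij: "i \<in> {1..n}" "j \<in> {i<..n}"
    have "((\<lambda>s. X j s \<omega> - X i s \<omega>) \<longlongrightarrow> X j T \<omega> - X i T \<omega>) (at T)"
    proof -
      have "continuous_on {0<..} (\<lambda>s. X j s \<omega> - X i s \<omega>)"
        using cont[of i] cont[of j] ij
        by (intro continuous_on_diff) (auto elim!: continuous_on_subset)
      then have "isCont (\<lambda>s. X j s \<omega> - X i s \<omega>) T"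
        using T by (subst (asm) continuous_on_eq_continuous_at) auto
      then show ?thesis by (simp add: isCont_def)
    qed
    then have "((\<lambda>s. X j s \<omega> - X i s \<omega>) \<longlongrightarrow> X j T \<omega> - X i T \<omega>) (at_right T)"
      by (rule filterlim_mono) (auto simp: at_le)
    moreover have "X j T \<omega> - X i T \<omega> > 0" using a T ij by (auto simp: weyl_chamber_def)
    ultimately have "eventually (\<lambda>s. X j s \<omega> - X i s \<omega> > 0) (at_right T)" by (rule order_tendstoD(1))
    then show "eventually (\<lambda>s. X i s \<omega> < X j s \<omega>) (at_right T)" by eventually_elim simp
  qed auto
  then obtain b where b: "b > T" "\<And>s. T < s \<Longrightarrow> s < b \<Longrightarrow> \<forall>i\<in>{1..n}. \<forall>j\<in>{i<..n}. X i s \<omega> < X j s \<omega>"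
    unfolding eventually_at_right_field by blast
  have "ereal b \<le> collision_time n X \<omega>"
    unfolding collision_time_def
  proof (rule Inf_greatest)
    fix t assume "t \<in> {ereal t |t. t > 0 \<and> (\<lambda>i. X i t \<omega>) \<notin> weyl_chamber n}"
    then obtain s where s: "t = ereal s" "s > 0" "(\<lambda>i. X i s \<omega>) \<notin> weyl_chamber n" by blast
    have "\<not> s \<le> T" using a s by blast
    moreover have "(\<lambda>i. X i s \<omega>) \<in> weyl_chamber n" if "T < s" "s < b"
      using b(2)[OF that] by (auto simp: weyl_chamber_def)
    ultimately show "ereal b \<le> t" using s by force
  qed
  then show "ereal T < collision_time n X \<omega>" using b(1) by (meson ereal_less_eq(3) less_le_trans ereal_less(2) less_ereal.simps(1))
qed

lemma indep_brownian_motions_shift: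
  assumes ibm: "indep_brownian_motions M n a x X"
  shows "indep_brownian_motions M n a (\<lambda>i. x i - c i) (\<lambda>i t \<omega>. X i t \<omega> - c i)"
proof -
  interpret prob_space M using ibm by (simp add: indep_brownian_motions_def)
  have "brownian_motion M (a i) (x i - c i) (\<lambda>t \<omega>. X i t \<omega> - c i)" if "i \<in> {1..n}" for i
  proof -
    have "brownian_motion M (a i) (x i) (X i)" using ibm that by (simp add: indep_brownian_motions_def)
    then show ?thesis by (auto simp: brownian_motion_def intro!: continuous_on_diff)
  qed
  moreover have "indep_vars (\<lambda>_. Pi\<^sub>M {0..} (\<lambda>_. borel)) (\<lambda>i \<omega>. \<lambda>t\<in>{0..}. X i t \<omega> - c i) {1..n}"
  proof -
    have "indep_vars (\<lambda>_. Pi\<^sub>M {0..} (\<lambda>_. borel)) (\<lambda>i. (\<lambda>y. \<lambda>t\<in>{0..}. y t - c i) \<circ> (\<lambda>\<omega>. \<lambda>t\<in>{0..}. X i t \<omega>)) {1..n}"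
      using ibm by (intro indep_vars_compose[where M'="\<lambda>_. Pi\<^sub>M {0..} (\<lambda>_. borel)"] measurable_restrict borel_measurable_diff)
         (auto simp: indep_brownian_motions_def)
    then show ?thesis
      by (subst indep_vars_cong[OF refl _ refl]) (auto simp: fun_eq_iff)
  qed
  ultimately show ?thesis using prob_space_axioms by (simp add: indep_brownian_motions_def)
qed

text \<open>The determinant is a combination of drift kernels started from the permutations of y.\<close>

lemma integrable_km_density:
  assumes s: "s > 0"
  shows "integrable (lebesgue_pi {1..n}) (km_density n a s y)"
proof -
  define c where "c p = exp ((\<Sum>i=1..n. a i * y (p i)) - (\<Sum>i=1..n. a i * y i))" for p
  have "km_density n a s y z = (\<Sum>p | p permutes {1..n}. of_int (sign p) * c p * drift_kernel n a s (\<lambda>i. y (p i)) z)" for z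
  proof -
    define E where "E = exp ((\<Sum>i=1..n. a i * z i) - (\<Sum>i=1..n. a i * y i) - s / 2 * (\<Sum>i=1..n. (a i)\<^sup>2))"
    have e: "E = c p * exp ((\<Sum>i=1..n. a i * z i) - (\<Sum>i=1..n. a i * y (p i)) - s / 2 * (\<Sum>i=1..n. (a i)\<^sup>2))" for p
      by (simp add: E_def c_def exp_add[symmetric])
    have "km_density n a s y z = (\<Sum>p | p permutes {1..n}. E * (of_int (sign p) * (\<Prod>i=1..n. gauss s (z i - y (p i)))))"
      unfolding km_density_def leibniz_def E_def by (rule sum_distrib_left)
    also have "\<dots> = (\<Sum>p | p permutes {1..n}. of_int (sign p) * c p * drift_kernel n a s (\<lambda>i. y (p i)) z)"
    proof (rule sum.cong[OF refl])
      fix p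
      show "E * (of_int (sign p) * (\<Prod>i=1..n. gauss s (z i - y (p i))))
        = of_int (sign p) * c p * drift_kernel n a s (\<lambda>i. y (p i)) z"
        unfolding drift_kernel_gauss[OF s] e[of p] by (simp only: mult_ac)
    qed
    finally show ?thesis .
  qed
  then have "km_density n a s y = (\<lambda>z. \<Sum>p | p permutes {1..n}. of_int (sign p) * c p * drift_kernel n a s (\<lambda>i. y (p i)) z)" by blast
  then show ?thesis
    by (simp add: integrable_drift_kernel[OF s])
qed

lemma borel_measurable_chamber_density:
  assumes "s > 0"
  shows "(\<lambda>z. indicator (weyl_chamber n) z * km_density n a s y z) \<in> borel_measurable (lebesgue_pi {1..n})"
proof -
  have [measurable]: "km_density n a s y \<in> borel_measurable (lebesgue_pi {1..n})"
    using integrable_km_density[OF assms, of n a y] by (rule borel_measurable_integrable)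
  have [measurable]: "Measurable.pred (lebesgue_pi {1..n}) (\<lambda>z. z \<in> weyl_chamber n)"
    by (rule pred_weyl_chamber) simp
  show ?thesis unfolding indicator_def by measurable
qed

lemma centred_cube_exhaust: "\<exists>r0::nat. \<forall>r\<ge>r0. z \<in> centred_cube n (real r)"
proof -
  obtain r0 :: nat where r0: "(\<Sum>i=1..n. \<bar>z i\<bar>) \<le> real r0" using real_arch_simple by blast
  have "\<bar>z i\<bar> \<le> real r0" if "i \<in> {1..n}" for i
    using member_le_sum[OF that, of "\<lambda>i. \<bar>z i\<bar>"] r0 by simp
  then show ?thesis by (intro exI[of _ r0]) (force simp: centred_cube_def)
qed

context
  fixes M :: "'w measure" and n :: nat and a x :: "nat \<Rightarrow> real" and X :: "nat \<Rightarrow> real \<Rightarrow> 'w \<Rightarrow> real"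
  assumes n: "n \<ge> 1" and ibm: "indep_brownian_motions M n a x X"
begin

interpretation prob_space M using ibm by (simp add: indep_brownian_motions_def)

lemma ibm_continuous: "\<omega> \<in> space M \<Longrightarrow> i \<in> {1..n} \<Longrightarrow> continuous_on {0..} (\<lambda>t. X i t \<omega>)"
  using ibm_component[OF n ibm] by (simp add: brownian_motion_def)

text \<open>Uncountably many times have to be reduced to countably many conditions. On a compact interval [u,
T] a path in the chamber has its gaps bounded below by some 1 / (m + 1), and by continuity such a bound need
only be checked at dyadic times. The intervals exclude 0, where the path is almost surely but perhaps not
surely in the chamber; their left endpoints u j tend to 0.\<close>

lemma survival_event_measurable:
  assumes T: "T > 0"
  shows "{\<omega> \<in> space M. ereal T < collision_time n X \<omega>} \<in> sets M"
proof -
  define u where "u j = T / (real j + 2)" for j :: nat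
  have u: "0 < u j" "u j < T" for j using T by (auto simp: u_def field_simps intro: add_pos_nonneg)
  define E where "E = {\<omega> \<in> space M. \<forall>j. \<exists>m::nat. \<forall>N k. k \<in> {..2 ^ N} \<longrightarrow> (\<forall>i\<in>{1..n}. \<forall>i'\<in>{i<..n}.
      1 / (real m + 1) \<le> X i' (u j + dyadic (T - u j) N k) \<omega> - X i (u j + dyadic (T - u j) N k) \<omega>)}"
  have "E \<in> sets M"
    unfolding E_def
  proof -
    have pm: "Measurable.pred M (\<lambda>\<omega>. c \<le> X i' t \<omega> - X i t \<omega>)" if "i \<in> {1..n}" "i' \<in> {1..n}" "t \<ge> 0" for c i i' t
    proof -
      have [measurable]: "X i t \<in> borel_measurable M" "X i' t \<in> borel_measurable M"
        using that by (auto intro: ibm_measurable[OF n ibm])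
      show ?thesis by measurable
    qed
    have "Measurable.pred M (\<lambda>\<omega>. \<forall>i\<in>{1..n}. \<forall>i'\<in>{i<..n}.
      1 / (real m + 1) \<le> X i' (u j + dyadic (T - u j) N k) \<omega> - X i (u j + dyadic (T - u j) N k) \<omega>)" for m j N k
    proof -
      have "0 \<le> u j + dyadic (T - u j) N k" using u[of j] by (auto simp: dyadic_def)
      then show ?thesis by (intro pred_intros_finite pm) auto
    qed
    note [measurable] = this
    show "{\<omega> \<in> space M. \<forall>j. \<exists>m::nat. \<forall>N k. k \<in> {..2 ^ N} \<longrightarrow> (\<forall>i\<in>{1..n}. \<forall>i'\<in>{i<..n}.
      1 / (real m + 1) \<le> X i' (u j + dyadic (T - u j) N k) \<omega> - X i (u j + dyadic (T - u j) N k) \<omega>)} \<in> sets M"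
      by measurable
  qed
  moreover have "{\<omega> \<in> space M. ereal T < collision_time n X \<omega>} = E"
  proof (intro Set.set_eqI iffI)
    fix \<omega> assume \<omega>: "\<omega> \<in> {\<omega> \<in> space M. ereal T < collision_time n X \<omega>}"
    then have sp: "\<omega> \<in> space M" by simp
    have st: "\<And>s. 0 < s \<Longrightarrow> s \<le> T \<Longrightarrow> (\<lambda>i. X i s \<omega>) \<in> weyl_chamber n"
      using \<omega> collision_time_greater_iff[of n X \<omega> T, OF ibm_continuous[OF sp] T] by auto
    have "\<exists>m::nat. \<forall>N k. k \<in> {..2 ^ N} \<longrightarrow> (\<forall>i\<in>{1..n}. \<forall>i'\<in>{i<..n}.
      1 / (real m + 1) \<le> X i' (u j + dyadic (T - u j) N k) \<omega> - X i (u j + dyadic (T - u j) N k) \<omega>)" for j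
    proof -
      have "\<exists>e>0. \<forall>s\<in>{u j..T}. e \<le> X i' s \<omega> - X i s \<omega>" if "i \<in> {1..n}" "i' \<in> {i<..n}" for i i'
      proof -
        have co: "continuous_on {u j..T} (\<lambda>s. X i' s \<omega> - X i s \<omega>)"
          using ibm_continuous[OF sp, of i] ibm_continuous[OF sp, of i'] u[of j] that
          by (intro continuous_on_diff) (auto elim!: continuous_on_subset)
        obtain s0 where s0: "s0 \<in> {u j..T}" "\<forall>s\<in>{u j..T}. X i' s0 \<omega> - X i s0 \<omega> \<le> X i' s \<omega> - X i s \<omega>"
          using continuous_attains_inf[OF compact_Icc _ co] u[of j] by force
        have "X i s0 \<omega> < X i' s0 \<omega>" using st[of s0] s0(1) u[of j] that by (auto simp: weyl_chamber_def)
        then show ?thesis using s0(2) by (intro exI[of _ "X i' s0 \<omega> - X i s0 \<omega>"]) auto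
      qed
      then obtain e where e: "\<And>i i'. i \<in> {1..n} \<Longrightarrow> i' \<in> {i<..n} \<Longrightarrow> e i i' > 0 \<and> (\<forall>s\<in>{u j..T}. e i i' \<le> X i' s \<omega> - X i s \<omega>)"
        by metis
      \<comment> \<open>The element 1 only serves to make the finite set of lower bounds nonempty, for n = 1.\<close>
      define F where "F = insert 1 ((\<lambda>(i, i'). e i i') ` (SIGMA i:{1..n}. {i<..n}))"
      have F: "finite F" "F \<noteq> {}" "\<And>y. y \<in> F \<Longrightarrow> y > 0" using e by (auto simp: F_def)
      then have "Min F > 0" by simp
      then obtain m :: nat where m: "1 / (real m + 1) < Min F"
        using reals_Archimedean[of "Min F"] by (auto simp: inverse_eq_divide add.commute)
      show ?thesis
      proof (intro exI allI impI ballI)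
        fix N k i i' :: nat assume k: "k \<in> {..2 ^ N}" and i: "i \<in> {1..n}" "i' \<in> {i<..n}"
        have "u j + dyadic (T - u j) N k \<in> {u j..T}"
          using dyadic_bounds[of "T - u j" k N] k u[of j] by auto
        moreover have "e i i' \<in> F"
          unfolding F_def using i by (intro insertI2 image_eqI[where x="(i, i')"]) auto
        then have "Min F \<le> e i i'" using F by simp
        ultimately show "1 / (real m + 1) \<le> X i' (u j + dyadic (T - u j) N k) \<omega> - X i (u j + dyadic (T - u j) N k) \<omega>"
          using e[OF i] m by fastforce
      qed
    qed
    then show "\<omega> \<in> E" using sp by (simp add: E_def)
  next
    fix \<omega> assume \<omega>: "\<omega> \<in> E"
    then have sp: "\<omega> \<in> space M" by (simp add: E_def)
    have "X i s \<omega> < X i' s \<omega>" if s: "0 < s" "s \<le> T" and i: "i \<in> {1..n}" "i' \<in> {i<..n}" for s i i'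
    proof -
      obtain j :: nat where "T / s < real j" using reals_Archimedean2 by blast
      then have "T < s * (real j + 2)" using s by (simp add: field_simps)
      then have uj: "u j \<le> s" by (simp add: u_def field_simps)
      obtain m :: nat where m: "\<And>N k. k \<le> 2 ^ N \<Longrightarrow> 1 / (real m + 1) \<le> X i' (u j + dyadic (T - u j) N k) \<omega> - X i (u j + dyadic (T - u j) N k) \<omega>"
        using \<omega> i unfolding E_def by fastforce
      have "1 / (real m + 1) \<le> X i' (u j + (s - u j)) \<omega> - X i (u j + (s - u j)) \<omega>"
      proof (rule dyadic_bound_continuous[where f="\<lambda>r. X i' (u j + r) \<omega> - X i (u j + r) \<omega>" and T="T - u j"])
        show "continuous_on {0..} (\<lambda>r. X i' (u j + r) \<omega> - X i (u j + r) \<omega>)"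
          using u[of j] i by (intro continuous_on_diff continuous_on_compose2[OF ibm_continuous[OF sp]] continuous_intros) auto
      qed (use m uj s u[of j] in auto)
      moreover have "0 < 1 / (real m + 1)" by simp
      moreover have "u j + (s - u j) = s" by simp
      ultimately show ?thesis by (metis diff_gt_0_iff_gt less_le_trans)
    qed
    then have "\<forall>s. 0 < s \<and> s \<le> T \<longrightarrow> (\<lambda>i. X i s \<omega>) \<in> weyl_chamber n" by (auto simp: weyl_chamber_def)
    then show "\<omega> \<in> {\<omega> \<in> space M. ereal T < collision_time n X \<omega>}"
      using collision_time_greater_iff[of n X \<omega> T, OF ibm_continuous[OF sp] T] sp by auto
  qed
  ultimately show ?thesis by simp
qed

text \<open>Order at dyadic times only yields weak inequalities at the other times. Therefore the process is
shifted by -\<epsilon> i in coordinate i: if the shifted path is ordered at dyadic times, then the gaps of the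
original path are at least \<epsilon> there, and hence always. The limit \<epsilon> \<rightarrow> 0 is taken
in the starting point.\<close>

lemma reflected_mean_le_survival:
  assumes T: "T > 0" and x: "x \<in> weyl_chamber n"
  shows "reflected_mean n a R T x \<le> prob {\<omega> \<in> space M. ereal T < collision_time n X \<omega>}"
proof -
  define e where "e N = 1 / (real N + 1)" for N
  have e: "e N > 0" for N by (simp add: e_def)
  have elim: "e \<longlonglongrightarrow> 0" unfolding e_def[abs_def] using LIMSEQ_inverse_real_of_nat by (simp add: inverse_eq_divide add.commute)
  have xlim: "(\<lambda>N. x i - e N * real i) \<longlonglongrightarrow> x i" for i
    using tendsto_diff[OF tendsto_const tendsto_mult_left_zero[OF elim], of "x i" "real i"] by simp
  have "(\<lambda>N. reflected_mean n a R T (\<lambda>i. x i - e N * real i)) \<longlonglongrightarrow> reflected_mean n a R T x"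
    by (rule reflected_mean_continuous[OF tendsto_const T xlim])
  moreover have "eventually (\<lambda>N. \<forall>i\<in>{1..n}. \<forall>j\<in>{i<..n}. x i - e N * real i < x j - e N * real j) sequentially"
  proof (intro eventually_ball_finite ballI)
    fix i j assume "i \<in> {1..n}" "j \<in> {i<..n}"
    then have "x j - x i > 0" using x by (auto simp: weyl_chamber_def)
    moreover have "(\<lambda>N. (x j - e N * real j) - (x i - e N * real i)) \<longlonglongrightarrow> x j - x i"
      by (intro tendsto_diff xlim)
    ultimately have "eventually (\<lambda>N. (x j - e N * real j) - (x i - e N * real i) > 0) sequentially"
      by (intro order_tendstoD(1))
    then show "eventually (\<lambda>N. x i - e N * real i < x j - e N * real j) sequentially" by eventually_elim simp
  qed auto
  then have "eventually (\<lambda>N. reflected_mean n a R T (\<lambda>i. x i - e N * real i) \<le> prob {\<omega> \<in> space M. ereal T < collision_time n X \<omega>}) sequentially"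
  proof eventually_elim
    case (elim N)
    let ?X = "\<lambda>i t \<omega>. X i t \<omega> - e N * real i"
    have xN: "(\<lambda>i. x i - e N * real i) \<in> weyl_chamber n" using elim by (auto simp: weyl_chamber_def)
    have "reflected_mean n a R T (\<lambda>i. x i - e N * real i)
      = prob {\<omega> \<in> space M. (\<forall>N'. \<forall>k\<le>2 ^ N'. (\<lambda>i. ?X i (dyadic T N' k) \<omega>) \<in> weyl_chamber n) \<and> (\<lambda>i. ?X i T \<omega>) \<in> centred_cube n R}"
      using ibm_dyadic_survival[OF n indep_brownian_motions_shift[OF ibm, of "\<lambda>i. e N * real i"] T xN] by simp
    also have "\<dots> \<le> prob {\<omega> \<in> space M. ereal T < collision_time n X \<omega>}"
    proof (rule finite_measure_mono[OF subsetI survival_event_measurable[OF T]])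
      fix \<omega> assume \<omega>: "\<omega> \<in> {\<omega> \<in> space M. (\<forall>N'. \<forall>k\<le>2 ^ N'. (\<lambda>i. ?X i (dyadic T N' k) \<omega>) \<in> weyl_chamber n) \<and> (\<lambda>i. ?X i T \<omega>) \<in> centred_cube n R}"
      then have sp: "\<omega> \<in> space M" by simp
      have "X i s \<omega> < X j s \<omega>" if s: "0 < s" "s \<le> T" and ij: "1 \<le> i" "i < j" "j \<le> n" for s i j
      proof -
        have "e N * (real j - real i) \<le> X j s \<omega> - X i s \<omega>"
        proof (rule dyadic_bound_continuous[where f="\<lambda>s. X j s \<omega> - X i s \<omega>" and T=T, OF T])
          show "continuous_on {0..} (\<lambda>s. X j s \<omega> - X i s \<omega>)"
            using ij by (intro continuous_on_diff ibm_continuous[OF sp]) auto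
          fix N' k :: nat assume "k \<le> 2 ^ N'"
          then have "(\<lambda>i. ?X i (dyadic T N' k) \<omega>) \<in> weyl_chamber n" using \<omega> by blast
          then have "?X i (dyadic T N' k) \<omega> < ?X j (dyadic T N' k) \<omega>" using ij by (auto simp: weyl_chamber_def)
          then show "e N * (real j - real i) \<le> X j (dyadic T N' k) \<omega> - X i (dyadic T N' k) \<omega>"
            by (simp add: algebra_simps)
        qed (use s in auto)
        moreover have "e N * (real j - real i) > 0" using ij e[of N] by simp
        ultimately show ?thesis by linarith
      qed
      then have "\<forall>s. 0 < s \<and> s \<le> T \<longrightarrow> (\<lambda>i. X i s \<omega>) \<in> weyl_chamber n" by (auto simp: weyl_chamber_def)
      then show "\<omega> \<in> {\<omega> \<in> space M. ereal T < collision_time n X \<omega>}"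
        using collision_time_greater_iff[of n X \<omega> T, OF ibm_continuous[OF sp] T] sp by auto
    qed
    finally show ?case .
  qed
  then have "\<exists>N0. \<forall>N\<ge>N0. reflected_mean n a R T (\<lambda>i. x i - e N * real i) \<le> prob {\<omega> \<in> space M. ereal T < collision_time n X \<omega>}"
    by (simp add: eventually_sequentially)
  ultimately show ?thesis by (rule LIMSEQ_le_const2)
qed

text \<open>The Karlin--McGregor formula with drift. Survival implies survival on the grids, and the converse
inequality holds by the shift above; it remains to let the cubes exhaust the space.\<close>

theorem survival_probability:
  assumes T: "T > 0" and x: "x \<in> weyl_chamber n"
  shows "prob {\<omega> \<in> space M. ereal T < collision_time n X \<omega>}
     = (\<integral>z. indicator (weyl_chamber n) z * km_density n a T x z \<partial>lebesgue_pi {1..n})"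
proof -
  let ?A = "{\<omega> \<in> space M. ereal T < collision_time n X \<omega>}"
  let ?P = "lebesgue_pi {1..n}"
  define A where "A r = {\<omega> \<in> ?A. (\<lambda>i. X i T \<omega>) \<in> centred_cube n (real r)}" for r :: nat
  note Am[measurable] = survival_event_measurable[OF T]
  have bm[measurable]: "Measurable.pred M (\<lambda>\<omega>. (\<lambda>i. X i T \<omega>) \<in> centred_cube n R)" for R
    using T by (intro ibm_cube_measurable[OF n ibm]) simp
  have Ar: "A r \<in> sets M" for r
  proof -
    have "A r = ?A \<inter> {\<omega> \<in> space M. (\<lambda>i. X i T \<omega>) \<in> centred_cube n (real r)}" by (auto simp: A_def)
    then show ?thesis using Am bm[unfolded pred_def] by simp
  qed
  have "(\<lambda>r. prob (A r)) \<longlonglongrightarrow> prob (\<Union>r. A r)"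
  proof (rule finite_Lim_measure_incseq)
    show "incseq A" by (rule incseq_SucI) (force simp: A_def centred_cube_def)
  qed (use Ar in auto)
  also have "(\<Union>r. A r) = ?A"
  proof -
    have "\<exists>r::nat. (\<lambda>i. X i T \<omega>) \<in> centred_cube n (real r)" for \<omega>
      using centred_cube_exhaust[of "\<lambda>i. X i T \<omega>" n] by blast
    then show ?thesis by (auto simp: A_def)
  qed
  finally have lim1: "(\<lambda>r. prob (A r)) \<longlonglongrightarrow> prob ?A" .
  have lower: "prob (A r) \<le> reflected_mean n a (real r) T x" for r
  proof -
    let ?D = "{\<omega> \<in> space M. (\<forall>N. \<forall>k\<le>2 ^ N. (\<lambda>i. X i (dyadic T N k) \<omega>) \<in> weyl_chamber n) \<and> (\<lambda>i. X i T \<omega>) \<in> centred_cube n (real r)}"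
    have Dm: "?D \<in> sets M"
    proof -
      have [measurable]: "Measurable.pred M (\<lambda>\<omega>. (\<lambda>i. X i (dyadic T N k) \<omega>) \<in> weyl_chamber n)" for N k
        using T by (intro ibm_chamber_measurable[OF n ibm]) (simp add: dyadic_def)
      show ?thesis by measurable
    qed
    have "prob (A r) \<le> prob ?D"
    proof (rule finite_measure_mono_AE[OF _ Dm])
      show "AE \<omega> in M. \<omega> \<in> A r \<longrightarrow> \<omega> \<in> ?D"
        using ibm_start[OF n ibm] AE_space
      proof eventually_elim
        case (elim \<omega>)
        show ?case
        proof
          assume \<omega>: "\<omega> \<in> A r"
          then have st: "(\<lambda>i. X i s \<omega>) \<in> weyl_chamber n" if "0 < s" "s \<le> T" for s
            using collision_time_greater_iff[of n X \<omega> T, OF ibm_continuous[OF elim(2)] T] that by (auto simp: A_def)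
          have 0: "(\<lambda>i. X i 0 \<omega>) \<in> weyl_chamber n"
            using x elim(1) by (subst weyl_chamber_cong[where z=x]) auto
          have "(\<lambda>i. X i (dyadic T N k) \<omega>) \<in> weyl_chamber n" if "k \<le> 2 ^ N" for N k
          proof (cases "k = 0")
            case False
            show ?thesis using False T dyadic_bounds[OF _ that, of T] by (intro st) (auto simp: dyadic_def)
          qed (use 0 in simp)
          then show "\<omega> \<in> ?D" using \<omega> by (auto simp: A_def)
        qed
      qed
    qed
    then show ?thesis using ibm_dyadic_survival[OF n ibm T x] by simp
  qed
  have "(\<lambda>r. reflected_mean n a (real r) T x) \<longlonglongrightarrow> prob ?A"
    by (rule tendsto_sandwich[OF _ _ lim1 tendsto_const])
       (auto intro!: always_eventually lower reflected_mean_le_survival[OF T x])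
  moreover have "(\<lambda>r. reflected_mean n a (real r) T x) \<longlonglongrightarrow> (\<integral>z. indicator (weyl_chamber n) z * km_density n a T x z \<partial>?P)"
    unfolding reflected_mean_def integral_reflected_weight[OF T]
  proof (rule integral_dominated_convergence)
    note density_m[measurable] = borel_measurable_chamber_density[OF T, of n a x] and pred_centred_cube[measurable]
    show "(\<lambda>z. indicator (weyl_chamber n) z * km_density n a T x z) \<in> borel_measurable ?P" by measurable
    have "(\<lambda>z. of_bool (z \<in> centred_cube n (real r)) * (indicator (weyl_chamber n) z * km_density n a T x z)) \<in> borel_measurable ?P" for r :: nat
      unfolding of_bool_def by measurable
    then show "(\<lambda>z. indicator (weyl_chamber n \<inter> centred_cube n (real r)) z * km_density n a T x z) \<in> borel_measurable ?P" for r :: nat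
      by (simp add: indicator_def of_bool_conj mult_ac)
    show "integrable ?P (\<lambda>z. \<bar>km_density n a T x z\<bar>)" by (intro integrable_abs integrable_km_density[OF T])
    show "AE z in ?P. norm (indicator (weyl_chamber n \<inter> centred_cube n (real r)) z * km_density n a T x z) \<le> \<bar>km_density n a T x z\<bar>" for r :: nat
      by (auto simp: indicator_def)
    show "AE z in ?P. (\<lambda>r. indicator (weyl_chamber n \<inter> centred_cube n (real r)) z * km_density n a T x z)
       \<longlonglongrightarrow> indicator (weyl_chamber n) z * km_density n a T x z"
    proof (rule AE_I2)
      fix z
      obtain r0 where "\<And>r. r \<ge> r0 \<Longrightarrow> z \<in> centred_cube n (real r)" using centred_cube_exhaust[of z n] by blast
      then have "eventually (\<lambda>r. indicator (weyl_chamber n) z * km_density n a T x z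
          = indicator (weyl_chamber n \<inter> centred_cube n (real r)) z * km_density n a T x z) sequentially"
        by (intro eventually_sequentiallyI[of r0]) (auto simp: indicator_def)
      then show "(\<lambda>r. indicator (weyl_chamber n \<inter> centred_cube n (real r)) z * km_density n a T x z)
         \<longlonglongrightarrow> indicator (weyl_chamber n) z * km_density n a T x z"
        by (rule Lim_transform_eventually[OF tendsto_const])
    qed
  qed
  ultimately show ?thesis by (rule LIMSEQ_unique)
qed

end

section \<open>Divided differences\<close>

lemma rolle_zero_count:
  fixes f f' :: "real \<Rightarrow> real"
  assumes der: "\<And>x. (f has_real_derivative f' x) (at x)"
    and "finite Z" "Z \<noteq> {}" "\<And>z. z \<in> Z \<Longrightarrow> f z = 0"
  shows "\<exists>Z'. finite Z' \<and> card Z = Suc (card Z') \<and> Z' \<subseteq> {Min Z..Max Z} \<and> (\<forall>z\<in>Z'. f' z = 0)"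
  using assms(2-)
proof (induction Z rule: finite_linorder_max_induct)
  case (insert b A)
  show ?case
  proof (cases "A = {}")
    case True
    then show ?thesis by (intro exI[of _ "{}"]) auto
  next
    case False
    then obtain Z' where Z': "finite Z'" "card A = Suc (card Z')" "Z' \<subseteq> {Min A..Max A}" "\<forall>z\<in>Z'. f' z = 0"
      using insert by (metis insertCI)
    have lt: "Max A < b" using insert(2) False \<open>finite A\<close> by simp
    have "continuous_on {Max A..b} f"
      using der by (meson DERIV_isCont continuous_at_imp_continuous_on)
    moreover have "f (Max A) = f b" using insert.prems(2) False \<open>finite A\<close> by simp
    ultimately have "\<exists>z>Max A. z < b \<and> (f has_real_derivative 0) (at z)"
      using lt der by (intro Rolle) (auto simp: real_differentiable_def)
    then obtain z where z: "Max A < z" "z < b" "f' z = 0" using DERIV_unique[OF der] by metis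
    have Mi: "Min (insert b A) = Min A" using lt False \<open>finite A\<close>
      by (metis Max_ge Min_in Min_insert linorder_not_le min.absorb2 order.strict_implies_order order_le_less_trans)
    have Ma: "Max (insert b A) = b" using insert(2) \<open>finite A\<close> by (intro Max_eqI) auto
    have MM: "Min A \<le> Max A" using False \<open>finite A\<close> by simp
    have "z \<notin> Z'" using z Z'(3) by auto
    moreover have "b \<notin> A" using insert(2) by blast
    ultimately show ?thesis
      using Z' z lt MM \<open>finite A\<close> unfolding Mi Ma
      by (intro exI[of _ "insert z Z'"]) (auto intro: order_trans)
  qed
qed simp

lemma rolle_iterated:
  fixes F :: "nat \<Rightarrow> real \<Rightarrow> real"
  assumes der: "\<And>j x. (F j has_real_derivative F (Suc j) x) (at x)"
    and "finite Z" "card Z = Suc k" "Z \<subseteq> {a..b}" "\<And>z. z \<in> Z \<Longrightarrow> F 0 z = 0"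
  shows "\<exists>z\<in>{a..b}. F k z = 0"
  using assms
proof (induction k arbitrary: F Z)
  case 0
  then show ?case by (metis card_1_singletonE One_nat_def insertI1 subset_iff)
next
  case (Suc k)
  have ne: "Z \<noteq> {}" using Suc.prems(3) by auto
  obtain Z' where Z': "finite Z'" "card Z = Suc (card Z')" "Z' \<subseteq> {Min Z..Max Z}" "\<forall>z\<in>Z'. F 1 z = 0"
    using rolle_zero_count[of "F 0" "F 1" Z] Suc.prems ne by (auto simp: One_nat_def)
  have "Min Z \<in> {a..b}" "Max Z \<in> {a..b}" using Suc.prems ne by (meson Min_in Max_in subset_iff)+
  then have "Z' \<subseteq> {a..b}" using Z'(3) by fastforce
  then show ?case
    using Suc.IH[of "\<lambda>j. F (Suc j)" Z'] Suc.prems Z' by (simp add: One_nat_def)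
qed

text \<open>Lagrange's form of the divided difference at the nodes s l, for l in I.\<close>

definition divdiff :: "(real \<Rightarrow> real) \<Rightarrow> (nat \<Rightarrow> real) \<Rightarrow> nat set \<Rightarrow> real" where
  "divdiff f s I = (\<Sum>l\<in>I. f (s l) / (\<Prod>p\<in>I - {l}. s l - s p))"

text \<open>Subtract the interpolating polynomial P: the difference has k + 1 zeros, so its k-th derivative
has one. The k-th derivative of P is the constant k! times its leading coefficient, the divided
difference.\<close>

lemma divdiff_mean_value:
  fixes F :: "nat \<Rightarrow> real \<Rightarrow> real"
  assumes der: "\<And>j x. (F j has_real_derivative F (Suc j) x) (at x)"
    and I: "finite I" "card I = Suc k" and inj: "inj_on s I" and ab: "\<And>l. l \<in> I \<Longrightarrow> s l \<in> {a..b}"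
  shows "\<exists>z\<in>{a..b}. divdiff (F 0) s I = F k z / fact k"
proof -
  define q where "q l = (\<Prod>p\<in>I - {l}. [:- s p, 1:])" for l
  define P where "P = (\<Sum>l\<in>I. Polynomial.smult (F 0 (s l) / (\<Prod>p\<in>I - {l}. s l - s p)) (q l))"
  have degq: "Polynomial.degree (q l) = k" and leadq: "Polynomial.coeff (q l) k = 1" if "l \<in> I" for l
  proof -
    have "Polynomial.degree (q l) = (\<Sum>p\<in>I - {l}. Polynomial.degree [:- s p, 1:])"
      unfolding q_def by (rule degree_prod_eq_sum_degree) simp
    also have "\<dots> = k" using I that by simp
    finally show d: "Polynomial.degree (q l) = k" .
    have "lead_coeff (q l) = (\<Prod>p\<in>I - {l}. lead_coeff [:- s p, 1:])"
      unfolding q_def by (rule lead_coeff_prod)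
    then show "Polynomial.coeff (q l) k = 1" using d by simp
  qed
  have degP: "Polynomial.degree P \<le> k"
    unfolding P_def by (rule degree_sum_le) (use I degq in \<open>auto intro: order_trans[OF degree_smult_le]\<close>)
  have coeffP: "Polynomial.coeff P k = divdiff (F 0) s I"
    unfolding P_def divdiff_def by (simp add: coeff_sum leadq cong: sum.cong)
  have evalP: "poly P (s r) = F 0 (s r)" if r: "r \<in> I" for r
  proof -
    have z: "poly (q l) (s r) = 0" if "l \<in> I" "l \<noteq> r" for l
      unfolding q_def poly_prod using r that I by (intro prod_zero) auto
    have nz: "(\<Prod>p\<in>I - {r}. s r - s p) \<noteq> 0"
      using I inj r by (auto simp: inj_on_def)
    have "poly P (s r) = (\<Sum>l\<in>I. F 0 (s l) / (\<Prod>p\<in>I - {l}. s l - s p) * poly (q l) (s r))"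
      unfolding P_def by (simp add: poly_sum)
    also have "\<dots> = (\<Sum>l\<in>I. if l = r then F 0 (s r) else 0)"
    proof (rule sum.cong[OF refl])
      fix l assume l: "l \<in> I"
      show "F 0 (s l) / (\<Prod>p\<in>I - {l}. s l - s p) * poly (q l) (s r) = (if l = r then F 0 (s r) else 0)"
      proof (cases "l = r")
        case True
        then show ?thesis using nz by (simp add: q_def poly_prod)
      qed (use z[OF l] in simp)
    qed
    also have "\<dots> = F 0 (s r)" using I r by simp
    finally show ?thesis .
  qed
  define G where "G j x = F j x - poly ((pderiv ^^ j) P) x" for j x
  have "\<exists>z\<in>{a..b}. G k z = 0"
  proof (rule rolle_iterated)
    show "(G j has_real_derivative G (Suc j) x) (at x)" for j x
      unfolding G_def by (auto intro!: derivative_eq_intros der poly_DERIV)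
    show "finite (s ` I)" "card (s ` I) = Suc k" using I inj by (auto simp: card_image)
    show "s ` I \<subseteq> {a..b}" using ab by auto
    show "G 0 z = 0" if "z \<in> s ` I" for z using that evalP by (auto simp: G_def)
  qed
  then obtain z where z: "z \<in> {a..b}" "G k z = 0" by blast
  have "Polynomial.degree ((pderiv ^^ k) P) = 0" using degP by (simp add: degree_higher_pderiv)
  then obtain c where "(pderiv ^^ k) P = [:c:]" by (rule degree_eq_zeroE)
  then have "poly ((pderiv ^^ k) P) z = Polynomial.coeff ((pderiv ^^ k) P) 0"
    by simp
  also have "\<dots> = fact k * divdiff (F 0) s I"
    by (simp add: coeff_higher_pderiv coeffP pochhammer_fact)
  finally show ?thesis using z by (intro bexI[of _ z]) (auto simp: G_def)
qed

lemma divdiff_exp: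
  assumes I: "finite I" "card I = Suc k" and inj: "inj_on s I" and ab: "\<And>l. l \<in> I \<Longrightarrow> s l \<in> {a..b}"
  shows "\<exists>z\<in>{a..b}. divdiff (\<lambda>r. exp (c * r)) s I = c ^ k * exp (c * z) / fact k"
proof -
  have "((\<lambda>r. c ^ j * exp (c * r)) has_real_derivative c ^ Suc j * exp (c * z)) (at z)" for j z
    by (auto intro!: derivative_eq_intros)
  from divdiff_mean_value[where F="\<lambda>j r. c ^ j * exp (c * r)", OF this I inj ab] show ?thesis by simp
qed

text \<open>Replacing the column at s j by the divided difference over {g j..j} is multiplication by an upper
triangular matrix, whose diagonal holds the inverse products of the differences.\<close>

lemma leibniz_divdiff:
  assumes g: "\<And>j. j \<in> {1..n} \<Longrightarrow> 1 \<le> g j \<and> g j \<le> j"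
    and inj: "\<And>j. j \<in> {1..n} \<Longrightarrow> inj_on s {g j..j}"
  shows "leibniz n (\<lambda>i j. \<phi> i (s j))
    = (\<Prod>j=1..n. \<Prod>p=g j..<j. s j - s p) * leibniz n (\<lambda>i j. divdiff (\<phi> i) s {g j..j})"
proof -
  \<comment> \<open>Column j of u holds the coefficients of the divided difference over {g j..j}.\<close>
  define u where "u l j = (if g j \<le> l \<and> l \<le> j then 1 / (\<Prod>p\<in>{g j..j} - {l}. s l - s p) else 0)" for l j
  let ?A = "Matrix.mat n n (\<lambda>(r, c). \<phi> (Suc r) (s (Suc c)))"
  let ?U = "Matrix.mat n n (\<lambda>(r, c). u (Suc r) (Suc c))"
  let ?B = "Matrix.mat n n (\<lambda>(r, c). divdiff (\<phi> (Suc r)) s {g (Suc c)..Suc c})"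
  have "?A * ?U = ?B"
  proof (rule eq_matI)
    fix r c assume "r < dim_row ?B" "c < dim_col ?B"
    then have rc: "r < n" "c < n" by auto
    have gc: "1 \<le> g (Suc c)" "g (Suc c) \<le> Suc c" using g[of "Suc c"] rc by auto
    have "(?A * ?U) $$ (r, c) = (\<Sum>l=0..<n. \<phi> (Suc r) (s (Suc l)) * u (Suc l) (Suc c))"
      using rc by (simp add: scalar_prod_def)
    also have "\<dots> = (\<Sum>l=1..n. \<phi> (Suc r) (s l) * u l (Suc c))"
      by (rule sum.reindex_bij_witness[of _ "\<lambda>l. l - 1" Suc]) (auto simp: One_nat_def)
    also have "\<dots> = (\<Sum>l\<in>{g (Suc c)..Suc c}. \<phi> (Suc r) (s l) * u l (Suc c))"
      by (rule sum.mono_neutral_right) (use gc rc in \<open>auto simp: u_def\<close>)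
    also have "\<dots> = divdiff (\<phi> (Suc r)) s {g (Suc c)..Suc c}"
      unfolding divdiff_def by (rule sum.cong) (auto simp: u_def)
    finally show "(?A * ?U) $$ (r, c) = ?B $$ (r, c)" using rc by simp
  qed auto
  then have "Determinant.det ?A * Determinant.det ?U = Determinant.det ?B"
    by (subst det_mult[symmetric]) auto
  moreover have "Determinant.det ?U = (\<Prod>j=1..n. 1 / (\<Prod>p=g j..<j. s j - s p))"
  proof -
    have "upper_triangular ?U"
      by (auto simp: upper_triangular_def u_def)
    then have "Determinant.det ?U = prod_list (diag_mat ?U)"
      by (rule det_upper_triangular) auto
    also have "\<dots> = (\<Prod>j=0..<n. u (Suc j) (Suc j))"
      by (simp add: prod_list_diag_prod)
    also have "\<dots> = (\<Prod>j=1..n. u j j)"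
      by (rule prod.reindex_bij_witness[of _ "\<lambda>l. l - 1" Suc]) (auto simp: One_nat_def)
    also have "\<dots> = (\<Prod>j=1..n. 1 / (\<Prod>p=g j..<j. s j - s p))"
    proof (rule prod.cong[OF refl])
      fix j assume j: "j \<in> {1..n}"
      have "{g j..j} - {j} = {g j..<j}" by auto
      then show "u j j = 1 / (\<Prod>p=g j..<j. s j - s p)" using g[OF j] by (simp add: u_def)
    qed
    finally show ?thesis .
  qed
  moreover have "(\<Prod>j=1..n. 1 / (\<Prod>p=g j..<j. s j - s p)) * (\<Prod>j=1..n. \<Prod>p=g j..<j. s j - s p) = 1"
  proof -
    have "(\<Prod>p=g j..<j. s j - s p) \<noteq> 0" if j: "j \<in> {1..n}" for j
      using inj_onD[OF inj[OF j], of j] g[OF j] by force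
    then show ?thesis by (simp add: prod.distrib[symmetric])
  qed
  moreover have "A = v * B" if "A * U = B" "U = u" "u * v = 1" for A U B u v :: real
    using that by (metis mult.assoc mult.commute mult.right_neutral)
  ultimately have "Determinant.det ?A = (\<Prod>j=1..n. \<Prod>p=g j..<j. s j - s p) * Determinant.det ?B"
    by blast
  then show ?thesis unfolding leibniz_eq_det .
qed

section \<open>Zeros of exponential polynomials\<close>

text \<open>Dividing by one of the exponentials and differentiating lowers the degree of its coefficient and
keeps the other degrees, so the right-hand side drops by one. By Rolle the number of zeros drops by at most
one.\<close>

lemma exp_poly_zero_count:
  fixes p :: "real \<Rightarrow> real poly"
  assumes "finite \<Lambda>" "\<Lambda> \<noteq> {}" "\<And>\<theta>. \<theta> \<in> \<Lambda> \<Longrightarrow> p \<theta> \<noteq> 0"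
    and "finite Z" "\<And>z. z \<in> Z \<Longrightarrow> (\<Sum>\<theta>\<in>\<Lambda>. poly (p \<theta>) z * exp (\<theta> * z)) = 0"
  shows "card Z < (\<Sum>\<theta>\<in>\<Lambda>. Suc (Polynomial.degree (p \<theta>)))"
  using assms
proof (induction "\<Sum>\<theta>\<in>\<Lambda>. Suc (Polynomial.degree (p \<theta>))" arbitrary: \<Lambda> p Z rule: less_induct)
  case less
  obtain \<mu> where \<mu>: "\<mu> \<in> \<Lambda>" using less.prems(2) by blast
  define \<phi> where "\<phi> z = exp (- \<mu> * z) * (\<Sum>\<theta>\<in>\<Lambda>. poly (p \<theta>) z * exp (\<theta> * z))" for z
  \<comment> \<open>The derivative of \<phi> is exp (- \<mu> * z) times the exponential polynomial with coefficients p'.\<close>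
  define p' where "p' \<theta> = pderiv (p \<theta>) + Polynomial.smult (\<theta> - \<mu>) (p \<theta>)" for \<theta>
  define \<Lambda>' where "\<Lambda>' = {\<theta>\<in>\<Lambda>. p' \<theta> \<noteq> 0}"
  have fin: "finite \<Lambda>'" using less.prems(1) by (simp add: \<Lambda>'_def)
  have der: "(\<phi> has_real_derivative exp (- \<mu> * z) * (\<Sum>\<theta>\<in>\<Lambda>. poly (p' \<theta>) z * exp (\<theta> * z))) (at z)" for z
  proof -
    have "(\<phi> has_real_derivative (- \<mu> * exp (- \<mu> * z)) * (\<Sum>\<theta>\<in>\<Lambda>. poly (p \<theta>) z * exp (\<theta> * z))
       + exp (- \<mu> * z) * (\<Sum>\<theta>\<in>\<Lambda>. poly (pderiv (p \<theta>)) z * exp (\<theta> * z) + poly (p \<theta>) z * (\<theta> * exp (\<theta> * z)))) (at z)"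
      unfolding \<phi>_def by (rule derivative_eq_intros DERIV_sum poly_DERIV refl | simp add: algebra_simps sum_distrib_left)+
    moreover have "(- \<mu> * exp (- \<mu> * z)) * (\<Sum>\<theta>\<in>\<Lambda>. poly (p \<theta>) z * exp (\<theta> * z))
       + exp (- \<mu> * z) * (\<Sum>\<theta>\<in>\<Lambda>. poly (pderiv (p \<theta>)) z * exp (\<theta> * z) + poly (p \<theta>) z * (\<theta> * exp (\<theta> * z)))
      = exp (- \<mu> * z) * (\<Sum>\<theta>\<in>\<Lambda>. poly (p' \<theta>) z * exp (\<theta> * z))"
      unfolding p'_def by (simp add: sum_distrib_left sum.distrib[symmetric] algebra_simps)
    ultimately show ?thesis by simp
  qed
  have sum': "(\<Sum>\<theta>\<in>\<Lambda>. poly (p' \<theta>) z * exp (\<theta> * z)) = (\<Sum>\<theta>\<in>\<Lambda>'. poly (p' \<theta>) z * exp (\<theta> * z))" for z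
    by (rule sum.mono_neutral_right) (use less.prems(1) in \<open>auto simp: \<Lambda>'_def\<close>)
  have deg: "Polynomial.degree (p' \<theta>) = Polynomial.degree (p \<theta>) \<and> p' \<theta> \<noteq> 0" if "\<theta> \<in> \<Lambda>" "\<theta> \<noteq> \<mu>" for \<theta>
  proof -
    have "Polynomial.coeff (p' \<theta>) (Polynomial.degree (p \<theta>)) = (\<theta> - \<mu>) * lead_coeff (p \<theta>)"
      by (simp add: p'_def coeff_pderiv coeff_eq_0)
    then have "Polynomial.coeff (p' \<theta>) (Polynomial.degree (p \<theta>)) \<noteq> 0" using that less.prems(3) by simp
    moreover have "Polynomial.degree (p' \<theta>) \<le> Polynomial.degree (p \<theta>)"
      unfolding p'_def by (rule degree_add_le) (auto simp: degree_pderiv intro: degree_smult_le)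
    ultimately show ?thesis using le_degree by force
  qed
  have degmu: "Polynomial.degree (p' \<mu>) = Polynomial.degree (p \<mu>) - 1" "p' \<mu> \<noteq> 0 \<longleftrightarrow> Polynomial.degree (p \<mu>) \<noteq> 0"
    by (auto simp: p'_def degree_pderiv pderiv_eq_0_iff)
  have split: "(\<Sum>\<theta>\<in>\<Lambda>. Suc (Polynomial.degree (p \<theta>))) = Suc (\<Sum>\<theta>\<in>\<Lambda>'. Suc (Polynomial.degree (p' \<theta>)))"
  proof -
    have "(\<Sum>\<theta>\<in>\<Lambda>'. Suc (Polynomial.degree (p' \<theta>))) = (\<Sum>\<theta>\<in>\<Lambda>. if p' \<theta> \<noteq> 0 then Suc (Polynomial.degree (p' \<theta>)) else 0)"
      unfolding \<Lambda>'_def using less.prems(1) by (simp add: sum.inter_filter)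
    also have "\<dots> = (if p' \<mu> \<noteq> 0 then Suc (Polynomial.degree (p' \<mu>)) else 0)
        + (\<Sum>\<theta>\<in>\<Lambda> - {\<mu>}. if p' \<theta> \<noteq> 0 then Suc (Polynomial.degree (p' \<theta>)) else 0)"
      using less.prems(1) \<mu> by (subst sum.remove[of _ \<mu>]) auto
    also have "(\<Sum>\<theta>\<in>\<Lambda> - {\<mu>}. if p' \<theta> \<noteq> 0 then Suc (Polynomial.degree (p' \<theta>)) else 0) = (\<Sum>\<theta>\<in>\<Lambda> - {\<mu>}. Suc (Polynomial.degree (p \<theta>)))"
      by (rule sum.cong) (use deg in auto)
    also have "(if p' \<mu> \<noteq> 0 then Suc (Polynomial.degree (p' \<mu>)) else 0) = Polynomial.degree (p \<mu>)"
      using degmu by auto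
    finally show ?thesis using less.prems(1) \<mu> by (subst sum.remove[of _ \<mu>]) auto
  qed
  show ?case
  proof (cases "Z = {}")
    case True
    then show ?thesis using split by simp
  next
    case False
    obtain Z' where Z': "finite Z'" "card Z = Suc (card Z')"
      "\<forall>z\<in>Z'. exp (- \<mu> * z) * (\<Sum>\<theta>\<in>\<Lambda>. poly (p' \<theta>) z * exp (\<theta> * z)) = 0"
      using rolle_zero_count[of \<phi>, OF der less.prems(4) False] less.prems(5) by (auto simp: \<phi>_def)
    have z': "(\<Sum>\<theta>\<in>\<Lambda>'. poly (p' \<theta>) z * exp (\<theta> * z)) = 0" if "z \<in> Z'" for z
      using Z'(3) that by (simp add: sum')
    show ?thesis
    proof (cases "\<Lambda>' = {}")
      case True
      have \<Lambda>\<mu>: "\<Lambda> = {\<mu>}" using True deg \<mu> by (auto simp: \<Lambda>'_def)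
      have "Polynomial.degree (p \<mu>) = 0" using True degmu \<mu> by (auto simp: \<Lambda>'_def)
      then obtain c where c: "p \<mu> = [:c:]" by (rule degree_eq_zeroE)
      have "c \<noteq> 0" using less.prems(3)[OF \<mu>] c by simp
      then have "(\<Sum>\<theta>\<in>\<Lambda>. poly (p \<theta>) z * exp (\<theta> * z)) \<noteq> 0" for z by (simp add: \<Lambda>\<mu> c)
      then show ?thesis using False less.prems(5) by blast
    next
      case False
      have "card Z' < (\<Sum>\<theta>\<in>\<Lambda>'. Suc (Polynomial.degree (p' \<theta>)))"
        by (rule less.hyps[OF _ fin False _ Z'(1) z']) (use split in \<open>auto simp: \<Lambda>'_def\<close>)
      then show ?thesis using split Z'(2) by simp
    qed
  qed
qed

text \<open>A vector in the kernel of the matrix is an exponential polynomial that vanishes at the n points x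
i. Its coefficient at an exponent f j has degree less than the number of columns with this exponent, so n
zeros are too many.\<close>

lemma leibniz_exp_monomials_nonzero:
  assumes g: "\<And>j. j \<in> {1..n} \<Longrightarrow> 1 \<le> g j \<and> g j \<le> j"
    and f: "\<And>j p. j \<in> {1..n} \<Longrightarrow> p \<in> {g j..j} \<Longrightarrow> f p = f j"
    and fg: "\<And>i j. i \<in> {1..n} \<Longrightarrow> j \<in> {1..n} \<Longrightarrow> f i = f j \<Longrightarrow> g i = g j"
    and x: "inj_on x {1..n}"
  shows "leibniz n (\<lambda>i j. exp (x i * f j) * x i ^ (j - g j)) \<noteq> (0::real)"
proof
  let ?A = "Matrix.mat n n (\<lambda>(r, c). exp (x (Suc r) * f (Suc c)) * x (Suc r) ^ (Suc c - g (Suc c)))"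
  assume "leibniz n (\<lambda>i j. exp (x i * f j) * x i ^ (j - g j)) = 0"
  then have "Determinant.det ?A = 0" by (simp add: leibniz_eq_det)
  then obtain w where w: "w \<in> carrier_vec n" "w \<noteq> 0\<^sub>v n" "?A *\<^sub>v w = 0\<^sub>v n"
    using det_0_iff_vec_prod_zero_field[of ?A n] by auto
  define v where "v j = vec_index w (j - 1)" for j
  obtain j0 where j0: "j0 \<in> {1..n}" "v j0 \<noteq> 0"
  proof -
    have "\<exists>i<n. vec_index w i \<noteq> 0" using w(1,2) by (metis carrier_vecD eq_vecI index_zero_vec(1,2))
    then obtain i where "i < n" "vec_index w i \<noteq> 0" by blast
    then show ?thesis using that[of "Suc i"] by (simp add: v_def)
  qed
  have zero: "(\<Sum>j=1..n. exp (x i * f j) * x i ^ (j - g j) * v j) = 0" if i: "i \<in> {1..n}" for i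
  proof -
    obtain r where r: "i = Suc r" "r < n" using i by (cases i) (auto simp: One_nat_def)
    have "vec_index (?A *\<^sub>v w) (i - 1) = 0" using w(3) r by simp
    moreover have "vec_index (?A *\<^sub>v w) (i - 1) = (\<Sum>c=0..<n. exp (x i * f (Suc c)) * x i ^ (Suc c - g (Suc c)) * vec_index w c)"
      using r w(1) by (simp add: scalar_prod_def)
    moreover have "\<dots> = (\<Sum>j=1..n. exp (x i * f j) * x i ^ (j - g j) * v j)"
      by (rule sum.reindex_bij_witness[of _ "\<lambda>l. l - 1" Suc]) (auto simp: v_def One_nat_def)
    ultimately show ?thesis by simp
  qed
  define G where "G \<theta> = {j\<in>{1..n}. f j = \<theta>}" for \<theta>
  define p where "p \<theta> = (\<Sum>j\<in>G \<theta>. monom (v j) (j - g j))" for \<theta>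
  define \<Lambda> where "\<Lambda> = {\<theta>\<in>f ` {1..n}. p \<theta> \<noteq> 0}"
  have ginj: "j - g j \<noteq> i - g i" if "i \<in> G \<theta>" "j \<in> G \<theta>" "i \<noteq> j" for i j \<theta>
    using that fg[of i j] g[of i] g[of j] by (auto simp: G_def)
  have coeff: "Polynomial.coeff (p \<theta>) (j - g j) = v j" if j: "j \<in> G \<theta>" for j \<theta>
  proof -
    have "Polynomial.coeff (p \<theta>) (j - g j) = (\<Sum>i\<in>G \<theta>. if i = j then v j else 0)"
      unfolding p_def coeff_sum
    proof (rule sum.cong[OF refl])
      fix i assume "i \<in> G \<theta>"
      then show "Polynomial.coeff (monom (v i) (i - g i)) (j - g j) = (if i = j then v j else 0)"
        using ginj[of i \<theta> j] j by (cases "i = j") auto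
    qed
    then show ?thesis using j by (simp add: G_def)
  qed
  have ne: "f j0 \<in> \<Lambda>"
  proof -
    have "Polynomial.coeff (p (f j0)) (j0 - g j0) \<noteq> 0" using coeff[of j0 "f j0"] j0 by (simp add: G_def)
    then have "p (f j0) \<noteq> 0" by auto
    then show ?thesis using j0 by (simp add: \<Lambda>_def)
  qed
  have deg: "Suc (Polynomial.degree (p \<theta>)) \<le> card (G \<theta>)" if "\<theta> \<in> \<Lambda>" for \<theta>
  proof -
    have "G \<theta> \<noteq> {}" using that by (auto simp: \<Lambda>_def G_def)
    have "j - g j \<le> card (G \<theta>) - 1" if "j \<in> G \<theta>" for j
    proof -
      have j: "j \<in> {1..n}" "f j = \<theta>" using that by (auto simp: G_def)
      have "{g j..j} \<subseteq> G \<theta>" using f[OF j(1)] g[OF j(1)] j by (auto simp: G_def)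
      then have "card {g j..j} \<le> card (G \<theta>)" by (intro card_mono) (auto simp: G_def)
      then show ?thesis using g[OF j(1)] by simp
    qed
    then have "Polynomial.degree (p \<theta>) \<le> card (G \<theta>) - 1"
      unfolding p_def by (intro degree_sum_le) (auto simp: G_def intro: order_trans[OF degree_monom_le])
    moreover have "card (G \<theta>) > 0" using \<open>G \<theta> \<noteq> {}\<close> by (simp add: card_gt_0_iff G_def)
    ultimately show ?thesis by simp
  qed
  have "card (x ` {1..n}) < (\<Sum>\<theta>\<in>\<Lambda>. Suc (Polynomial.degree (p \<theta>)))"
  proof (rule exp_poly_zero_count)
    show "finite \<Lambda>" "\<Lambda> \<noteq> {}" "\<And>\<theta>. \<theta> \<in> \<Lambda> \<Longrightarrow> p \<theta> \<noteq> 0" using ne by (auto simp: \<Lambda>_def)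
    fix z assume "z \<in> x ` {1..n}"
    then obtain i where i: "i \<in> {1..n}" "z = x i" by blast
    have "(\<Sum>\<theta>\<in>\<Lambda>. poly (p \<theta>) z * exp (\<theta> * z)) = (\<Sum>\<theta>\<in>f ` {1..n}. poly (p \<theta>) z * exp (\<theta> * z))"
      by (rule sum.mono_neutral_left) (auto simp: \<Lambda>_def)
    also have "\<dots> = (\<Sum>\<theta>\<in>f ` {1..n}. \<Sum>j\<in>G \<theta>. exp (x i * f j) * x i ^ (j - g j) * v j)"
    proof (rule sum.cong[OF refl])
      fix \<theta>
      have "poly (p \<theta>) z * exp (\<theta> * z) = (\<Sum>j\<in>G \<theta>. v j * z ^ (j - g j) * exp (\<theta> * z))"
        by (simp add: p_def poly_sum poly_monom sum_distrib_right)
      also have "\<dots> = (\<Sum>j\<in>G \<theta>. exp (x i * f j) * x i ^ (j - g j) * v j)"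
        by (rule sum.cong) (auto simp: G_def i)
      finally show "poly (p \<theta>) z * exp (\<theta> * z) = (\<Sum>j\<in>G \<theta>. exp (x i * f j) * x i ^ (j - g j) * v j)" .
    qed
    also have "\<dots> = (\<Sum>j=1..n. exp (x i * f j) * x i ^ (j - g j) * v j)"
      unfolding G_def by (rule sum.image_gen[symmetric]) simp
    finally show "(\<Sum>\<theta>\<in>\<Lambda>. poly (p \<theta>) z * exp (\<theta> * z)) = 0" using zero[OF i(1)] by simp
  qed simp
  also have "\<dots> \<le> (\<Sum>\<theta>\<in>\<Lambda>. card (G \<theta>))" by (rule sum_mono) (rule deg)
  also have "\<dots> \<le> (\<Sum>\<theta>\<in>f ` {1..n}. card (G \<theta>))" by (rule sum_mono2) (auto simp: \<Lambda>_def)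
  also have "\<dots> = n"
    using sum.image_gen[of "{1..n}" "\<lambda>_. 1::nat" f] by (simp add: G_def)
  finally show False using x by (simp add: card_image)
qed

lemma tendsto_leibniz:
  assumes "\<And>i j. i \<in> {1..n} \<Longrightarrow> j \<in> {1..n} \<Longrightarrow> ((\<lambda>t. F t i j) \<longlongrightarrow> G i j) L"
  shows "((\<lambda>t. leibniz n (F t)) \<longlongrightarrow> leibniz n G) L"
  unfolding leibniz_def
proof (intro tendsto_sum tendsto_mult tendsto_const tendsto_prod)
  fix p i assume "p \<in> {p. p permutes {1..n}}" "i \<in> {1..n}"
  then show "((\<lambda>t. F t i (p i)) \<longlongrightarrow> G i (p i)) L"
    using permutes_in_image[of p "{1..n}" i] by (intro assms) auto
qed

section \<open>Blocks\<close>

text \<open>The part of stability that does not mention a. It holds for the ends of the blocks and also for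
the ends of the groups of blocks with equal means.\<close>

definition partition_cuts :: "nat \<Rightarrow> nat \<Rightarrow> (nat \<Rightarrow> nat) \<Rightarrow> bool" where
  "partition_cuts n q m \<longleftrightarrow> m 0 = 0 \<and> m q = n \<and> (\<forall>i\<in>{1..q}. m (i - 1) < m i)"

definition block_of :: "nat \<Rightarrow> (nat \<Rightarrow> nat) \<Rightarrow> nat \<Rightarrow> nat" where
  "block_of q m u = (THE k. k \<in> {1..q} \<and> m (k - 1) < u \<and> u \<le> m k)"

definition block_start :: "nat \<Rightarrow> (nat \<Rightarrow> nat) \<Rightarrow> nat \<Rightarrow> nat" where
  "block_start q m u = m (block_of q m u - 1) + 1"

lemma cuts_less:
  assumes "partition_cuts n q m" "i < j" "j \<le> q"
  shows "m i < m j"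
  using assms(2,3)
proof (induction j)
  case (Suc j)
  have "m j < m (Suc j)" using assms(1) Suc.prems unfolding partition_cuts_def by (metis atLeastAtMost_iff diff_Suc_1 le_add1 plus_1_eq_Suc)
  then show ?case using Suc by (cases "i = j") auto
qed simp

lemma cuts_le:
  assumes "partition_cuts n q m" "i \<le> j" "j \<le> q"
  shows "m i \<le> m j"
  using cuts_less[OF assms(1), of i j] assms by (cases "i = j") auto

lemma block_unique:
  assumes P: "partition_cuts n q m" and "k \<in> {1..q}" "m (k - 1) < u" "u \<le> m k"
    and "l \<in> {1..q}" "m (l - 1) < u" "u \<le> m l"
  shows "k = l"
proof (rule ccontr)
  assume "k \<noteq> l"
  then consider "k < l" | "l < k" by linarith
  then show False
  proof cases
    case 1
    then have "m k \<le> m (l - 1)" using assms by (intro cuts_le[OF P]) auto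
    then show False using assms by simp
  next
    case 2
    then have "m l \<le> m (k - 1)" using assms by (intro cuts_le[OF P]) auto
    then show False using assms by simp
  qed
qed

lemma block_of_eq:
  assumes "partition_cuts n q m" "k \<in> {1..q}" "m (k - 1) < u" "u \<le> m k"
  shows "block_of q m u = k"
  unfolding block_of_def by (rule the_equality) (use assms block_unique[OF assms(1)] in blast)+

lemma block_of_bounds:
  assumes P: "partition_cuts n q m" and u: "u \<in> {1..n}"
  shows "block_of q m u \<in> {1..q}" "m (block_of q m u - 1) < u" "u \<le> m (block_of q m u)"
proof -
  define k where "k = (LEAST k. u \<le> m k)"
  have q: "u \<le> m q" using P u by (simp add: partition_cuts_def)
  then have k: "u \<le> m k" "k \<le> q" unfolding k_def by (auto intro: LeastI[of "\<lambda>k. u \<le> m k"] Least_le[of "\<lambda>k. u \<le> m k"])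
  have k0: "k \<noteq> 0"
  proof
    assume "k = 0"
    then show False using k(1) u P by (simp add: partition_cuts_def)
  qed
  then have "m (k - 1) < u" using not_less_Least[of "k - 1" "\<lambda>k. u \<le> m k"] by (simp add: k_def)
  then have "block_of q m u = k" using k k0 by (intro block_of_eq[OF P]) auto
  then show "block_of q m u \<in> {1..q}" "m (block_of q m u - 1) < u" "u \<le> m (block_of q m u)"
    using k k0 \<open>m (k - 1) < u\<close> by auto
qed

lemma block_of_iff:
  assumes P: "partition_cuts n q m" and k: "k \<in> {1..q}" and u: "u \<in> {1..n}"
  shows "block_of q m u = k \<longleftrightarrow> m (k - 1) < u \<and> u \<le> m k"
  using block_of_eq[OF P k] block_of_bounds[OF P u] by auto

lemma block_of_mono:
  assumes P: "partition_cuts n q m" and "1 \<le> u" "u \<le> v" "v \<le> n"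
  shows "block_of q m u \<le> block_of q m v"
proof (rule ccontr)
  assume "\<not> ?thesis"
  then have lt: "block_of q m v < block_of q m u" by simp
  note u = block_of_bounds[OF P, of u] and v = block_of_bounds[OF P, of v]
  have "m (block_of q m v) \<le> m (block_of q m u - 1)"
    using lt u assms by (intro cuts_le[OF P]) auto
  then show False using u(2) v(3) assms by simp
qed

lemma block_cells:
  assumes P: "partition_cuts n q m"
  shows "{1..n} = (\<Union>i\<in>{1..q}. {m (i - 1)<..m i})"
proof
  show "{1..n} \<subseteq> (\<Union>i\<in>{1..q}. {m (i - 1)<..m i})"
    using block_of_bounds[OF P] by fastforce
  show "(\<Union>i\<in>{1..q}. {m (i - 1)<..m i}) \<subseteq> {1..n}"
    using cuts_le[OF P, of _ q] P by (fastforce simp: partition_cuts_def)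
qed

lemma block_cells_disjoint:
  assumes P: "partition_cuts n q m" and "i \<in> {1..q}" "j \<in> {1..q}" "i \<noteq> j"
  shows "{m (i - 1)<..m i} \<inter> {m (j - 1)<..m j} = {}"
proof (rule ccontr)
  assume "\<not> ?thesis"
  then obtain u where "u \<in> {m (i - 1)<..m i} \<inter> {m (j - 1)<..m j}" by blast
  then have "m (i - 1) < u" "u \<le> m i" "m (j - 1) < u" "u \<le> m j" by auto
  then show False using block_unique[OF P assms(2) _ _ assms(3)] assms(4) by blast
qed

lemma sum_over_blocks:
  assumes P: "partition_cuts n q m"
  shows "(\<Sum>u=1..n. \<phi> u) = (\<Sum>i=1..q. \<Sum>u\<in>{m (i - 1)<..m i}. \<phi> u)"
  unfolding block_cells[OF P]
  by (rule sum.UNION_disjoint, simp, simp, intro ballI impI, rule block_cells_disjoint[OF P])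

lemma prod_over_blocks:
  assumes P: "partition_cuts n q m"
  shows "(\<Prod>u=1..n. \<phi> u) = (\<Prod>i=1..q. \<Prod>u\<in>{m (i - 1)<..m i}. \<phi> u)"
  unfolding block_cells[OF P]
  by (rule prod.UNION_disjoint, simp, simp, intro ballI impI, rule block_cells_disjoint[OF P])

lemma block_start_cell:
  assumes P: "partition_cuts n q m" and i: "i \<in> {1..q}" and u: "u \<in> {m (i - 1)<..m i}"
  shows "block_start q m u = m (i - 1) + 1"
  using block_of_eq[OF P i, of u] u by (simp add: block_start_def)

lemma block_start_bounds:
  assumes P: "partition_cuts n q m" and u: "u \<in> {1..n}"
  shows "1 \<le> block_start q m u" "block_start q m u \<le> u"
  using block_of_bounds[OF P u] by (auto simp: block_start_def)

lemma sum_choose_block_len: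
  assumes P: "partition_cuts n q m"
  shows "(\<Sum>i=1..q. real (block_len m i choose 2)) = (\<Sum>u=1..n. real (u - block_start q m u))"
  unfolding sum_over_blocks[OF P]
proof (rule sum.cong[OF refl])
  fix i assume i: "i \<in> {1..q}"
  have lt: "m (i - 1) < m i" using i by (intro cuts_less[OF P]) auto
  have "(\<Sum>u\<in>{m (i - 1)<..m i}. real (u - block_start q m u)) = (\<Sum>u\<in>{m (i - 1)<..m i}. real (u - (m (i - 1) + 1)))"
    by (rule sum.cong) (use block_start_cell[OF P i] in auto)
  also have "\<dots> = (\<Sum>k<block_len m i. real k)"
    by (rule sum.reindex_bij_witness[of _ "\<lambda>k. m (i - 1) + 1 + k" "\<lambda>u. u - (m (i - 1) + 1)"])
       (use lt in \<open>auto simp: block_len_def\<close>)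
  also have "\<dots> = real (\<Sum>k<block_len m i. k)" by simp
  also have "(\<Sum>k<block_len m i. k) = block_len m i choose 2"
    by (simp add: choose_two Sum_Ico_nat[of 0, simplified] lessThan_atLeast0)
  finally show "real (block_len m i choose 2) = (\<Sum>u\<in>{m (i - 1)<..m i}. real (u - block_start q m u))" by simp
qed

lemma prod_c_const:
  assumes P: "partition_cuts n q m"
  shows "(\<Prod>i=1..q. c_const (block_len m i)) = (\<Prod>u=1..n. 1 / fact (u - block_start q m u))"
  unfolding prod_over_blocks[OF P]
proof (rule prod.cong[OF refl])
  fix i assume i: "i \<in> {1..q}"
  have lt: "m (i - 1) < m i" using i by (intro cuts_less[OF P]) auto
  have "(\<Prod>u\<in>{m (i - 1)<..m i}. 1 / fact (u - block_start q m u) :: real) = (\<Prod>u\<in>{m (i - 1)<..m i}. 1 / fact (u - (m (i - 1) + 1)))"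
    by (rule prod.cong) (use block_start_cell[OF P i] in auto)
  also have "\<dots> = (\<Prod>k=0..<block_len m i. 1 / fact k)"
    by (rule prod.reindex_bij_witness[of _ "\<lambda>k. m (i - 1) + 1 + k" "\<lambda>u. u - (m (i - 1) + 1)"])
       (use lt in \<open>auto simp: block_len_def\<close>)
  also have "\<dots> = (\<Prod>k=1..block_len m i - 1. 1 / fact k)"
  proof -
    have "{0..<block_len m i} = insert 0 {1..block_len m i - 1}" using lt by (auto simp: block_len_def)
    then show ?thesis by simp
  qed
  also have "\<dots> = c_const (block_len m i)" by (simp add: c_const_def prod_dividef)
  finally show "c_const (block_len m i) = (\<Prod>u\<in>{m (i - 1)<..m i}. 1 / fact (u - block_start q m u))" ..
qed

lemma prod_within_blocks:
  assumes P: "partition_cuts n q m"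
  shows "(\<Prod>i=1..q. H_fun (block_len m i - 1) (\<lambda>r. \<xi> (m (i - 1) + r)))
    = (\<Prod>j=1..n. \<Prod>p=block_start q m j..<j. \<Sum>r=p..<j. \<xi> r)"
  unfolding prod_over_blocks[OF P]
proof (rule prod.cong[OF refl])
  fix i assume i: "i \<in> {1..q}"
  have lt: "m (i - 1) < m i" using i by (intro cuts_less[OF P]) auto
  let ?\<mu> = "m (i - 1)" and ?l = "block_len m i - 1"
  have l: "?l + 1 = m i - ?\<mu>" using lt by (simp add: block_len_def)
  have "(\<Prod>j\<in>{?\<mu><..m i}. \<Prod>p=block_start q m j..<j. \<Sum>r=p..<j. \<xi> r)
      = (\<Prod>j\<in>{?\<mu><..m i}. \<Prod>p=?\<mu>+1..<j. \<Sum>r=p..<j. \<xi> r)"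
    by (rule prod.cong) (use block_start_cell[OF P i] in auto)
  also have "\<dots> = (\<Prod>(j, p)\<in>(SIGMA j:{?\<mu><..m i}. {?\<mu>+1..<j}). \<Sum>r=p..<j. \<xi> r)"
    by (rule prod.Sigma) auto
  also have "\<dots> = (\<Prod>(c, d)\<in>{(c, d). 1 \<le> c \<and> c < d \<and> d \<le> ?l + 1}. \<Sum>r=c..d - 1. \<xi> (?\<mu> + r))"
  proof (rule prod.reindex_bij_witness[of _ "\<lambda>(c, d). (?\<mu> + d, ?\<mu> + c)" "\<lambda>(j, p). (p - ?\<mu>, j - ?\<mu>)"])
    fix y assume "y \<in> (SIGMA j:{?\<mu><..m i}. {?\<mu>+1..<j})"
    then obtain j p where y: "y = (j, p)" "?\<mu> < j" "j \<le> m i" "?\<mu> + 1 \<le> p" "p < j" by auto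
    have "(\<Sum>r=p - ?\<mu>..(j - ?\<mu>) - 1. \<xi> (?\<mu> + r)) = (\<Sum>r=p..<j. \<xi> r)"
      by (rule sum.reindex_bij_witness[of _ "\<lambda>r. r - ?\<mu>" "\<lambda>r. ?\<mu> + r"]) (use y in auto)
    then show "(case case y of (j, p) \<Rightarrow> (p - ?\<mu>, j - ?\<mu>) of (c, d) \<Rightarrow> \<Sum>r=c..d - 1. \<xi> (?\<mu> + r)) = (case y of (j, p) \<Rightarrow> \<Sum>r=p..<j. \<xi> r)"
      by (simp add: y)
  qed (use l in auto)
  also have "\<dots> = H_fun ?l (\<lambda>r. \<xi> (?\<mu> + r))" by (simp add: H_fun_def)
  finally show "H_fun ?l (\<lambda>r. \<xi> (?\<mu> + r)) = (\<Prod>j\<in>{?\<mu><..m i}. \<Prod>p=block_start q m j..<j. \<Sum>r=p..<j. \<xi> r)" by simp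
qed

section \<open>Stable partitions\<close>

abbreviation interior_idx :: "nat \<Rightarrow> nat \<Rightarrow> (nat \<Rightarrow> nat) \<Rightarrow> nat set" where
  "interior_idx n q m \<equiv> {1..n} - m ` {1..q}"

abbreviation cut_idx :: "nat \<Rightarrow> (nat \<Rightarrow> nat) \<Rightarrow> nat set" where
  "cut_idx q m \<equiv> m ` {1..q - 1}"

text \<open>The partial sums of a - f. They vanish at the cuts, are positive elsewhere by irreducibility, and
turn out to be the rates at which the density decays in the gaps inside blocks.\<close>

definition excess :: "(nat \<Rightarrow> real) \<Rightarrow> nat \<Rightarrow> (nat \<Rightarrow> nat) \<Rightarrow> nat \<Rightarrow> real" where
  "excess a q m k = (\<Sum>u=1..k. a u - f_vec a q m u)"

context
  fixes n q :: nat and a :: "nat \<Rightarrow> real" and m :: "nat \<Rightarrow> nat"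
  assumes n: "n \<ge> 1" and stable: "stable_partition n a q m"
begin

lemma stable_cuts: "partition_cuts n q m"
  using stable by (simp add: stable_partition_def partition_cuts_def)

lemma stable_q_pos: "q \<ge> 1"
  using stable n by (cases q) (auto simp: stable_partition_def One_nat_def)

lemma f_vec_eq_block_mean: "f_vec a q m u = block_mean a m (block_of q m u)"
  by (simp add: f_vec_def block_of_def)

lemma block_mean_mono:
  assumes "1 \<le> i" "i \<le> j" "j \<le> q"
  shows "block_mean a m i \<le> block_mean a m j"
  using assms(2,3)
proof (induction j rule: dec_induct)
  case (step k)
  have "block_mean a m k \<le> block_mean a m (k + 1)" using stable step assms(1) unfolding stable_partition_def by auto
  then show ?case using step unfolding Suc_eq_plus1 by simp
qed simp

lemma f_vec_mono: "1 \<le> u \<Longrightarrow> u \<le> v \<Longrightarrow> v \<le> n \<Longrightarrow> f_vec a q m u \<le> f_vec a q m v"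
  unfolding f_vec_eq_block_mean using block_of_bounds[OF stable_cuts] block_of_mono[OF stable_cuts]
  by (intro block_mean_mono) auto

lemma inj_cuts: "inj_on m {0..q}"
  using cuts_less[OF stable_cuts] by (auto simp: inj_on_def) (metis less_irrefl nat_neq_iff)

lemma last_cut: "m q = n" using stable by (simp add: stable_partition_def)

lemma cut_idx_subset: "cut_idx q m \<subseteq> {1..<n}"
proof
  fix k assume "k \<in> cut_idx q m"
  then obtain i where i: "1 \<le> i" "i \<le> q - 1" "k = m i" by auto
  then have "m 0 < m i" "m i < m q" using stable_q_pos by (auto intro!: cuts_less[OF stable_cuts])
  then show "k \<in> {1..<n}" using i last_cut by (simp add: One_nat_def)
qed

lemma interior_idx_eq: "interior_idx n q m = {1..<n} - cut_idx q m"
proof -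
  have "{1..q} = insert q {1..q - 1}" using stable_q_pos by auto
  then have "m ` {1..q} = insert n (cut_idx q m)" using last_cut by (metis image_insert)
  then show ?thesis by auto
qed

lemma card_cut_idx: "card (cut_idx q m) = q - 1"
  using card_image[of m "{1..q - 1}"] inj_on_subset[OF inj_cuts, of "{1..q - 1}"] by fastforce

lemma f_vec_interior:
  assumes "k \<in> interior_idx n q m"
  shows "f_vec a q m (Suc k) = f_vec a q m k" "block_of q m (Suc k) = block_of q m k"
proof -
  have k: "k \<in> {1..n}" "Suc k \<in> {1..n}" using assms interior_idx_eq by auto
  note b = block_of_bounds[OF stable_cuts k(1)]
  have "k \<noteq> m (block_of q m k)" using assms b(1) by auto
  then show "block_of q m (Suc k) = block_of q m k"
    using b by (intro block_of_eq[OF stable_cuts]) auto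
  then show "f_vec a q m (Suc k) = f_vec a q m k" by (simp add: f_vec_eq_block_mean)
qed

lemma block_of_cut:
  assumes "1 \<le> i" "i \<le> q - 1"
  shows "block_of q m (m i) = i" "block_of q m (Suc (m i)) = Suc i"
proof -
  have lt: "m (i - 1) < m i" "m i < m (Suc i)"
    using assms by (auto intro!: cuts_less[OF stable_cuts])
  show "block_of q m (m i) = i" using assms lt by (intro block_of_eq[OF stable_cuts]) auto
  show "block_of q m (Suc (m i)) = Suc i" using assms lt by (intro block_of_eq[OF stable_cuts]) auto
qed

lemma within_block_interior:
  assumes "j \<in> {1..n}" "block_start q m j \<le> r" "r < j"
  shows "r \<in> interior_idx n q m"
proof -
  note b = block_of_bounds[OF stable_cuts assms(1)]
  have r: "m (block_of q m j - 1) < r" "r < m (block_of q m j)"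
    using assms b by (auto simp: block_start_def)
  have "r \<notin> m ` {1..q}"
  proof
    assume "r \<in> m ` {1..q}"
    then obtain i where i: "i \<in> {1..q}" "r = m i" by auto
    show False
    proof (cases "i < block_of q m j")
      case True
      then have "m i \<le> m (block_of q m j - 1)" using b by (intro cuts_le[OF stable_cuts]) auto
      then show False using r i by simp
    next
      case False
      then have "m (block_of q m j) \<le> m i" using i by (intro cuts_le[OF stable_cuts]) auto
      then show False using r i by simp
    qed
  qed
  then show ?thesis using assms r by auto
qed

lemma sum_block_excess:
  assumes i: "i \<in> {1..q}"
  shows "(\<Sum>u\<in>{m (i - 1)<..m i}. a u - f_vec a q m u) = 0"
proof -
  have lt: "m (i - 1) < m i" using i by (intro cuts_less[OF stable_cuts]) auto
  have "f_vec a q m u = block_mean a m i" if "u \<in> {m (i - 1)<..m i}" for u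
    using block_of_eq[OF stable_cuts i, of u] that by (simp add: f_vec_eq_block_mean)
  then have "(\<Sum>u\<in>{m (i - 1)<..m i}. a u - f_vec a q m u) = (\<Sum>u\<in>{m (i - 1)<..m i}. a u) - real (m i - m (i - 1)) * block_mean a m i"
    by (simp add: sum_subtractf)
  moreover have "{m (i - 1)<..m i} = {m (i - 1) + 1..m i}" by auto
  then have "(\<Sum>u\<in>{m (i - 1)<..m i}. a u) = real (m i - m (i - 1)) * block_mean a m i"
    using lt by (simp add: block_mean_def avg_def)
  ultimately show ?thesis by simp
qed

lemma excess_cut: "i \<le> q \<Longrightarrow> excess a q m (m i) = 0"
proof (induction i)
  case 0
  then show ?case using stable by (simp add: excess_def stable_partition_def)
next
  case (Suc i)
  have lt: "m i < m (Suc i)" using Suc by (intro cuts_less[OF stable_cuts]) auto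
  have "{1..m (Suc i)} = {1..m i} \<union> {m i<..m (Suc i)}" using lt by auto
  then have "excess a q m (m (Suc i)) = excess a q m (m i) + (\<Sum>u\<in>{m i<..m (Suc i)}. a u - f_vec a q m u)"
    unfolding excess_def by (subst sum.union_disjoint[symmetric]) auto
  then show ?case using Suc sum_block_excess[of "Suc i"] by simp
qed

text \<open>Irreducibility says that the first c entries of the block have a larger mean than the remaining
ones, hence than the whole block.\<close>

lemma excess_pos:
  assumes k: "k \<in> interior_idx n q m"
  shows "excess a q m k > 0"
proof -
  have kn: "k \<in> {1..n}" using k by simp
  define i where "i = block_of q m k"
  have i: "i \<in> {1..q}" "m (i - 1) < k" "k \<le> m i" using block_of_bounds[OF stable_cuts kn] by (auto simp: i_def)
  have "k \<noteq> m i" using k i(1) by auto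
  then have ki: "k < m i" using i by simp
  define \<mu> where "\<mu> = m (i - 1)"
  define r where "r = block_len m i"
  define c where "c = k - \<mu>"
  have r: "r = m i - \<mu>" by (simp add: r_def \<mu>_def block_len_def)
  have c: "1 \<le> c" "c \<le> r - 1" "c < r" using i ki by (auto simp: c_def r \<mu>_def)
  have irr: "avg (\<lambda>j. a (\<mu> + j)) 1 c > avg (\<lambda>j. a (\<mu> + j)) (c + 1) r"
    using stable i(1) c unfolding stable_partition_def irreducible_vector_def r_def \<mu>_def by blast
  have fc: "f_vec a q m u = block_mean a m i" if "u \<in> {\<mu><..m i}" for u
    using block_of_eq[OF stable_cuts i(1), of u] that by (simp add: f_vec_eq_block_mean \<mu>_def)
  define A where "A = (\<Sum>j=1..c. a (\<mu> + j))"
  define B where "B = (\<Sum>j=c+1..r. a (\<mu> + j))"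
  have "A / real c > B / real (r - c)" using irr c by (simp add: avg_def A_def B_def)
  then have AB: "A * real (r - c) > B * real c" using c by (simp add: field_simps)
  have tot: "real r * block_mean a m i = A + B"
  proof -
    have "real r * block_mean a m i = (\<Sum>u=\<mu>+1..m i. a u)"
      using i ki by (simp add: block_mean_def avg_def r \<mu>_def)
    also have "\<dots> = (\<Sum>j=1..r. a (\<mu> + j))"
      by (rule sum.reindex_bij_witness[of _ "\<lambda>j. \<mu> + j" "\<lambda>u. u - \<mu>"]) (auto simp: r)
    also have "{1..r} = {1..c} \<union> {c+1..r}" using c by auto
    also have "(\<Sum>j\<in>{1..c} \<union> {c+1..r}. a (\<mu> + j)) = A + B"
      unfolding A_def B_def by (rule sum.union_disjoint) auto
    finally show ?thesis .
  qed
  have "excess a q m k = excess a q m \<mu> + (\<Sum>u\<in>{\<mu><..k}. a u - f_vec a q m u)"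
  proof -
    have "{1..k} = {1..\<mu>} \<union> {\<mu><..k}" using i by (auto simp: \<mu>_def)
    then show ?thesis unfolding excess_def by (subst sum.union_disjoint[symmetric]) auto
  qed
  also have "excess a q m \<mu> = 0" unfolding \<mu>_def using i by (intro excess_cut) auto
  also have "(\<Sum>u\<in>{\<mu><..k}. a u - f_vec a q m u) = (\<Sum>j=1..c. a (\<mu> + j) - block_mean a m i)"
    by (rule sum.reindex_bij_witness[of _ "\<lambda>j. \<mu> + j" "\<lambda>u. u - \<mu>"]) (use i ki fc in \<open>auto simp: c_def \<mu>_def\<close>)
  also have "\<dots> = A - real c * block_mean a m i" by (simp add: sum_subtractf A_def)
  finally have "excess a q m k = A - real c * block_mean a m i" by simp
  then have "real r * excess a q m k = real r * A - real c * (real r * block_mean a m i)"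
    by (simp only:) (simp add: algebra_simps)
  also have "\<dots> = real r * A - real c * (A + B)" by (simp only: tot)
  also have "\<dots> = A * real (r - c) - B * real c" using c by (simp add: of_nat_diff algebra_simps)
  finally have "real r * excess a q m k > 0" using AB by simp
  then show ?thesis using c by (simp add: zero_less_mult_iff)
qed

lemma summation_by_parts_excess:
  "(\<Sum>u=1..n. (a u - f_vec a q m u) * w u) = - (\<Sum>k\<in>interior_idx n q m. excess a q m k * (w (Suc k) - w k))"
proof -
  have "(\<Sum>u=1..N. (a u - f_vec a q m u) * w u) = excess a q m N * w N - (\<Sum>k=1..<N. excess a q m k * (w (Suc k) - w k))" for N
  proof (induction N)
    case 0 then show ?case by (simp add: excess_def)
  next
    case (Suc N)
    have "excess a q m (Suc N) = excess a q m N + (a (Suc N) - f_vec a q m (Suc N))" by (simp add: excess_def)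
    moreover have "(\<Sum>k=1..<Suc N. excess a q m k * (w (Suc k) - w k)) = (\<Sum>k=1..<N. excess a q m k * (w (Suc k) - w k)) + excess a q m N * (w (Suc N) - w N)"
      by (cases "N = 0") (auto simp: excess_def)
    ultimately show ?case using Suc by (cases "N = 0") (auto simp: algebra_simps excess_def)
  qed
  from this[of n] have "(\<Sum>u=1..n. (a u - f_vec a q m u) * w u) = - (\<Sum>k=1..<n. excess a q m k * (w (Suc k) - w k))"
    using excess_cut[of q] last_cut by simp
  also have "(\<Sum>k=1..<n. excess a q m k * (w (Suc k) - w k)) = (\<Sum>k\<in>interior_idx n q m. excess a q m k * (w (Suc k) - w k))"
  proof (rule sum.mono_neutral_right)
    show "\<forall>k\<in>{1..<n} - (interior_idx n q m). excess a q m k * (w (Suc k) - w k) = 0"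
      using excess_cut by (auto simp: interior_idx_eq)
  qed (use interior_idx_eq in auto)
  finally show ?thesis .
qed

text \<open>By symmetry, the sum over pairs u < v is half of the sum over all pairs. Expanding the latter
gives the covariance of a and w on the block, as a - f sums to zero there.\<close>

lemma pair_sum_in_block:
  assumes i: "i \<in> {1..q}"
  shows "1 / real (block_len m i) * (\<Sum>(u, v) \<in> {(u, v). m (i - 1) < u \<and> u < v \<and> v \<le> m i}. (w v - w u) * (a u - a v))
    = - (\<Sum>u\<in>{m (i - 1)<..m i}. (a u - f_vec a q m u) * w u)"
proof -
  let ?C = "{m (i - 1)<..m i}" and ?P = "{(u, v). m (i - 1) < u \<and> u < v \<and> v \<le> m i}"
  have lt: "m (i - 1) < m i" using i by (intro cuts_less[OF stable_cuts]) auto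
  define \<nu> where "\<nu> = real (block_len m i)"
  have \<nu>: "\<nu> > 0" "real (card ?C) = \<nu>" using lt by (auto simp: \<nu>_def block_len_def)
  \<comment> \<open>Diagonal pairs contribute 0, and transposed pairs contribute equally.\<close>
  define \<phi> where "\<phi> u v = (w v - w u) * (a u - a v)" for u v
  have finP: "finite ?P" by (rule finite_subset[of _ "{..m i} \<times> {..m i}"]) auto
  have "(\<Sum>u\<in>?C. \<Sum>v\<in>?C. \<phi> u v) = (\<Sum>(u, v)\<in>?C \<times> ?C. \<phi> u v)"
    by (simp add: sum.cartesian_product)
  also have "?C \<times> ?C = ?P \<union> ((\<lambda>(u, v). (v, u)) ` ?P \<union> {(u, v). u = v \<and> u \<in> ?C})"
    by (auto simp: image_iff)
  also have "(\<Sum>(u, v)\<in>\<dots>. \<phi> u v) = (\<Sum>(u, v)\<in>?P. \<phi> u v) + (\<Sum>(u, v)\<in>(\<lambda>(u, v). (v, u)) ` ?P \<union> {(u, v). u = v \<and> u \<in> ?C}. \<phi> u v)"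
    by (rule sum.union_disjoint) (auto intro: finP finite_subset[of _ "?C \<times> ?C"])
  also have "(\<Sum>(u, v)\<in>(\<lambda>(u, v). (v, u)) ` ?P \<union> {(u, v). u = v \<and> u \<in> ?C}. \<phi> u v)
      = (\<Sum>(u, v)\<in>(\<lambda>(u, v). (v, u)) ` ?P. \<phi> u v) + (\<Sum>(u, v)\<in>{(u, v). u = v \<and> u \<in> ?C}. \<phi> u v)"
    by (rule sum.union_disjoint) (auto intro: finP finite_subset[of _ "?C \<times> ?C"])
  also have "(\<Sum>(u, v)\<in>(\<lambda>(u, v). (v, u)) ` ?P. \<phi> u v) = (\<Sum>(u, v)\<in>?P. \<phi> u v)"
    by (subst sum.reindex) (auto simp: inj_on_def \<phi>_def algebra_simps intro!: sum.cong)
  also have "(\<Sum>(u, v)\<in>{(u, v). u = v \<and> u \<in> ?C}. \<phi> u v) = 0"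
    by (rule sum.neutral) (auto simp: \<phi>_def)
  finally have two: "(\<Sum>u\<in>?C. \<Sum>v\<in>?C. \<phi> u v) = 2 * (\<Sum>(u, v)\<in>?P. \<phi> u v)" by simp
  define e where "e u = a u - f_vec a q m u" for u
  have fc: "f_vec a q m u = block_mean a m i" if "u \<in> ?C" for u
    using block_of_eq[OF stable_cuts i, of u] that by (simp add: f_vec_eq_block_mean)
  have e0: "(\<Sum>u\<in>?C. e u) = 0" unfolding e_def by (rule sum_block_excess[OF i])
  have "(\<Sum>u\<in>?C. \<Sum>v\<in>?C. \<phi> u v) = (\<Sum>u\<in>?C. \<Sum>v\<in>?C. e u * w v - e u * w u - (e v * w v - w u * e v))"
    by (intro sum.cong refl) (simp add: \<phi>_def e_def fc algebra_simps)
  also have "\<dots> = (\<Sum>u\<in>?C. e u * (\<Sum>v\<in>?C. w v) - \<nu> * (e u * w u) - ((\<Sum>v\<in>?C. e v * w v) - w u * (\<Sum>v\<in>?C. e v)))"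
    using \<nu>(2) by (simp add: sum_subtractf sum_distrib_left)
  also have "\<dots> = (\<Sum>u\<in>?C. e u) * (\<Sum>v\<in>?C. w v) - \<nu> * (\<Sum>u\<in>?C. e u * w u) - \<nu> * (\<Sum>v\<in>?C. e v * w v)"
    by (simp only: sum_subtractf sum_distrib_right[symmetric] sum_distrib_left[symmetric] sum_constant e0 \<nu>(2))
  finally have "(\<Sum>(u, v)\<in>?P. \<phi> u v) = - (\<nu> * (\<Sum>u\<in>?C. e u * w u))" using two e0 by simp
  then show ?thesis using \<nu> by (simp add: \<phi>_def e_def \<nu>_def[symmetric])
qed

lemma gamma_rate_eq: "gamma_rate a q m = (\<Sum>u=1..n. (a u - f_vec a q m u)\<^sup>2) / 2"
proof -
  have "1 / real (block_len m l) * (\<Sum>(u, v) \<in> {(u, v). m (l - 1) < u \<and> u < v \<and> v \<le> m l}. (a u - a v)\<^sup>2)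
    = (\<Sum>u\<in>{m (l - 1)<..m l}. (a u - f_vec a q m u)\<^sup>2)" if l: "l \<in> {1..q}" for l
  proof -
    have "(\<Sum>(u, v) \<in> {(u, v). m (l - 1) < u \<and> u < v \<and> v \<le> m l}. (a u - a v)\<^sup>2)
       = (\<Sum>(u, v) \<in> {(u, v). m (l - 1) < u \<and> u < v \<and> v \<le> m l}. (- a v - - a u) * (a u - a v))"
      by (intro sum.cong) (auto simp: power2_eq_square)
    then have "1 / real (block_len m l) * (\<Sum>(u, v) \<in> {(u, v). m (l - 1) < u \<and> u < v \<and> v \<le> m l}. (a u - a v)\<^sup>2)
       = (\<Sum>u\<in>{m (l - 1)<..m l}. (a u - f_vec a q m u) * a u)"
      using pair_sum_in_block[OF l, of "\<lambda>u. - a u"] by (simp add: sum_negf)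
    also have "\<dots> = (\<Sum>u\<in>{m (l - 1)<..m l}. (a u - f_vec a q m u)\<^sup>2 + (a u - f_vec a q m u) * block_mean a m l)"
    proof (rule sum.cong[OF refl])
      fix u assume u: "u \<in> {m (l - 1)<..m l}"
      have "f_vec a q m u = block_mean a m l" using block_of_eq[OF stable_cuts l, of u] u by (simp add: f_vec_eq_block_mean)
      then show "(a u - f_vec a q m u) * a u = (a u - f_vec a q m u)\<^sup>2 + (a u - f_vec a q m u) * block_mean a m l" by (simp add: power2_eq_square algebra_simps)
    qed
    also have "\<dots> = (\<Sum>u\<in>{m (l - 1)<..m l}. (a u - f_vec a q m u)\<^sup>2)"
      using sum_block_excess[OF l] by (simp add: sum.distrib sum_distrib_right[symmetric])
    finally show ?thesis .
  qed
  then show ?thesis unfolding gamma_rate_def sum_over_blocks[OF stable_cuts] by simp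
qed

text \<open>The increments of w in the previous identities are now the coordinates \<xi>, and summation by
parts collects their coefficients.\<close>

lemma A2_exponent:
  "- (1/2) * (\<Sum>l=1..q. 2 / real (block_len m l) *
          (\<Sum>(u, v) \<in> {(u, v). m (l - 1) < u \<and> u < v \<and> v \<le> m l}. (\<Sum>r=u..v - 1. \<xi> r) * (a u - a v)))
    = - (\<Sum>k\<in>interior_idx n q m. excess a q m k * \<xi> k)"
proof -
  define w where "w u = (\<Sum>r=1..<u. \<xi> r)" for u
  have wd: "w (Suc k) - w k = \<xi> k" if "k \<ge> 1" for k using that by (simp add: w_def)
  have wuv: "w v - w u = (\<Sum>r=u..v - 1. \<xi> r)" if "1 \<le> u" "u < v" for u v
  proof -
    have "{1..<v} = {1..<u} \<union> {u..v - 1}" using that by auto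
    then have "w v = w u + (\<Sum>r=u..v - 1. \<xi> r)"
      unfolding w_def by (subst sum.union_disjoint[symmetric]) (use that in auto)
    then show ?thesis by simp
  qed
  have "2 / real (block_len m l) * (\<Sum>(u, v) \<in> {(u, v). m (l - 1) < u \<and> u < v \<and> v \<le> m l}. (\<Sum>r=u..v - 1. \<xi> r) * (a u - a v))
     = - 2 * (\<Sum>u\<in>{m (l - 1)<..m l}. (a u - f_vec a q m u) * w u)" if l: "l \<in> {1..q}" for l
  proof -
    have "(\<Sum>(u, v) \<in> {(u, v). m (l - 1) < u \<and> u < v \<and> v \<le> m l}. (\<Sum>r=u..v - 1. \<xi> r) * (a u - a v))
      = (\<Sum>(u, v) \<in> {(u, v). m (l - 1) < u \<and> u < v \<and> v \<le> m l}. (w v - w u) * (a u - a v))"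
      by (intro sum.cong) (auto simp: wuv)
    then show ?thesis using pair_sum_in_block[OF l, of w] by simp
  qed
  then have "- (1/2) * (\<Sum>l=1..q. 2 / real (block_len m l) *
          (\<Sum>(u, v) \<in> {(u, v). m (l - 1) < u \<and> u < v \<and> v \<le> m l}. (\<Sum>r=u..v - 1. \<xi> r) * (a u - a v)))
     = - (1/2) * (\<Sum>l=1..q. - 2 * (\<Sum>u\<in>{m (l - 1)<..m l}. (a u - f_vec a q m u) * w u))"
    by simp
  also have "\<dots> = (\<Sum>u=1..n. (a u - f_vec a q m u) * w u)"
    unfolding sum_over_blocks[OF stable_cuts] by (simp add: sum_distrib_left[symmetric] sum_negf)
  also have "\<dots> = - (\<Sum>k\<in>interior_idx n q m. excess a q m k * \<xi> k)"
    unfolding summation_by_parts_excess using wd by (intro arg_cong[where f=uminus] sum.cong) auto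
  finally show ?thesis .
qed

end

section \<open>Groups of blocks with equal means\<close>

lemma sorted_enumeration:
  fixes S :: "nat set"
  assumes S: "finite S"
  defines "e \<equiv> \<lambda>k. sorted_list_of_set S ! (k - 1)"
  shows "e ` {1..card S} = S" "\<And>k l. 1 \<le> k \<Longrightarrow> k < l \<Longrightarrow> l \<le> card S \<Longrightarrow> e k < e l"
proof -
  let ?L = "sorted_list_of_set S"
  have L: "length ?L = card S" "set ?L = S" "sorted_wrt (<) ?L"
    using S by (auto simp: strict_sorted_list_of_set)
  have "e ` {1..card S} = (!) ?L ` {0..<card S}"
  proof -
    have "(\<lambda>k. k - 1) ` {1..card S} = {0..<card S}"
      by (auto simp: image_iff One_nat_def intro!: bexI[of _ "Suc _"])
    then show ?thesis unfolding e_def by (metis (no_types) image_image)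
  qed
  also have "\<dots> = S" using L nth_image[of "card S" ?L] by simp
  finally show "e ` {1..card S} = S" .
  show "e k < e l" if "1 \<le> k" "k < l" "l \<le> card S" for k l
    unfolding e_def by (rule sorted_wrt_nth_less[OF L(3)]) (use that L in auto)
qed

context
  fixes n q :: nat and a :: "nat \<Rightarrow> real" and m :: "nat \<Rightarrow> nat"
  assumes n: "n \<ge> 1" and stable: "stable_partition n a q m"
begin

lemma strict_idx_props: "finite (strict_idx a q m)" "q \<in> strict_idx a q m" "strict_idx a q m \<subseteq> {1..q}"
  using stable_q_pos[OF n stable] by (auto simp: strict_idx_def)

lemma idx_0: "idx a q m 0 = 0" by (simp add: idx_def)

lemma idx_image: "idx a q m ` {1..q' a q m} = strict_idx a q m"
proof -
  have "idx a q m ` {1..q' a q m} = (\<lambda>k. sorted_list_of_set (strict_idx a q m) ! (k - 1)) ` {1..q' a q m}"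
    by (rule image_cong) (auto simp: idx_def)
  then show ?thesis using sorted_enumeration(1)[OF strict_idx_props(1)] by (simp add: q'_def)
qed

lemma idx_less:
  assumes "k < l" "l \<le> q' a q m"
  shows "idx a q m k < idx a q m l"
proof (cases "k = 0")
  case True
  have "idx a q m l \<in> strict_idx a q m" using idx_image assms by auto
  then show ?thesis using True strict_idx_props(3) by (auto simp: idx_0)
next
  case False
  then show ?thesis using sorted_enumeration(2)[OF strict_idx_props(1), of k l] assms
    by (simp add: idx_def q'_def)
qed

lemma idx_le_q: "k \<le> q' a q m \<Longrightarrow> idx a q m k \<le> q"
  using idx_image strict_idx_props(3) idx_0 by (cases "k = 0") (auto simp: subset_iff)

lemma idx_last: "idx a q m (q' a q m) = q"
proof -
  obtain k where k: "k \<in> {1..q' a q m}" "idx a q m k = q" using idx_image strict_idx_props(2) by (metis imageE)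
  have "\<not> k < q' a q m" using idx_less[of k "q' a q m"] idx_le_q[of "q' a q m"] k by auto
  then show ?thesis using k by auto
qed

lemma group_cuts: "partition_cuts n (q' a q m) (m' a q m)"
proof -
  have m0: "m 0 = 0" "m q = n" using stable by (auto simp: stable_partition_def)
  have e: "m' a q m k = m (idx a q m k)" for k by (simp add: m'_def idx_0 m0)
  show ?thesis
    unfolding partition_cuts_def e idx_0 idx_last m0
    by (auto intro!: cuts_less[OF stable_cuts[OF n stable]] idx_less idx_le_q)
qed

lemma m'_eq: "m' a q m k = m (idx a q m k)"
  using stable by (auto simp: m'_def idx_0 stable_partition_def)

lemma block_mean_step:
  assumes "1 \<le> i" "i < q" "i \<notin> strict_idx a q m"
  shows "block_mean a m i = block_mean a m (Suc i)"
  using block_mean_mono[OF n stable, of i "Suc i"] assms unfolding Suc_eq_plus1 by (auto simp: strict_idx_def)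

lemma block_mean_const:
  assumes "1 \<le> i" "i \<le> j" "j \<le> q" "\<And>l. i \<le> l \<Longrightarrow> l < j \<Longrightarrow> l \<notin> strict_idx a q m"
  shows "block_mean a m i = block_mean a m j"
  using assms(2,3,4)
proof (induction j rule: dec_induct)
  case (step k)
  then show ?case using block_mean_step[of k] assms(1) by auto
qed simp

text \<open>A group consists of whole blocks.\<close>

lemma block_of_in_group:
  assumes "u \<in> {1..n}"
  defines "k \<equiv> block_of (q' a q m) (m' a q m) u"
  shows "idx a q m (k - 1) < block_of q m u" "block_of q m u \<le> idx a q m k"
proof -
  note P = stable_cuts[OF n stable]
  note g = block_of_bounds[OF group_cuts assms(1), folded k_def]
  note b = block_of_bounds[OF P assms(1)]
  show "idx a q m (k - 1) < block_of q m u"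
  proof (rule ccontr)
    assume "\<not> ?thesis"
    then have "m (block_of q m u) \<le> m (idx a q m (k - 1))"
      using g by (intro cuts_le[OF P] idx_le_q) auto
    then show False using g(2) b(3) by (simp add: m'_eq)
  qed
  show "block_of q m u \<le> idx a q m k"
  proof (rule ccontr)
    assume "\<not> ?thesis"
    then have "m (idx a q m k) \<le> m (block_of q m u - 1)"
      using b by (intro cuts_le[OF P]) auto
    then show False using g(3) b(2) by (simp add: m'_eq)
  qed
qed

lemma f_vec_group:
  assumes "u \<in> {1..n}"
  shows "f_vec a q m u = block_mean a m (idx a q m (block_of (q' a q m) (m' a q m) u))"
proof -
  define k where "k = block_of (q' a q m) (m' a q m) u"
  note g = block_of_bounds[OF group_cuts assms, folded k_def]
  note b = block_of_bounds[OF stable_cuts[OF n stable] assms]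
  note ib = block_of_in_group[OF assms, folded k_def]
  have "block_mean a m (block_of q m u) = block_mean a m (idx a q m k)"
  proof (rule block_mean_const[OF _ ib(2)])
    show "idx a q m k \<le> q" using g by (intro idx_le_q) auto
    fix l assume l: "block_of q m u \<le> l" "l < idx a q m k"
    show "l \<notin> strict_idx a q m"
    proof
      assume "l \<in> strict_idx a q m"
      then obtain k' where k': "k' \<in> {1..q' a q m}" "l = idx a q m k'" using idx_image by (metis imageE)
      have "\<not> k \<le> k'"
      proof
        assume "k \<le> k'"
        then have "idx a q m k \<le> idx a q m k'" using idx_less[of k k'] k' by (cases "k = k'") auto
        then show False using l k' by simp
      qed
      then have "k' \<le> k - 1" by simp
      moreover have "k - 1 \<le> q' a q m" using g(1) by auto
      ultimately have "idx a q m k' \<le> idx a q m (k - 1)" using idx_less[of k' "k - 1"] by (cases "k' = k - 1") auto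
      then show False using l k' ib(1) by simp
    qed
  qed (use b in auto)
  then show ?thesis using f_vec_eq_block_mean[OF n stable] by (simp add: k_def)
qed

lemma f_vec_eq_iff_group:
  assumes "u \<in> {1..n}" "v \<in> {1..n}"
  shows "f_vec a q m u = f_vec a q m v \<longleftrightarrow>
    block_of (q' a q m) (m' a q m) u = block_of (q' a q m) (m' a q m) v"
proof
  have less: "f_vec a q m u < f_vec a q m v"
    if uv: "u \<in> {1..n}" "v \<in> {1..n}" and lt: "block_of (q' a q m) (m' a q m) u < block_of (q' a q m) (m' a q m) v" for u v
  proof -
    define k l where "k = block_of (q' a q m) (m' a q m) u" and "l = block_of (q' a q m) (m' a q m) v"
    have kl: "1 \<le> k" "k < l" "l \<le> q' a q m"
      using block_of_bounds[OF group_cuts uv(1)] block_of_bounds[OF group_cuts uv(2)] lt by (auto simp: k_def l_def)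
    then have "idx a q m k < idx a q m l" "idx a q m l \<le> q" by (auto intro: idx_less idx_le_q)
    moreover have "idx a q m k \<in> strict_idx a q m" using idx_image kl by (metis atLeastAtMost_iff image_eqI less_imp_le_nat order_trans)
    ultimately have "block_mean a m (idx a q m k) < block_mean a m (idx a q m k + 1)"
      "1 \<le> idx a q m k" "idx a q m k + 1 \<le> idx a q m l" "idx a q m l \<le> q"
      using strict_idx_props(3) by (auto simp: strict_idx_def)
    then have "block_mean a m (idx a q m k) < block_mean a m (idx a q m l)"
      using block_mean_mono[OF n stable, of "idx a q m k + 1" "idx a q m l"] by simp
    then show ?thesis using f_vec_group uv by (simp add: k_def l_def)
  qed
  show "block_of (q' a q m) (m' a q m) u = block_of (q' a q m) (m' a q m) v" if "f_vec a q m u = f_vec a q m v"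
    using less[of u v] less[of v u] assms that by (metis less_irrefl linorder_neqE_nat)
  show "f_vec a q m u = f_vec a q m v" if "block_of (q' a q m) (m' a q m) u = block_of (q' a q m) (m' a q m) v"
    using f_vec_group assms that by simp
qed

text \<open>The groups are the maximal runs of blocks with equal means; m' lists their ends.\<close>

abbreviation "group_start \<equiv> block_start (q' a q m) (m' a q m)"

lemma group_start_bounds: "j \<in> {1..n} \<Longrightarrow> 1 \<le> group_start j \<and> group_start j \<le> j"
  using block_start_bounds[OF group_cuts] by blast

lemma f_vec_const_on_group: "j \<in> {1..n} \<Longrightarrow> p \<in> {group_start j..j} \<Longrightarrow> f_vec a q m p = f_vec a q m j"
proof -
  assume j: "j \<in> {1..n}" and p: "p \<in> {group_start j..j}"
  note g = block_of_bounds[OF group_cuts j]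
  have "block_of (q' a q m) (m' a q m) p = block_of (q' a q m) (m' a q m) j"
    using p g j by (intro block_of_eq[OF group_cuts]) (auto simp: block_start_def)
  then show ?thesis using f_vec_eq_iff_group[of p j] j p group_start_bounds[OF j] by auto
qed

lemma group_start_eq: "i \<in> {1..n} \<Longrightarrow> j \<in> {1..n} \<Longrightarrow> f_vec a q m i = f_vec a q m j \<Longrightarrow> group_start i = group_start j"
  using f_vec_eq_iff_group by (simp add: block_start_def)

lemma group_start_le_block_start:
  assumes j: "j \<in> {1..n}"
  shows "group_start j \<le> block_start q m j"
proof -
  let ?p = "block_start q m j"
  have p: "?p \<in> {1..n}" using block_start_bounds[OF stable_cuts[OF n stable] j] j by auto
  have "block_of q m ?p = block_of q m j"
    using block_of_bounds[OF stable_cuts[OF n stable] j] block_start_bounds[OF stable_cuts[OF n stable] j]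
    by (intro block_of_eq[OF stable_cuts[OF n stable]]) (auto simp: block_start_def)
  then have "f_vec a q m ?p = f_vec a q m j" using f_vec_eq_block_mean[OF n stable] by simp
  then show ?thesis using group_start_eq[OF p j] group_start_bounds[OF p] by simp
qed

lemma cut_not_group_end_iff:
  assumes "1 \<le> i" "i \<le> q - 1"
  shows "m i \<notin> m' a q m ` {1..q' a q m} \<longleftrightarrow> f_vec a q m (Suc (m i)) = f_vec a q m (m i)"
proof -
  have "m' a q m ` {1..q' a q m} = m ` strict_idx a q m"
    unfolding idx_image[symmetric] image_image by (rule image_cong) (simp_all add: m'_eq)
  moreover have "m i \<in> m ` strict_idx a q m \<longleftrightarrow> i \<in> strict_idx a q m"
    using inj_on_image_mem_iff[OF inj_cuts[OF n stable], of i "strict_idx a q m"] strict_idx_props(3) assms by fastforce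
  moreover have "i \<notin> strict_idx a q m \<longleftrightarrow> block_mean a m (Suc i) = block_mean a m i"
    using assms block_mean_mono[OF n stable, of i "Suc i"] unfolding Suc_eq_plus1 by (auto simp: strict_idx_def)
  moreover have "f_vec a q m (Suc (m i)) = block_mean a m (Suc i)" "f_vec a q m (m i) = block_mean a m i"
    using block_of_cut[OF n stable assms] f_vec_eq_block_mean[OF n stable] by simp_all
  ultimately show ?thesis by simp
qed

lemma nonstrict_run_iff:
  "{i..i + k} \<subseteq> {1..q} - strict_idx a q m \<longleftrightarrow>
    1 \<le> i \<and> i + k + 1 \<le> q \<and> block_mean a m i = block_mean a m (i + k + 1)"
proof
  assume A: "{i..i + k} \<subseteq> {1..q} - strict_idx a q m"
  moreover have "i \<in> {i..i + k}" "i + k \<in> {i..i + k}" by auto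
  ultimately have i: "i \<in> {1..q} - strict_idx a q m" "i + k \<in> {1..q} - strict_idx a q m" by blast+
  then have "i + k \<noteq> q" using strict_idx_props(2) by auto
  then have le: "i + k + 1 \<le> q" using i by auto
  have "block_mean a m i = block_mean a m (i + k + 1)"
  proof (rule block_mean_const)
    fix l assume "i \<le> l" "l < i + k + 1"
    then have "l \<in> {i..i + k}" by auto
    then show "l \<notin> strict_idx a q m" using A by blast
  qed (use i le in auto)
  then show "1 \<le> i \<and> i + k + 1 \<le> q \<and> block_mean a m i = block_mean a m (i + k + 1)" using i le by auto
next
  assume A: "1 \<le> i \<and> i + k + 1 \<le> q \<and> block_mean a m i = block_mean a m (i + k + 1)"
  show "{i..i + k} \<subseteq> {1..q} - strict_idx a q m"
  proof
    fix l assume l: "l \<in> {i..i + k}"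
    have "block_mean a m i \<le> block_mean a m l" "block_mean a m (l + 1) \<le> block_mean a m (i + k + 1)"
      by (rule block_mean_mono[OF n stable]; use A l in auto)+
    then have "\<not> block_mean a m l < block_mean a m (l + 1)" using A by linarith
    moreover have "l \<le> i + k" "i \<le> l" "i + k + 1 \<le> q" "1 \<le> i" using A l by auto
    then have "1 \<le> l" "l < q" by linarith+
    ultimately show "l \<in> {1..q} - strict_idx a q m" unfolding strict_idx_def by auto
  qed
qed

text \<open>Between a member of block i and a member of block i', the cuts are those at the ends of the blocks
i, ..., i' - 1.\<close>

lemma cut_sum:
  assumes i: "i \<in> {1..q}" and i': "i' \<in> {1..q}" and p: "p \<in> {m (i - 1)<..m i}" and j: "j \<in> {m (i' - 1)<..m i'}"
  shows "(\<Sum>r\<in>cut_idx q m \<inter> {p..<j}. \<xi> r) = (\<Sum>l=i..<i'. \<xi> (m l))"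
proof -
  note P = stable_cuts[OF n stable]
  have mem: "p \<le> m l \<longleftrightarrow> i \<le> l" "m l < j \<longleftrightarrow> l < i'" if l: "l \<in> {1..q - 1}" for l
  proof -
    show "p \<le> m l \<longleftrightarrow> i \<le> l"
    proof
      assume pl: "p \<le> m l"
      show "i \<le> l"
      proof (rule ccontr)
        assume "\<not> i \<le> l"
        then have "m l \<le> m (i - 1)" using i by (intro cuts_le[OF P]) auto
        then show False using pl p by simp
      qed
    next
      assume "i \<le> l"
      then have "m i \<le> m l" using l by (intro cuts_le[OF P]) auto
      then show "p \<le> m l" using p by simp
    qed
    show "m l < j \<longleftrightarrow> l < i'"
    proof
      assume lj: "m l < j"
      show "l < i'"
      proof (rule ccontr)
        assume "\<not> l < i'"
        then have "m i' \<le> m l" using l by (intro cuts_le[OF P]) auto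
        then show False using lj j by simp
      qed
    next
      assume "l < i'"
      then have "m l \<le> m (i' - 1)" using i' by (intro cuts_le[OF P]) auto
      then show "m l < j" using j by simp
    qed
  qed
  have e: "cut_idx q m \<inter> {p..<j} = m ` {i..<i'}"
  proof
    show "cut_idx q m \<inter> {p..<j} \<subseteq> m ` {i..<i'}" using mem by auto
    show "m ` {i..<i'} \<subseteq> cut_idx q m \<inter> {p..<j}"
    proof
      fix r assume "r \<in> m ` {i..<i'}"
      then obtain l where l: "r = m l" "i \<le> l" "l < i'" by auto
      then have "l \<in> {1..q - 1}" using i i' by auto
      then show "r \<in> cut_idx q m \<inter> {p..<j}" using mem[of l] l by auto
    qed
  qed
  have "inj_on m {i..<i'}" by (rule inj_on_subset[OF inj_cuts[OF n stable]]) (use i' in auto)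
  then show ?thesis unfolding e by (simp add: sum.reindex)
qed

text \<open>The index i and the run length k stand for the pair of blocks i and i + k + 1 in a common group;
the exponent counts the pairs of their members.\<close>

lemma A3_product:
  fixes \<xi> :: "nat \<Rightarrow> real"
  shows "(\<Prod>k=0..q - 1. \<Prod>i \<in> {i. {i..i + k} \<subseteq> {1..q} - strict_idx a q m}.
           (\<Sum>j=0..k. \<xi> (m (i + j))) ^ (block_len m i * block_len m (i + k + 1)))
   = (\<Prod>j=1..n. \<Prod>p=group_start j..<block_start q m j. \<Sum>r\<in>cut_idx q m \<inter> {p..<j}. \<xi> r)"
proof -
  note P = stable_cuts[OF n stable]
  define \<psi> where "\<psi> i i' = (\<Sum>l=i..<i'. \<xi> (m l))" for i i'
  \<comment> \<open>The earlier blocks in the group of block i'.\<close>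
  define G where "G i' = {i. 1 \<le> i \<and> i < i' \<and> block_mean a m i = block_mean a m i'}" for i'
  have finG: "finite (G i')" for i' by (rule finite_subset[of _ "{..i'}"]) (auto simp: G_def)
  have cell_card: "card {m (i - 1)<..m i} = block_len m i" for i by (simp add: block_len_def)
  have "(\<Prod>j=1..n. \<Prod>p=group_start j..<block_start q m j. \<Sum>r\<in>cut_idx q m \<inter> {p..<j}. \<xi> r)
     = (\<Prod>i'=1..q. \<Prod>i\<in>G i'. \<psi> i i' ^ (block_len m i * block_len m i'))"
    unfolding prod_over_blocks[OF P]
  proof (rule prod.cong[OF refl])
    fix i' assume i': "i' \<in> {1..q}"
    have inner: "(\<Prod>p=group_start j..<block_start q m j. \<Sum>r\<in>cut_idx q m \<inter> {p..<j}. \<xi> r) = (\<Prod>i\<in>G i'. \<psi> i i' ^ block_len m i)"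
      if j: "j \<in> {m (i' - 1)<..m i'}" for j
    proof -
      have jn: "j \<in> {1..n}" using block_cells[OF P] i' j by blast
      have bj: "block_of q m j = i'" using block_of_eq[OF P i'] j by simp
      have cells: "{group_start j..<block_start q m j} = (\<Union>i\<in>G i'. {m (i - 1)<..m i})"
      proof (intro subset_antisym subsetI)
        fix p assume p: "p \<in> {group_start j..<block_start q m j}"
        have pn: "p \<in> {1..n}" "p \<le> j" using p group_start_bounds[OF jn] block_start_bounds[OF P jn] jn by auto
        have fe: "f_vec a q m p = f_vec a q m j" using f_vec_const_on_group[OF jn, of p] p pn by auto
        note b = block_of_bounds[OF P pn(1)]
        have "p \<le> m (i' - 1)" using p bj by (simp add: block_start_def)
        then have "block_of q m p < i'"
        proof -
          have "\<not> i' \<le> block_of q m p"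
          proof
            assume "i' \<le> block_of q m p"
            then have "m (i' - 1) \<le> m (block_of q m p - 1)" using b i' by (intro cuts_le[OF P]) auto
            then show False using \<open>p \<le> m (i' - 1)\<close> b(2) by simp
          qed
          then show ?thesis by simp
        qed
        then have "block_of q m p \<in> G i'" using b fe bj f_vec_eq_block_mean[OF n stable] by (simp add: G_def)
        then show "p \<in> (\<Union>i\<in>G i'. {m (i - 1)<..m i})" using b by auto
      next
        fix p assume "p \<in> (\<Union>i\<in>G i'. {m (i - 1)<..m i})"
        then obtain i where i: "1 \<le> i" "i < i'" "block_mean a m i = block_mean a m i'" "p \<in> {m (i - 1)<..m i}" by (auto simp: G_def)
        have iq: "i \<in> {1..q}" using i i' by auto
        have pn: "p \<in> {1..n}" using block_cells[OF P] iq i by blast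
        have "block_of q m p = i" using block_of_eq[OF P iq] i by simp
        then have "f_vec a q m p = f_vec a q m j" using i bj f_vec_eq_block_mean[OF n stable] by simp
        then have "group_start j \<le> p" using group_start_eq[OF pn jn] group_start_bounds[OF pn] by simp
        moreover have "m i \<le> m (i' - 1)" using i i' by (intro cuts_le[OF P]) auto
        then have "p < block_start q m j" using i bj by (simp add: block_start_def)
        ultimately show "p \<in> {group_start j..<block_start q m j}" by simp
      qed
      have Gq: "i \<in> {1..q}" if "i \<in> G i'" for i using that i' by (auto simp: G_def)
      have "(\<Prod>p=group_start j..<block_start q m j. \<Sum>r\<in>cut_idx q m \<inter> {p..<j}. \<xi> r)
        = (\<Prod>i\<in>G i'. \<Prod>p\<in>{m (i - 1)<..m i}. \<Sum>r\<in>cut_idx q m \<inter> {p..<j}. \<xi> r)"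
        unfolding cells
        by (rule prod.UNION_disjoint, rule finG, simp, intro ballI impI, rule block_cells_disjoint[OF P Gq Gq])
      also have "\<dots> = (\<Prod>i\<in>G i'. \<Prod>p\<in>{m (i - 1)<..m i}. \<psi> i i')"
        by (intro prod.cong refl) (simp add: cut_sum[OF Gq i' _ j] \<psi>_def)
      also have "\<dots> = (\<Prod>i\<in>G i'. \<psi> i i' ^ block_len m i)"
        by (simp only: prod_constant cell_card)
      finally show ?thesis .
    qed
    have "(\<Prod>j\<in>{m (i' - 1)<..m i'}. \<Prod>p=group_start j..<block_start q m j. \<Sum>r\<in>cut_idx q m \<inter> {p..<j}. \<xi> r)
      = (\<Prod>j\<in>{m (i' - 1)<..m i'}. \<Prod>i\<in>G i'. \<psi> i i' ^ block_len m i)"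
      by (intro prod.cong refl inner)
    also have "\<dots> = (\<Prod>i\<in>G i'. \<psi> i i' ^ block_len m i) ^ block_len m i'"
      by (simp only: prod_constant cell_card)
    also have "\<dots> = (\<Prod>i\<in>G i'. \<psi> i i' ^ (block_len m i * block_len m i'))"
      unfolding prod_power_distrib power_mult ..
    finally show "(\<Prod>j\<in>{m (i' - 1)<..m i'}. \<Prod>p=group_start j..<block_start q m j. \<Sum>r\<in>cut_idx q m \<inter> {p..<j}. \<xi> r)
      = (\<Prod>i\<in>G i'. \<psi> i i' ^ (block_len m i * block_len m i'))" .
  qed
  also have "\<dots> = (\<Prod>(i', i)\<in>(SIGMA i':{1..q}. G i'). \<psi> i i' ^ (block_len m i * block_len m i'))"
    by (rule prod.Sigma) (use finG in auto)
  also have "\<dots> = (\<Prod>(k, i)\<in>(SIGMA k:{0..q - 1}. {i. {i..i + k} \<subseteq> {1..q} - strict_idx a q m}).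
      (\<Sum>j=0..k. \<xi> (m (i + j))) ^ (block_len m i * block_len m (i + k + 1)))"
  proof (rule prod.reindex_bij_witness[of _ "\<lambda>(k, i). (i + k + 1, i)" "\<lambda>(i', i). (i' - i - 1, i)"])
    fix y assume "y \<in> (SIGMA i':{1..q}. G i')"
    then obtain i' i where y: "y = (i', i)" "i' \<in> {1..q}" "1 \<le> i" "i < i'" "block_mean a m i = block_mean a m i'" by (auto simp: G_def)
    define k where "k = i' - i - 1"
    have i': "i' = i + k + 1" using y by (simp add: k_def)
    show "(case case y of (i', i) \<Rightarrow> (i' - i - 1, i) of (k, i) \<Rightarrow> (i + k + 1, i)) = y" using y i' by simp
    show "(case y of (i', i) \<Rightarrow> (i' - i - 1, i)) \<in> (SIGMA k:{0..q - 1}. {i. {i..i + k} \<subseteq> {1..q} - strict_idx a q m})"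
      using y i' unfolding mem_Sigma_iff by (simp add: nonstrict_run_iff k_def[symmetric])
    have "(\<Sum>j=0..k. \<xi> (m (i + j))) = \<psi> i i'"
      unfolding \<psi>_def by (rule sum.reindex_bij_witness[of _ "\<lambda>l. l - i" "\<lambda>j. i + j"]) (auto simp: i')
    then show "(case case y of (i', i) \<Rightarrow> (i' - i - 1, i) of (k, i) \<Rightarrow> (\<Sum>j=0..k. \<xi> (m (i + j))) ^ (block_len m i * block_len m (i + k + 1)))
      = (case y of (i', i) \<Rightarrow> \<psi> i i' ^ (block_len m i * block_len m i'))"
      using y i' by (simp add: k_def[symmetric])
  next
    fix y assume "y \<in> (SIGMA k:{0..q - 1}. {i. {i..i + k} \<subseteq> {1..q} - strict_idx a q m})"
    then obtain k i where y: "y = (k, i)" "{i..i + k} \<subseteq> {1..q} - strict_idx a q m" by auto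
    then have "1 \<le> i \<and> i + k + 1 \<le> q \<and> block_mean a m i = block_mean a m (i + k + 1)" by (simp only: nonstrict_run_iff)
    then show "(case case y of (k, i) \<Rightarrow> (i + k + 1, i) of (i', i) \<Rightarrow> (i' - i - 1, i)) = y"
      "(case y of (k, i) \<Rightarrow> (i + k + 1, i)) \<in> (SIGMA i':{1..q}. G i')"
      using y by (auto simp: G_def)
  qed
  also have "\<dots> = (\<Prod>k=0..q - 1. \<Prod>i \<in> {i. {i..i + k} \<subseteq> {1..q} - strict_idx a q m}.
           (\<Sum>j=0..k. \<xi> (m (i + j))) ^ (block_len m i * block_len m (i + k + 1)))"
  proof (rule prod.Sigma[symmetric])
    show "\<forall>k\<in>{0..q - 1}. finite {i. {i..i + k} \<subseteq> {1..q} - strict_idx a q m}"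
      unfolding nonstrict_run_iff by (auto intro: finite_subset[of _ "{..q}"])
  qed simp
  finally show ?thesis by simp
qed

lemma alpha_exp_eq:
  "alpha_exp n a q m = ((\<Sum>j=1..n. real (j - group_start j)) + (real n - real q) + (\<Sum>j=1..n. real (j - block_start q m j))) / 2"
  unfolding alpha_exp_def sum_choose_block_len[OF group_cuts] sum_choose_block_len[OF stable_cuts[OF n stable]] by simp

lemma h_fun_eq:
  "h_fun n a q m x = exp (- (\<Sum>i=1..n. x i * a i)) *
     leibniz n (\<lambda>i j. exp (x i * f_vec a q m j) * x i ^ (j - group_start j))"
proof -
  have e: "(\<Sum>l=1..q' a q m. if m' a q m (l - 1) < j \<and> j \<le> m' a q m l then j - m' a q m (l - 1) - 1 else 0) = j - group_start j"
    if j: "j \<in> {1..n}" for j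
  proof -
    define k where "k = block_of (q' a q m) (m' a q m) j"
    note g = block_of_bounds[OF group_cuts j, folded k_def]
    have "(\<Sum>l=1..q' a q m. if m' a q m (l - 1) < j \<and> j \<le> m' a q m l then j - m' a q m (l - 1) - 1 else 0)
       = (\<Sum>l=1..q' a q m. if l = k then j - m' a q m (k - 1) - 1 else 0)"
      by (rule sum.cong[OF refl]) (use block_of_iff[OF group_cuts _ j] k_def in auto)
    also have "\<dots> = j - group_start j" using g by (simp add: block_start_def k_def)
    finally show ?thesis .
  qed
  have "Matrix.mat n n (\<lambda>(r, s). let i = Suc r; j = Suc s in
         exp (x i * f_vec a q m j) *
         x i ^ (\<Sum>l=1..q' a q m. if m' a q m (l - 1) < j \<and> j \<le> m' a q m l then j - m' a q m (l - 1) - 1 else 0))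
     = Matrix.mat n n (\<lambda>(r, s). exp (x (Suc r) * f_vec a q m (Suc s)) * x (Suc r) ^ (Suc s - group_start (Suc s)))"
    by (rule eq_matI) (use e in \<open>auto simp: Let_def\<close>)
  then show ?thesis by (simp only: h_fun_def leibniz_eq_det)
qed

lemma A1_eq: "A1 n a q m = (2 * pi) powr (- real n / 2) * sqrt (2 * pi / real n) * (\<Prod>j=1..n. 1 / fact (j - group_start j))"
  unfolding A1_def prod_c_const[OF group_cuts] ..

end

section \<open>The density in rescaled coordinates\<close>

lemma leibniz_transpose: "leibniz n (\<lambda>i j. F j i) = leibniz n F"
proof -
  have "Matrix.mat n n (\<lambda>(r, s). F (Suc s) (Suc r)) = transpose_mat (Matrix.mat n n (\<lambda>(r, s). F (Suc r) (Suc s)))"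
    by (rule eq_matI) auto
  then show ?thesis unfolding leibniz_eq_det by (simp add: det_transpose[of _ n])
qed

lemma leibniz_scale: "leibniz n (\<lambda>i j. \<alpha> i * \<beta> j * F i j) = (\<Prod>i=1..n. \<alpha> i) * (\<Prod>j=1..n. \<beta> j) * leibniz n F"
proof -
  have "of_int (sign p) * (\<Prod>i=1..n. \<alpha> i * \<beta> (p i) * F i (p i))
      = (\<Prod>i=1..n. \<alpha> i) * (\<Prod>j=1..n. \<beta> j) * (of_int (sign p) * (\<Prod>i=1..n. F i (p i)))"
    if "p permutes {1..n}" for p
  proof -
    have "(\<Prod>i=1..n. \<beta> (p i)) = (\<Prod>j=1..n. \<beta> j)"
      using prod.permute[OF that, of \<beta>] by (simp add: o_def)
    then show ?thesis by (simp add: prod.distrib)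
  qed
  then show ?thesis unfolding leibniz_def sum_distrib_left by (intro sum.cong) auto
qed

lemma leibniz_cong:
  assumes "\<And>i j. i \<in> {1..n} \<Longrightarrow> j \<in> {1..n} \<Longrightarrow> F i j = G i j"
  shows "leibniz n F = leibniz n G"
  unfolding leibniz_def
proof (intro sum.cong refl arg_cong2[where f="(*)"] prod.cong)
  fix p i assume "p \<in> {p. p permutes {1..n}}" "i \<in> {1..n}"
  then show "F i (p i) = G i (p i)" using permutes_in_image[of p "{1..n}" i] by (intro assms) auto
qed

lemma weyl_chamber_consecutive: "y \<in> weyl_chamber n \<longleftrightarrow> (\<forall>k\<in>{1..<n}. y k < y (Suc k))"
proof
  assume A: "\<forall>k\<in>{1..<n}. y k < y (Suc k)"
  have "y i < y j" if "1 \<le> i" "i < j" "j \<le> n" for i j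
    using that(2,3)
  proof (induction j)
    case (Suc j)
    have "j = i \<or> y i < y j" using Suc by (cases "i = j") auto
    moreover have "y j < y (Suc j)" using A Suc.prems that(1) by auto
    ultimately show ?case by auto
  qed simp
  then show "y \<in> weyl_chamber n" by (auto simp: weyl_chamber_def)
qed (auto simp: weyl_chamber_def)

text \<open>The gaps inside blocks are indexed by I, those between blocks by K, and the index n is used for
the mean.\<close>

locale survival_setup =
  fixes n q :: nat and a x :: "nat \<Rightarrow> real" and m :: "nat \<Rightarrow> nat"
  assumes n: "n \<ge> 1" and stable: "stable_partition n a q m" and x: "x \<in> weyl_chamber n"
begin

abbreviation f where "f \<equiv> f_vec a q m"
abbreviation gstart where "gstart \<equiv> block_start (q' a q m) (m' a q m)"
abbreviation bstart where "bstart \<equiv> block_start q m"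
abbreviation I where "I \<equiv> interior_idx n q m"
abbreviation K where "K \<equiv> cut_idx q m"
abbreviation \<beta> where "\<beta> \<equiv> excess a q m"

lemma n_notin_I: "n \<notin> I"
  using interior_idx_eq[OF n stable] by auto

lemma index_split: "{1..n} = I \<union> insert n K" "I \<inter> insert n K = {}" "n \<notin> K" "finite K"
  using interior_idx_eq[OF n stable] cut_idx_subset[OF n stable] n by auto

text \<open>Gaps inside a block have a positive rate of decay and stay of order 1; the other coordinates
fluctuate on the scale sqrt t.\<close>

definition scale where "scale t k = (if k \<in> I then 1 else sqrt t)"
text \<open>The fluctuation of a gap in units of sqrt t.\<close>

definition sgap where "sgap t \<zeta> k = (if k \<in> I then \<zeta> k / sqrt t else \<zeta> k)" for \<zeta> :: "nat \<Rightarrow> real"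
definition fluct where "fluct t \<zeta> j = \<zeta> n + (\<Sum>k=1..<n. real k / real n * sgap t \<zeta> k) - (\<Sum>k=j..<n. sgap t \<zeta> k)"
text \<open>The constants are the gaps and the mean of t f.\<close>

definition position where
  "position t = gap_coords n (scale t) (\<lambda>k. t * (f (Suc k) - f k))
     (t * f n - (\<Sum>k=1..<n. real k / real n * (t * (f (Suc k) - f k))))"

lemma sgap_scale: "t > 0 \<Longrightarrow> scale t k * \<zeta> k = sqrt t * sgap t \<zeta> k"
  by (simp add: scale_def sgap_def)

lemma position_eq:
  assumes t: "t > 0" and j: "j \<in> {1..n}"
  shows "position t \<zeta> j = t * f j + sqrt t * fluct t \<zeta> j"
proof -
  have "(\<Sum>k=j..<n. t * (f (Suc k) - f k)) = t * (\<Sum>k=j..<n. f (Suc k) - f k)"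
    by (simp only: sum_distrib_left)
  also have "(\<Sum>k=j..<n. f (Suc k) - f k) = f n - f j"
    using j by (intro sum_Suc_diff') simp
  finally have tel: "(\<Sum>k=j..<n. t * (f (Suc k) - f k)) = t * f n - t * f j"
    by (simp only: right_diff_distrib)
  have sn: "scale t n = sqrt t" by (simp only: scale_def n_notin_I if_False)
  have "position t \<zeta> j = t * f n - (\<Sum>k=1..<n. real k / real n * (t * (f (Suc k) - f k))) + sqrt t * \<zeta> n
     + (\<Sum>k=1..<n. real k / real n * (sqrt t * sgap t \<zeta> k + t * (f (Suc k) - f k)))
     - (\<Sum>k=j..<n. sqrt t * sgap t \<zeta> k + t * (f (Suc k) - f k))"
    using j by (simp add: position_def gap_coords_def sgap_scale[OF t] sn)
  also have "(\<Sum>k=1..<n. real k / real n * (sqrt t * sgap t \<zeta> k + t * (f (Suc k) - f k)))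
     = sqrt t * (\<Sum>k=1..<n. real k / real n * sgap t \<zeta> k) + (\<Sum>k=1..<n. real k / real n * (t * (f (Suc k) - f k)))"
    by (simp add: sum.distrib[symmetric] sum_distrib_left algebra_simps)
  also have "(\<Sum>k=j..<n. sqrt t * sgap t \<zeta> k + t * (f (Suc k) - f k)) = sqrt t * (\<Sum>k=j..<n. sgap t \<zeta> k) + (t * f n - t * f j)"
    by (simp add: sum.distrib tel sum_distrib_left)
  finally show ?thesis by (simp add: fluct_def algebra_simps)
qed

lemma fluct_diff:
  assumes "p \<le> j" "j \<le> n"
  shows "fluct t \<zeta> j - fluct t \<zeta> p = (\<Sum>r=p..<j. sgap t \<zeta> r)"
proof -
  have "(\<Sum>r=p..<n. sgap t \<zeta> r) = (\<Sum>r=p..<j. sgap t \<zeta> r) + (\<Sum>r=j..<n. sgap t \<zeta> r)"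
    using assms by (simp add: sum.atLeastLessThan_concat)
  then show ?thesis by (simp add: fluct_def)
qed

lemma position_in_chamber_iff:
  assumes t: "t > 0"
  shows "position t \<zeta> \<in> weyl_chamber n \<longleftrightarrow> (\<forall>k\<in>{1..<n}. 0 < sqrt t * sgap t \<zeta> k + t * (f (Suc k) - f k))"
  unfolding weyl_chamber_consecutive
proof (intro ball_cong refl)
  fix k assume k: "k \<in> {1..<n}"
  have "fluct t \<zeta> (Suc k) - fluct t \<zeta> k = sgap t \<zeta> k" using fluct_diff[of k "Suc k" t \<zeta>] k by simp
  moreover have "position t \<zeta> (Suc k) - position t \<zeta> k
     = sqrt t * (fluct t \<zeta> (Suc k) - fluct t \<zeta> k) + t * (f (Suc k) - f k)"
    using position_eq[OF t, of k \<zeta>] position_eq[OF t, of "Suc k" \<zeta>] k by (simp add: algebra_simps)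
  ultimately show "position t \<zeta> k < position t \<zeta> (Suc k) \<longleftrightarrow> 0 < sqrt t * sgap t \<zeta> k + t * (f (Suc k) - f k)"
    by (metis diff_gt_0_iff_gt)
qed

text \<open>The positions divided by t are the nodes of the matrix exp (x i * z j / t).\<close>

definition slope where "slope t \<zeta> j = f j + fluct t \<zeta> j / sqrt t"

lemma position_slope: "t > 0 \<Longrightarrow> j \<in> {1..n} \<Longrightarrow> position t \<zeta> j / t = slope t \<zeta> j"
  by (simp add: position_eq slope_def field_simps)

text \<open>What remains of the difference of two nodes in a common group after a factor 1 / t (same block) or
1 / sqrt t (different blocks).\<close>

definition pair_gap where
  "pair_gap t \<zeta> p j = (if bstart j \<le> p then \<Sum>r=p..<j. \<zeta> r else \<Sum>r=p..<j. sgap t \<zeta> r)"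

definition dd_matrix where
  "dd_matrix t \<zeta> i j = divdiff (\<lambda>r. exp (x i * r)) (slope t \<zeta>) {gstart j..j}"

text \<open>The density in rescaled coordinates, up to the factor prefactor that depends on t only.\<close>

definition integrand where
  "integrand t \<zeta> = exp (- (\<Sum>k\<in>I. \<beta> k * \<zeta> k) - (\<Sum>j=1..n. (fluct t \<zeta> j)\<^sup>2) / 2) *
     (\<Prod>j=1..n. \<Prod>p=gstart j..<j. pair_gap t \<zeta> p j) * leibniz n (dd_matrix t \<zeta>)"

definition prefactor where
  "prefactor t = exp (- (\<Sum>i=1..n. x i * a i)) * exp (- gamma_rate a q m * t) * (1 / sqrt (2 * pi * t)) ^ n *
     exp (- (\<Sum>i=1..n. (x i)\<^sup>2) / (2 * t)) *
     (\<Prod>j=1..n. \<Prod>p=gstart j..<j. if bstart j \<le> p then 1 / t else 1 / sqrt t)"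

lemma slope_diff:
  assumes t: "t > 0" and j: "j \<in> {1..n}" and p: "p \<in> {gstart j..<j}"
  shows "slope t \<zeta> j - slope t \<zeta> p = pair_gap t \<zeta> p j * (if bstart j \<le> p then 1 / t else 1 / sqrt t)"
proof -
  have fe: "f p = f j" using f_vec_const_on_group[OF n stable j, of p] p by auto
  have d: "slope t \<zeta> j - slope t \<zeta> p = (\<Sum>r=p..<j. sgap t \<zeta> r) / sqrt t"
    unfolding slope_def fe using fluct_diff[of p j t \<zeta>] j p by (simp add: diff_divide_distrib[symmetric])
  show ?thesis
  proof (cases "bstart j \<le> p")
    case True
    have "sgap t \<zeta> r = \<zeta> r / sqrt t" if "r \<in> {p..<j}" for r
      using within_block_interior[OF n stable j, of r] True that by (simp add: sgap_def)
    then have "(\<Sum>r=p..<j. sgap t \<zeta> r) = (\<Sum>r=p..<j. \<zeta> r) / sqrt t"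
      by (simp add: sum_divide_distrib)
    then show ?thesis using d True t by (simp add: pair_gap_def)
  qed (simp add: d pair_gap_def)
qed

lemma slope_inj:
  assumes t: "t > 0" and W: "position t \<zeta> \<in> weyl_chamber n" and "A \<subseteq> {1..n}"
  shows "inj_on (slope t \<zeta>) A"
proof -
  have ne: "position t \<zeta> i \<noteq> position t \<zeta> j" if "i \<in> {1..n}" "j \<in> {1..n}" "i \<noteq> j" for i j
    using W that by (auto simp: weyl_chamber_def) (metis nat_neq_iff less_irrefl)
  have "inj_on (slope t \<zeta>) {1..n}"
  proof (rule inj_onI)
    fix i j assume ij: "i \<in> {1..n}" "j \<in> {1..n}" "slope t \<zeta> i = slope t \<zeta> j"
    then have "position t \<zeta> i / t = position t \<zeta> j / t" by (simp only: position_slope[OF t])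
    then have "position t \<zeta> i = position t \<zeta> j" using t by simp
    then show "i = j" using ne ij by blast
  qed
  then show ?thesis using assms(3) by (rule inj_on_subset)
qed

text \<open>In each coordinate, completing the square around t f leaves - t (a - f)^2 / 2, a multiple of (a -
f) times the fluctuation, and the square of the fluctuation. Summed over the coordinates, the first term is
the rate \<gamma>; the second becomes a sum over gaps after summation by parts, from which the gaps between
blocks drop out because the excess vanishes there.\<close>

lemma exponent_identity:
  assumes t: "t > 0"
  shows "(\<Sum>i=1..n. a i * position t \<zeta> i) - t / 2 * (\<Sum>i=1..n. (a i)\<^sup>2) - (\<Sum>i=1..n. (position t \<zeta> i)\<^sup>2) / (2 * t)
    = - gamma_rate a q m * t - (\<Sum>k\<in>I. \<beta> k * \<zeta> k) - (\<Sum>j=1..n. (fluct t \<zeta> j)\<^sup>2) / 2"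
proof -
  let ?v = "fluct t \<zeta>"
  have square: "A * (s * s * F + s * V) - s * s / 2 * A\<^sup>2 - (s * s * F + s * V)\<^sup>2 / (2 * (s * s))
     = - (A - F)\<^sup>2 / 2 * (s * s) + s * ((A - F) * V) - V\<^sup>2 / 2" if "s \<noteq> 0" for A F V s :: real
  proof -
    have "(s * s * F + s * V)\<^sup>2 / (2 * (s * s)) = (s * F + V)\<^sup>2 / 2"
      using that by (simp add: field_simps power2_eq_square)
    then show ?thesis by (simp add: field_simps power2_eq_square)
  qed
  have e: "a i * position t \<zeta> i - t / 2 * (a i)\<^sup>2 - (position t \<zeta> i)\<^sup>2 / (2 * t)
     = - (a i - f i)\<^sup>2 / 2 * t + sqrt t * ((a i - f i) * ?v i) - (?v i)\<^sup>2 / 2" if i: "i \<in> {1..n}" for i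
    using square[of "sqrt t" "a i" "f i" "?v i"] t unfolding position_eq[OF t i] by simp
  have "(\<Sum>i=1..n. a i * position t \<zeta> i) - t / 2 * (\<Sum>i=1..n. (a i)\<^sup>2) - (\<Sum>i=1..n. (position t \<zeta> i)\<^sup>2) / (2 * t)
    = (\<Sum>i=1..n. a i * position t \<zeta> i - t / 2 * (a i)\<^sup>2 - (position t \<zeta> i)\<^sup>2 / (2 * t))"
    by (simp add: sum_subtractf sum_distrib_left sum_divide_distrib)
  also have "\<dots> = (\<Sum>i=1..n. - (a i - f i)\<^sup>2 / 2 * t + sqrt t * ((a i - f i) * ?v i) - (?v i)\<^sup>2 / 2)"
    by (intro sum.cong refl e)
  also have "\<dots> = - gamma_rate a q m * t + sqrt t * (\<Sum>i=1..n. (a i - f i) * ?v i) - (\<Sum>i=1..n. (?v i)\<^sup>2) / 2"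
    unfolding gamma_rate_eq[OF n stable] sum_subtractf sum.distrib
    by (simp add: sum_distrib_left[symmetric] sum_distrib_right[symmetric] sum_divide_distrib[symmetric] sum_negf)
  also have "sqrt t * (\<Sum>i=1..n. (a i - f i) * ?v i) = - (\<Sum>k\<in>I. \<beta> k * \<zeta> k)"
  proof -
    have "sqrt t * (\<beta> k * (?v (Suc k) - ?v k)) = \<beta> k * \<zeta> k" if k: "k \<in> I" for k
    proof -
      have "Suc k \<le> n" using k interior_idx_eq[OF n stable] by auto
      then have "?v (Suc k) - ?v k = sgap t \<zeta> k" using fluct_diff[of k "Suc k" t \<zeta>] by simp
      then show ?thesis using k t by (simp add: sgap_def)
    qed
    then have "sqrt t * (\<Sum>k\<in>I. \<beta> k * (?v (Suc k) - ?v k)) = (\<Sum>k\<in>I. \<beta> k * \<zeta> k)"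
      unfolding sum_distrib_left by (rule sum.cong[OF refl])
    then show ?thesis unfolding summation_by_parts_excess[OF n stable] by (simp only: mult_minus_right)
  qed
  finally show ?thesis by simp
qed

text \<open>The Gaussian determinant is the determinant of exp (x i * z j / t) up to factors of rows and
columns. In each group its nodes approach each other, and the product of their differences is extracted by
divided differences.\<close>

lemma km_density_position:
  assumes t: "t > 0" and W: "position t \<zeta> \<in> weyl_chamber n"
  shows "km_density n a t x (position t \<zeta>) = prefactor t * integrand t \<zeta>"
proof -
  let ?z = "position t \<zeta>" and ?s = "sqrt (2 * pi * t)"
  have gs: "gauss t (?z i - x j) = (exp (- (?z i)\<^sup>2 / (2 * t)) / ?s) * exp (- (x j)\<^sup>2 / (2 * t)) * exp (x j * slope t \<zeta> i)"
    if i: "i \<in> {1..n}" for i j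
  proof -
    have "- (?z i - x j)\<^sup>2 / (2 * t) = - (?z i)\<^sup>2 / (2 * t) + - (x j)\<^sup>2 / (2 * t) + x j * slope t \<zeta> i"
      unfolding position_slope[OF t i, symmetric] using t by (simp add: power2_diff field_simps)
    then show ?thesis unfolding gauss_eq[OF t] by (simp only: exp_add) simp
  qed
  have "leibniz n (\<lambda>i j. gauss t (?z i - x j))
      = leibniz n (\<lambda>i j. (exp (- (?z i)\<^sup>2 / (2 * t)) / ?s) * exp (- (x j)\<^sup>2 / (2 * t)) * exp (x j * slope t \<zeta> i))"
    by (rule leibniz_cong) (rule gs)
  also have "\<dots> = (\<Prod>i=1..n. exp (- (?z i)\<^sup>2 / (2 * t)) / ?s) * (\<Prod>j=1..n. exp (- (x j)\<^sup>2 / (2 * t))) *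
      leibniz n (\<lambda>i j. exp (x j * slope t \<zeta> i))"
    by (rule leibniz_scale)
  also have "leibniz n (\<lambda>i j. exp (x j * slope t \<zeta> i)) = leibniz n (\<lambda>i j. exp (x i * slope t \<zeta> j))"
    by (rule leibniz_transpose)
  also have "\<dots> = (\<Prod>j=1..n. \<Prod>p=gstart j..<j. slope t \<zeta> j - slope t \<zeta> p) * leibniz n (dd_matrix t \<zeta>)"
    unfolding dd_matrix_def
  proof (rule leibniz_divdiff)
    fix j assume j: "j \<in> {1..n}"
    show "1 \<le> gstart j \<and> gstart j \<le> j" using group_start_bounds[OF n stable j] .
    then show "inj_on (slope t \<zeta>) {gstart j..j}" using j by (intro slope_inj[OF t W]) auto
  qed
  also have "(\<Prod>j=1..n. \<Prod>p=gstart j..<j. slope t \<zeta> j - slope t \<zeta> p)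
     = (\<Prod>j=1..n. \<Prod>p=gstart j..<j. pair_gap t \<zeta> p j) * (\<Prod>j=1..n. \<Prod>p=gstart j..<j. if bstart j \<le> p then 1 / t else 1 / sqrt t)"
    unfolding prod.distrib[symmetric] by (intro prod.cong refl slope_diff[OF t])
  also have "(\<Prod>i=1..n. exp (- (?z i)\<^sup>2 / (2 * t)) / ?s) = exp (- (\<Sum>i=1..n. (?z i)\<^sup>2) / (2 * t)) * (1 / ?s) ^ n"
    by (simp add: prod_dividef exp_sum[symmetric] sum_negf sum_divide_distrib[symmetric] power_divide)
  also have "(\<Prod>j=1..n. exp (- (x j)\<^sup>2 / (2 * t))) = exp (- (\<Sum>i=1..n. (x i)\<^sup>2) / (2 * t))"
    by (simp add: exp_sum[symmetric] sum_negf sum_divide_distrib[symmetric])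
  finally have L: "leibniz n (\<lambda>i j. gauss t (?z i - x j)) =
     exp (- (\<Sum>i=1..n. (?z i)\<^sup>2) / (2 * t)) * (1 / ?s) ^ n * exp (- (\<Sum>i=1..n. (x i)\<^sup>2) / (2 * t)) *
     ((\<Prod>j=1..n. \<Prod>p=gstart j..<j. pair_gap t \<zeta> p j) *
      (\<Prod>j=1..n. \<Prod>p=gstart j..<j. if bstart j \<le> p then 1 / t else 1 / sqrt t) * leibniz n (dd_matrix t \<zeta>))" .
  have ax: "(\<Sum>i=1..n. a i * x i) = (\<Sum>i=1..n. x i * a i)" by (simp add: mult.commute)
  have "exp ((\<Sum>i=1..n. a i * ?z i) - (\<Sum>i=1..n. a i * x i) - t / 2 * (\<Sum>i=1..n. (a i)\<^sup>2)) * exp (- (\<Sum>i=1..n. (?z i)\<^sup>2) / (2 * t))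
     = exp (- (\<Sum>i=1..n. x i * a i) + ((\<Sum>i=1..n. a i * ?z i) - t / 2 * (\<Sum>i=1..n. (a i)\<^sup>2) - (\<Sum>i=1..n. (?z i)\<^sup>2) / (2 * t)))"
    unfolding exp_add[symmetric] ax by simp
  also have "\<dots> = exp (- (\<Sum>i=1..n. x i * a i)) * exp (- gamma_rate a q m * t) *
     exp (- (\<Sum>k\<in>I. \<beta> k * \<zeta> k) - (\<Sum>j=1..n. (fluct t \<zeta> j)\<^sup>2) / 2)"
    unfolding exponent_identity[OF t] exp_add[symmetric] by simp
  finally have E: "exp ((\<Sum>i=1..n. a i * ?z i) - (\<Sum>i=1..n. a i * x i) - t / 2 * (\<Sum>i=1..n. (a i)\<^sup>2)) * exp (- (\<Sum>i=1..n. (?z i)\<^sup>2) / (2 * t))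
     = exp (- (\<Sum>i=1..n. x i * a i)) * exp (- gamma_rate a q m * t) *
     exp (- (\<Sum>k\<in>I. \<beta> k * \<zeta> k) - (\<Sum>j=1..n. (fluct t \<zeta> j)\<^sup>2) / 2)" .
  have R: "E0 * (Z * S * X0 * (P * T0 * D)) = (A * G * S * X0 * T0) * (V * P * D)" if "E0 * Z = A * G * V" for E0 Z S X0 P T0 D A G V :: real
    using that by (simp add: mult_ac)
  show ?thesis
    unfolding km_density_def L prefactor_def integrand_def by (rule R[OF E])
qed

lemma prod_scale:
  assumes t: "t > 0"
  shows "(\<Prod>k=1..n. scale t k) = sqrt t ^ q"
proof -
  have "(\<Prod>k=1..n. scale t k) = (\<Prod>k\<in>I. scale t k) * (\<Prod>k\<in>insert n K. scale t k)"
    using prod.union_disjoint[OF _ _ index_split(2), of "scale t"] index_split(4)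
      prod.cong[OF index_split(1), of "scale t" "scale t"] by simp
  also have "(\<Prod>k\<in>I. scale t k) = 1" by (rule prod.neutral) (simp add: scale_def)
  also have "(\<Prod>k\<in>insert n K. scale t k) = (\<Prod>k\<in>insert n K. sqrt t)"
    using index_split(2) by (intro prod.cong) (auto simp: scale_def)
  also have "\<dots> = sqrt t ^ card (insert n K)" by simp
  also have "card (insert n K) = q"
    using index_split(3,4) card_cut_idx[OF n stable] stable_q_pos[OF n stable] by simp
  finally show ?thesis by simp
qed

text \<open>The powers of t: q / 2 from the Jacobian, - n / 2 from the Gaussian normalisation, and - 1 or - 1
/ 2 for each pair of indices in a common block, or in a common group but in different blocks.\<close>

lemma prefactor_eq:
  assumes t: "t > 0"
  shows "(\<Prod>k=1..n. scale t k) * prefactor t =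
    (2 * pi) powr (- real n / 2) * exp (- (\<Sum>i=1..n. x i * a i)) * exp (- (\<Sum>i=1..n. (x i)\<^sup>2) / (2 * t)) *
    t powr (- alpha_exp n a q m) * exp (- gamma_rate a q m * t)"
proof -
  have sq: "sqrt t = t powr (1/2)" using t by (simp add: powr_half_sqrt)
  have 1: "sqrt t ^ q = t powr (real q / 2)"
    unfolding sq using t by (simp add: powr_realpow[symmetric] powr_powr)
  have 2: "(1 / sqrt (2 * pi * t)) ^ n = (2 * pi) powr (- real n / 2) * t powr (- real n / 2)"
  proof -
    have "1 / sqrt (2 * pi * t) = (2 * pi * t) powr (- 1/2)"
      using t by (simp add: powr_minus_divide powr_half_sqrt)
    then have "(1 / sqrt (2 * pi * t)) ^ n = (2 * pi * t) powr (- real n / 2)"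
      using t by (simp add: powr_realpow[symmetric] powr_powr)
    then show ?thesis using t by (simp add: powr_mult)
  qed
  have 3: "(\<Prod>p=gstart j..<j. if bstart j \<le> p then 1 / t else 1 / sqrt t)
     = t powr (- (real (j - gstart j) + real (j - bstart j)) / 2)" if j: "j \<in> {1..n}" for j
  proof -
    have le: "gstart j \<le> bstart j" "bstart j \<le> j"
      using group_start_le_block_start[OF n stable j] block_start_bounds[OF stable_cuts[OF n stable] j] by auto
    then have "{gstart j..<j} = {gstart j..<bstart j} \<union> {bstart j..<j}" by auto
    then have "(\<Prod>p=gstart j..<j. if bstart j \<le> p then 1 / t else 1 / sqrt t)
      = (\<Prod>p=gstart j..<bstart j. if bstart j \<le> p then 1 / t else 1 / sqrt t) * (\<Prod>p=bstart j..<j. if bstart j \<le> p then 1 / t else 1 / sqrt t)"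
      by (simp only:) (rule prod.union_disjoint, auto)
    also have "\<dots> = (\<Prod>p=gstart j..<bstart j. 1 / sqrt t) * (\<Prod>p=bstart j..<j. 1 / t)"
      by (intro arg_cong2[where f="(*)"] prod.cong) auto
    also have "\<dots> = (t powr (- 1/2)) ^ (bstart j - gstart j) * (t powr (- 1)) ^ (j - bstart j)"
      using t by (simp add: powr_minus_divide powr_half_sqrt)
    also have "\<dots> = t powr (- (1/2) * real (bstart j - gstart j) - real (j - bstart j))"
    proof -
      have "(t powr c) ^ k = t powr (c * real k)" for c k
        using t by (simp add: powr_realpow[symmetric] powr_powr)
      then show ?thesis by (simp only: powr_add[symmetric]) simp
    qed
    also have "- (1/2) * real (bstart j - gstart j) - real (j - bstart j) = - (real (j - gstart j) + real (j - bstart j)) / 2"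
      using le by (simp add: of_nat_diff field_simps)
    finally show ?thesis .
  qed
  have "(\<Prod>j=1..n. \<Prod>p=gstart j..<j. if bstart j \<le> p then 1 / t else 1 / sqrt t)
     = (\<Prod>j=1..n. t powr (- (real (j - gstart j) + real (j - bstart j)) / 2))"
    by (intro prod.cong refl 3)
  also have "\<dots> = t powr (\<Sum>j=1..n. - (real (j - gstart j) + real (j - bstart j)) / 2)"
    using t by (simp add: powr_sum)
  also have "(\<Sum>j=1..n. - (real (j - gstart j) + real (j - bstart j)) / 2)
     = - ((\<Sum>j=1..n. real (j - gstart j)) + (\<Sum>j=1..n. real (j - bstart j))) / 2"
    by (simp add: sum_negf sum_subtractf sum_divide_distrib[symmetric])
  finally have 4: "(\<Prod>j=1..n. \<Prod>p=gstart j..<j. if bstart j \<le> p then 1 / t else 1 / sqrt t)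
     = t powr (- ((\<Sum>j=1..n. real (j - gstart j)) + (\<Sum>j=1..n. real (j - bstart j))) / 2)" .
  have 5: "t powr (real q / 2) * t powr (- real n / 2) * t powr (- ((\<Sum>j=1..n. real (j - gstart j)) + (\<Sum>j=1..n. real (j - bstart j))) / 2)
     = t powr (- alpha_exp n a q m)"
    unfolding powr_add[symmetric] alpha_exp_eq[OF n stable]
    by (rule arg_cong[where f="(powr) t"]) (simp add: field_simps)
  have "(\<Prod>k=1..n. scale t k) * prefactor t =
    (2 * pi) powr (- real n / 2) * exp (- (\<Sum>i=1..n. x i * a i)) * exp (- (\<Sum>i=1..n. (x i)\<^sup>2) / (2 * t)) *
    (t powr (real q / 2) * t powr (- real n / 2) * t powr (- ((\<Sum>j=1..n. real (j - gstart j)) + (\<Sum>j=1..n. real (j - bstart j))) / 2))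
    * exp (- gamma_rate a q m * t)"
    unfolding prod_scale[OF t] prefactor_def 1 2 4 by (simp only: mult_ac)
  then show ?thesis unfolding 5 .
qed

end

section \<open>An integrable bound\<close>

text \<open>D is the vector with the gaps y and sum 0. In the basis of gaps, the Gram matrix of such vectors
is S_mat.\<close>

lemma centred_sum_squares:
  fixes y :: "nat \<Rightarrow> real"
  assumes n: "n \<ge> 1"
  defines "D \<equiv> \<lambda>j. \<Sum>k=1..<n. (real k / real n - of_bool (j \<le> k)) * y k"
  shows "(\<Sum>j=1..n. (c + D j)\<^sup>2) = real n * c\<^sup>2 + (\<Sum>j=1..n. (D j)\<^sup>2)"
    and "(\<Sum>j=1..n. (D j)\<^sup>2) = (\<Sum>k=1..<n. \<Sum>l=1..<n. S_mat n k l * y k * y l)"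
proof -
  have cnt: "(\<Sum>j=1..n. of_bool (j \<le> k)) = real k" if "k < n" for k
  proof -
    have "(\<Sum>j=1..n. of_bool (j \<le> k)) = (\<Sum>j=1..k. 1::real)"
      by (rule sum.mono_neutral_cong_right) (use that in auto)
    then show ?thesis by simp
  qed
  have "(\<Sum>j=1..n. D j) = (\<Sum>k=1..<n. \<Sum>j=1..n. (real k / real n - of_bool (j \<le> k)) * y k)"
    unfolding D_def by (rule sum.swap)
  also have "\<dots> = (\<Sum>k=1..<n. 0)"
  proof (rule sum.cong[OF refl])
    fix k assume k: "k \<in> {1..<n}"
    have "(\<Sum>j=1..n. (real k / real n - of_bool (j \<le> k)) * y k) = (\<Sum>j=1..n. real k / real n - of_bool (j \<le> k)) * y k"
      by (simp only: sum_distrib_right)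
    also have "(\<Sum>j=1..n. real k / real n - of_bool (j \<le> k)) = 0"
      using cnt[of k] k n by (simp add: sum_subtractf)
    finally show "(\<Sum>j=1..n. (real k / real n - of_bool (j \<le> k)) * y k) = 0" by simp
  qed
  finally have D0: "(\<Sum>j=1..n. D j) = 0" by simp
  have "(\<Sum>j=1..n. (c + D j)\<^sup>2) = (\<Sum>j=1..n. c\<^sup>2 + 2 * c * D j + (D j)\<^sup>2)"
    by (simp add: power2_sum algebra_simps)
  also have "\<dots> = real n * c\<^sup>2 + 2 * c * (\<Sum>j=1..n. D j) + (\<Sum>j=1..n. (D j)\<^sup>2)"
    by (simp only: sum.distrib sum_distrib_left[symmetric]) simp
  finally show "(\<Sum>j=1..n. (c + D j)\<^sup>2) = real n * c\<^sup>2 + (\<Sum>j=1..n. (D j)\<^sup>2)" by (simp add: D0)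
  have S: "(\<Sum>j=1..n. (real k / real n - of_bool (j \<le> k)) * (real l / real n - of_bool (j \<le> l))) = S_mat n k l"
    if k: "k < n" and l: "l < n" for k l
  proof -
    have "(\<Sum>j=1..n. (real k / real n - of_bool (j \<le> k)) * (real l / real n - of_bool (j \<le> l)))
      = (\<Sum>j=1..n. real k * real l / (real n)\<^sup>2 - real k / real n * of_bool (j \<le> l) - real l / real n * of_bool (j \<le> k) + of_bool (j \<le> min k l))"
      by (rule sum.cong) (auto simp: power2_eq_square algebra_simps of_bool_def)
    also have "\<dots> = real n * (real k * real l / (real n)\<^sup>2) - real k / real n * (\<Sum>j=1..n. of_bool (j \<le> l))
        - real l / real n * (\<Sum>j=1..n. of_bool (j \<le> k)) + (\<Sum>j=1..n. of_bool (j \<le> min k l))"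
      by (simp only: sum.distrib sum_subtractf sum_distrib_left[symmetric] sum_constant card_atLeastAtMost) simp
    also have "\<dots> = real n * (real k * real l / (real n)\<^sup>2) - real k / real n * real l - real l / real n * real k + real (min k l)"
      using cnt[of l] cnt[of k] cnt[of "min k l"] k l by (simp only: min_less_iff_disj simp_thms)
    also have "\<dots> = S_mat n k l"
      using n by (auto simp: S_mat_def min_def power2_eq_square field_simps)
    finally show ?thesis .
  qed
  have "(\<Sum>j=1..n. (D j)\<^sup>2) = (\<Sum>j=1..n. \<Sum>k=1..<n. \<Sum>l=1..<n.
      ((real k / real n - of_bool (j \<le> k)) * (real l / real n - of_bool (j \<le> l))) * (y k * y l))"
    unfolding D_def power2_eq_square sum_product by (simp only: mult_ac)
  also have "\<dots> = (\<Sum>k=1..<n. \<Sum>j=1..n. \<Sum>l=1..<n.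
      ((real k / real n - of_bool (j \<le> k)) * (real l / real n - of_bool (j \<le> l))) * (y k * y l))"
    by (rule sum.swap)
  also have "\<dots> = (\<Sum>k=1..<n. \<Sum>l=1..<n. \<Sum>j=1..n.
      ((real k / real n - of_bool (j \<le> k)) * (real l / real n - of_bool (j \<le> l))) * (y k * y l))"
    by (intro sum.cong refl sum.swap)
  also have "\<dots> = (\<Sum>k=1..<n. \<Sum>l=1..<n. S_mat n k l * (y k * y l))"
    by (intro sum.cong refl) (simp only: sum_distrib_right[symmetric] S atLeastLessThan_iff)
  finally show "(\<Sum>j=1..n. (D j)\<^sup>2) = (\<Sum>k=1..<n. \<Sum>l=1..<n. S_mat n k l * y k * y l)"
    by (simp only: mult.assoc)
qed

lemma power_le_exp:
  fixes L d :: real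
  assumes "L \<ge> 0" "d > 0"
  shows "L ^ N \<le> (real N / d) ^ N * exp (d * L)"
proof (cases "N = 0")
  case True
  then show ?thesis using assms by simp
next
  case False
  have "(d * L / real N) ^ N \<le> (1 + d * L / real N) ^ N"
    using assms by (intro power_mono) auto
  also have "\<dots> \<le> exp (d * L)"
    using assms False by (intro exp_ge_one_plus_x_over_n_power_n) (auto intro: order_trans[of _ 0])
  finally have "(real N / d) ^ N * (d * L / real N) ^ N \<le> (real N / d) ^ N * exp (d * L)"
    using assms by (intro mult_left_mono) auto
  then show ?thesis using assms False by (simp add: power_mult_distrib[symmetric])
qed

lemma integrable_exp_half_line:
  assumes "d > 0"
  shows "integrable lborel (\<lambda>y::real. of_bool (y > 0) * exp (- d * y))"
proof -
  have "emeasure (density lborel (\<lambda>y. ennreal (erlang_density 0 d y))) UNIV = 1"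
    using prob_space.emeasure_space_1[OF prob_space_exponential_density[OF assms]] by simp
  then have "(\<integral>\<^sup>+y. ennreal (erlang_density 0 d y) \<partial>lborel) = 1"
    by (simp add: emeasure_density)
  then have "integrable lborel (erlang_density 0 d)"
    using assms by (intro integrableI_nonneg) (auto simp: erlang_density_def)
  then have "integrable lborel (\<lambda>y. (1 / d) * erlang_density 0 d y)" by simp
  then show ?thesis
  proof (rule Bochner_Integration.integrable_bound)
    show "AE y in lborel. norm (of_bool (y > 0) * exp (- d * y)) \<le> norm (1 / d * erlang_density 0 d y)"
      using assms by (auto simp: erlang_density_def mult.commute)
  qed (simp add: of_bool_def)
qed

lemma integrable_exp_quadratic:
  "integrable lborel (\<lambda>y::real. exp (- y\<^sup>2 / 16 + c * \<bar>y\<bar>))"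
proof -
  have "integrable lborel (\<lambda>y. (exp (8 * c\<^sup>2) * sqrt (2 * pi * 4\<^sup>2)) * normal_density 0 4 y)"
    by (intro integrable_mult_right integrable_normal_density) simp
  then show ?thesis
  proof (rule Bochner_Integration.integrable_bound)
    show "AE y in lborel. norm (exp (- y\<^sup>2 / 16 + c * \<bar>y\<bar>)) \<le> norm (exp (8 * c\<^sup>2) * sqrt (2 * pi * 4\<^sup>2) * normal_density 0 4 y)"
    proof (rule AE_I2)
      fix y :: real
      have "0 \<le> (\<bar>y\<bar> / 4 - 4 * c)\<^sup>2" by simp
      then have "- y\<^sup>2 / 16 + c * \<bar>y\<bar> \<le> 8 * c\<^sup>2 + - y\<^sup>2 / 32"
        by (simp add: power2_diff power_divide field_simps)
      then have "exp (- y\<^sup>2 / 16 + c * \<bar>y\<bar>) \<le> exp (8 * c\<^sup>2 + - y\<^sup>2 / 32)" by simp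
      also have "\<dots> = exp (8 * c\<^sup>2) * exp (- y\<^sup>2 / 32)" by (rule exp_add)
      also have "exp (- y\<^sup>2 / 32) = sqrt (2 * pi * 4\<^sup>2) * normal_density 0 4 y"
        by (simp add: normal_density_def)
      finally show "norm (exp (- y\<^sup>2 / 16 + c * \<bar>y\<bar>)) \<le> norm (exp (8 * c\<^sup>2) * sqrt (2 * pi * 4\<^sup>2) * normal_density 0 4 y)"
        by (simp add: mult.assoc)
    qed
  qed simp
qed

context survival_setup
begin

lemma fluct_centred:
  assumes "j \<in> {1..n}"
  shows "fluct t \<zeta> j = \<zeta> n + (\<Sum>k=1..<n. (real k / real n - of_bool (j \<le> k)) * sgap t \<zeta> k)"
proof -
  have "(\<Sum>k=j..<n. sgap t \<zeta> k) = (\<Sum>k=1..<n. of_bool (j \<le> k) * sgap t \<zeta> k)"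
    by (rule sum.mono_neutral_cong_left) (use assms in auto)
  then show ?thesis by (simp add: fluct_def left_diff_distrib sum_subtractf)
qed

lemma sum_fluct_squares:
  "(\<Sum>j=1..n. (fluct t \<zeta> j)\<^sup>2) = real n * (\<zeta> n)\<^sup>2 + (\<Sum>k=1..<n. \<Sum>l=1..<n. S_mat n k l * sgap t \<zeta> k * sgap t \<zeta> l)"
proof -
  have "(\<Sum>j=1..n. (fluct t \<zeta> j)\<^sup>2) = (\<Sum>j=1..n. (\<zeta> n + (\<Sum>k=1..<n. (real k / real n - of_bool (j \<le> k)) * sgap t \<zeta> k))\<^sup>2)"
    by (intro sum.cong refl) (simp add: fluct_centred)
  then show ?thesis
    using centred_sum_squares(1)[OF n, of "\<zeta> n" "sgap t \<zeta>"] centred_sum_squares(2)[OF n, of "sgap t \<zeta>"] by simp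
qed

text \<open>The gaps are differences of consecutive fluctuations, and the mean is orthogonal to the
rest.\<close>

lemma sum_fluct_squares_ge:
  "(\<Sum>j=1..n. (fluct t \<zeta> j)\<^sup>2) \<ge> (\<Sum>k\<in>insert n K. (\<zeta> k)\<^sup>2) / 8"
proof -
  let ?V = "\<Sum>j=1..n. (fluct t \<zeta> j)\<^sup>2"
  let ?D = "\<lambda>j. \<Sum>k=1..<n. (real k / real n - of_bool (j \<le> k)) * sgap t \<zeta> k"
  have "?V = (\<Sum>j=1..n. (\<zeta> n + ?D j)\<^sup>2)"
    by (intro sum.cong refl) (simp add: fluct_centred)
  also have "\<dots> = real n * (\<zeta> n)\<^sup>2 + (\<Sum>j=1..n. (?D j)\<^sup>2)" by (rule centred_sum_squares(1)[OF n])
  also have "\<dots> \<ge> 1 * (\<zeta> n)\<^sup>2 + 0"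
    using n by (intro add_mono mult_right_mono sum_nonneg) auto
  finally have V1: "?V \<ge> (\<zeta> n)\<^sup>2" by simp
  have "(\<Sum>k\<in>K. (\<zeta> k)\<^sup>2) = (\<Sum>k\<in>K. (sgap t \<zeta> k)\<^sup>2)"
    by (rule sum.cong) (use index_split(2) in \<open>auto simp: sgap_def\<close>)
  also have "\<dots> \<le> (\<Sum>k=1..<n. (sgap t \<zeta> k)\<^sup>2)"
    using cut_idx_subset[OF n stable] by (intro sum_mono2) auto
  also have "\<dots> \<le> (\<Sum>k=1..<n. 2 * (fluct t \<zeta> (Suc k))\<^sup>2 + 2 * (fluct t \<zeta> k)\<^sup>2)"
  proof (rule sum_mono)
    fix k assume k: "k \<in> {1..<n}"
    have s: "sgap t \<zeta> k = fluct t \<zeta> (Suc k) - fluct t \<zeta> k"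
      using fluct_diff[of k "Suc k" t \<zeta>] k by simp
    have "0 \<le> (fluct t \<zeta> (Suc k) + fluct t \<zeta> k)\<^sup>2" by simp
    then show "(sgap t \<zeta> k)\<^sup>2 \<le> 2 * (fluct t \<zeta> (Suc k))\<^sup>2 + 2 * (fluct t \<zeta> k)\<^sup>2"
      unfolding s by (simp add: power2_sum power2_diff)
  qed
  also have "\<dots> = 2 * (\<Sum>k=1..<n. (fluct t \<zeta> (Suc k))\<^sup>2) + 2 * (\<Sum>k=1..<n. (fluct t \<zeta> k)\<^sup>2)"
    by (simp add: sum.distrib sum_distrib_left)
  also have "(\<Sum>k=1..<n. (fluct t \<zeta> (Suc k))\<^sup>2) = (\<Sum>k=Suc 1..<Suc n. (fluct t \<zeta> k)\<^sup>2)"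
    by (rule sum.shift_bounds_Suc_ivl[symmetric])
  also have "\<dots> \<le> ?V" by (intro sum_mono2) auto
  also have "(\<Sum>k=1..<n. (fluct t \<zeta> k)\<^sup>2) \<le> ?V" by (intro sum_mono2) auto
  finally have V2: "(\<Sum>k\<in>K. (\<zeta> k)\<^sup>2) \<le> 4 * ?V" by simp
  have "(\<Sum>k\<in>insert n K. (\<zeta> k)\<^sup>2) = (\<zeta> n)\<^sup>2 + (\<Sum>k\<in>K. (\<zeta> k)\<^sup>2)"
    using index_split(3,4) by simp
  moreover have "0 \<le> ?V" by (intro sum_nonneg) simp
  ultimately show ?thesis using V1 V2 by linarith
qed

lemma abs_fluct_le:
  assumes "j \<in> {1..n}"
  shows "\<bar>fluct t \<zeta> j\<bar> \<le> \<bar>\<zeta> n\<bar> + (\<Sum>k=1..<n. \<bar>sgap t \<zeta> k\<bar>)"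
proof -
  have "\<bar>\<Sum>k=1..<n. (real k / real n - of_bool (j \<le> k)) * sgap t \<zeta> k\<bar> \<le> (\<Sum>k=1..<n. \<bar>sgap t \<zeta> k\<bar>)"
  proof (rule order_trans[OF sum_abs], rule sum_mono)
    fix k assume k: "k \<in> {1..<n}"
    then have "0 \<le> real k / real n" "real k / real n \<le> 1" by auto
    then have "\<bar>real k / real n - of_bool (j \<le> k)\<bar> \<le> 1" by (cases "j \<le> k") auto
    then show "\<bar>(real k / real n - of_bool (j \<le> k)) * sgap t \<zeta> k\<bar> \<le> \<bar>sgap t \<zeta> k\<bar>"
      unfolding abs_mult by (rule mult_left_le_one_le[rotated 2]) auto
  qed
  then show ?thesis unfolding fluct_centred[OF assms] by linarith
qed

lemma sum_abs_sgap:
  assumes "t > 0"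
  shows "\<bar>\<zeta> n\<bar> + (\<Sum>k=1..<n. \<bar>sgap t \<zeta> k\<bar>) = (\<Sum>k\<in>insert n K. \<bar>\<zeta> k\<bar>) + (\<Sum>k\<in>I. \<bar>\<zeta> k\<bar>) / sqrt t"
proof -
  have open_index_split: "{1..<n} = I \<union> K" using interior_idx_eq[OF n stable] cut_idx_subset[OF n stable] by auto
  have dis: "I \<inter> K = {}" using index_split(2) by auto
  have "(\<Sum>k=1..<n. \<bar>sgap t \<zeta> k\<bar>) = (\<Sum>k\<in>I. \<bar>sgap t \<zeta> k\<bar>) + (\<Sum>k\<in>K. \<bar>sgap t \<zeta> k\<bar>)"
    using sum.union_disjoint[OF _ _ dis, of "\<lambda>k. \<bar>sgap t \<zeta> k\<bar>"] index_split(4)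
      sum.cong[OF open_index_split, of "\<lambda>k. \<bar>sgap t \<zeta> k\<bar>" "\<lambda>k. \<bar>sgap t \<zeta> k\<bar>"] by simp
  also have "(\<Sum>k\<in>I. \<bar>sgap t \<zeta> k\<bar>) = (\<Sum>k\<in>I. \<bar>\<zeta> k\<bar>) / sqrt t"
    unfolding sum_divide_distrib by (rule sum.cong) (use assms in \<open>auto simp: sgap_def\<close>)
  also have "(\<Sum>k\<in>K. \<bar>sgap t \<zeta> k\<bar>) = (\<Sum>k\<in>K. \<bar>\<zeta> k\<bar>)"
    by (rule sum.cong) (use dis in \<open>auto simp: sgap_def\<close>)
  finally show ?thesis using index_split(3,4) by simp
qed

lemma slope_bounds:
  assumes t: "t > 0" and j: "j \<in> {1..n}"
  shows "\<bar>slope t \<zeta> j\<bar> \<le> (\<Sum>i=1..n. \<bar>f i\<bar>) + ((\<Sum>k\<in>insert n K. \<bar>\<zeta> k\<bar>) / sqrt t + (\<Sum>k\<in>I. \<bar>\<zeta> k\<bar>) / t)"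
proof -
  have "\<bar>f j\<bar> \<le> (\<Sum>i=1..n. \<bar>f i\<bar>)" by (rule member_le_sum[of j "{1..n}" "\<lambda>i. \<bar>f i\<bar>"]) (use j in auto)
  moreover have "\<bar>fluct t \<zeta> j / sqrt t\<bar> \<le> ((\<Sum>k\<in>insert n K. \<bar>\<zeta> k\<bar>) + (\<Sum>k\<in>I. \<bar>\<zeta> k\<bar>) / sqrt t) / sqrt t"
    unfolding abs_divide using abs_fluct_le[OF j, of t \<zeta>, unfolded sum_abs_sgap[OF t]] t
    by (simp add: divide_right_mono)
  moreover have "((\<Sum>k\<in>insert n K. \<bar>\<zeta> k\<bar>) + (\<Sum>k\<in>I. \<bar>\<zeta> k\<bar>) / sqrt t) / sqrt t
      = (\<Sum>k\<in>insert n K. \<bar>\<zeta> k\<bar>) / sqrt t + (\<Sum>k\<in>I. \<bar>\<zeta> k\<bar>) / t"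
    using t by (simp add: add_divide_distrib)
  ultimately show ?thesis unfolding slope_def by linarith
qed

lemma pair_gap_bound:
  assumes t: "t \<ge> 1" and j: "j \<in> {1..n}" and p: "1 \<le> p"
  shows "\<bar>pair_gap t \<zeta> p j\<bar> \<le> (\<Sum>k=1..n. \<bar>\<zeta> k\<bar>)"
proof -
  have s: "\<bar>sgap t \<zeta> r\<bar> \<le> \<bar>\<zeta> r\<bar>" for r
  proof -
    have "\<bar>\<zeta> r\<bar> / sqrt t \<le> \<bar>\<zeta> r\<bar> / 1" using t by (intro divide_left_mono) auto
    then show ?thesis using t by (simp add: sgap_def)
  qed
  have "\<bar>pair_gap t \<zeta> p j\<bar> \<le> (\<Sum>r=p..<j. \<bar>\<zeta> r\<bar>)"
    unfolding pair_gap_def using s by (auto intro: sum_abs order_trans[OF sum_abs] sum_mono)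
  also have "\<dots> \<le> (\<Sum>k=1..n. \<bar>\<zeta> k\<bar>)" using j p by (intro sum_mono2) auto
  finally show ?thesis .
qed

lemma interior_rate: "\<exists>d>0. \<forall>k\<in>I. 4 * d \<le> \<beta> k"
proof -
  define d where "d = Min (insert 1 (\<beta> ` I)) / 4"
  have "\<forall>y\<in>insert 1 (\<beta> ` I). y > 0" using excess_pos[OF n stable] by auto
  then have "d > 0" unfolding d_def by (subst zero_less_divide_iff) (auto simp: Min_gr_iff)
  moreover have "\<forall>k\<in>I. 4 * d \<le> \<beta> k" unfolding d_def by auto
  ultimately show ?thesis by blast
qed

definition dominating where
  "dominating C d c \<zeta> = C * (\<Prod>k=1..n. if k \<in> I then of_bool (\<zeta> k > 0) * exp (- (2 * d) * \<zeta> k)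
      else exp (- (\<zeta> k)\<^sup>2 / 16 + c * \<bar>\<zeta> k\<bar>))"

lemma integrable_dominating:
  assumes "d > 0"
  shows "integrable (lebesgue_pi {1..n}) (dominating C d c)"
  unfolding dominating_def[abs_def]
proof (rule integrable_mult_right)
  have i: "integrable lborel (\<lambda>y. if k \<in> I then of_bool (y > 0) * exp (- (2 * d) * y) else exp (- y\<^sup>2 / 16 + c * \<bar>y\<bar>))" for k
  proof (cases "k \<in> I")
    case True
    then show ?thesis using integrable_exp_half_line[of "2 * d"] assms by simp
  next
    case False
    then show ?thesis using integrable_exp_quadratic[of c] by (simp only: if_False)
  qed
  show "integrable (lebesgue_pi {1..n}) (\<lambda>\<zeta>. \<Prod>k=1..n. if k \<in> I then of_bool (\<zeta> k > 0) * exp (- (2 * d) * \<zeta> k)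
      else exp (- (\<zeta> k)\<^sup>2 / 16 + c * \<bar>\<zeta> k\<bar>))"
    using product_sigma_finite.product_integrable_prod[OF product_sigma_finite_lborel, of "{1..n}"
      "\<lambda>k y. if k \<in> I then of_bool (y > 0) * exp (- (2 * d) * y) else exp (- y\<^sup>2 / 16 + c * \<bar>y\<bar>)", OF _ i]
    by simp
qed

text \<open>A divided difference of the exponential is a derivative at an intermediate point.\<close>

lemma dd_matrix_bound:
  assumes t: "t > 0" and W: "position t \<zeta> \<in> weyl_chamber n" and i: "i \<in> {1..n}" and j: "j \<in> {1..n}"
    and S: "\<And>p. p \<in> {1..n} \<Longrightarrow> \<bar>slope t \<zeta> p\<bar> \<le> S"
  shows "\<bar>dd_matrix t \<zeta> i j\<bar> \<le> (1 + (\<Sum>i=1..n. \<bar>x i\<bar>)) ^ n * exp ((\<Sum>i=1..n. \<bar>x i\<bar>) * S)"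
proof -
  let ?X = "\<Sum>i=1..n. \<bar>x i\<bar>"
  note g = group_start_bounds[OF n stable j]
  have "\<exists>z\<in>{-S..S}. divdiff (\<lambda>r. exp (x i * r)) (slope t \<zeta>) {gstart j..j} = x i ^ (j - gstart j) * exp (x i * z) / fact (j - gstart j)"
  proof (rule divdiff_exp)
    show "card {gstart j..j} = Suc (j - gstart j)" using g by auto
    show "inj_on (slope t \<zeta>) {gstart j..j}" by (rule slope_inj[OF t W]) (use g j in auto)
    show "slope t \<zeta> l \<in> {-S..S}" if "l \<in> {gstart j..j}" for l
      using S[of l] that g j by (auto simp: abs_le_iff)
  qed simp
  then obtain z where z: "z \<in> {-S..S}" "dd_matrix t \<zeta> i j = x i ^ (j - gstart j) * exp (x i * z) / fact (j - gstart j)"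
    unfolding dd_matrix_def by blast
  have X: "\<bar>x i\<bar> \<le> ?X" by (rule member_le_sum[of i "{1..n}" "\<lambda>i. \<bar>x i\<bar>"]) (use i in auto)
  have "x i * z \<le> \<bar>x i\<bar> * \<bar>z\<bar>" by (metis abs_ge_self abs_mult)
  also have "\<dots> \<le> ?X * S" using X z by (intro mult_mono) auto
  finally have e: "exp (x i * z) \<le> exp (?X * S)" by simp
  have "\<bar>x i ^ (j - gstart j)\<bar> = \<bar>x i\<bar> ^ (j - gstart j)" by (simp add: power_abs)
  also have "\<dots> \<le> (1 + ?X) ^ (j - gstart j)" using X by (intro power_mono) auto
  also have "\<dots> \<le> (1 + ?X) ^ n" using j X by (intro power_increasing) (auto intro: sum_nonneg)
  finally have p: "\<bar>x i ^ (j - gstart j)\<bar> \<le> (1 + ?X) ^ n" .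
  have "\<bar>dd_matrix t \<zeta> i j\<bar> = \<bar>x i ^ (j - gstart j)\<bar> * exp (x i * z) / fact (j - gstart j)"
    unfolding z(2) by (simp add: abs_mult)
  also have "\<dots> \<le> \<bar>x i ^ (j - gstart j)\<bar> * exp (x i * z) / 1"
    by (intro divide_left_mono) (auto simp: fact_ge_1)
  also have "\<dots> \<le> (1 + ?X) ^ n * exp (?X * S)"
    using p e by (simp, intro mult_mono) (auto intro!: zero_le_power add_nonneg_nonneg sum_nonneg)
  finally show ?thesis .
qed

text \<open>Of the rate 4 * d at which the exponential decays in a gap inside a block, one d absorbs the
polynomial factor and another one the growth of the determinant, whose nodes depend on such a gap only through
\<zeta> k / t. In the other coordinates the Gaussian absorbs everything.\<close>

lemma integrand_bound:
  "\<exists>C d c T. d > 0 \<and> (\<forall>t\<ge>T. t > 0 \<and> (\<forall>\<zeta>. position t \<zeta> \<in> weyl_chamber n \<longrightarrow> \<bar>integrand t \<zeta>\<bar> \<le> dominating C d c \<zeta>))"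
proof -
  obtain d where d: "d > 0" "\<forall>k\<in>I. 4 * d \<le> \<beta> k" using interior_rate by blast
  define X where "X = (\<Sum>i=1..n. \<bar>x i\<bar>)"
  define Fm where "Fm = (\<Sum>i=1..n. \<bar>f i\<bar>)"
  define N where "N = (\<Sum>j=1..n. j - gstart j)"
  \<comment> \<open>The rate at which the determinant grows in the gaps inside blocks is at most n * X / t, hence at most d from time T on.\<close>
  define T where "T = max 1 (real n * X / d)"
  define C where "C = (real N / d) ^ N * (fact n * ((1 + X) ^ n * exp (X * Fm)) ^ n)"
  define c where "c = real n * X + d"
  have X0: "X \<ge> 0" by (simp add: X_def sum_nonneg)
  have "\<bar>integrand t \<zeta>\<bar> \<le> dominating C d c \<zeta>" if t: "t \<ge> T" and W: "position t \<zeta> \<in> weyl_chamber n" for t \<zeta>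
  proof -
    have t1: "t \<ge> 1" and t0: "t > 0" and tX: "real n * X / t \<le> d"
      using t d X0 by (auto simp: T_def pos_divide_le_eq mult.commute)
    let ?A = "\<Sum>k\<in>insert n K. \<bar>\<zeta> k\<bar>" and ?B = "\<Sum>k\<in>I. \<bar>\<zeta> k\<bar>" and ?L = "\<Sum>k=1..n. \<bar>\<zeta> k\<bar>"
    have pos: "\<zeta> k > 0" if k: "k \<in> I" for k
    proof -
      have "k \<in> {1..<n}" using k interior_idx_eq[OF n stable] by auto
      moreover have "f (Suc k) = f k" using f_vec_interior(1)[OF n stable k] .
      ultimately have "0 < sqrt t * sgap t \<zeta> k" using W unfolding position_in_chamber_iff[OF t0] by force
      then show ?thesis using k t0 by (simp add: sgap_def zero_less_mult_iff zero_less_divide_iff)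
    qed
    have AB: "?L = ?A + ?B"
      using sum.union_disjoint[OF _ _ index_split(2), of "\<lambda>k. \<bar>\<zeta> k\<bar>"] index_split(4)
        sum.cong[OF index_split(1), of "\<lambda>k. \<bar>\<zeta> k\<bar>" "\<lambda>k. \<bar>\<zeta> k\<bar>"] by simp
    have A0: "?A \<ge> 0" "?B \<ge> 0" by (auto intro: sum_nonneg)
    define S where "S = Fm + (?A / sqrt t + ?B / t)"
    have "\<bar>leibniz n (dd_matrix t \<zeta>)\<bar> \<le> fact n * ((1 + X) ^ n * exp (X * S)) ^ n"
      unfolding X_def S_def Fm_def
      by (intro leibniz_abs_le dd_matrix_bound[OF t0 W] slope_bounds[OF t0])
    also have "((1 + X) ^ n * exp (X * S)) ^ n = ((1 + X) ^ n * exp (X * Fm)) ^ n * exp (real n * X * (?A / sqrt t + ?B / t))"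
      by (simp add: S_def distrib_left exp_add power_mult_distrib exp_of_nat_mult[symmetric] mult.assoc)
    also have "exp (real n * X * (?A / sqrt t + ?B / t)) \<le> exp (real n * X * ?A + d * ?B)"
    proof -
      have "?A / sqrt t \<le> ?A / 1" using t1 A0 by (intro divide_left_mono) auto
      then have "real n * X * (?A / sqrt t) \<le> real n * X * ?A" using X0 by (intro mult_left_mono) auto
      moreover have "real n * X * (?B / t) = (real n * X / t) * ?B" by simp
      then have "real n * X * (?B / t) \<le> d * ?B" using mult_right_mono[OF tX A0(2)] by simp
      ultimately show ?thesis by (simp add: distrib_left)
    qed
    finally have b1: "\<bar>leibniz n (dd_matrix t \<zeta>)\<bar> \<le> fact n * (((1 + X) ^ n * exp (X * Fm)) ^ n * exp (real n * X * ?A + d * ?B))"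
      using X0 by (simp add: mult_left_mono)
    have "\<bar>\<Prod>j=1..n. \<Prod>p=gstart j..<j. pair_gap t \<zeta> p j\<bar> = (\<Prod>j=1..n. \<Prod>p=gstart j..<j. \<bar>pair_gap t \<zeta> p j\<bar>)"
      by (simp add: abs_prod)
    also have "\<dots> \<le> (\<Prod>j=1..n. \<Prod>p=gstart j..<j. ?L)"
    proof (intro prod_mono conjI prod_nonneg)
      fix j p assume "j \<in> {1..n}" "p \<in> {gstart j..<j}"
      then show "\<bar>pair_gap t \<zeta> p j\<bar> \<le> ?L"
        using group_start_bounds[OF n stable, of j] by (intro pair_gap_bound[OF t1]) auto
    qed auto
    also have "\<dots> = ?L ^ N" by (simp add: N_def power_sum)
    also have "\<dots> \<le> (real N / d) ^ N * exp (d * ?L)" using d by (intro power_le_exp) (auto intro: sum_nonneg)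
    finally have b2: "\<bar>\<Prod>j=1..n. \<Prod>p=gstart j..<j. pair_gap t \<zeta> p j\<bar> \<le> (real N / d) ^ N * exp (d * ?L)" .
    have b3: "- (\<Sum>k\<in>I. \<beta> k * \<zeta> k) - (\<Sum>j=1..n. (fluct t \<zeta> j)\<^sup>2) / 2 \<le> - (4 * d) * ?B - (\<Sum>k\<in>insert n K. (\<zeta> k)\<^sup>2) / 16"
    proof -
      have "(4 * d) * ?B \<le> (\<Sum>k\<in>I. \<beta> k * \<zeta> k)"
        unfolding sum_distrib_left
        by (rule sum_mono) (use d pos in \<open>auto intro!: mult_mono simp: less_imp_le\<close>)
      then show ?thesis using sum_fluct_squares_ge[of \<zeta> t] by simp
    qed
    have "\<bar>integrand t \<zeta>\<bar> \<le> exp (- (4 * d) * ?B - (\<Sum>k\<in>insert n K. (\<zeta> k)\<^sup>2) / 16) * ((real N / d) ^ N * exp (d * ?L)) *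
       (fact n * (((1 + X) ^ n * exp (X * Fm)) ^ n * exp (real n * X * ?A + d * ?B)))"
      unfolding integrand_def abs_mult
      by (intro mult_mono b1 b2) (use b3 d in auto)
    also have "\<dots> = C * exp ((- (4 * d) * ?B - (\<Sum>k\<in>insert n K. (\<zeta> k)\<^sup>2) / 16) + d * ?L + (real n * X * ?A + d * ?B))"
      by (simp only: C_def exp_add mult_ac)
    also have "(- (4 * d) * ?B - (\<Sum>k\<in>insert n K. (\<zeta> k)\<^sup>2) / 16) + d * ?L + (real n * X * ?A + d * ?B)
      = - (2 * d) * ?B + (- (\<Sum>k\<in>insert n K. (\<zeta> k)\<^sup>2) / 16 + c * ?A)"
      unfolding AB c_def by (simp add: algebra_simps)
    also have "\<dots> = (\<Sum>k\<in>I. - (2 * d) * \<zeta> k) + (\<Sum>k\<in>insert n K. - (\<zeta> k)\<^sup>2 / 16 + c * \<bar>\<zeta> k\<bar>)"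
    proof -
      have "?B = (\<Sum>k\<in>I. \<zeta> k)" by (rule sum.cong) (use pos in \<open>auto simp: less_imp_le\<close>)
      then have "- (2 * d) * ?B = (\<Sum>k\<in>I. - (2 * d) * \<zeta> k)" by (simp only: sum_distrib_left)
      moreover have "- (\<Sum>k\<in>insert n K. (\<zeta> k)\<^sup>2) / 16 + c * ?A = (\<Sum>k\<in>insert n K. - (\<zeta> k)\<^sup>2 / 16 + c * \<bar>\<zeta> k\<bar>)"
        by (simp only: sum.distrib sum_distrib_left sum_divide_distrib[symmetric] sum_negf)
      ultimately show ?thesis by simp
    qed
    also have "C * exp \<dots> = dominating C d c \<zeta>"
    proof -
      have "(\<Prod>k=1..n. if k \<in> I then of_bool (\<zeta> k > 0) * exp (- (2 * d) * \<zeta> k) else exp (- (\<zeta> k)\<^sup>2 / 16 + c * \<bar>\<zeta> k\<bar>))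
         = (\<Prod>k\<in>I. if k \<in> I then of_bool (\<zeta> k > 0) * exp (- (2 * d) * \<zeta> k) else exp (- (\<zeta> k)\<^sup>2 / 16 + c * \<bar>\<zeta> k\<bar>))
         * (\<Prod>k\<in>insert n K. if k \<in> I then of_bool (\<zeta> k > 0) * exp (- (2 * d) * \<zeta> k) else exp (- (\<zeta> k)\<^sup>2 / 16 + c * \<bar>\<zeta> k\<bar>))"
        (is "prod ?h _ = _")
        using prod.union_disjoint[OF _ _ index_split(2), of ?h] index_split(4)
          prod.cong[OF index_split(1), of ?h ?h] by simp
      also have "\<dots> = (\<Prod>k\<in>I. exp (- (2 * d) * \<zeta> k)) * (\<Prod>k\<in>insert n K. exp (- (\<zeta> k)\<^sup>2 / 16 + c * \<bar>\<zeta> k\<bar>))"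
        by (intro arg_cong2[where f="(*)"] prod.cong refl) (use pos index_split(2) in auto)
      also have "\<dots> = exp ((\<Sum>k\<in>I. - (2 * d) * \<zeta> k) + (\<Sum>k\<in>insert n K. - (\<zeta> k)\<^sup>2 / 16 + c * \<bar>\<zeta> k\<bar>))"
        using index_split(4) by (simp only: exp_add exp_sum finite_insert finite_Diff finite_atLeastAtMost)
      finally show ?thesis by (simp only: dominating_def)
    qed
    finally show ?thesis .
  qed
  moreover have "T > 0" by (simp add: T_def)
  ultimately show ?thesis using d(1) by (meson less_le_trans)
qed

end

section \<open>The pointwise limit\<close>

lemma pos_linear_dominates_sqrt:
  fixes c d :: real
  assumes "d > 0"
  shows "filterlim (\<lambda>t. sqrt t * c + t * d) at_top at_top"
  using assms by real_asymp

context survival_setup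
begin

text \<open>The integrand of A2, extended by 0.\<close>

definition interior_part where
  "interior_part \<xi> = of_bool (\<forall>k\<in>I. \<xi> k > 0) *
     (exp (- (\<Sum>k\<in>I. \<beta> k * \<xi> k)) * (\<Prod>j=1..n. \<Prod>p=bstart j..<j. \<Sum>r=p..<j. \<xi> r))"

text \<open>The integrand of A3, extended by 0.\<close>

definition cut_part where
  "cut_part \<xi> = of_bool (\<forall>k\<in>K. f (Suc k) = f k \<longrightarrow> \<xi> k > 0) *
     (exp (- (1/2) * (\<Sum>k\<in>K. \<Sum>l\<in>K. S_mat n k l * \<xi> k * \<xi> l)) *
      (\<Prod>j=1..n. \<Prod>p=gstart j..<bstart j. \<Sum>r\<in>K \<inter> {p..<j}. \<xi> r))"

definition profile where
  "profile \<zeta> = interior_part \<zeta> * cut_part \<zeta> * exp (- (real n * (\<zeta> n)\<^sup>2) / 2)"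

definition limit_det where
  "limit_det = leibniz n (\<lambda>i j. x i ^ (j - gstart j) * exp (x i * f j) / fact (j - gstart j))"

definition chamber_integrand where
  "chamber_integrand t \<zeta> = (if t > 0 then indicator (weyl_chamber n) (position t \<zeta>) * integrand t \<zeta> else 0)"

lemma open_index_split: "{1..<n} = I \<union> K" "I \<inter> K = {}"
  using interior_idx_eq[OF n stable] cut_idx_subset[OF n stable] index_split(2) by auto

lemma tendsto_div_sqrt: "(g \<longlongrightarrow> (l::real)) at_top \<Longrightarrow> ((\<lambda>t. g t / sqrt t) \<longlongrightarrow> 0) at_top"
  by (erule tendsto_divide_0) (rule filterlim_at_top_imp_at_infinity[OF sqrt_at_top])

lemma tendsto_sgap: "((\<lambda>t. sgap t \<zeta> k) \<longlongrightarrow> (if k \<in> I then 0 else \<zeta> k)) at_top"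
proof (cases "k \<in> I")
  case True
  then show ?thesis
    unfolding sgap_def using tendsto_div_sqrt[OF tendsto_const, of "\<zeta> k"] by (simp only: if_True)
qed (simp only: sgap_def if_False tendsto_const)

lemma tendsto_slope: "((\<lambda>t. slope t \<zeta> j) \<longlongrightarrow> f j) at_top"
proof -
  let ?l = "\<lambda>k. if k \<in> I then 0 else \<zeta> k"
  have "((\<lambda>t. fluct t \<zeta> j) \<longlongrightarrow> \<zeta> n + (\<Sum>k=1..<n. real k / real n * ?l k) - (\<Sum>k=j..<n. ?l k)) at_top"
    unfolding fluct_def
    by (intro tendsto_diff tendsto_add tendsto_const tendsto_sum tendsto_mult tendsto_sgap)
  then have "((\<lambda>t. fluct t \<zeta> j / sqrt t) \<longlongrightarrow> 0) at_top" by (rule tendsto_div_sqrt)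
  from tendsto_add[OF tendsto_const[of "f j"] this] show ?thesis unfolding slope_def by simp
qed

lemma tendsto_sum_fluct_squares:
  "((\<lambda>t. \<Sum>j=1..n. (fluct t \<zeta> j)\<^sup>2) \<longlongrightarrow>
     real n * (\<zeta> n)\<^sup>2 + (\<Sum>k\<in>K. \<Sum>l\<in>K. S_mat n k l * \<zeta> k * \<zeta> l)) at_top"
proof -
  let ?l = "\<lambda>k. if k \<in> I then 0 else \<zeta> k"
  have restrict: "(\<Sum>k=1..<n. g k) = (\<Sum>k\<in>K. h k)" if "\<And>k. k \<in> I \<Longrightarrow> g k = (0::real)" "\<And>k. k \<in> K \<Longrightarrow> g k = h k" for g h
    by (rule sum.mono_neutral_cong_right) (use that open_index_split in auto)
  have "(\<Sum>k=1..<n. \<Sum>l=1..<n. S_mat n k l * ?l k * ?l l) = (\<Sum>k\<in>K. \<Sum>l\<in>K. S_mat n k l * \<zeta> k * \<zeta> l)"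
  proof (rule restrict)
    fix k assume k: "k \<in> K"
    then have "k \<notin> I" using open_index_split(2) by blast
    show "(\<Sum>l=1..<n. S_mat n k l * ?l k * ?l l) = (\<Sum>l\<in>K. S_mat n k l * \<zeta> k * \<zeta> l)"
    proof (rule restrict)
      fix l assume "l \<in> K"
      then have "l \<notin> I" using open_index_split(2) by blast
      then show "S_mat n k l * ?l k * ?l l = S_mat n k l * \<zeta> k * \<zeta> l"
        using \<open>k \<notin> I\<close> by (simp only: if_False)
    qed (simp only: if_True mult_zero_right)
  qed (simp only: if_True mult_zero_right mult_zero_left sum.neutral_const)
  moreover have "((\<lambda>t. \<Sum>j=1..n. (fluct t \<zeta> j)\<^sup>2) \<longlongrightarrow>
     real n * (\<zeta> n)\<^sup>2 + (\<Sum>k=1..<n. \<Sum>l=1..<n. S_mat n k l * ?l k * ?l l)) at_top"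
    unfolding sum_fluct_squares
    by (intro tendsto_add tendsto_const tendsto_sum tendsto_mult tendsto_sgap)
  ultimately show ?thesis by simp
qed

text \<open>In units of sqrt t, the gaps inside blocks disappear.\<close>

lemma tendsto_pair_gap:
  assumes j: "j \<in> {1..n}" and p: "1 \<le> p"
  shows "((\<lambda>t. pair_gap t \<zeta> p j) \<longlongrightarrow>
    (if bstart j \<le> p then \<Sum>r=p..<j. \<zeta> r else \<Sum>r\<in>K \<inter> {p..<j}. \<zeta> r)) at_top"
proof (cases "bstart j \<le> p")
  case False
  have "{p..<j} \<subseteq> I \<union> K" using j p unfolding open_index_split(1)[symmetric] by auto
  then have "(\<Sum>r=p..<j. if r \<in> I then 0 else \<zeta> r) = (\<Sum>r\<in>K \<inter> {p..<j}. \<zeta> r)"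
    by (intro sum.mono_neutral_cong_right) (use open_index_split(2) in auto)
  moreover have "((\<lambda>t. \<Sum>r=p..<j. sgap t \<zeta> r) \<longlongrightarrow> (\<Sum>r=p..<j. if r \<in> I then 0 else \<zeta> r)) at_top"
    by (intro tendsto_sum tendsto_sgap)
  ultimately show ?thesis using False by (simp add: pair_gap_def)
qed (simp add: pair_gap_def)

lemma tendsto_prod_pair_gap:
  "((\<lambda>t. \<Prod>j=1..n. \<Prod>p=gstart j..<j. pair_gap t \<zeta> p j) \<longlongrightarrow>
     (\<Prod>j=1..n. \<Prod>p=bstart j..<j. \<Sum>r=p..<j. \<zeta> r) *
     (\<Prod>j=1..n. \<Prod>p=gstart j..<bstart j. \<Sum>r\<in>K \<inter> {p..<j}. \<zeta> r)) at_top"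
proof -
  let ?g = "\<lambda>p j. if bstart j \<le> p then \<Sum>r=p..<j. \<zeta> r else \<Sum>r\<in>K \<inter> {p..<j}. \<zeta> r"
  have "(\<Prod>p=gstart j..<j. ?g p j) = (\<Prod>p=bstart j..<j. \<Sum>r=p..<j. \<zeta> r) * (\<Prod>p=gstart j..<bstart j. \<Sum>r\<in>K \<inter> {p..<j}. \<zeta> r)"
    if j: "j \<in> {1..n}" for j
  proof -
    have le: "gstart j \<le> bstart j" "bstart j \<le> j"
      using group_start_le_block_start[OF n stable j] block_start_bounds[OF stable_cuts[OF n stable] j] by auto
    have "(\<Prod>p=gstart j..<j. ?g p j) = (\<Prod>p=gstart j..<bstart j. ?g p j) * (\<Prod>p=bstart j..<j. ?g p j)"
      using le by (simp only: prod.atLeastLessThan_concat)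
    also have "(\<Prod>p=gstart j..<bstart j. ?g p j) = (\<Prod>p=gstart j..<bstart j. \<Sum>r\<in>K \<inter> {p..<j}. \<zeta> r)"
      by (rule prod.cong) auto
    also have "(\<Prod>p=bstart j..<j. ?g p j) = (\<Prod>p=bstart j..<j. \<Sum>r=p..<j. \<zeta> r)"
      by (rule prod.cong) auto
    finally show ?thesis by (simp only: mult.commute)
  qed
  then have "(\<Prod>j=1..n. \<Prod>p=gstart j..<j. ?g p j) = (\<Prod>j=1..n. \<Prod>p=bstart j..<j. \<Sum>r=p..<j. \<zeta> r) *
     (\<Prod>j=1..n. \<Prod>p=gstart j..<bstart j. \<Sum>r\<in>K \<inter> {p..<j}. \<zeta> r)"
    unfolding prod.distrib[symmetric] by (rule prod.cong[OF refl])
  moreover have "((\<lambda>t. \<Prod>j=1..n. \<Prod>p=gstart j..<j. pair_gap t \<zeta> p j) \<longlongrightarrow> (\<Prod>j=1..n. \<Prod>p=gstart j..<j. ?g p j)) at_top"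
  proof (intro tendsto_prod tendsto_pair_gap)
    fix j p assume "j \<in> {1..n}" "p \<in> {gstart j..<j}"
    then show "1 \<le> p" using group_start_bounds[OF n stable, of j] by auto
  qed
  ultimately show ?thesis by simp
qed

text \<open>The intermediate point in the mean value theorem lies between nodes that all tend to f j.\<close>

lemma tendsto_dd_matrix:
  assumes W: "\<forall>\<^sub>F t in at_top. position t \<zeta> \<in> weyl_chamber n" and j: "j \<in> {1..n}"
  shows "((\<lambda>t. dd_matrix t \<zeta> i j) \<longlongrightarrow> x i ^ (j - gstart j) * exp (x i * f j) / fact (j - gstart j)) at_top"
proof -
  note g = group_start_bounds[OF n stable j]
  define e where "e t = (\<Sum>p\<in>{gstart j..j}. \<bar>slope t \<zeta> p - f j\<bar>)" for t
  have "((\<lambda>t. e t) \<longlongrightarrow> (\<Sum>p\<in>{gstart j..j}. \<bar>f p - f j\<bar>)) at_top"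
    unfolding e_def by (intro tendsto_sum tendsto_rabs tendsto_diff tendsto_slope tendsto_const)
  moreover have "(\<Sum>p\<in>{gstart j..j}. \<bar>f p - f j\<bar>) = 0"
    by (intro sum.neutral ballI) (simp only: f_vec_const_on_group[OF n stable j] diff_self abs_zero)
  ultimately have e0: "(e \<longlongrightarrow> 0) at_top" by simp
  have "\<exists>z. \<bar>z - f j\<bar> \<le> e t \<and> dd_matrix t \<zeta> i j = x i ^ (j - gstart j) * exp (x i * z) / fact (j - gstart j)"
    if t: "t > 0" and Wt: "position t \<zeta> \<in> weyl_chamber n" for t
  proof -
    have "\<exists>z\<in>{f j - e t..f j + e t}. divdiff (\<lambda>r. exp (x i * r)) (slope t \<zeta>) {gstart j..j}
        = x i ^ (j - gstart j) * exp (x i * z) / fact (j - gstart j)"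
    proof (rule divdiff_exp)
      show "card {gstart j..j} = Suc (j - gstart j)" using g by auto
      show "inj_on (slope t \<zeta>) {gstart j..j}" by (rule slope_inj[OF t Wt]) (use g j in auto)
      fix l assume l: "l \<in> {gstart j..j}"
      have "\<bar>slope t \<zeta> l - f j\<bar> \<le> e t"
        unfolding e_def by (rule member_le_sum[OF l, of "\<lambda>p. \<bar>slope t \<zeta> p - f j\<bar>"]) auto
      then show "slope t \<zeta> l \<in> {f j - e t..f j + e t}" by auto
    qed simp
    then obtain z where "z \<in> {f j - e t..f j + e t}"
      "dd_matrix t \<zeta> i j = x i ^ (j - gstart j) * exp (x i * z) / fact (j - gstart j)"
      unfolding dd_matrix_def by blast
    then show ?thesis by (intro exI[of _ z]) auto
  qed
  then obtain z where z: "\<And>t. t > 0 \<Longrightarrow> position t \<zeta> \<in> weyl_chamber n \<Longrightarrow> \<bar>z t - f j\<bar> \<le> e t \<and>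
      dd_matrix t \<zeta> i j = x i ^ (j - gstart j) * exp (x i * z t) / fact (j - gstart j)"
    by metis
  have ev: "\<forall>\<^sub>F t in at_top. \<bar>z t - f j\<bar> \<le> e t \<and>
      dd_matrix t \<zeta> i j = x i ^ (j - gstart j) * exp (x i * z t) / fact (j - gstart j)"
    using W eventually_gt_at_top[of 0] by eventually_elim (rule z)
  have "((\<lambda>t. z t - f j) \<longlongrightarrow> 0) at_top"
    by (rule Lim_null_comparison[OF _ e0]) (use ev in \<open>auto elim: eventually_mono\<close>)
  then have "(z \<longlongrightarrow> f j) at_top" by (rule LIM_zero_cancel)
  then have "((\<lambda>t. x i ^ (j - gstart j) * exp (x i * z t) / fact (j - gstart j)) \<longlongrightarrow>
      x i ^ (j - gstart j) * exp (x i * f j) / fact (j - gstart j)) at_top"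
    by (intro tendsto_intros) auto
  moreover have "\<forall>\<^sub>F t in at_top. x i ^ (j - gstart j) * exp (x i * z t) / fact (j - gstart j) = dd_matrix t \<zeta> i j"
    using ev by eventually_elim simp
  ultimately show ?thesis by (rule Lim_transform_eventually)
qed

text \<open>Where f increases, the term t * (f (Suc k) - f k) dominates the fluctuation of order sqrt t. So
only the gaps between equal entries of f have to be positive.\<close>

lemma eventually_in_chamber:
  assumes I: "\<And>k. k \<in> I \<Longrightarrow> \<zeta> k > 0" and K: "\<And>k. k \<in> K \<Longrightarrow> f (Suc k) = f k \<Longrightarrow> \<zeta> k > 0"
  shows "\<forall>\<^sub>F t in at_top. position t \<zeta> \<in> weyl_chamber n"
proof -
  have "\<forall>\<^sub>F t in at_top. 0 < sqrt t * sgap t \<zeta> k + t * (f (Suc k) - f k)" if k: "k \<in> {1..<n}" for k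
  proof (cases "f (Suc k) = f k")
    case True
    have "sgap t \<zeta> k > 0" if "t > 0" for t
      using I[of k] K[of k] True k that unfolding open_index_split(1) by (auto simp: sgap_def)
    then show ?thesis using True by (intro eventually_mono[OF eventually_gt_at_top[of 0]]) auto
  next
    case False
    then have kI: "k \<notin> I" using f_vec_interior(1)[OF n stable, of k] by auto
    have "f k \<le> f (Suc k)" using f_vec_mono[OF n stable, of k "Suc k"] k by auto
    then have d: "f (Suc k) - f k > 0" using False by auto
    have "filterlim (\<lambda>t. sqrt t * \<zeta> k + t * (f (Suc k) - f k)) at_top at_top"
      using pos_linear_dominates_sqrt[OF d] .
    then have "\<forall>\<^sub>F t in at_top. 0 < sqrt t * \<zeta> k + t * (f (Suc k) - f k)"
      by (simp add: filterlim_at_top_dense)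
    then show ?thesis using kI by (simp only: sgap_def if_False)
  qed
  then have "\<forall>\<^sub>F t in at_top. \<forall>k\<in>{1..<n}. 0 < sqrt t * sgap t \<zeta> k + t * (f (Suc k) - f k)"
    by (intro eventually_ball_finite) auto
  then show ?thesis using eventually_gt_at_top[of 0]
    by eventually_elim (simp add: position_in_chamber_iff)
qed

lemma in_chamber_imp:
  assumes t: "t > 0" and W: "position t \<zeta> \<in> weyl_chamber n" and k: "k \<in> {1..<n}" and f: "f (Suc k) = f k"
  shows "\<zeta> k > 0"
proof -
  have "0 < sqrt t * sgap t \<zeta> k" using W k f unfolding position_in_chamber_iff[OF t] by force
  then show ?thesis using t by (auto simp: sgap_def zero_less_mult_iff zero_less_divide_iff split: if_splits)
qed

lemma tendsto_chamber_integrand: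
  "((\<lambda>t. chamber_integrand t \<zeta>) \<longlongrightarrow> profile \<zeta> * limit_det) at_top"
proof (cases "(\<forall>k\<in>I. \<zeta> k > 0) \<and> (\<forall>k\<in>K. f (Suc k) = f k \<longrightarrow> \<zeta> k > 0)")
  case True
  then have W: "\<forall>\<^sub>F t in at_top. position t \<zeta> \<in> weyl_chamber n"
    by (intro eventually_in_chamber) auto
  let ?Q = "real n * (\<zeta> n)\<^sup>2 + (\<Sum>k\<in>K. \<Sum>l\<in>K. S_mat n k l * \<zeta> k * \<zeta> l)"
  have "((\<lambda>t. integrand t \<zeta>) \<longlongrightarrow> exp (- (\<Sum>k\<in>I. \<beta> k * \<zeta> k) - ?Q / 2) *
     ((\<Prod>j=1..n. \<Prod>p=bstart j..<j. \<Sum>r=p..<j. \<zeta> r) *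
     (\<Prod>j=1..n. \<Prod>p=gstart j..<bstart j. \<Sum>r\<in>K \<inter> {p..<j}. \<zeta> r)) * limit_det) at_top"
    unfolding integrand_def limit_det_def
    by (intro tendsto_mult tendsto_prod_pair_gap tendsto_leibniz tendsto_dd_matrix[OF W] tendsto_exp
        tendsto_diff tendsto_const tendsto_divide tendsto_sum_fluct_squares) auto
  moreover have "exp (- (\<Sum>k\<in>I. \<beta> k * \<zeta> k) - ?Q / 2) = exp (- (\<Sum>k\<in>I. \<beta> k * \<zeta> k)) *
      exp (- (1/2) * (\<Sum>k\<in>K. \<Sum>l\<in>K. S_mat n k l * \<zeta> k * \<zeta> l)) * exp (- (real n * (\<zeta> n)\<^sup>2) / 2)"
    unfolding exp_add[symmetric] by (rule arg_cong[where f=exp]) (simp add: field_simps)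
  ultimately have "((\<lambda>t. integrand t \<zeta>) \<longlongrightarrow> profile \<zeta> * limit_det) at_top"
    unfolding profile_def interior_part_def cut_part_def using True by (simp add: mult_ac)
  moreover have "\<forall>\<^sub>F t in at_top. integrand t \<zeta> = chamber_integrand t \<zeta>"
    using W eventually_gt_at_top[of 0] by eventually_elim (simp add: chamber_integrand_def)
  ultimately show ?thesis by (rule Lim_transform_eventually)
next
  case False
  then obtain k where k: "k \<in> {1..<n}" "f (Suc k) = f k" "\<not> \<zeta> k > 0"
    using f_vec_interior(1)[OF n stable] unfolding open_index_split(1) by blast
  have "chamber_integrand t \<zeta> = 0" for t
    using in_chamber_imp[OF _ _ k(1,2), of t \<zeta>] k(3) by (auto simp: chamber_integrand_def indicator_def)
  moreover have "profile \<zeta> = 0"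
    using False by (auto simp: profile_def interior_part_def cut_part_def)
  ultimately show ?thesis by simp
qed

end

section \<open>The integral of the limit\<close>

lemma nn_integral_lebesgue_pi_split:
  assumes fin: "finite I" "finite K" and disj: "I \<inter> insert n K = {}" "n \<notin> K"
    and F[measurable]: "F \<in> borel_measurable (lebesgue_pi I)"
    and G[measurable]: "G \<in> borel_measurable (lebesgue_pi K)"
    and g[measurable]: "g \<in> borel_measurable borel"
  shows "(\<integral>\<^sup>+\<zeta>. F (restrict \<zeta> I) * (G (restrict \<zeta> K) * g (\<zeta> n)) \<partial>lebesgue_pi (I \<union> insert n K))
    = (\<integral>\<^sup>+\<xi>. F \<xi> \<partial>lebesgue_pi I) * ((\<integral>\<^sup>+\<xi>. G \<xi> \<partial>lebesgue_pi K) * (\<integral>\<^sup>+z. g z \<partial>lborel))"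
proof -
  interpret product_sigma_finite "\<lambda>_::nat. lborel :: real measure" by (rule product_sigma_finite_lborel)
  have GgM[measurable]: "(\<lambda>\<zeta>. G (restrict \<zeta> K) * g (\<zeta> n)) \<in> borel_measurable (lebesgue_pi (insert n K))"
  proof (intro borel_measurable_times_ennreal)
    show "(\<lambda>\<zeta>. G (restrict \<zeta> K)) \<in> borel_measurable (lebesgue_pi (insert n K))"
      by (rule measurable_compose[OF measurable_restrict_subset G]) auto
    have "(\<lambda>\<zeta>. \<zeta> n) \<in> measurable (lebesgue_pi (insert n K)) lborel" by (rule measurable_component_singleton) simp
    then show "(\<lambda>\<zeta>. g (\<zeta> n)) \<in> borel_measurable (lebesgue_pi (insert n K))"
      by (rule measurable_compose) simp
  qed
  have M: "(\<lambda>\<zeta>. F (restrict \<zeta> I) * (G (restrict \<zeta> K) * g (\<zeta> n))) \<in> borel_measurable (lebesgue_pi (I \<union> insert n K))"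
  proof (intro borel_measurable_times_ennreal)
    show "(\<lambda>\<zeta>. F (restrict \<zeta> I)) \<in> borel_measurable (lebesgue_pi (I \<union> insert n K))"
      by (rule measurable_compose[OF measurable_restrict_subset F]) auto
    show "(\<lambda>\<zeta>. G (restrict \<zeta> K)) \<in> borel_measurable (lebesgue_pi (I \<union> insert n K))"
      by (rule measurable_compose[OF measurable_restrict_subset G]) auto
    have "(\<lambda>\<zeta>. \<zeta> n) \<in> measurable (lebesgue_pi (I \<union> insert n K)) lborel" by (rule measurable_component_singleton) simp
    then show "(\<lambda>\<zeta>. g (\<zeta> n)) \<in> borel_measurable (lebesgue_pi (I \<union> insert n K))"
      by (rule measurable_compose) simp
  qed
  have "(\<integral>\<^sup>+\<zeta>. F (restrict \<zeta> I) * (G (restrict \<zeta> K) * g (\<zeta> n)) \<partial>lebesgue_pi (I \<union> insert n K))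
    = (\<integral>\<^sup>+\<xi>. \<integral>\<^sup>+\<eta>. F (restrict (merge I (insert n K) (\<xi>, \<eta>)) I) * (G (restrict (merge I (insert n K) (\<xi>, \<eta>)) K)
        * g (merge I (insert n K) (\<xi>, \<eta>) n)) \<partial>lebesgue_pi (insert n K) \<partial>lebesgue_pi I)"
    using fin by (intro product_nn_integral_fold[OF disj(1) _ _ M]) auto
  also have "\<dots> = (\<integral>\<^sup>+\<xi>. \<integral>\<^sup>+\<eta>. F \<xi> * (G (restrict \<eta> K) * g (\<eta> n)) \<partial>lebesgue_pi (insert n K) \<partial>lebesgue_pi I)"
  proof (intro nn_integral_cong)
    fix \<xi> \<eta> :: "nat \<Rightarrow> real" assume \<xi>: "\<xi> \<in> space (lebesgue_pi I)"
    have "restrict (merge I (insert n K) (\<xi>, \<eta>)) I = \<xi>"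
      using \<xi> by (auto simp: restrict_def merge_def fun_eq_iff space_PiM PiE_def extensional_def)
    moreover have "restrict (merge I (insert n K) (\<xi>, \<eta>)) K = restrict \<eta> K" "merge I (insert n K) (\<xi>, \<eta>) n = \<eta> n"
      using disj by (auto simp: restrict_def merge_def fun_eq_iff)
    ultimately show "F (restrict (merge I (insert n K) (\<xi>, \<eta>)) I) * (G (restrict (merge I (insert n K) (\<xi>, \<eta>)) K)
        * g (merge I (insert n K) (\<xi>, \<eta>) n)) = F \<xi> * (G (restrict \<eta> K) * g (\<eta> n))" by simp
  qed
  also have "\<dots> = (\<integral>\<^sup>+\<xi>. F \<xi> \<partial>lebesgue_pi I) * (\<integral>\<^sup>+\<eta>. G (restrict \<eta> K) * g (\<eta> n) \<partial>lebesgue_pi (insert n K))"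
    by (simp add: nn_integral_cmult nn_integral_multc)
  also have "(\<integral>\<^sup>+\<eta>. G (restrict \<eta> K) * g (\<eta> n) \<partial>lebesgue_pi (insert n K))
    = (\<integral>\<^sup>+\<xi>. \<integral>\<^sup>+z. G (restrict (\<xi>(n := z)) K) * g ((\<xi>(n := z)) n) \<partial>lborel \<partial>lebesgue_pi K)"
    by (rule product_nn_integral_insert[OF fin(2) disj(2) GgM])
  also have "\<dots> = (\<integral>\<^sup>+\<xi>. \<integral>\<^sup>+z. G \<xi> * g z \<partial>lborel \<partial>lebesgue_pi K)"
  proof (intro nn_integral_cong)
    fix \<xi> :: "nat \<Rightarrow> real" and z assume \<xi>: "\<xi> \<in> space (lebesgue_pi K)"
    have "restrict (\<xi>(n := z)) K = \<xi>"
      using \<xi> disj(2) by (auto simp: restrict_def fun_eq_iff space_PiM PiE_def extensional_def)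
    then show "G (restrict (\<xi>(n := z)) K) * g ((\<xi>(n := z)) n) = G \<xi> * g z" by simp
  qed
  also have "\<dots> = (\<integral>\<^sup>+\<xi>. G \<xi> \<partial>lebesgue_pi K) * (\<integral>\<^sup>+z. g z \<partial>lborel)"
    by (simp add: nn_integral_cmult nn_integral_multc)
  finally show ?thesis .
qed

lemma integral_exp_quadratic:
  assumes "c > 0"
  shows "(\<integral>z. exp (- (c * z\<^sup>2) / 2) \<partial>lborel) = sqrt (2 * pi / c)"
proof -
  have "exp (- (c * z\<^sup>2) / 2) = sqrt (2 * pi / c) * normal_density 0 (1 / sqrt c) z" for z
    using assms by (simp add: normal_density_def power_divide real_sqrt_divide)
  then show ?thesis using assms by simp
qed

context survival_setup
begin

lemma finite_indices: "finite I" "finite K" using index_split(4) by auto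

lemma interior_part_restrict: "interior_part (restrict \<xi> I) = interior_part \<xi>"
proof -
  have "(\<Prod>j=1..n. \<Prod>p=bstart j..<j. \<Sum>r=p..<j. restrict \<xi> I r) = (\<Prod>j=1..n. \<Prod>p=bstart j..<j. \<Sum>r=p..<j. \<xi> r)"
  proof (intro prod.cong sum.cong refl)
    fix j p r assume "j \<in> {1..n}" "p \<in> {bstart j..<j}" "r \<in> {p..<j}"
    then have "r \<in> I" using within_block_interior[OF n stable, of j r] by auto
    then show "restrict \<xi> I r = \<xi> r" by (rule restrict_apply')
  qed
  moreover have "(\<Sum>k\<in>I. \<beta> k * restrict \<xi> I k) = (\<Sum>k\<in>I. \<beta> k * \<xi> k)"
    by (rule sum.cong) (simp_all only: restrict_apply')
  moreover have "(\<forall>k\<in>I. restrict \<xi> I k > 0) \<longleftrightarrow> (\<forall>k\<in>I. \<xi> k > 0)"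
    by (rule ball_cong) (simp_all only: restrict_apply')
  ultimately show ?thesis unfolding interior_part_def by simp
qed

lemma cut_part_restrict: "cut_part (restrict \<xi> K) = cut_part \<xi>"
proof -
  have "(\<Prod>j=1..n. \<Prod>p=gstart j..<bstart j. \<Sum>r\<in>K \<inter> {p..<j}. restrict \<xi> K r) = (\<Prod>j=1..n. \<Prod>p=gstart j..<bstart j. \<Sum>r\<in>K \<inter> {p..<j}. \<xi> r)"
    by (intro prod.cong sum.cong refl) (simp only: Int_iff restrict_apply')
  moreover have "(\<Sum>k\<in>K. \<Sum>l\<in>K. S_mat n k l * restrict \<xi> K k * restrict \<xi> K l) = (\<Sum>k\<in>K. \<Sum>l\<in>K. S_mat n k l * \<xi> k * \<xi> l)"
    by (intro sum.cong refl) (simp only: restrict_apply')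
  moreover have "(\<forall>k\<in>K. f (Suc k) = f k \<longrightarrow> restrict \<xi> K k > 0) \<longleftrightarrow> (\<forall>k\<in>K. f (Suc k) = f k \<longrightarrow> \<xi> k > 0)"
    by (rule ball_cong) (simp_all only: restrict_apply')
  ultimately show ?thesis unfolding cut_part_def by simp
qed

lemma measurable_interior_part: "interior_part \<in> borel_measurable (lebesgue_pi I)"
proof -
  have c[measurable]: "(\<lambda>\<xi>. \<xi> k) \<in> borel_measurable (lebesgue_pi I)" if "k \<in> I" for k
    using measurable_component_singleton[OF that, of "\<lambda>_. lborel"] by simp
  have 1: "Measurable.pred (lebesgue_pi I) (\<lambda>\<xi>. \<forall>k\<in>I. \<xi> k > 0)"
    by (intro pred_intros_finite finite_indices borel_measurable_pred_less borel_measurable_const c)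
  have 2: "(\<lambda>\<xi>. \<Prod>j=1..n. \<Prod>p=bstart j..<j. \<Sum>r=p..<j. \<xi> r) \<in> borel_measurable (lebesgue_pi I)"
  proof (intro borel_measurable_prod borel_measurable_sum c)
    fix j p r assume "j \<in> {1..n}" "p \<in> {bstart j..<j}" "r \<in> {p..<j}"
    then show "r \<in> I" using within_block_interior[OF n stable, of j r] by auto
  qed
  have 3: "(\<lambda>\<xi>. exp (- (\<Sum>k\<in>I. \<beta> k * \<xi> k))) \<in> borel_measurable (lebesgue_pi I)"
    by (intro measurable_compose[OF _ borel_measurable_exp] borel_measurable_uminus borel_measurable_sum
        borel_measurable_times borel_measurable_const c)
  show ?thesis
    unfolding interior_part_def[abs_def] of_bool_def
    by (intro borel_measurable_times measurable_If borel_measurable_const 2 3 1[unfolded pred_def])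
qed

lemma measurable_cut_part: "cut_part \<in> borel_measurable (lebesgue_pi K)"
proof -
  have c: "(\<lambda>\<xi>. \<xi> k) \<in> borel_measurable (lebesgue_pi K)" if "k \<in> K" for k
    using measurable_component_singleton[OF that, of "\<lambda>_. lborel"] by simp
  have 1: "Measurable.pred (lebesgue_pi K) (\<lambda>\<xi>. \<forall>k\<in>K. f (Suc k) = f k \<longrightarrow> \<xi> k > 0)"
    by (intro pred_intros_finite pred_intros_logic finite_indices borel_measurable_pred_less borel_measurable_const c) simp_all
  have 2: "(\<lambda>\<xi>. \<Prod>j=1..n. \<Prod>p=gstart j..<bstart j. \<Sum>r\<in>K \<inter> {p..<j}. \<xi> r) \<in> borel_measurable (lebesgue_pi K)"
    by (intro borel_measurable_prod borel_measurable_sum c) (rule IntD1)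
  have 3: "(\<lambda>\<xi>. exp (- (1/2) * (\<Sum>k\<in>K. \<Sum>l\<in>K. S_mat n k l * \<xi> k * \<xi> l))) \<in> borel_measurable (lebesgue_pi K)"
    by (intro measurable_compose[OF _ borel_measurable_exp] borel_measurable_sum
        borel_measurable_times borel_measurable_const c)
  show ?thesis
    unfolding cut_part_def[abs_def] of_bool_def
    by (intro borel_measurable_times measurable_If borel_measurable_const 2 3 1[unfolded pred_def])
qed

lemma interior_part_nonneg: "interior_part \<xi> \<ge> 0"
proof (cases "\<forall>k\<in>I. \<xi> k > 0")
  case True
  have "(\<Prod>j=1..n. \<Prod>p=bstart j..<j. \<Sum>r=p..<j. \<xi> r) \<ge> 0"
  proof (intro prod_nonneg sum_nonneg ballI)
    fix j p r assume "j \<in> {1..n}" "p \<in> {bstart j..<j}" "r \<in> {p..<j}"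
    then have "r \<in> I" using within_block_interior[OF n stable, of j r] by auto
    then show "\<xi> r \<ge> 0" using True by (auto simp: less_imp_le)
  qed
  then show ?thesis unfolding interior_part_def by simp
next
  case False
  then show ?thesis unfolding interior_part_def by (simp only: of_bool_eq mult_zero_left order_refl)
qed

text \<open>Within a group, f is constant.\<close>

lemma tied_cut:
  assumes "j \<in> {1..n}" "r \<in> {gstart j..<j}"
  shows "f (Suc r) = f r"
  using f_vec_const_on_group[OF n stable assms(1), of r] f_vec_const_on_group[OF n stable assms(1), of "Suc r"] assms(2) by simp

lemma cut_part_nonneg: "cut_part \<xi> \<ge> 0"
proof (cases "\<forall>k\<in>K. f (Suc k) = f k \<longrightarrow> \<xi> k > 0")
  case True
  have "(\<Prod>j=1..n. \<Prod>p=gstart j..<bstart j. \<Sum>r\<in>K \<inter> {p..<j}. \<xi> r) \<ge> 0"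
  proof (intro prod_nonneg sum_nonneg ballI)
    fix j p r assume *: "j \<in> {1..n}" "p \<in> {gstart j..<bstart j}" "r \<in> K \<inter> {p..<j}"
    then have "f (Suc r) = f r" by (intro tied_cut[of j]) auto
    then show "\<xi> r \<ge> 0" using True *(3) by (auto simp: less_imp_le)
  qed
  then show ?thesis unfolding cut_part_def by simp
next
  case False
  then show ?thesis unfolding cut_part_def by (simp only: of_bool_eq mult_zero_left order_refl)
qed

lemma profile_nonneg: "profile \<zeta> \<ge> 0"
  unfolding profile_def by (intro mult_nonneg_nonneg interior_part_nonneg cut_part_nonneg) simp

lemma lebesgue_pi_index_split: "lebesgue_pi {1..n} = lebesgue_pi (I \<union> insert n K)"
  by (rule arg_cong[OF index_split(1)])

lemma measurable_profile: "profile \<in> borel_measurable (lebesgue_pi {1..n})"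
proof -
  have 1: "(\<lambda>\<zeta>. interior_part (restrict \<zeta> I)) \<in> borel_measurable (lebesgue_pi {1..n})"
    by (rule measurable_compose[OF measurable_restrict_subset measurable_interior_part]) auto
  have 2: "(\<lambda>\<zeta>. cut_part (restrict \<zeta> K)) \<in> borel_measurable (lebesgue_pi {1..n})"
    by (rule measurable_compose[OF measurable_restrict_subset measurable_cut_part])
      (use cut_idx_subset[OF n stable] in auto)
  have 3: "(\<lambda>\<zeta>. exp (- (real n * (\<zeta> n)\<^sup>2) / 2)) \<in> borel_measurable (lebesgue_pi {1..n})"
  proof -
    have "(\<lambda>\<zeta>. \<zeta> n) \<in> borel_measurable (lebesgue_pi {1..n})" using n by simp
    then show ?thesis by measurable
  qed
  show ?thesis
    unfolding profile_def[abs_def]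
    using borel_measurable_times[OF borel_measurable_times[OF 1[unfolded interior_part_restrict] 2[unfolded cut_part_restrict]] 3] .
qed

lemma integral_interior_part: "(\<integral>\<xi>. interior_part \<xi> \<partial>lebesgue_pi I) = A2 n a q m"
  unfolding A2_def Let_def set_lebesgue_integral_def A2_exponent[OF n stable]
    prod_within_blocks[OF stable_cuts[OF n stable]]
proof (rule Bochner_Integration.integral_cong[OF refl])
  fix \<xi> :: "nat \<Rightarrow> real" assume sp: "\<xi> \<in> space (lebesgue_pi I)"
  have "indicator {\<xi> \<in> space (lebesgue_pi I). \<forall>i\<in>I. 0 < \<xi> i} \<xi> = (of_bool (\<forall>i\<in>I. 0 < \<xi> i) :: real)"
    unfolding indicator_def mem_Collect_eq using sp by (simp only: simp_thms)
  then show "interior_part \<xi> = indicator {\<xi> \<in> space (lebesgue_pi I). \<forall>i\<in>I. 0 < \<xi> i} \<xi> *\<^sub>R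
     (exp (- (\<Sum>k\<in>I. \<beta> k * \<xi> k)) * (\<Prod>j=1..n. \<Prod>p=bstart j..<j. \<Sum>r=p..<j. \<xi> r))"
    unfolding interior_part_def by (simp only: real_scaleR_def)
qed

lemma integral_cut_part: "(\<integral>\<xi>. cut_part \<xi> \<partial>lebesgue_pi K) = A3 n a q m"
  unfolding A3_def Let_def set_lebesgue_integral_def A3_product[OF n stable]
proof (rule Bochner_Integration.integral_cong[OF refl])
  fix \<xi> :: "nat \<Rightarrow> real" assume sp: "\<xi> \<in> space (lebesgue_pi K)"
  have "(\<forall>i\<in>{1..q - 1}. m i \<notin> m' a q m ` {1..q' a q m} \<longrightarrow> 0 < \<xi> (m i)) \<longleftrightarrow>
      (\<forall>i\<in>{1..q - 1}. f (Suc (m i)) = f (m i) \<longrightarrow> 0 < \<xi> (m i))"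
    by (rule ball_cong[OF refl]) (use cut_not_group_end_iff[OF n stable] in auto)
  then have D: "(\<forall>i\<in>{1..q - 1}. m i \<notin> m' a q m ` {1..q' a q m} \<longrightarrow> 0 < \<xi> (m i)) \<longleftrightarrow>
      (\<forall>k\<in>K. f (Suc k) = f k \<longrightarrow> 0 < \<xi> k)" by blast
  have "indicator {\<xi> \<in> space (lebesgue_pi K). \<forall>i\<in>{1..q - 1}. m i \<notin> m' a q m ` {1..q' a q m} \<longrightarrow> 0 < \<xi> (m i)} \<xi>
     = (of_bool (\<forall>k\<in>K. f (Suc k) = f k \<longrightarrow> 0 < \<xi> k) :: real)"
    unfolding indicator_def mem_Collect_eq D using sp by (simp only: simp_thms)
  then show "cut_part \<xi> = indicator {\<xi> \<in> space (lebesgue_pi K). \<forall>i\<in>{1..q - 1}. m i \<notin> m' a q m ` {1..q' a q m} \<longrightarrow> 0 < \<xi> (m i)} \<xi> *\<^sub>R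
     (exp (- (1/2) * (\<Sum>k\<in>K. \<Sum>l\<in>K. S_mat n k l * \<xi> k * \<xi> l)) *
      (\<Prod>j=1..n. \<Prod>p=gstart j..<bstart j. \<Sum>r\<in>K \<inter> {p..<j}. \<xi> r))"
    unfolding cut_part_def by (simp only: real_scaleR_def)
qed

text \<open>Tonelli, since the profile is a function of the coordinates in I times one of those in K times a
Gaussian in the mean.\<close>

lemma integral_profile:
  "(\<integral>\<zeta>. profile \<zeta> \<partial>lebesgue_pi {1..n}) = A2 n a q m * (A3 n a q m * sqrt (2 * pi / real n))"
proof -
  let ?g = "\<lambda>z. exp (- (real n * z\<^sup>2) / 2) :: real"
  have e: "ennreal (profile \<zeta>) = ennreal (interior_part (restrict \<zeta> I)) *
     (ennreal (cut_part (restrict \<zeta> K)) * ennreal (?g (\<zeta> n)))" for \<zeta>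
    unfolding interior_part_restrict cut_part_restrict profile_def mult.assoc
    by (simp add: ennreal_mult[symmetric] interior_part_nonneg cut_part_nonneg)
  have "(\<integral>\<zeta>. profile \<zeta> \<partial>lebesgue_pi {1..n}) = enn2real (\<integral>\<^sup>+\<zeta>. ennreal (profile \<zeta>) \<partial>lebesgue_pi {1..n})"
    by (rule integral_eq_nn_integral[OF measurable_profile]) (simp add: profile_nonneg)
  also have "(\<integral>\<^sup>+\<zeta>. ennreal (profile \<zeta>) \<partial>lebesgue_pi {1..n}) =
     (\<integral>\<^sup>+\<xi>. ennreal (interior_part \<xi>) \<partial>lebesgue_pi I) *
     ((\<integral>\<^sup>+\<xi>. ennreal (cut_part \<xi>) \<partial>lebesgue_pi K) * (\<integral>\<^sup>+z. ennreal (?g z) \<partial>lborel))"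
    unfolding e lebesgue_pi_index_split
  proof (rule nn_integral_lebesgue_pi_split[OF finite_indices index_split(2,3)])
    show "(\<lambda>\<xi>. ennreal (interior_part \<xi>)) \<in> borel_measurable (lebesgue_pi I)"
      by (rule measurable_compose[OF measurable_interior_part measurable_ennreal])
    show "(\<lambda>\<xi>. ennreal (cut_part \<xi>)) \<in> borel_measurable (lebesgue_pi K)"
      by (rule measurable_compose[OF measurable_cut_part measurable_ennreal])
    show "(\<lambda>z. ennreal (?g z)) \<in> borel_measurable borel" by measurable
  qed
  finally show ?thesis
    unfolding enn2real_mult integral_interior_part[symmetric] integral_cut_part[symmetric]
    using integral_eq_nn_integral[OF measurable_interior_part] integral_eq_nn_integral[OF measurable_cut_part]
      integral_eq_nn_integral[of ?g lborel] integral_exp_quadratic[of "real n"] n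
    by (simp add: interior_part_nonneg cut_part_nonneg)
qed

end

section \<open>Asymptotics of the survival probability\<close>

context survival_setup
begin

lemma prefactor_pos: "t > 0 \<Longrightarrow> prefactor t > 0"
  unfolding prefactor_def by (intro mult_pos_pos prod_pos zero_less_power) auto

lemma scale_pos: "t > 0 \<Longrightarrow> scale t k > 0"
  by (simp add: scale_def)

lemma density_on_chamber_position:
  assumes t: "t > 0"
  shows "indicator (weyl_chamber n) (position t \<zeta>) * km_density n a t x (position t \<zeta>) = prefactor t * chamber_integrand t \<zeta>"
  using km_density_position[OF t, of \<zeta>] t by (simp add: chamber_integrand_def indicator_def)

lemma measurable_chamber_integrand: "chamber_integrand t \<in> borel_measurable (lebesgue_pi {1..n})"
proof (cases "t > 0")
  case True
  have p: "position t \<in> measurable (lebesgue_pi {1..n}) (lebesgue_pi {1..n})"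
    unfolding position_def by (rule measurable_gap_coords[OF n])
  have "chamber_integrand t \<zeta> = indicator (weyl_chamber n) (position t \<zeta>) * km_density n a t x (position t \<zeta>) / prefactor t" for \<zeta>
    using density_on_chamber_position[OF True, of \<zeta>] prefactor_pos[OF True] by simp
  then have "chamber_integrand t = (\<lambda>\<zeta>. indicator (weyl_chamber n) (position t \<zeta>) * km_density n a t x (position t \<zeta>) / prefactor t)"
    by blast
  then show ?thesis
    using measurable_compose[OF p borel_measurable_chamber_density[OF True]] by simp
next
  case False
  then have "chamber_integrand t = (\<lambda>_. 0)" by (simp add: chamber_integrand_def fun_eq_iff)
  then show ?thesis by simp
qed

text \<open>The change of variables to rescaled coordinates, whose Jacobian is the product of the
scales.\<close>

lemma integral_density_on_chamber:
  assumes t: "t > 0"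
  shows "(\<integral>z. indicator (weyl_chamber n) z * km_density n a t x z \<partial>lebesgue_pi {1..n})
    = ((\<Prod>k=1..n. scale t k) * prefactor t) * (\<integral>\<zeta>. chamber_integrand t \<zeta> \<partial>lebesgue_pi {1..n})"
proof -
  have "(\<integral>z. indicator (weyl_chamber n) z * km_density n a t x z \<partial>lebesgue_pi {1..n})
    = (\<Prod>k=1..n. scale t k) * (\<integral>\<zeta>. indicator (weyl_chamber n) (position t \<zeta>) * km_density n a t x (position t \<zeta>) \<partial>lebesgue_pi {1..n})"
    unfolding position_def
    by (rule integral_gap_coords[OF n _ borel_measurable_chamber_density[OF t]]) (rule scale_pos[OF t])
  also have "(\<integral>\<zeta>. indicator (weyl_chamber n) (position t \<zeta>) * km_density n a t x (position t \<zeta>) \<partial>lebesgue_pi {1..n})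
    = prefactor t * (\<integral>\<zeta>. chamber_integrand t \<zeta> \<partial>lebesgue_pi {1..n})"
    unfolding density_on_chamber_position[OF t] by (rule integral_mult_right_zero)
  finally show ?thesis by simp
qed

lemma tendsto_integral_chamber_integrand:
  "integrable (lebesgue_pi {1..n}) (\<lambda>\<zeta>. profile \<zeta> * limit_det)"
  "((\<lambda>t. \<integral>\<zeta>. chamber_integrand t \<zeta> \<partial>lebesgue_pi {1..n}) \<longlongrightarrow>
     (\<integral>\<zeta>. profile \<zeta> * limit_det \<partial>lebesgue_pi {1..n})) at_top"
proof -
  obtain C d c T where d: "d > 0" and b: "\<And>t. t \<ge> T \<Longrightarrow> t > 0"
    "\<And>t \<zeta>. t \<ge> T \<Longrightarrow> position t \<zeta> \<in> weyl_chamber n \<Longrightarrow> \<bar>integrand t \<zeta>\<bar> \<le> dominating C d c \<zeta>"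
    using integrand_bound by blast
  have "norm (chamber_integrand t \<zeta>) \<le> \<bar>dominating C d c \<zeta>\<bar>" if "t \<ge> T" for t \<zeta>
    using b(2)[OF that, of \<zeta>] by (auto simp: chamber_integrand_def indicator_def)
  then have bound: "\<forall>\<^sub>F t in at_top. AE \<zeta> in lebesgue_pi {1..n}. norm (chamber_integrand t \<zeta>) \<le> \<bar>dominating C d c \<zeta>\<bar>"
    by (intro eventually_mono[OF eventually_ge_at_top[of T]] AE_I2)
  have f: "(\<lambda>\<zeta>. profile \<zeta> * limit_det) \<in> borel_measurable (lebesgue_pi {1..n})"
    by (intro borel_measurable_times measurable_profile borel_measurable_const)
  note D = f measurable_chamber_integrand integrable_abs[OF integrable_dominating[OF d]]
    AE_I2[OF tendsto_chamber_integrand] bound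
  show "integrable (lebesgue_pi {1..n}) (\<lambda>\<zeta>. profile \<zeta> * limit_det)"
    by (rule integrable_dominated_convergence_at_top[OF D])
  show "((\<lambda>t. \<integral>\<zeta>. chamber_integrand t \<zeta> \<partial>lebesgue_pi {1..n}) \<longlongrightarrow>
     (\<integral>\<zeta>. profile \<zeta> * limit_det \<partial>lebesgue_pi {1..n})) at_top"
    by (rule integral_dominated_convergence_at_top[OF D])
qed

lemma limit_det_eq:
  "limit_det = (\<Prod>j=1..n. 1 / fact (j - gstart j)) * leibniz n (\<lambda>i j. exp (x i * f j) * x i ^ (j - gstart j))"
proof -
  have "limit_det = leibniz n (\<lambda>i j. 1 * (1 / fact (j - gstart j)) * (exp (x i * f j) * x i ^ (j - gstart j)))"
    unfolding limit_det_def by (rule leibniz_cong) simp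
  then show ?thesis unfolding leibniz_scale by simp
qed

lemma limit_det_nonzero: "limit_det \<noteq> 0"
proof -
  have "inj_on x {1..n}"
  proof (rule inj_onI, rule ccontr)
    fix i j assume "i \<in> {1..n}" "j \<in> {1..n}" "x i = x j" "i \<noteq> j"
    moreover have "x u < x v" if "u < v" "u \<in> {1..n}" "v \<in> {1..n}" for u v
      using x that by (auto simp: weyl_chamber_def)
    ultimately show False by (metis nat_neq_iff less_irrefl)
  qed
  from leibniz_exp_monomials_nonzero[OF _ _ _ this, of gstart f]
  have "leibniz n (\<lambda>i j. exp (x i * f j) * x i ^ (j - gstart j)) \<noteq> 0"
    using group_start_bounds[OF n stable] f_vec_const_on_group[OF n stable] group_start_eq[OF n stable] by blast
  then show ?thesis unfolding limit_det_eq by simp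
qed

lemma profile_pos:
  assumes "\<And>k. k \<in> {1..n} \<Longrightarrow> \<zeta> k > 0"
  shows "profile \<zeta> > 0"
proof -
  have "(\<Prod>j=1..n. \<Prod>p=bstart j..<j. \<Sum>r=p..<j. \<zeta> r) > 0"
  proof (intro prod_pos sum_pos ballI)
    fix j p r assume "j \<in> {1..n}" "p \<in> {bstart j..<j}" "r \<in> {p..<j}"
    then show "\<zeta> r > 0" by (intro assms) (auto simp: block_start_def)
  qed auto
  moreover have "(\<Prod>j=1..n. \<Prod>p=gstart j..<bstart j. \<Sum>r\<in>K \<inter> {p..<j}. \<zeta> r) > 0"
  proof (intro prod_pos sum_pos ballI)
    fix j p assume *: "j \<in> {1..n}" "p \<in> {gstart j..<bstart j}"
    let ?b = "block_of q m j"
    have b: "?b \<in> {1..q}" "m (?b - 1) < j" "bstart j = m (?b - 1) + 1"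
      using block_of_bounds[OF stable_cuts[OF n stable] *(1)] by (auto simp: block_start_def)
    have p: "1 \<le> p" "p \<le> m (?b - 1)" using group_start_bounds[OF n stable *(1)] * b(3) by auto
    have "?b \<noteq> 1" using p stable by (auto simp: stable_partition_def)
    then have "?b - 1 \<in> {1..q - 1}" using b(1) by auto
    then have "m (?b - 1) \<in> K \<inter> {p..<j}" using b(2) p by (intro IntI imageI) auto
    then show "K \<inter> {p..<j} \<noteq> {}" by blast
  next
    fix j p r assume "j \<in> {1..n}" "r \<in> K \<inter> {p..<j}"
    then show "\<zeta> r > 0" using cut_idx_subset[OF n stable] by (intro assms) auto
  qed auto
  moreover have "\<forall>k\<in>I. \<zeta> k > 0" "\<forall>k\<in>K. f (Suc k) = f k \<longrightarrow> \<zeta> k > 0"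
    using assms cut_idx_subset[OF n stable] by auto
  ultimately show ?thesis unfolding profile_def interior_part_def cut_part_def by simp
qed

text \<open>The profile is integrable as a dominated limit, and it is positive on the open unit cube.\<close>

lemma integral_profile_pos: "(\<integral>\<zeta>. profile \<zeta> \<partial>lebesgue_pi {1..n}) > 0"
proof -
  let ?P = "lebesgue_pi {1..n}" and ?B = "PiE {1..n} (\<lambda>_. {0<..<1::real})"
  have int: "integrable ?P profile"
    using tendsto_integral_chamber_integrand(1) limit_det_nonzero by simp
  have "(\<integral>\<zeta>. profile \<zeta> \<partial>?P) \<noteq> 0"
  proof
    assume "(\<integral>\<zeta>. profile \<zeta> \<partial>?P) = 0"
    then have "AE \<zeta> in ?P. profile \<zeta> = 0"
      using integral_nonneg_eq_0_iff_AE[OF int] profile_nonneg by simp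
    then have "AE \<zeta> in ?P. \<zeta> \<notin> ?B"
    proof eventually_elim
      case (elim \<zeta>)
      show ?case
      proof
        assume "\<zeta> \<in> ?B"
        then have "\<zeta> k > 0" if "k \<in> {1..n}" for k using PiE_mem[of \<zeta> "{1..n}" "\<lambda>_. {0<..<1}" k] that by simp
        then have "profile \<zeta> > 0" by (rule profile_pos)
        then show False using elim by simp
      qed
    qed
    then have "emeasure ?P {\<zeta> \<in> space ?P. \<zeta> \<in> ?B} = 0" by (rule emeasure_eq_0_AE)
    moreover have "{\<zeta> \<in> space ?P. \<zeta> \<in> ?B} = ?B" by (auto simp: space_PiM)
    moreover have "emeasure ?P ?B = (\<Prod>k\<in>{1..n}. emeasure lborel {0<..<1::real})"
      by (rule product_sigma_finite.emeasure_PiM[OF product_sigma_finite_lborel]) auto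
    ultimately show False by simp
  qed
  moreover have "(\<integral>\<zeta>. profile \<zeta> \<partial>?P) \<ge> 0" by (rule Bochner_Integration.integral_nonneg) (rule profile_nonneg)
  ultimately show ?thesis by simp
qed

text \<open>The constants match: the Jacobian times the prefactor carries the powers of t and of 2 pi, the
integral of the profile is A2 * A3 times the last root in A1, and the factorials of the divided differences
are the constants c in A1.\<close>

lemma survival_asymptotics:
  "(\<lambda>t. \<integral>z. indicator (weyl_chamber n) z * km_density n a t x z \<partial>lebesgue_pi {1..n}) \<sim>[at_top]
     (\<lambda>t. (A1 n a q m * A2 n a q m * A3 n a q m) * h_fun n a q m x *
        t powr (- alpha_exp n a q m) * exp (- gamma_rate a q m * t))"
proof (rule asymp_equivI')
  define G where "G = (\<integral>\<zeta>. profile \<zeta> \<partial>lebesgue_pi {1..n})"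
  define L where "L = leibniz n (\<lambda>i j. exp (x i * f j) * x i ^ (j - gstart j))"
  define F where "F = (\<Prod>j=1..n. 1 / fact (j - gstart j) :: real)"
  define c where "c = (2 * pi) powr (- real n / 2) * exp (- (\<Sum>i=1..n. x i * a i))"
  define r where "r t = t powr (- alpha_exp n a q m) * exp (- gamma_rate a q m * t)" for t
  let ?S = "\<lambda>t. \<integral>\<zeta>. chamber_integrand t \<zeta> \<partial>lebesgue_pi {1..n}"
  have GLF: "G * (F * L) \<noteq> 0"
    using integral_profile_pos limit_det_nonzero unfolding limit_det_eq G_def L_def F_def by simp
  have c0: "c > 0" by (simp add: c_def)
  have const: "(A1 n a q m * A2 n a q m * A3 n a q m) * h_fun n a q m x = c * (G * (F * L))"
    unfolding A1_eq[OF n stable] h_fun_eq[OF n stable] G_def integral_profile c_def L_def F_def by (simp only: mult_ac)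
  have ev: "\<forall>\<^sub>F t in at_top. exp (- (\<Sum>i=1..n. (x i)\<^sup>2) / (2 * t)) * ?S t / (G * (F * L)) =
     (\<integral>z. indicator (weyl_chamber n) z * km_density n a t x z \<partial>lebesgue_pi {1..n}) /
     ((A1 n a q m * A2 n a q m * A3 n a q m) * h_fun n a q m x * t powr (- alpha_exp n a q m) * exp (- gamma_rate a q m * t))"
    using eventually_gt_at_top[of 0]
  proof eventually_elim
    case (elim t)
    have r0: "r t > 0" using elim by (simp add: r_def)
    have "(\<integral>z. indicator (weyl_chamber n) z * km_density n a t x z \<partial>lebesgue_pi {1..n})
      = (c * r t) * (exp (- (\<Sum>i=1..n. (x i)\<^sup>2) / (2 * t)) * ?S t)"
      unfolding integral_density_on_chamber[OF elim] prefactor_eq[OF elim] c_def r_def by (simp only: mult_ac)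
    moreover have "(A1 n a q m * A2 n a q m * A3 n a q m) * h_fun n a q m x * t powr (- alpha_exp n a q m) * exp (- gamma_rate a q m * t)
      = (c * r t) * (G * (F * L))"
      unfolding const r_def by (simp only: mult_ac)
    ultimately show ?case using c0 r0 by (simp only: mult_divide_mult_cancel_left mult_pos_pos less_imp_neq[symmetric] simp_thms)
  qed
  have "((\<lambda>t. exp (- y / (2 * t))) \<longlongrightarrow> 1) at_top" for y :: real
    by real_asymp
  moreover have "(?S \<longlongrightarrow> G * (F * L)) at_top"
    using tendsto_integral_chamber_integrand(2) unfolding limit_det_eq G_def F_def L_def by simp
  ultimately have "((\<lambda>t. exp (- (\<Sum>i=1..n. (x i)\<^sup>2) / (2 * t)) * ?S t / (G * (F * L))) \<longlongrightarrow> 1 * (G * (F * L)) / (G * (F * L))) at_top"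
    using GLF by (intro tendsto_intros)
  then have "((\<lambda>t. exp (- (\<Sum>i=1..n. (x i)\<^sup>2) / (2 * t)) * ?S t / (G * (F * L))) \<longlongrightarrow> 1) at_top"
    using GLF by simp
  from Lim_transform_eventually[OF this ev]
  show "((\<lambda>t. (\<integral>z. indicator (weyl_chamber n) z * km_density n a t x z \<partial>lebesgue_pi {1..n}) /
     ((A1 n a q m * A2 n a q m * A3 n a q m) * h_fun n a q m x * t powr (- alpha_exp n a q m) * exp (- gamma_rate a q m * t))) \<longlongrightarrow> 1) at_top" .
qed

end

theorem theorem4p2:
  fixes M :: "'w measure"
    and n q :: nat
    and a x :: "nat \<Rightarrow> real"
    and X :: "nat \<Rightarrow> real \<Rightarrow> 'w \<Rightarrow> real"
    and m :: "nat \<Rightarrow> nat"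
  assumes "n \<ge> 1"
    and "x \<in> weyl_chamber n"
    and "indep_brownian_motions M n a x X"
    and "stable_partition n a q m"
  shows "(\<lambda>t. measure M {\<omega> \<in> space M. ereal t < collision_time n X \<omega>}) \<sim>[at_top]
         (\<lambda>t. (A1 n a q m * A2 n a q m * A3 n a q m) * h_fun n a q m x *
               t powr (- alpha_exp n a q m) * exp (- gamma_rate a q m * t))"
proof -
  interpret survival_setup n q a x m using assms by unfold_locales
  have "\<forall>\<^sub>F t in at_top. measure M {\<omega> \<in> space M. ereal t < collision_time n X \<omega>}
     = (\<integral>z. indicator (weyl_chamber n) z * km_density n a t x z \<partial>lebesgue_pi {1..n})"
    using eventually_gt_at_top[of 0]
    by eventually_elim (rule survival_probability[OF assms(1,3) _ assms(2)])
  then show ?thesis using survival_asymptotics by (simp only: asymp_equiv_cong[OF _ eventually_mono[OF eventually_True refl]])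
qed

end
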